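(* Let $Y$ be a smooth variety and $L\subset Y$ a divisor. Assume that there exist $a\in H^0(Y,\mathcal{O}_Y(nL))$ and $F\in H^0(Y,\mathcal{O}_Y(2L))$ such that: (i) the zero locus of $a^2-F^n\in H^0(Y,\mathcal{O}_Y(2nL))$ is smooth in the open set $F\neq0$; (ii) the divisors $\{a=0\}$ and $\{F=0\}$ intersect each other transversely; and $\{a=0\}\cap\{F=0\}\neq\emptyset$. Then $\pi_1(Y\setminus\mathcal{B})$ admits an epimorphism onto $D_n$, in particular it is non-abelian, where $\mathcal{B}=\{a^2-F^n=0\}$.
   Context: Varieties are over $\mathbb{C}$. $D_n$ is the dihedral group of order $2n$.
   Formalization: The epimorphism onto D_n is stated for all n ≥ 1, but non-abelianness only for n ≥ 3: D_1 and D_2 are abelian, and for Y = C², a = x, F = y the group is Z (n = 1) or Z² (n = 2). *)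

theory Defs
  imports "HOL-Analysis.Analysis" "HOL-Algebra.Group"
begin

section \<open>Complex algebraic varieties as spaces with functions\<close>

text \<open>
  The standard description (Serre's FAC) of a variety over \<open>\<complex>\<close> by its closed points:
  a set with a Zariski topology and, for every open \<open>U\<close>, the set \<open>\<O>(U)\<close> of regular functions
  \<open>U \<rightarrow> \<complex>\<close>. Functions are total in HOL, so an element of \<open>reg X U\<close> is any total
  function whose restriction to \<open>U\<close> is regular; values outside \<open>U\<close> are junk
  (see the first clause of \<open>function_sheaf\<close>). \<open>reg X U\<close> is only ever used for open \<open>U\<close>.
\<close>

record 'a fspace =
  ztop :: "'a topology"
  reg :: "'a set \<Rightarrow> ('a \<Rightarrow> complex) set"

abbreviation points :: "'a fspace \<Rightarrow> 'a set" where
  "points X \<equiv> topspace (ztop X)"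

definition open_subspace :: "'a fspace \<Rightarrow> 'a set \<Rightarrow> 'a fspace" where
  "open_subspace X U = \<lparr>ztop = subtopology (ztop X) U, reg = reg X\<rparr>"

definition function_sheaf :: "'a fspace \<Rightarrow> bool" where
  "function_sheaf X \<longleftrightarrow>
     (\<forall>U f g. openin (ztop X) U \<and> f \<in> reg X U \<and> (\<forall>x\<in>U. f x = g x) \<longrightarrow> g \<in> reg X U) \<and>
     (\<forall>U V. openin (ztop X) U \<and> openin (ztop X) V \<and> V \<subseteq> U \<longrightarrow> reg X U \<subseteq> reg X V) \<and>
     (\<forall>U f. openin (ztop X) U \<and>
        (\<forall>x\<in>U. \<exists>V. openin (ztop X) V \<and> x \<in> V \<and> V \<subseteq> U \<and> f \<in> reg X V) \<longrightarrow> f \<in> reg X U)"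

definition fspace_iso :: "'a fspace \<Rightarrow> 'b fspace \<Rightarrow> ('a \<Rightarrow> 'b) \<Rightarrow> bool" where
  "fspace_iso X Y \<phi> \<longleftrightarrow>
     homeomorphic_map (ztop X) (ztop Y) \<phi> \<and>
     (\<forall>V f. openin (ztop Y) V \<longrightarrow>
        (f \<in> reg Y V \<longleftrightarrow> f \<circ> \<phi> \<in> reg X {x \<in> points X. \<phi> x \<in> V}))"

definition fspace_isomorphic :: "'a fspace \<Rightarrow> 'b fspace \<Rightarrow> bool" where
  "fspace_isomorphic X Y \<longleftrightarrow> (\<exists>\<phi>. fspace_iso X Y \<phi>)"

subsection \<open>Affine algebraic sets\<close>

text \<open>\<open>\<complex>\<^sup>n\<close> is the set of sequences vanishing from index \<open>n\<close> on. As \<open>\<complex>\<close> is infinite,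
  polynomials are identified with the functions they define.\<close>

definition affine_space :: "nat \<Rightarrow> (nat \<Rightarrow> complex) set" where
  "affine_space n = {x. \<forall>i\<ge>n. x i = 0}"

inductive_set poly_funs :: "nat \<Rightarrow> ((nat \<Rightarrow> complex) \<Rightarrow> complex) set" for n where
  const: "(\<lambda>x. c) \<in> poly_funs n"
| coord: "i < n \<Longrightarrow> (\<lambda>x. x i) \<in> poly_funs n"
| add: "p \<in> poly_funs n \<Longrightarrow> q \<in> poly_funs n \<Longrightarrow> (\<lambda>x. p x + q x) \<in> poly_funs n"
| mult: "p \<in> poly_funs n \<Longrightarrow> q \<in> poly_funs n \<Longrightarrow> (\<lambda>x. p x * q x) \<in> poly_funs n"

definition zeros :: "nat \<Rightarrow> ((nat \<Rightarrow> complex) \<Rightarrow> complex) set \<Rightarrow> (nat \<Rightarrow> complex) set" where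
  "zeros n S = {x \<in> affine_space n. \<forall>p\<in>S. p x = 0}"

text \<open>The Zariski topology is generated by the principal open sets; regular functions are
  locally quotients of polynomials.\<close>

definition affine_fspace :: "nat \<Rightarrow> ((nat \<Rightarrow> complex) \<Rightarrow> complex) set \<Rightarrow> (nat \<Rightarrow> complex) fspace" where
  "affine_fspace n S =
     (let T = topology_generated_by {{x \<in> zeros n S. p x \<noteq> 0} | p. p \<in> poly_funs n}
      in \<lparr>ztop = T,
          reg = (\<lambda>U. {f. \<forall>x\<in>U. \<exists>V. openin T V \<and> x \<in> V \<and> V \<subseteq> U \<and>
                   (\<exists>p\<in>poly_funs n. \<exists>q\<in>poly_funs n. \<forall>y\<in>V. q y \<noteq> 0 \<and> f y = p y / q y)})\<rparr>)"

definition affine_variety_space :: "'a fspace \<Rightarrow> bool" where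
  "affine_variety_space X \<longleftrightarrow>
     (\<exists>n S. S \<subseteq> poly_funs n \<and> fspace_isomorphic X (affine_fspace n S))"

subsection \<open>Varieties and smoothness\<close>

text \<open>The Zariski topology of the product variety \<open>X \<times> Y\<close>: on \<open>U \<times> V\<close> with \<open>U\<close>, \<open>V\<close> affine
  open, the regular functions are \<open>\<O>(U) \<otimes> \<O>(V)\<close>, whose elements are the finite sums below.\<close>

definition zariski_prod :: "'a fspace \<Rightarrow> 'b fspace \<Rightarrow> ('a \<times> 'b) topology" where
  "zariski_prod X Y = topology_generated_by
     {{(x, y). x \<in> U \<and> y \<in> V \<and> (\<Sum>i<m. f i x * g i y) \<noteq> 0} | U V (m::nat) f g.
        openin (ztop X) U \<and> openin (ztop Y) V \<and>
        (\<forall>i<m. f i \<in> reg X U \<and> g i \<in> reg Y V)}"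

definition separated :: "'a fspace \<Rightarrow> bool" where
  "separated X \<longleftrightarrow> closedin (zariski_prod X X) {(x, x) | x. x \<in> points X}"

definition irreducible_topology :: "'a topology \<Rightarrow> bool" where
  "irreducible_topology T \<longleftrightarrow> topspace T \<noteq> {} \<and>
     (\<forall>U V. openin T U \<and> openin T V \<and> U \<noteq> {} \<and> V \<noteq> {} \<longrightarrow> U \<inter> V \<noteq> {})"

definition variety :: "'a fspace \<Rightarrow> bool" where
  "variety X \<longleftrightarrow> function_sheaf X \<and> irreducible_topology (ztop X) \<and> separated X \<and>
     (\<exists>\<U>. finite \<U> \<and> \<Union>\<U> = points X \<and>
        (\<forall>U\<in>\<U>. openin (ztop X) U \<and> affine_variety_space (open_subspace X U)))"

definition partial_deriv :: "nat \<Rightarrow> ((nat \<Rightarrow> complex) \<Rightarrow> complex) \<Rightarrow> (nat \<Rightarrow> complex) \<Rightarrow> complex" where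
  "partial_deriv i p x = deriv (\<lambda>t. p (x(i := t))) (x i)"

text \<open>Smoothness over \<open>\<complex>\<close> in the sense of the Jacobian criterion: every point has an affine
  open neighbourhood isomorphic to \<open>{f\<^sub>0 = \<dots> = f\<^sub>c\<^sub>-\<^sub>1 = 0} \<subseteq> \<complex>\<^sup>n\<close> where the Jacobian matrix of
  \<open>f\<^sub>0, \<dots>, f\<^sub>c\<^sub>-\<^sub>1\<close> has rank \<open>c\<close> at every point.\<close>

definition smooth_affine_space :: "'a fspace \<Rightarrow> bool" where
  "smooth_affine_space X \<longleftrightarrow>
     (\<exists>n c f. (\<forall>j<c. f j \<in> poly_funs n) \<and>
        (\<forall>x \<in> zeros n (f ` {..<c}). \<forall>b :: nat \<Rightarrow> complex.
           (\<forall>i<n. (\<Sum>j<c. b j * partial_deriv i (f j) x) = 0) \<longrightarrow> (\<forall>j<c. b j = 0)) \<and>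
        fspace_isomorphic X (affine_fspace n (f ` {..<c})))"

definition smooth_variety :: "'a fspace \<Rightarrow> bool" where
  "smooth_variety X \<longleftrightarrow> variety X \<and>
     (\<forall>x \<in> points X. \<exists>U. openin (ztop X) U \<and> x \<in> U \<and> smooth_affine_space (open_subspace X U))"

text \<open>The classical topology is the coarsest one making Zariski open sets open and regular
  functions continuous; on an affine algebraic set it is the Euclidean topology.\<close>

definition classical_topology :: "'a fspace \<Rightarrow> 'a topology" where
  "classical_topology X = topology_generated_by
     {{x \<in> U. f x \<in> W} | U f W. openin (ztop X) U \<and> f \<in> reg X U \<and> open W}"

section \<open>Divisors and sections\<close>

text \<open>A rational function on an irreducible \<open>X\<close> is represented by a pair \<open>(W, f)\<close> with \<open>f\<close> regular
  on the nonempty open set \<open>W\<close>; everything below depends only on its class modulo \<open>rat_eq\<close>.\<close>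

type_synonym 'a ratfun = "'a set \<times> ('a \<Rightarrow> complex)"

definition ratfuns :: "'a fspace \<Rightarrow> 'a ratfun set" where
  "ratfuns X = {(W, f). openin (ztop X) W \<and> W \<noteq> {} \<and> f \<in> reg X W}"

definition rat_eq :: "'a ratfun \<Rightarrow> 'a ratfun \<Rightarrow> bool" where
  "rat_eq r s \<longleftrightarrow> (\<forall>x \<in> fst r \<inter> fst s. snd r x = snd s x)"

definition rat_nonzero :: "'a ratfun \<Rightarrow> bool" where
  "rat_nonzero r \<longleftrightarrow> (\<exists>x \<in> fst r. snd r x \<noteq> 0)"

definition rat_mult :: "'a ratfun \<Rightarrow> 'a ratfun \<Rightarrow> 'a ratfun" where
  "rat_mult r s = (fst r \<inter> fst s, \<lambda>x. snd r x * snd s x)"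

definition rat_diff :: "'a ratfun \<Rightarrow> 'a ratfun \<Rightarrow> 'a ratfun" where
  "rat_diff r s = (fst r \<inter> fst s, \<lambda>x. snd r x - snd s x)"

definition rat_power :: "'a ratfun \<Rightarrow> nat \<Rightarrow> 'a ratfun" where
  "rat_power r m = (fst r, \<lambda>x. snd r x ^ m)"

text \<open>Divisors on a smooth variety are Cartier divisors, i.e. given by pairs \<open>(U, l)\<close> of an open set
  and a nonzero rational function (a local equation on \<open>U\<close>), the quotient of any two being an
  invertible regular function on the overlap. They need not be effective.\<close>

definition divisor :: "'a fspace \<Rightarrow> ('a set \<times> 'a ratfun) set \<Rightarrow> bool" where
  "divisor X L \<longleftrightarrow>
     (\<forall>(U, l) \<in> L. openin (ztop X) U \<and> l \<in> ratfuns X \<and> rat_nonzero l) \<and>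
     \<Union> (fst ` L) = points X \<and>
     (\<forall>(U, l) \<in> L. \<forall>(V, k) \<in> L. \<exists>u \<in> reg X (U \<inter> V).
        (\<forall>x \<in> U \<inter> V. u x \<noteq> 0) \<and> rat_eq l (rat_mult (U \<inter> V, u) k))"

text \<open>\<open>H\<^sup>0(X, \<O>\<^sub>X(mL))\<close>: the rational functions \<open>s\<close> with \<open>s l\<^sup>m\<close> regular on \<open>U\<close> for all
  \<open>(U, l)\<close> in \<open>L\<close>, that is, with \<open>div(s) + mL \<ge> 0\<close> or \<open>s = 0\<close>.\<close>

definition sections_mult :: "'a fspace \<Rightarrow> ('a set \<times> 'a ratfun) set \<Rightarrow> nat \<Rightarrow> 'a ratfun set" where
  "sections_mult X L m = {s \<in> ratfuns X. \<forall>(U, l) \<in> L. \<exists>h \<in> reg X U.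
     rat_eq (U, h) (rat_mult s (rat_power l m))}"

text \<open>The regular function \<open>s l\<^sup>m\<close> expresses the section \<open>s\<close> of \<open>\<O>\<^sub>X(mL)\<close> in the
  local trivialisation given by \<open>(U, l)\<close>; it is a local equation of the zero scheme of \<open>s\<close>.\<close>

definition local_equation ::
  "'a fspace \<Rightarrow> ('a set \<times> 'a ratfun) set \<Rightarrow> nat \<Rightarrow> 'a ratfun \<Rightarrow> 'a \<Rightarrow> ('a \<Rightarrow> complex) \<Rightarrow> bool" where
  "local_equation X L m s x h \<longleftrightarrow> (\<exists>(U, l) \<in> L. x \<in> U \<and> h \<in> reg X U \<and>
     rat_eq (U, h) (rat_mult s (rat_power l m)))"

definition zero_locus ::
  "'a fspace \<Rightarrow> ('a set \<times> 'a ratfun) set \<Rightarrow> nat \<Rightarrow> 'a ratfun \<Rightarrow> 'a set" where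
  "zero_locus X L m s = {x \<in> points X. \<exists>h. local_equation X L m s x h \<and> h x = 0}"

subsection \<open>Smoothness and transversality of zero divisors\<close>

text \<open>\<open>\<mm>\<^sub>x\<^sup>2\<close> in the local ring at \<open>x\<close>, on representatives of germs.\<close>

definition max_ideal_square :: "'a fspace \<Rightarrow> 'a \<Rightarrow> ('a \<Rightarrow> complex) set" where
  "max_ideal_square X x = {g. \<exists>U (m::nat) u v. openin (ztop X) U \<and> x \<in> U \<and>
     (\<forall>i<m. u i \<in> reg X U \<and> v i \<in> reg X U \<and> u i x = 0 \<and> v i x = 0) \<and>
     (\<forall>y\<in>U. g y = (\<Sum>i<m. u i y * v i y))}"

text \<open>Linear independence of the differentials \<open>d\<^sub>x g \<in> \<mm>\<^sub>x / \<mm>\<^sub>x\<^sup>2\<close>, the class of \<open>g - g(x)\<close>.\<close>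

definition independent_differentials :: "'a fspace \<Rightarrow> 'a \<Rightarrow> ('a \<Rightarrow> complex) list \<Rightarrow> bool" where
  "independent_differentials X x gs \<longleftrightarrow> (\<forall>c :: nat \<Rightarrow> complex.
     (\<lambda>y. \<Sum>i<length gs. c i * ((gs ! i) y - (gs ! i) x)) \<in> max_ideal_square X x \<longrightarrow>
     (\<forall>i<length gs. c i = 0))"

text \<open>Smoothness of the zero divisor as a scheme (hence reducedness): on a smooth variety, the
  Jacobian criterion says that a local equation has nonzero differential at each of its zeros.\<close>

definition zero_divisor_smooth_in ::
  "'a fspace \<Rightarrow> ('a set \<times> 'a ratfun) set \<Rightarrow> nat \<Rightarrow> 'a ratfun \<Rightarrow> 'a set \<Rightarrow> bool" where
  "zero_divisor_smooth_in X L m s W \<longleftrightarrow>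
     (\<forall>x \<in> zero_locus X L m s \<inter> W. \<forall>h. local_equation X L m s x h \<longrightarrow>
        independent_differentials X x [h])"

definition zero_divisors_transverse ::
  "'a fspace \<Rightarrow> ('a set \<times> 'a ratfun) set \<Rightarrow> nat \<Rightarrow> 'a ratfun \<Rightarrow> nat \<Rightarrow> 'a ratfun \<Rightarrow> bool" where
  "zero_divisors_transverse X L m s k t \<longleftrightarrow>
     (\<forall>x \<in> zero_locus X L m s \<inter> zero_locus X L k t. \<forall>g h.
        local_equation X L m s x g \<and> local_equation X L k t x h \<longrightarrow>
        independent_differentials X x [g, h])"

section \<open>Fundamental group and dihedral groups\<close>

definition loops :: "'a topology \<Rightarrow> 'a \<Rightarrow> (real \<Rightarrow> 'a) set" where
  "loops T x0 = {p. pathin T p \<and> p 0 = x0 \<and> p 1 = x0}"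

definition loop_class :: "'a topology \<Rightarrow> 'a \<Rightarrow> (real \<Rightarrow> 'a) \<Rightarrow> (real \<Rightarrow> 'a) set" where
  "loop_class T x0 p = {q \<in> loops T x0.
     homotopic_with (\<lambda>r. r 0 = x0 \<and> r 1 = x0) (top_of_set {0..1}) T p q}"

text \<open>The library's \<open>joinpaths\<close> is restricted to type class topologies.\<close>

definition loop_join :: "(real \<Rightarrow> 'a) \<Rightarrow> (real \<Rightarrow> 'a) \<Rightarrow> real \<Rightarrow> 'a" where
  "loop_join p q = (\<lambda>t. if t \<le> 1/2 then p (2 * t) else q (2 * t - 1))"

definition fundamental_group :: "'a topology \<Rightarrow> 'a \<Rightarrow> (real \<Rightarrow> 'a) set monoid" where
  "fundamental_group T x0 =
     \<lparr>carrier = loop_class T x0 ` loops T x0,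
      mult = (\<lambda>A B. \<Union>p\<in>A. \<Union>q\<in>B. loop_class T x0 (loop_join p q)),
      one = loop_class T x0 (\<lambda>t. x0)\<rparr>"

text \<open>The dihedral group of order \<open>2n\<close>, for \<open>n \<ge> 1\<close>: the pair \<open>(i, e)\<close> stands for \<open>r\<^sup>i s\<^sup>e\<close>, where
  \<open>r\<^sup>n = s\<^sup>2 = 1\<close> and \<open>s r s = r\<^sup>-\<^sup>1\<close>.\<close>

definition dihedral_group :: "nat \<Rightarrow> (int \<times> bool) monoid" where
  "dihedral_group n =
     \<lparr>carrier = {0..<int n} \<times> UNIV,
      mult = (\<lambda>(i, e) (j, e'). ((if e then i - j else i + j) mod int n, e \<noteq> e')),
      one = (0, False)\<rparr>"

end

theory Submission
  imports Defs "HOL-Complex_Analysis.Complex_Analysis"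
begin

text \<open>Consider the equations \<open>w w' = F\<close> and \<open>w\<^sup>n + w'\<^sup>n = 2 a\<close>. The powers \<open>w\<^sup>n\<close> and \<open>w'\<^sup>n\<close> are the roots of
\<open>T\<^sup>2 - 2 a T + F\<^sup>n\<close>, whose discriminant is \<open>4 (a\<^sup>2 - F\<^sup>n)\<close>. Off \<open>\<B>\<close> they are distinct, and then
\<open>D\<^sub>n\<close> permutes the solutions \<open>(w, w')\<close> over a point simply transitively: the rotations act by
\<open>(\<zeta> w, \<zeta>\<^sup>-\<^sup>1 w')\<close> with \<open>\<zeta>\<^sup>n = 1\<close>, the reflection exchanges \<open>w\<close> and \<open>w'\<close> (\<open>act_free\<close>, \<open>act_transitive\<close>).
The solutions therefore form a covering of \<open>Y - \<B>\<close> with an action of \<open>D\<^sub>n\<close> that is simply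
transitive on fibres. The action commutes with path lifting, so lifting loops defines a homomorphism from
\<open>\<pi>\<^sub>1(Y - \<B>)\<close> to \<open>D\<^sub>n\<close>. It is onto if, starting from one point of the fibre, the lifts of loops reach
every other point of that fibre (\<open>monodromy_epimorphism\<close>).

To reach all points it is enough to look near a common zero of \<open>a\<close> and \<open>F\<close>. Transversality makes
\<open>(a, F)\<close> part of a coordinate system there, so a bidisc in the \<open>(a, F)\<close>-plane embeds into \<open>Y\<close>
(\<open>transversal_local_section\<close>). The covering restricted to it is the map
\<open>(w, w') \<mapsto> ((w\<^sup>n + w'\<^sup>n) / 2, w w')\<close> on the set \<open>{w\<^sup>n \<noteq> w'\<^sup>n}\<close>. This set is the complement of a curve, hence
path connected near the origin, and it is stable under \<open>D\<^sub>n\<close>; a path in it from \<open>(w, w')\<close> to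
\<open>g (w, w')\<close> projects to a loop with monodromy \<open>g\<close> (\<open>carries_local_model\<close>). A path from the
given base point to this neighbourhood then transports the loops (\<open>loops_conjugate\<close>).

Such a path exists because a nonempty Zariski open subset of a smooth irreducible variety is path connected
in the classical topology (\<open>zariski_open_path_connected\<close>). This is the deepest ingredient. Since nonempty
Zariski open sets meet, it reduces to principal open subsets of a smooth irreducible affine \<open>V\<close> of
dimension \<open>m\<close>. Some \<open>m\<close> of the coordinates define a projection \<open>V \<rightarrow> \<complex>\<^sup>m\<close> which is a finite covering over
\<open>{b \<noteq> 0}\<close> for some nonzero polynomial \<open>b\<close> (\<open>evenly_covered\<close>). Suppose that the part of \<open>V\<close> over \<open>{b \<noteq> 0}\<close> is a
disjoint union of two nonempty unions \<open>X\<close> and \<open>X'\<close> of path components. For a polynomial \<open>h\<close> the product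
of \<open>T - h p\<close> over the points \<open>p\<close> of \<open>X\<close> in the fibre of \<open>x\<close> is holomorphic in \<open>x\<close> off \<open>{b = 0}\<close>
and, for suitable \<open>h\<close>, of polynomial growth; by Liouville's theorem it is a polynomial in \<open>x\<close> and \<open>T\<close>
(\<open>fibre_product_polynomial\<close>). The same holds for \<open>X'\<close>. At \<open>T = h\<close> the product of the two polynomials vanishes
on \<open>V\<close>, so by irreducibility one of the factors does, and this is false when \<open>h\<close> separates the points of two
suitable fibres (\<open>Vb_path_connected\<close>). Points of \<open>V\<close> lying over \<open>{b = 0}\<close> are joined to the others by
short arcs (\<open>connect_to_dense_open\<close>).\<close>

section \<open>Polynomial functions and their restrictions to lines\<close>

lemma poly_funs_uminus: "p \<in> poly_funs n \<Longrightarrow> (\<lambda>x. - p x) \<in> poly_funs n"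
  using poly_funs.mult[OF poly_funs.const[of "-1"], of p n] by simp

lemma poly_funs_diff: "p \<in> poly_funs n \<Longrightarrow> q \<in> poly_funs n \<Longrightarrow> (\<lambda>x. p x - q x) \<in> poly_funs n"
  using poly_funs.add[OF _ poly_funs_uminus, of p n q] by simp

lemma poly_funs_sum: "(\<And>i. i \<in> I \<Longrightarrow> f i \<in> poly_funs n) \<Longrightarrow> (\<lambda>x. \<Sum>i\<in>I. f i x) \<in> poly_funs n"
  by (induct I rule: infinite_finite_induct) (auto intro: poly_funs.intros)

lemma poly_funs_prod: "(\<And>i. i \<in> I \<Longrightarrow> f i \<in> poly_funs n) \<Longrightarrow> (\<lambda>x. \<Prod>i\<in>I. f i x) \<in> poly_funs n"
  by (induct I rule: infinite_finite_induct) (auto intro: poly_funs.intros)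

lemma poly_funs_power: "p \<in> poly_funs n \<Longrightarrow> (\<lambda>x. p x ^ k) \<in> poly_funs n"
  by (induct k) (auto intro: poly_funs.intros)

lemmas poly_funs_intros = poly_funs.intros poly_funs_uminus poly_funs_diff poly_funs_sum
  poly_funs_prod poly_funs_power

lemma poly_funs_cong: "p \<in> poly_funs n \<Longrightarrow> (\<And>i. i < n \<Longrightarrow> x i = y i) \<Longrightarrow> p x = p y"
  by (induct rule: poly_funs.induct) auto

lemma poly_funs_subst:
  "p \<in> poly_funs n \<Longrightarrow> (\<And>i. i < n \<Longrightarrow> g i \<in> poly_funs k) \<Longrightarrow> (\<lambda>x. p (\<lambda>i. g i x)) \<in> poly_funs k"
  by (induct rule: poly_funs.induct) (auto intro: poly_funs.intros)

lemma poly_funs_mono: "p \<in> poly_funs n \<Longrightarrow> n \<le> k \<Longrightarrow> p \<in> poly_funs k"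
  by (induct rule: poly_funs.induct) (auto intro: poly_funs.intros)

lemma continuous_on_poly_funs: "p \<in> poly_funs n \<Longrightarrow> continuous_on UNIV p"
  by (induct rule: poly_funs.induct) (auto intro!: continuous_intros)

text \<open>A bound on the degree of all restrictions to complex lines. For polynomial functions it replaces the
total degree, and it makes sense for functions not yet known to be polynomial.\<close>

definition line_deg :: "((nat \<Rightarrow> complex) \<Rightarrow> complex) \<Rightarrow> nat \<Rightarrow> bool" where
  "line_deg p D \<longleftrightarrow> (\<forall>a b. \<exists>q. degree q \<le> D \<and> (\<forall>t. p (\<lambda>i. a i + t * b i) = poly q t))"

lemma line_deg_const: "line_deg (\<lambda>x. c) D"
  unfolding line_deg_def by (intro allI exI[of _ "[:c:]"]) auto

lemma line_deg_coord: "line_deg (\<lambda>x. x i) 1"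
  unfolding line_deg_def
proof (intro allI)
  fix a b :: "nat \<Rightarrow> complex"
  show "\<exists>q. degree q \<le> 1 \<and> (\<forall>t. a i + t * b i = poly q t)"
    by (intro exI[of _ "[:a i, b i:]"]) auto
qed

lemma line_deg_mono: "line_deg p D \<Longrightarrow> D \<le> E \<Longrightarrow> line_deg p E"
  unfolding line_deg_def by (meson order_trans)

lemma line_deg_add:
  assumes "line_deg p D" "line_deg q D"
  shows "line_deg (\<lambda>x. p x + q x) D"
  unfolding line_deg_def
proof (intro allI)
  fix a b
  obtain u v where "degree u \<le> D" "\<And>t. p (\<lambda>i. a i + t * b i) = poly u t"
    "degree v \<le> D" "\<And>t. q (\<lambda>i. a i + t * b i) = poly v t"
    using assms unfolding line_deg_def by meson
  then show "\<exists>w. degree w \<le> D \<and> (\<forall>t. p (\<lambda>i. a i + t * b i) + q (\<lambda>i. a i + t * b i) = poly w t)"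
    by (intro exI[of _ "u + v"]) (simp add: degree_add_le)
qed

lemma line_deg_mult:
  assumes "line_deg p D" "line_deg q E"
  shows "line_deg (\<lambda>x. p x * q x) (D + E)"
  unfolding line_deg_def
proof (intro allI)
  fix a b
  obtain u v where "degree u \<le> D" "\<And>t. p (\<lambda>i. a i + t * b i) = poly u t"
    "degree v \<le> E" "\<And>t. q (\<lambda>i. a i + t * b i) = poly v t"
    using assms unfolding line_deg_def by meson
  then show "\<exists>w. degree w \<le> D + E \<and> (\<forall>t. p (\<lambda>i. a i + t * b i) * q (\<lambda>i. a i + t * b i) = poly w t)"
    by (intro exI[of _ "u * v"]) (simp add: order_trans[OF degree_mult_le])
qed

lemma line_deg_sum: "(\<And>i. i \<in> I \<Longrightarrow> line_deg (f i) D) \<Longrightarrow> line_deg (\<lambda>x. \<Sum>i\<in>I. f i x) D"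
  by (induct I rule: infinite_finite_induct) (auto intro: line_deg_const line_deg_add)

lemma line_deg_power: "line_deg p D \<Longrightarrow> line_deg (\<lambda>x. p x ^ k) (k * D)"
  by (induct k) (auto intro: line_deg_const line_deg_mult)

lemma line_deg_prod:
  "finite I \<Longrightarrow> (\<And>i. i \<in> I \<Longrightarrow> line_deg (f i) D) \<Longrightarrow> line_deg (\<lambda>x. \<Prod>i\<in>I. f i x) (card I * D)"
  by (induct I rule: finite_induct) (auto intro: line_deg_const line_deg_mult)

lemma poly_funs_line_deg: "p \<in> poly_funs n \<Longrightarrow> \<exists>D. line_deg p D"
proof (induct rule: poly_funs.induct)
  case (add p q)
  then obtain D E where "line_deg p D" "line_deg q E" by blast
  then have "line_deg (\<lambda>x. p x + q x) (max D E)"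
    by (intro line_deg_add) (auto elim: line_deg_mono)
  then show ?case by blast
qed (auto intro: line_deg_const line_deg_coord line_deg_mult)

lemma finite_zeros_on_line:
  assumes "p \<in> poly_funs n" "p (\<lambda>i. a i + t0 * b i) \<noteq> 0"
  shows "finite {t. p (\<lambda>i. a i + t * b i) = 0}"
proof -
  obtain D where "line_deg p D" using poly_funs_line_deg assms by blast
  then obtain q where q: "\<And>t. p (\<lambda>i. a i + t * b i) = poly q t" unfolding line_deg_def by blast
  then have "q \<noteq> 0" using assms(2) by auto
  then show ?thesis using q poly_roots_finite[of q] by simp
qed

text \<open>Both functions are nonzero at some point of the line through \<open>a\<close> and \<open>b\<close>, on which each
has only finitely many zeros; thus nonzero polynomial functions form an integral domain.\<close>

lemma poly_funs_common_nonzero: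
  assumes "p \<in> poly_funs n" "q \<in> poly_funs k" "p a \<noteq> 0" "q b \<noteq> 0"
  shows "\<exists>x. p x \<noteq> 0 \<and> q x \<noteq> 0"
proof -
  let ?l = "\<lambda>t::complex. \<lambda>i. a i + t * (b i - a i)"
  have "finite {t. p (?l t) = 0}"
    by (rule finite_zeros_on_line[OF assms(1), where ?t0.0 = 0]) (use assms in simp)
  moreover have "finite {t. q (?l t) = 0}"
    by (rule finite_zeros_on_line[OF assms(2), where ?t0.0 = 1]) (use assms in simp)
  ultimately have "finite ({t. p (?l t) = 0} \<union> {t. q (?l t) = 0})" by blast
  then obtain t where "t \<notin> {t. p (?l t) = 0} \<union> {t. q (?l t) = 0}"
    using ex_new_if_finite infinite_UNIV_char_0 by blast
  then show ?thesis by blast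
qed

lemma poly_funs_common_nonzero_finite:
  assumes "finite I" "\<And>i. i \<in> I \<Longrightarrow> P i \<in> poly_funs n" "\<And>i. i \<in> I \<Longrightarrow> \<exists>x. P i x \<noteq> 0"
  shows "\<exists>x. \<forall>i\<in>I. P i x \<noteq> 0"
  using assms
proof (induct I rule: finite_induct)
  case (insert j I)
  obtain y where y: "P j y \<noteq> 0" using insert(5) by blast
  obtain x where x: "\<forall>i\<in>I. P i x \<noteq> 0" using insert(3,4,5) by force
  note xy = x y
  have "(\<lambda>x. \<Prod>i\<in>I. P i x) \<in> poly_funs n" "(\<Prod>i\<in>I. P i x) \<noteq> 0"
    using insert xy by (auto intro: poly_funs_prod)
  then obtain z where "(\<Prod>i\<in>I. P i z) \<noteq> 0" "P j z \<noteq> 0"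
    using poly_funs_common_nonzero[of _ n _ n] insert(4) xy(2) by blast
  then show ?case using insert(1) by auto
qed auto

text \<open>A polynomial in one variable of degree at most \<open>D\<close> with \<open>D + 1\<close> zeros vanishes. Applied to one
coordinate after the other, this frees the coordinates from the grid.\<close>

lemma vanish_on_grid:
  assumes p: "line_deg p D"
    and grid: "\<And>x. (\<forall>i<n. x i \<in> of_nat ` {..D}) \<Longrightarrow> p x = 0"
  shows "p x = 0"
proof -
  have "j \<le> n \<Longrightarrow> (\<forall>i. j \<le> i \<and> i < n \<longrightarrow> x i \<in> of_nat ` {..D}) \<Longrightarrow> p x = 0" for j x
  proof (induct j arbitrary: x)
    case 0
    then show ?case using grid by auto
  next
    case (Suc j)
    define a where "a = x(j := 0)"
    define b where "b = (\<lambda>i. if i = j then 1 else 0 :: complex)"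
    obtain q where q: "degree q \<le> D" "\<And>t. p (\<lambda>i. a i + t * b i) = poly q t"
      using p unfolding line_deg_def by blast
    have ab: "(\<lambda>i. a i + t * b i) = x(j := t)" for t by (auto simp: a_def b_def fun_eq_iff)
    have z: "poly q (of_nat k) = 0" if "k \<le> D" for k
      unfolding q(2)[symmetric] ab
      by (rule Suc(1)) (use Suc(2,3) that in \<open>auto simp: Suc_le_eq\<close>)
    have "q = 0"
    proof (rule ccontr)
      assume "q \<noteq> 0"
      then have "card {x. poly q x = 0} \<le> D" using card_poly_roots_bound[of q] q(1) by linarith
      moreover have "of_nat ` {..D} \<subseteq> {x. poly q x = 0}" using z by auto
      then have "card (of_nat ` {..D} :: complex set) \<le> card {x. poly q x = 0}"
        by (intro card_mono poly_roots_finite \<open>q \<noteq> 0\<close>)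
      moreover have "card (of_nat ` {..D} :: complex set) = Suc D"
        by (subst card_image) (auto simp: inj_on_def)
      ultimately show False by simp
    qed
    then have "p (x(j := x j)) = 0" using q(2)[of "x j"] ab by simp
    then show ?case by simp
  qed
  from this[of n x] show ?thesis by (meson leD order_refl)
qed

text \<open>Fewer equations than unknowns, by elimination of one unknown at a time. The index sets are
arbitrary, since the unknowns will be monomials and the equations points of a grid.\<close>

section \<open>Linear algebra with polynomial coefficients\<close>

lemma nontrivial_solution:
  fixes A :: "'j \<Rightarrow> 'i \<Rightarrow> complex"
  assumes "finite J" "finite I" "card J < card I"
  shows "\<exists>c. (\<exists>i\<in>I. c i \<noteq> 0) \<and> (\<forall>j\<in>J. (\<Sum>i\<in>I. A j i * c i) = 0)"
  using assms
proof (induct J arbitrary: I A rule: finite_induct)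
  case empty
  then have "I \<noteq> {}" by auto
  then show ?case by (intro exI[of _ "\<lambda>i. 1"]) auto
next
  case (insert k J)
  show ?case
  proof (cases "\<forall>i\<in>I. A k i = 0")
    case True
    have "card J < card I" using insert by auto
    then show ?thesis using insert(3)[of I A] insert True by auto
  next
    case False
    then obtain i0 where i0: "i0 \<in> I" "A k i0 \<noteq> 0" by blast
    let ?B = "\<lambda>j i. A j i - A j i0 / A k i0 * A k i"
    have "card J < card (I - {i0})" using insert i0 by auto
    then obtain c where c: "\<exists>i\<in>I-{i0}. c i \<noteq> 0" "\<forall>j\<in>J. (\<Sum>i\<in>I-{i0}. ?B j i * c i) = 0"
      using insert(3)[OF finite_Diff[OF insert(4)] \<open>card J < card (I - {i0})\<close>, of ?B] by blast
    define S where "S j = (\<Sum>i\<in>I-{i0}. A j i * c i)" for j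
    define c' where "c' = c(i0 := - S k / A k i0)"
    have sum: "(\<Sum>i\<in>I. A j i * c' i) = A j i0 * c' i0 + S j" for j
      unfolding S_def using i0 insert(4) by (subst sum.remove[of I i0]) (auto simp: c'_def intro!: sum.cong)
    have "(\<Sum>i\<in>I. A k i * c' i) = 0" unfolding sum using i0 by (simp add: c'_def)
    moreover have "(\<Sum>i\<in>I. A j i * c' i) = 0" if "j \<in> J" for j
    proof -
      have "0 = (\<Sum>i\<in>I-{i0}. A j i * c i - A j i0 / A k i0 * (A k i * c i))"
        using c(2) that by (simp add: algebra_simps)
      also have "\<dots> = S j - A j i0 / A k i0 * S k"
        unfolding S_def by (simp add: sum_subtractf sum_distrib_left)
      finally have "S j = A j i0 / A k i0 * S k" by simp
      moreover have "c' i0 = - S k / A k i0" by (simp add: c'_def)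
      ultimately show ?thesis unfolding sum by simp
    qed
    moreover have "\<exists>i\<in>I. c' i \<noteq> 0" using c(1) by (auto simp: c'_def)
    ultimately show ?thesis by blast
  qed
qed

text \<open>Linear independence of the first \<open>k\<close> rows of a matrix with \<open>N\<close> columns.\<close>

definition indep_rows :: "nat \<Rightarrow> nat \<Rightarrow> (nat \<Rightarrow> nat \<Rightarrow> complex) \<Rightarrow> bool" where
  "indep_rows k N A \<longleftrightarrow> (\<forall>b. (\<forall>i<N. (\<Sum>j<k. b j * A j i) = 0) \<longrightarrow> (\<forall>j<k. b j = 0))"

lemma indep_rows_le:
  assumes "indep_rows k N A"
  shows "k \<le> N"
proof (rule ccontr)
  assume "\<not> k \<le> N"
  then obtain b where "\<exists>j\<in>{..<k}. b j \<noteq> 0" "\<forall>i\<in>{..<N}. (\<Sum>j<k. A j i * b j) = 0"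
    using nontrivial_solution[of "{..<N}" "{..<k}" "\<lambda>i j. A j i"] by auto
  then show False using assms unfolding indep_rows_def by (auto simp: mult.commute)
qed

lemma indep_rows_SucD:
  assumes "indep_rows (Suc k) N A"
  shows "indep_rows k N A"
  unfolding indep_rows_def
proof (intro allI impI)
  fix b j assume b: "\<forall>i<N. (\<Sum>j<k. b j * A j i) = 0" and j: "j < k"
  then have "\<forall>i<N. (\<Sum>j<Suc k. (b(k := 0)) j * A j i) = 0" by simp
  then have "(b(k := 0)) j = 0" using assms j unfolding indep_rows_def by (metis less_SucI)
  then show "b j = 0" using j by simp
qed

text \<open>A matrix with polynomial entries whose rows are independent at \<open>z0\<close> has a right inverse up to a polynomial
factor \<open>J\<close> with \<open>J z0 \<noteq> 0\<close>, so its rows stay independent where \<open>J\<close> does not vanish. This avoids minors: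
rows are added one at a time, as in Gram-Schmidt, keeping all denominators in \<open>J\<close>.\<close>

lemma polynomial_right_inverse:
  assumes "\<And>j i. j < k \<Longrightarrow> i < N \<Longrightarrow> A j i \<in> poly_funs n"
    and "indep_rows k N (\<lambda>j i. A j i z0)"
  shows "\<exists>R J. J \<in> poly_funs n \<and> J z0 \<noteq> 0 \<and> (\<forall>i<N. \<forall>l<k. R i l \<in> poly_funs n) \<and>
    (\<forall>z. \<forall>j<k. \<forall>l<k. (\<Sum>i<N. A j i z * R i l z) = (if j = l then J z else 0))"
  using assms
proof (induct k)
  case 0
  then show ?case by (intro exI[of _ "\<lambda>_ _ _. 0"] exI[of _ "\<lambda>_. 1"]) (auto intro: poly_funs.intros)
next
  case (Suc k)
  have "indep_rows k N (\<lambda>j i. A j i z0)" using indep_rows_SucD Suc(3) .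
  then obtain R J where J: "J \<in> poly_funs n" "J z0 \<noteq> 0"
    and R: "\<And>i l. i < N \<Longrightarrow> l < k \<Longrightarrow> R i l \<in> poly_funs n"
    and AR: "\<And>z j l. j < k \<Longrightarrow> l < k \<Longrightarrow> (\<Sum>i<N. A j i z * R i l z) = (if j = l then J z else 0)"
  proof -
    have "\<And>j i. j < k \<Longrightarrow> i < N \<Longrightarrow> A j i \<in> poly_funs n" using Suc(2) by simp
    from Suc(1)[OF this \<open>indep_rows k N (\<lambda>j i. A j i z0)\<close>] show thesis using that by blast
  qed
  define \<beta> where "\<beta> l z = (\<Sum>i<N. A k i z * R i l z)" for l z
  \<comment> \<open>\<open>w i0\<close> is \<open>J\<close> times the unit vector \<open>i0\<close>, made orthogonal to the first \<open>k\<close> rows, and \<open>\<kappa> i0\<close> is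
    its product with the new row.\<close>
  define w where "w i0 i z = (if i = i0 then J z else 0) - (\<Sum>l<k. A l i0 z * R i l z)" for i0 i z
  define \<kappa> where "\<kappa> i0 z = (\<Sum>i<N. A k i z * w i0 i z)" for i0 z
  have Aw: "(\<Sum>i<N. A j i z * w i0 i z) = J z * A j i0 z - (\<Sum>l<k. A l i0 z * (\<Sum>i<N. A j i z * R i l z))"
    if "i0 < N" for j i0 z
  proof -
    have "(\<Sum>i<N. A j i z * w i0 i z)
      = (\<Sum>i<N. A j i z * (if i = i0 then J z else 0)) - (\<Sum>i<N. \<Sum>l<k. A l i0 z * (A j i z * R i l z))"
      unfolding w_def by (simp add: right_diff_distrib sum_subtractf sum_distrib_left mult.left_commute)
    also have "(\<Sum>i<N. A j i z * (if i = i0 then J z else 0)) = A j i0 z * J z"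
      using that by (simp add: if_distrib[of "\<lambda>x. _ * x"] cong: if_cong)
    also have "(\<Sum>i<N. \<Sum>l<k. A l i0 z * (A j i z * R i l z)) = (\<Sum>l<k. A l i0 z * (\<Sum>i<N. A j i z * R i l z))"
      by (subst sum.swap) (simp add: sum_distrib_left)
    finally show ?thesis by (simp add: mult.commute)
  qed
  have Aw0: "(\<Sum>i<N. A j i z * w i0 i z) = 0" if "i0 < N" "j < k" for j i0 z
    unfolding Aw[OF that(1)] using AR that by (simp add: if_distrib[of "\<lambda>x. _ * x"] cong: if_cong)
  have \<kappa>: "\<kappa> i0 z = J z * A k i0 z - (\<Sum>l<k. A l i0 z * \<beta> l z)" if "i0 < N" for i0 z
    unfolding \<kappa>_def \<beta>_def Aw[OF that] ..
  have "\<exists>i0<N. \<kappa> i0 z0 \<noteq> 0"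
  proof (rule ccontr)
    assume n: "\<not> ?thesis"
    let ?b = "\<lambda>l. if l < k then - \<beta> l z0 else J z0"
    have "\<forall>i<N. (\<Sum>j<Suc k. ?b j * A j i z0) = 0"
      using n \<kappa> by (auto simp: sum_negf mult.commute)
    with Suc(3)[unfolded indep_rows_def, rule_format, of ?b k] have "?b k = 0" by simp
    then show False using J by simp
  qed
  then obtain i0 where i0: "i0 < N" "\<kappa> i0 z0 \<noteq> 0" by blast
  define R' where "R' i l z = (if l < k then \<kappa> i0 z * R i l z - \<beta> l z * w i0 i z else J z * w i0 i z)" for i l z
  have P\<beta>: "\<beta> l \<in> poly_funs n" if "l < k" for l
    unfolding \<beta>_def using that Suc(2) R by (intro poly_funs_intros) auto
  have Pw: "w i0 i \<in> poly_funs n" if "i < N" for i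
    unfolding w_def using that Suc(2) R J i0 by (cases "i = i0") (auto intro!: poly_funs_intros)
  have P\<kappa>: "\<kappa> i0 \<in> poly_funs n" unfolding \<kappa>_def using Pw Suc(2) by (intro poly_funs_intros) auto
  have "R' i l \<in> poly_funs n" if "i < N" "l < Suc k" for i l
    unfolding R'_def using that R P\<beta> Pw P\<kappa> J by (cases "l < k") (auto intro!: poly_funs_intros)
  moreover have "(\<Sum>i<N. A j i z * R' i l z) = (if j = l then J z * \<kappa> i0 z else 0)"
    if "j < Suc k" "l < Suc k" for j l z
  proof (cases "l < k")
    case True
    have "(\<Sum>i<N. A j i z * R' i l z) = \<kappa> i0 z * (\<Sum>i<N. A j i z * R i l z) - \<beta> l z * (\<Sum>i<N. A j i z * w i0 i z)"
      unfolding R'_def using True by (simp add: right_diff_distrib sum_subtractf sum_distrib_left mult.left_commute)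
    also have "\<dots> = (if j = l then J z * \<kappa> i0 z else 0)"
    proof (cases "j < k")
      case True then show ?thesis using Aw0 AR i0 \<open>l < k\<close> by simp
    next
      case False
      then have "j = k" using that by simp
      then show ?thesis unfolding \<beta>_def[symmetric] using True \<kappa>_def by (simp add: \<beta>_def)
    qed
    finally show ?thesis .
  next
    case False
    then have l: "l = k" using that by simp
    have "(\<Sum>i<N. A j i z * R' i l z) = J z * (\<Sum>i<N. A j i z * w i0 i z)"
      unfolding R'_def l by (simp add: sum_distrib_left mult.left_commute)
    then show ?thesis using Aw0[of i0 j z] i0 that l \<kappa>_def[of i0 z]
      by (cases "j < k") (auto simp: less_Suc_eq)
  qed
  moreover have "(\<lambda>z. J z * \<kappa> i0 z) \<in> poly_funs n" using J P\<kappa> by (intro poly_funs_intros)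
  ultimately show ?case using J i0
    by (intro exI[of _ R'] exI[of _ "\<lambda>z. J z * \<kappa> i0 z"]) auto
qed

lemma right_inverse_imp_indep_rows:
  assumes "\<And>j l. j < k \<Longrightarrow> l < k \<Longrightarrow> (\<Sum>i<N. A j i * R i l) = (if j = l then c else 0)" "c \<noteq> (0::complex)"
  shows "indep_rows k N A"
  unfolding indep_rows_def
proof (intro allI impI)
  fix b l assume b: "\<forall>i<N. (\<Sum>j<k. b j * A j i) = 0" and l: "l < k"
  have "0 = (\<Sum>i<N. (\<Sum>j<k. b j * A j i) * R i l)" using b by simp
  also have "\<dots> = (\<Sum>i<N. \<Sum>j<k. b j * (A j i * R i l))" by (simp add: sum_distrib_right mult.assoc)
  also have "\<dots> = (\<Sum>j<k. b j * (\<Sum>i<N. A j i * R i l))" by (subst sum.swap) (simp add: sum_distrib_left)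
  also have "\<dots> = b l * c" using assms l by (simp add: if_distrib[of "\<lambda>x. _ * x"] cong: if_cong)
  finally show "b l = 0" using assms by simp
qed

lemma indep_rows_right_inverse:
  assumes "indep_rows k N A"
  obtains R :: "nat \<Rightarrow> nat \<Rightarrow> complex"
    where "\<And>j l. j < k \<Longrightarrow> l < k \<Longrightarrow> (\<Sum>i<N. A j i * R i l) = (if j = l then 1 else 0)"
proof -
  obtain R :: "nat \<Rightarrow> nat \<Rightarrow> (nat \<Rightarrow> complex) \<Rightarrow> complex" and J where J: "J (\<lambda>_. 0) \<noteq> 0" and
    R: "(\<forall>z. \<forall>j<k. \<forall>l<k. (\<Sum>i<N. A j i * R i l z) = (if j = l then J z else 0))"
    using polynomial_right_inverse[of k N "\<lambda>j i _. A j i" 0 "\<lambda>_. 0", OF poly_funs.const assms]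
    by (elim exE conjE) (rule that)
  have "(\<Sum>i<N. A j i * (R i l (\<lambda>_. 0) / J (\<lambda>_. 0))) = (if j = l then 1 else 0)" if "j < k" "l < k" for j l
    using R[rule_format, OF that, of "\<lambda>_. 0"] J by (simp add: sum_divide_distrib[symmetric])
  then show ?thesis by (rule that)
qed

text \<open>A kernel vector \<open>v\<close> of the given rows separates the new unit row from their span.\<close>

lemma indep_rows_append_coordinate:
  assumes A: "indep_rows k N A" and v: "\<And>j. j < k \<Longrightarrow> (\<Sum>i<N. A j i * v i) = 0"
    and i0: "i0 < N" "v i0 \<noteq> 0"
  shows "indep_rows (Suc k) N (\<lambda>j i. if j < k then A j i else if i = i0 then 1 else 0)"
  unfolding indep_rows_def
proof (intro allI impI)
  let ?A = "\<lambda>j i. if j < k then A j i else if i = i0 then 1 else 0"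
  fix b l assume b: "\<forall>i<N. (\<Sum>j<Suc k. b j * ?A j i) = 0" and l: "l < Suc k"
  have b': "(\<Sum>j<k. b j * A j i) + b k * (if i = i0 then 1 else 0) = 0" if "i < N" for i
    using b[rule_format, OF that] by simp
  have "0 = (\<Sum>i<N. ((\<Sum>j<k. b j * A j i) + b k * (if i = i0 then 1 else 0)) * v i)" using b' by simp
  also have "\<dots> = (\<Sum>i<N. \<Sum>j<k. b j * (A j i * v i)) + (\<Sum>i<N. b k * (if i = i0 then v i else 0))"
    by (simp add: distrib_right sum.distrib sum_distrib_right mult.assoc) (auto intro!: sum.cong)
  also have "(\<Sum>i<N. \<Sum>j<k. b j * (A j i * v i)) = (\<Sum>j<k. b j * (\<Sum>i<N. A j i * v i))"
    by (subst sum.swap) (simp add: sum_distrib_left)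
  also have "\<dots> = 0" using v by simp
  also have "(\<Sum>i<N. b k * (if i = i0 then v i else 0)) = b k * v i0"
    using i0 by (simp add: sum_distrib_left[symmetric])
  finally have bk: "b k = 0" using i0 by simp
  then have "\<forall>i<N. (\<Sum>j<k. b j * A j i) = 0" using b' by simp
  then have "\<forall>j<k. b j = 0" using A unfolding indep_rows_def by blast
  then show "b l = 0" using bk l by (auto simp: less_Suc_eq)
qed

lemma indep_rows_kernel:
  fixes A :: "nat \<Rightarrow> nat \<Rightarrow> complex"
  assumes "k < N"
  obtains v i0 where "\<And>j. j < k \<Longrightarrow> (\<Sum>i<N. A j i * v i) = 0" "i0 < N" "v i0 \<noteq> 0"
proof -
  have "card {..<k} < card {..<N}" using assms by simp
  from nontrivial_solution[OF _ _ this, of A]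
  obtain v where "\<exists>i\<in>{..<N}. v i \<noteq> 0" "\<forall>j\<in>{..<k}. (\<Sum>i<N. A j i * v i) = 0" by auto
  then show thesis using that[of v] by blast
qed

text \<open>Basis extension by unit rows. For the Jacobian matrix of the equations of a smooth variety the
added unit rows select the coordinates that are local parameters.\<close>

lemma extend_rows_by_coordinates:
  assumes "indep_rows k N A"
  shows "\<exists>\<iota>. (\<forall>l<N-k. \<iota> l < N) \<and>
    indep_rows N N (\<lambda>j i. if j < k then A j i else if i = \<iota> (j - k) then 1 else 0)"
  using assms
proof (induct "N - k" arbitrary: k A)
  case 0
  then have "k = N" using indep_rows_le by force
  then have "indep_rows N N (\<lambda>j i. if j < k then A j i else if i = id (j - k) then 1 else 0)"
    using 0(2) unfolding indep_rows_def by simp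
  then show ?case using 0 by (intro exI[of _ id]) auto
next
  case (Suc d)
  then have k: "k < N" by simp
  obtain v i0 where v: "\<And>j. j < k \<Longrightarrow> (\<Sum>i<N. A j i * v i) = 0" "i0 < N" "v i0 \<noteq> 0"
    using indep_rows_kernel[OF k] by metis
  let ?A = "\<lambda>j i. if j < k then A j i else if i = i0 then 1 else 0"
  have "indep_rows (Suc k) N ?A" using indep_rows_append_coordinate[OF Suc(3) v] .
  moreover have "d = N - Suc k" using Suc(2) by simp
  ultimately obtain \<iota> where \<iota>: "\<forall>l<N-Suc k. \<iota> l < N"
    "indep_rows N N (\<lambda>j i. if j < Suc k then ?A j i else if i = \<iota> (j - Suc k) then 1 else 0)"
    using Suc(1) by blast
  let ?\<iota> = "\<lambda>l. case l of 0 \<Rightarrow> i0 | Suc l' \<Rightarrow> \<iota> l'"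
  have "(\<lambda>j i. if j < Suc k then ?A j i else if i = \<iota> (j - Suc k) then 1 else 0) =
    (\<lambda>j i. if j < k then A j i else if i = ?\<iota> (j - k) then 1 else 0 :: complex)"
    by (intro ext) (auto split: nat.split simp: not_less less_Suc_eq Suc_diff_Suc diff_Suc)
  then show ?case using \<iota> v k by (intro exI[of _ ?\<iota>]) (auto split: nat.split)
qed

lemma indep_rows_left_inverse:
  assumes A: "indep_rows N N A"
    and R: "\<And>j l. j < N \<Longrightarrow> l < N \<Longrightarrow> (\<Sum>i<N. A j i * R i l) = (if j = l then 1 else (0::complex))"
    and i: "i < N"
  shows "(\<Sum>l<N. R i l * (\<Sum>i<N. A l i * v i)) = v i"
proof (rule ccontr)
  assume ne: "\<not> ?thesis"
  define u where "u i = v i - (\<Sum>l<N. R i l * (\<Sum>i<N. A l i * v i))" for i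
  have "(\<Sum>i<N. A j i * u i) = 0" if "j < N" for j
  proof -
    have "(\<Sum>i<N. A j i * u i) = (\<Sum>i<N. A j i * v i) - (\<Sum>i<N. \<Sum>l<N. (A j i * R i l) * (\<Sum>i<N. A l i * v i))"
      unfolding u_def by (simp add: right_diff_distrib sum_subtractf sum_distrib_left mult.assoc)
    also have "(\<Sum>i<N. \<Sum>l<N. (A j i * R i l) * (\<Sum>i<N. A l i * v i)) =
      (\<Sum>l<N. (\<Sum>i<N. A j i * R i l) * (\<Sum>i<N. A l i * v i))"
      by (subst sum.swap) (simp only: sum_distrib_right)
    also have "\<dots> = (\<Sum>i<N. A j i * v i)"
      using R that by (simp add: if_distrib[of "\<lambda>x. x * _"] cong: if_cong)
    finally show ?thesis by simp
  qed
  moreover have "u i \<noteq> 0" using ne unfolding u_def by simp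
  ultimately have "indep_rows (Suc N) N (\<lambda>j i'. if j < N then A j i' else if i' = i then 1 else 0)"
    using indep_rows_append_coordinate[OF A] i by blast
  then show False using indep_rows_le by fastforce
qed

text \<open>A polynomial function of \<open>n + 1\<close> variables seen as a univariate polynomial in the last one, whose
coefficients are polynomial functions of the first \<open>n\<close>.\<close>

section \<open>Algebraic dependence of polynomials\<close>

lemma poly_funs_last_variable:
  assumes "p \<in> poly_funs (Suc n)"
  shows "\<exists>C d. (\<forall>k. (\<lambda>x. coeff (C x) k) \<in> poly_funs n) \<and> (\<forall>x. degree (C x) \<le> d) \<and>
    (\<forall>x. p x = poly (C x) (x n))"
  using assms
proof (induct rule: poly_funs.induct)
  case (const c)
  then show ?case by (intro exI[of _ "\<lambda>x. [:c:]"] exI[of _ 0]) (auto intro: poly_funs.intros)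
next
  case (coord i)
  show ?case
  proof (cases "i = n")
    case True
    then show ?thesis by (intro exI[of _ "\<lambda>x. [:0,1:]"] exI[of _ 1]) (auto intro: poly_funs.intros)
  next
    case False
    have "(\<lambda>x. coeff [:x i:] k) \<in> poly_funs n" for k
      using False coord by (cases k) (auto intro!: poly_funs.intros)
    then show ?thesis by (intro exI[of _ "\<lambda>x. [:x i:]"] exI[of _ 0]) auto
  qed
next
  case (add p q)
  then obtain C d C' d' where C: "\<forall>k. (\<lambda>x. coeff (C x) k) \<in> poly_funs n" "\<forall>x. degree (C x) \<le> d"
    "\<forall>x. p x = poly (C x) (x n)" "\<forall>k. (\<lambda>x. coeff (C' x) k) \<in> poly_funs n" "\<forall>x. degree (C' x) \<le> d'"
    "\<forall>x. q x = poly (C' x) (x n)" by metis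
  have "degree (C x + C' x) \<le> max d d'" for x
    using C(2,5) by (meson degree_add_le le_max_iff_disj)
  then show ?case using C by (intro exI[of _ "\<lambda>x. C x + C' x"] exI[of _ "max d d'"]) (auto intro!: poly_funs.add)
next
  case (mult p q)
  then obtain C d C' d' where C: "\<forall>k. (\<lambda>x. coeff (C x) k) \<in> poly_funs n" "\<forall>x. degree (C x) \<le> d"
    "\<forall>x. p x = poly (C x) (x n)" "\<forall>k. (\<lambda>x. coeff (C' x) k) \<in> poly_funs n" "\<forall>x. degree (C' x) \<le> d'"
    "\<forall>x. q x = poly (C' x) (x n)" by metis
  have "degree (C x * C' x) \<le> d + d'" for x
    using C(2,5) by (meson degree_mult_le add_mono order_trans)
  then show ?case using C
    by (intro exI[of _ "\<lambda>x. C x * C' x"] exI[of _ "d + d'"])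
       (auto intro!: poly_funs_sum poly_funs.mult simp: coeff_mult)
qed

text \<open>Digits to base \<open>B\<close> number the monomials in the next proof: the code \<open>e\<close> stands for the monomial whose exponents
are the digits of \<open>e\<close>.\<close>

lemma digit_sum: "(\<Sum>i<m. (e div B ^ i mod B) * B ^ i) = e mod (B::nat) ^ m"
proof (induct m)
  case (Suc m)
  have "e mod (B ^ m * B) = B ^ m * (e div B ^ m mod B) + e mod B ^ m" by (rule mod_mult2_eq)
  then show ?case using Suc by (simp add: mult.commute)
qed auto

text \<open>Any \<open>N + 1\<close> polynomials in \<open>N\<close> variables are algebraically dependent, by counting. Monomials in the
\<open>g j\<close> with exponents at most \<open>K\<close> are \<open>(K + 1)^(N + 1)\<close> many, while a linear combination of them
vanishes as soon as it does on a grid with \<open>O(K^N)\<close> points.\<close>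

lemma algebraic_dependence:
  assumes g: "\<And>j. j \<le> N \<Longrightarrow> g j \<in> poly_funs N"
  shows "\<exists>Q\<in>poly_funs (Suc N). (\<exists>Y. Q Y \<noteq> 0) \<and> (\<forall>x. Q (\<lambda>j. g j x) = 0)"
proof -
  have "\<exists>D. \<forall>j\<le>N. line_deg (g j) D"
  proof -
    have "\<forall>j. \<exists>D. j \<le> N \<longrightarrow> line_deg (g j) D" using g poly_funs_line_deg by blast
    then obtain D where D: "\<forall>j\<le>N. line_deg (g j) (D j)" by metis
    have "line_deg (g j) (\<Sum>j\<le>N. D j)" if "j \<le> N" for j
      by (rule line_deg_mono[of _ "D j"]) (use D that in \<open>auto intro!: member_le_sum\<close>)
    then show ?thesis by blast
  qed
  then obtain D where D: "\<And>j. j \<le> N \<Longrightarrow> line_deg (g j) D" by blast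
  \<comment> \<open>The grid has \<open>(E + 1)^N \<le> (B C)^N = B^N K\<close> points, fewer than the \<open>M = B^(N + 1)\<close> monomials
    with exponents at most \<open>K\<close>; this is what the choice of \<open>K\<close> achieves.\<close>
  define C where "C = Suc N * D + 1"
  define K where "K = C ^ N"
  define B where "B = Suc K"
  define E where "E = card {..N} * (K * D)"
  define M where "M = B ^ Suc N"
  define mono where "mono e Y = (\<Prod>i\<le>N. Y i ^ (e div B ^ i mod B))" for e and Y :: "nat \<Rightarrow> complex"
  define Gr where "Gr = PiE {..<N} (\<lambda>_. of_nat ` {..E} :: complex set)"
  have "finite Gr" unfolding Gr_def by (intro finite_PiE) auto
  have cGr: "card Gr = Suc E ^ N"
  proof -
    have "card (of_nat ` {..E} :: complex set) = Suc E" by (subst card_image) (auto simp: inj_on_def)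
    then show ?thesis unfolding Gr_def by (subst card_PiE) auto
  qed
  have "Suc E \<le> B * C" unfolding E_def B_def C_def by (simp add: algebra_simps)
  then have "Suc E ^ N \<le> (B * C) ^ N" by (rule power_mono) simp
  also have "\<dots> = B ^ N * K" by (simp add: power_mult_distrib K_def)
  also have "\<dots> < M" by (simp add: M_def B_def)
  finally have "card Gr < card {..<M}" using cGr by simp
  then obtain c where c: "\<exists>e\<in>{..<M}. c e \<noteq> 0" "\<forall>x\<in>Gr. (\<Sum>e<M. mono e (\<lambda>j. g j x) * c e) = 0"
    using nontrivial_solution[OF \<open>finite Gr\<close>, of "{..<M}" "\<lambda>x e. mono e (\<lambda>j. g j x)"] by auto
  define Q where "Q Y = (\<Sum>e<M. mono e Y * c e)" for Y
  have Q: "Q \<in> poly_funs (Suc N)" unfolding Q_def mono_def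
    by (intro poly_funs_intros) auto
  have "line_deg (\<lambda>x. g i x ^ (e div B ^ i mod B)) (K * D)" if "i \<le> N" for i e
  proof (rule line_deg_mono[OF line_deg_power[OF D[OF that]]])
    have "e div B ^ i mod B \<le> K" using mod_less_divisor[of B "e div B ^ i"] by (simp add: B_def)
    then show "e div B ^ i mod B * D \<le> K * D" by simp
  qed
  then have "line_deg (\<lambda>x. mono e (\<lambda>j. g j x)) E" for e
    unfolding mono_def E_def by (intro line_deg_prod) auto
  then have "line_deg (\<lambda>x. mono e (\<lambda>j. g j x) * c e) (E + 0)" for e
    by (intro line_deg_mult line_deg_const)
  then have QE: "line_deg (\<lambda>x. Q (\<lambda>j. g j x)) E"
    unfolding Q_def by (intro line_deg_sum) auto
  have Qp: "(\<lambda>x. Q (\<lambda>j. g j x)) \<in> poly_funs N"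
    by (rule poly_funs_subst[OF Q]) (use g in auto)
  have Q0: "Q (\<lambda>j. g j x) = 0" for x
  proof (rule vanish_on_grid[OF QE, of N])
    fix x :: "nat \<Rightarrow> complex" assume x: "\<forall>i<N. x i \<in> of_nat ` {..E}"
    have "Q (\<lambda>j. g j x) = Q (\<lambda>j. g j (restrict x {..<N}))"
      by (rule poly_funs_cong[OF Qp]) auto
    also have "\<dots> = 0" unfolding Q_def using c(2) x by (auto simp: Gr_def)
    finally show "Q (\<lambda>j. g j x) = 0" .
  qed
  have "\<exists>Y. Q Y \<noteq> 0"
  proof (rule ccontr)
    assume n: "\<not> ?thesis"
    \<comment> \<open>Substituting \<open>Y i = T^(B^i)\<close> sends the monomial with code \<open>e\<close> to \<open>T^e\<close>, so \<open>Q\<close> is not zero.\<close>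
    define q where "q = (\<Sum>e<M. monom (c e) e)"
    have "poly q T = 0" for T
    proof -
      have "mono e (\<lambda>i. T ^ (B ^ i)) = T ^ e" if "e < M" for e
      proof -
        have "mono e (\<lambda>i. T ^ (B ^ i)) = T ^ (\<Sum>i\<le>N. (e div B ^ i mod B) * B ^ i)"
          unfolding mono_def power_sum by (simp add: power_mult[symmetric] mult.commute)
        also have "(\<Sum>i\<le>N. (e div B ^ i mod B) * B ^ i) = e"
          using digit_sum[of e B "Suc N"] that by (simp only: lessThan_Suc_atMost M_def mod_less)
        finally show ?thesis .
      qed
      then have "Q (\<lambda>i. T ^ (B ^ i)) = poly q T"
        unfolding Q_def q_def by (simp add: poly_sum poly_monom mult.commute)
      then show ?thesis using n by simp
    qed
    then have "q = 0" using poly_all_0_iff_0 by blast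
    moreover have "coeff q e = c e" if "e < M" for e
      unfolding q_def coeff_sum using that by simp
    ultimately show False using c(1) by auto
  qed
  then show ?thesis using Q Q0 by blast
qed

text \<open>Differentiability in the form of Caratheodory, with both arguments varying: the difference quotients
\<open>\<phi> i\<close> are continuous at the diagonal point \<open>(z0, z0)\<close>, where their value is \<open>A i\<close>. This is strict
differentiability. Unlike differentiability at a point it suffices for the inverse function theorem,
and it is inherited by sums, products and reciprocals.\<close>

section \<open>Strict differentiability and local sections\<close>

definition strict_diff ::
  "nat \<Rightarrow> ((nat \<Rightarrow> complex) \<Rightarrow> complex) \<Rightarrow> (nat \<Rightarrow> complex) \<Rightarrow> (nat \<Rightarrow> complex) \<Rightarrow> bool" where
  "strict_diff N g z0 A \<longleftrightarrow> (\<exists>\<phi>. (\<forall>i<N. (\<phi> i \<longlongrightarrow> A i) (nhds (z0, z0))) \<and>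
     (\<forall>\<^sub>F w in nhds (z0, z0). g (fst w) - g (snd w) = (\<Sum>i<N. \<phi> i w * (fst w i - snd w i))))"

lemma strict_diff_cong: "strict_diff N g z A \<Longrightarrow> (\<And>i. i < N \<Longrightarrow> A i = B i) \<Longrightarrow> strict_diff N g z B"
  unfolding strict_diff_def by (elim exE, rule_tac x = \<phi> in exI) simp

lemma strict_diff_const: "strict_diff N (\<lambda>x. c) z (\<lambda>i. 0)"
  unfolding strict_diff_def by (intro exI[of _ "\<lambda>i w. 0"]) auto

lemma strict_diff_coord:
  assumes "k < N"
  shows "strict_diff N (\<lambda>x. x k) z (\<lambda>i. if i = k then 1 else 0)"
proof -
  have "x k - y k = (\<Sum>i<N. (if i = k then 1 else 0) * (x i - y i))" for x y :: "nat \<Rightarrow> complex"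
    using assms by (simp add: if_distrib[of "\<lambda>x. x * _"] cong: if_cong)
  then show ?thesis
    unfolding strict_diff_def by (intro exI[of _ "\<lambda>i w. if i = k then 1 else 0"]) auto
qed

lemma strict_diff_add:
  assumes "strict_diff N g z A" "strict_diff N h z B"
  shows "strict_diff N (\<lambda>x. g x + h x) z (\<lambda>i. A i + B i)"
proof -
  obtain \<phi> \<psi> where \<phi>: "\<And>i. i < N \<Longrightarrow> (\<phi> i \<longlongrightarrow> A i) (nhds (z, z))"
    "\<forall>\<^sub>F w in nhds (z, z). g (fst w) - g (snd w) = (\<Sum>i<N. \<phi> i w * (fst w i - snd w i))"
    "\<And>i. i < N \<Longrightarrow> (\<psi> i \<longlongrightarrow> B i) (nhds (z, z))"
    "\<forall>\<^sub>F w in nhds (z, z). h (fst w) - h (snd w) = (\<Sum>i<N. \<psi> i w * (fst w i - snd w i))"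
    using assms unfolding strict_diff_def by blast
  show ?thesis unfolding strict_diff_def
  proof (intro exI[of _ "\<lambda>i w. \<phi> i w + \<psi> i w"] conjI allI impI)
    show "((\<lambda>w. \<phi> i w + \<psi> i w) \<longlongrightarrow> A i + B i) (nhds (z, z))" if "i < N" for i
      by (intro tendsto_add \<phi> that)
    show "\<forall>\<^sub>F w in nhds (z, z). g (fst w) + h (fst w) - (g (snd w) + h (snd w)) =
       (\<Sum>i<N. (\<phi> i w + \<psi> i w) * (fst w i - snd w i))"
      using \<phi>(2,4)
    proof eventually_elim
      case (elim w)
      have "(\<Sum>i<N. (\<phi> i w + \<psi> i w) * (fst w i - snd w i)) =
        (g (fst w) - g (snd w)) + (h (fst w) - h (snd w))"
        unfolding elim by (simp add: distrib_right sum.distrib)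
      then show ?case by simp
    qed
  qed
qed

lemma tendsto_nhds_fst: "(g \<longlongrightarrow> c) (nhds a) \<Longrightarrow> ((\<lambda>w. g (fst w)) \<longlongrightarrow> c) (nhds (a, b))"
proof (erule filterlim_compose)
  have "((\<lambda>w. fst w) \<longlongrightarrow> fst (a, b)) (nhds (a, b))" by (intro tendsto_fst filterlim_ident)
  then show "filterlim fst (nhds a) (nhds (a, b))" by simp
qed

lemma tendsto_nhds_snd: "(g \<longlongrightarrow> c) (nhds b) \<Longrightarrow> ((\<lambda>w. g (snd w)) \<longlongrightarrow> c) (nhds (a, b))"
proof (erule filterlim_compose)
  have "((\<lambda>w. snd w) \<longlongrightarrow> snd (a, b)) (nhds (a, b))" by (intro tendsto_snd filterlim_ident)
  then show "filterlim snd (nhds b) (nhds (a, b))" by simp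
qed

lemma strict_diff_mult:
  assumes "strict_diff N g z A" "strict_diff N h z B"
    and c: "(g \<longlongrightarrow> g z) (nhds z)" "(h \<longlongrightarrow> h z) (nhds z)"
  shows "strict_diff N (\<lambda>x. g x * h x) z (\<lambda>i. g z * B i + h z * A i)"
proof -
  obtain \<phi> \<psi> where \<phi>: "\<And>i. i < N \<Longrightarrow> (\<phi> i \<longlongrightarrow> A i) (nhds (z, z))"
    "\<forall>\<^sub>F w in nhds (z, z). g (fst w) - g (snd w) = (\<Sum>i<N. \<phi> i w * (fst w i - snd w i))"
    "\<And>i. i < N \<Longrightarrow> (\<psi> i \<longlongrightarrow> B i) (nhds (z, z))"
    "\<forall>\<^sub>F w in nhds (z, z). h (fst w) - h (snd w) = (\<Sum>i<N. \<psi> i w * (fst w i - snd w i))"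
    using assms unfolding strict_diff_def by blast
  show ?thesis unfolding strict_diff_def
  proof (intro exI[of _ "\<lambda>i w. g (fst w) * \<psi> i w + h (snd w) * \<phi> i w"] conjI allI impI)
    show "((\<lambda>w. g (fst w) * \<psi> i w + h (snd w) * \<phi> i w) \<longlongrightarrow> g z * B i + h z * A i) (nhds (z, z))"
      if "i < N" for i
      by (intro tendsto_add tendsto_mult tendsto_nhds_fst tendsto_nhds_snd \<phi> that c)
    show "\<forall>\<^sub>F w in nhds (z, z). g (fst w) * h (fst w) - g (snd w) * h (snd w) =
       (\<Sum>i<N. (g (fst w) * \<psi> i w + h (snd w) * \<phi> i w) * (fst w i - snd w i))"
      using \<phi>(2,4)
    proof eventually_elim
      case (elim w)
      have "(\<Sum>i<N. (g (fst w) * \<psi> i w + h (snd w) * \<phi> i w) * (fst w i - snd w i)) =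
        g (fst w) * (h (fst w) - h (snd w)) + h (snd w) * (g (fst w) - g (snd w))"
        unfolding elim by (simp add: distrib_right sum.distrib sum_distrib_left mult.assoc)
      then show ?case by (simp add: algebra_simps)
    qed
  qed
qed

lemma strict_diff_inverse:
  assumes "strict_diff N g z A" and c: "(g \<longlongrightarrow> g z) (nhds z)" "g z \<noteq> 0"
  shows "strict_diff N (\<lambda>x. inverse (g x)) z (\<lambda>i. - A i / (g z * g z))"
proof -
  obtain \<phi> where \<phi>: "\<And>i. i < N \<Longrightarrow> (\<phi> i \<longlongrightarrow> A i) (nhds (z, z))"
    "\<forall>\<^sub>F w in nhds (z, z). g (fst w) - g (snd w) = (\<Sum>i<N. \<phi> i w * (fst w i - snd w i))"
    using assms unfolding strict_diff_def by blast
  show ?thesis unfolding strict_diff_def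
  proof (intro exI[of _ "\<lambda>i w. - \<phi> i w / (g (fst w) * g (snd w))"] conjI allI impI)
    show "((\<lambda>w. - \<phi> i w / (g (fst w) * g (snd w))) \<longlongrightarrow> - A i / (g z * g z)) (nhds (z, z))"
      if "i < N" for i
      using c by (intro tendsto_divide tendsto_minus tendsto_mult tendsto_nhds_fst tendsto_nhds_snd \<phi> that) auto
    have "\<forall>\<^sub>F w in nhds (z, z). g (fst w) \<noteq> 0" "\<forall>\<^sub>F w in nhds (z, z). g (snd w) \<noteq> 0"
      using c by (auto intro!: tendsto_imp_eventually_ne tendsto_nhds_fst tendsto_nhds_snd)
    then show "\<forall>\<^sub>F w in nhds (z, z). inverse (g (fst w)) - inverse (g (snd w)) =
       (\<Sum>i<N. - \<phi> i w / (g (fst w) * g (snd w)) * (fst w i - snd w i))"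
      using \<phi>(2)
    proof eventually_elim
      case (elim w)
      have "(\<Sum>i<N. - \<phi> i w / (g (fst w) * g (snd w)) * (fst w i - snd w i)) =
        - (g (fst w) - g (snd w)) / (g (fst w) * g (snd w))"
        unfolding elim(3) by (simp add: sum_negf sum_divide_distrib)
      also have "\<dots> = inverse (g (fst w)) - inverse (g (snd w))"
        using elim(1,2) by (simp add: field_simps)
      finally show ?case by simp
    qed
  qed
qed

lemma tendsto_poly_funs: "p \<in> poly_funs N \<Longrightarrow> (p \<longlongrightarrow> p z) (nhds z)"
  using continuous_on_poly_funs[of p N] by (simp add: continuous_on_def tendsto_at_iff_tendsto_nhds)

lemma strict_diff_cmult: "strict_diff N g z A \<Longrightarrow> (g \<longlongrightarrow> g z) (nhds z) \<Longrightarrow> strict_diff N (\<lambda>x. k * g x) z (\<lambda>i. k * A i)"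
  using strict_diff_mult[OF strict_diff_const[of N k z]] by (auto elim: strict_diff_cong)

lemma strict_diff_sum:
  "finite J \<Longrightarrow> (\<And>j. j \<in> J \<Longrightarrow> strict_diff N (g j) z (A j)) \<Longrightarrow>
    strict_diff N (\<lambda>x. \<Sum>j\<in>J. g j x) z (\<lambda>i. \<Sum>j\<in>J. A j i)"
  by (induct J rule: finite_induct) (auto intro: strict_diff_const strict_diff_add)

lemma poly_funs_strict_diff:
  "p \<in> poly_funs N \<Longrightarrow> \<exists>A. (\<forall>i. A i \<in> poly_funs N) \<and> (\<forall>z. strict_diff N p z (\<lambda>i. A i z))"
proof (induct rule: poly_funs.induct)
  case (const c)
  then show ?case
    by (intro exI[of _ "\<lambda>i z. 0"]) (auto intro: poly_funs.intros strict_diff_const)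
next
  case (coord k)
  have "(\<lambda>z. if i = k then 1 else 0) \<in> poly_funs N" for i by (rule poly_funs.const)
  then show ?case using coord
    by (intro exI[of _ "\<lambda>i z. if i = k then 1 else 0"]) (auto intro: strict_diff_coord)
next
  case (add p q)
  then obtain A B where "\<And>i. A i \<in> poly_funs N" "\<And>z. strict_diff N p z (\<lambda>i. A i z)"
    "\<And>i. B i \<in> poly_funs N" "\<And>z. strict_diff N q z (\<lambda>i. B i z)" by blast
  then show ?case
    by (intro exI[of _ "\<lambda>i z. A i z + B i z"]) (auto intro!: poly_funs.intros strict_diff_add)
next
  case (mult p q)
  then obtain A B where "\<And>i. A i \<in> poly_funs N" "\<And>z. strict_diff N p z (\<lambda>i. A i z)"
    "\<And>i. B i \<in> poly_funs N" "\<And>z. strict_diff N q z (\<lambda>i. B i z)" by blast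
  then show ?case using mult(1,3)
    by (intro exI[of _ "\<lambda>i z. p z * B i z + q z * A i z"])
       (auto intro!: poly_funs.intros strict_diff_mult tendsto_poly_funs)
qed

lemma strict_diff_partial_derivative:
  assumes "strict_diff N g z A" "i < N"
  shows "((\<lambda>t. g (z(i := t))) has_field_derivative A i) (at (z i))"
proof -
  obtain \<phi> where \<phi>: "\<And>i. i < N \<Longrightarrow> (\<phi> i \<longlongrightarrow> A i) (nhds (z, z))"
    "\<forall>\<^sub>F w in nhds (z, z). g (fst w) - g (snd w) = (\<Sum>i<N. \<phi> i w * (fst w i - snd w i))"
    using assms unfolding strict_diff_def by blast
  have "continuous_on UNIV (\<lambda>t. z(i := t))"
  proof (rule continuous_on_coordinatewise_then_product)
    show "continuous_on UNIV (\<lambda>t. (z(i := t)) k)" for k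
      by (cases "k = i") (auto intro: continuous_intros)
  qed
  then have "((\<lambda>t. z(i := t)) \<longlongrightarrow> z(i := z i)) (at (z i))"
    unfolding continuous_on_def by blast
  then have lim: "filterlim (\<lambda>t. (z(i := t), z)) (nhds (z, z)) (at (z i))"
    by (intro tendsto_Pair) auto
  have "((\<lambda>t. \<phi> i (z(i := t), z)) \<longlongrightarrow> A i) (at (z i))"
    using filterlim_compose[OF \<phi>(1)[OF assms(2)] lim] .
  moreover have "\<forall>\<^sub>F t in at (z i). g (z(i := t)) - g z =
     (\<Sum>k<N. \<phi> k (z(i := t), z) * ((z(i := t)) k - z k))"
    using filterlim_iff[THEN iffD1, OF lim, rule_format, OF \<phi>(2)] by simp
  then have "\<forall>\<^sub>F t in at (z i). (g (z(i := t)) - g z) / (t - z i) = \<phi> i (z(i := t), z)"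
    using eventually_neq_at_within[of "z i" "z i" UNIV]
  proof eventually_elim
    case (elim t)
    have "(\<Sum>k<N. \<phi> k (z(i := t), z) * ((z(i := t)) k - z k)) =
      (\<Sum>k<N. if k = i then \<phi> i (z(i := t), z) * (t - z i) else 0)"
      by (intro sum.cong) auto
    then show ?case using elim assms(2) by simp
  qed
  ultimately show ?thesis
    unfolding has_field_derivative_iff by (simp add: tendsto_cong)
qed

lemma strict_diff_partial_deriv:
  "strict_diff N g z A \<Longrightarrow> i < N \<Longrightarrow> partial_deriv i g z = A i"
  unfolding partial_deriv_def using strict_diff_partial_derivative DERIV_imp_deriv by blast

lemma poly_funs_field_differentiable:
  assumes "p \<in> poly_funs N" "\<And>i. i < N \<Longrightarrow> (\<lambda>t. \<gamma> t i) field_differentiable at t0"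
  shows "(\<lambda>t. p (\<gamma> t)) field_differentiable at t0"
  using assms
  by (induct rule: poly_funs.induct)
     (auto intro: field_differentiable_const field_differentiable_add field_differentiable_mult)

lemma open_contains_box:
  fixes S :: "(nat \<Rightarrow> complex) set"
  assumes "open S" "z0 \<in> S" "z0 \<in> affine_space N"
  shows "\<exists>\<delta>>0. \<forall>x\<in>affine_space N. (\<forall>i<N. cmod (x i - z0 i) < \<delta>) \<longrightarrow> x \<in> S"
proof -
  have "openin (product_topology (\<lambda>_. euclidean) UNIV) S"
    using assms(1) by (simp add: euclidean_product_topology)
  from product_topology_open_contains_basis[OF this assms(2)]
  obtain X where X: "z0 \<in> PiE UNIV X" "\<And>i. open (X i)" "PiE UNIV X \<subseteq> S" by auto
  have "\<exists>d>0. ball (z0 i) d \<subseteq> X i" for i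
    using X(1) X(2)[of i] open_contains_ball by (metis PiE_mem UNIV_I)
  then obtain d where d: "\<And>i. d i > 0" "\<And>i. ball (z0 i) (d i) \<subseteq> X i" by metis
  define \<delta> where "\<delta> = Min (insert 1 (d ` {..<N}))"
  have "\<delta> > 0" using d(1) by (simp add: \<delta>_def)
  moreover have "x \<in> S" if x: "x \<in> affine_space N" "\<forall>i<N. cmod (x i - z0 i) < \<delta>" for x
  proof -
    have "x i \<in> X i" for i
    proof (cases "i < N")
      case True
      then have "\<delta> \<le> d i" by (simp add: \<delta>_def)
      then have "x i \<in> ball (z0 i) (d i)" using x(2) True by (force simp: dist_norm norm_minus_commute)
      then show ?thesis using d(2) by blast
    next
      case False
      then have "x i = z0 i" using x(1) assms(3) by (simp add: affine_space_def)
      then show ?thesis using PiE_mem[OF X(1)] by simp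
    qed
    then show ?thesis using X(3) by auto
  qed
  ultimately show ?thesis by blast
qed

lemma eventually_nhds_pair_box:
  fixes z0 :: "nat \<Rightarrow> complex"
  assumes "eventually P (nhds (z0, z0))" "z0 \<in> affine_space N"
  shows "\<exists>\<delta>>0. \<forall>x\<in>affine_space N. \<forall>y\<in>affine_space N.
    (\<forall>i<N. cmod (x i - z0 i) < \<delta>) \<longrightarrow> (\<forall>i<N. cmod (y i - z0 i) < \<delta>) \<longrightarrow> P (x, y)"
proof -
  obtain S where S: "open S" "(z0, z0) \<in> S" "\<And>w. w \<in> S \<Longrightarrow> P w"
    using assms(1) unfolding eventually_nhds by blast
  obtain A B where AB: "open A" "open B" "z0 \<in> A" "z0 \<in> B" "A \<times> B \<subseteq> S"
    using open_prod_elim[OF S(1,2)] by (metis mem_Sigma_iff)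
  obtain d e where "d > 0" "\<forall>x\<in>affine_space N. (\<forall>i<N. cmod (x i - z0 i) < d) \<longrightarrow> x \<in> A"
    "e > 0" "\<forall>x\<in>affine_space N. (\<forall>i<N. cmod (x i - z0 i) < e) \<longrightarrow> x \<in> B"
    using open_contains_box AB assms(2) by metis
  then show ?thesis using S(3) AB(5)
    by (intro exI[of _ "min d e"]) (auto simp: subset_eq)
qed

text \<open>Only points of \<open>affine_space N\<close> are compared, since a neighbourhood in the product topology does not
restrict the coordinates from some index on.\<close>

lemma strict_diff_family_estimate:
  fixes G :: "nat \<Rightarrow> (nat \<Rightarrow> complex) \<Rightarrow> complex"
  assumes "z0 \<in> affine_space N" "\<And>j. j < k \<Longrightarrow> strict_diff N (G j) z0 (A j)" "\<epsilon> > 0"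
  shows "\<exists>\<delta>>0. \<forall>x\<in>affine_space N. \<forall>y\<in>affine_space N.
    (\<forall>i<N. cmod (x i - z0 i) < \<delta>) \<longrightarrow> (\<forall>i<N. cmod (y i - z0 i) < \<delta>) \<longrightarrow>
    (\<forall>j<k. cmod (G j x - G j y - (\<Sum>i<N. A j i * (x i - y i))) \<le> \<epsilon> * (\<Sum>i<N. cmod (x i - y i)))"
proof -
  have "\<forall>\<^sub>F w in nhds (z0, z0). \<forall>j\<in>{..<k}.
    cmod (G j (fst w) - G j (snd w) - (\<Sum>i<N. A j i * (fst w i - snd w i))) \<le>
    \<epsilon> * (\<Sum>i<N. cmod (fst w i - snd w i))"
  proof (intro eventually_ball_finite finite_lessThan ballI)
    fix j assume "j \<in> {..<k}"
    then obtain \<phi> where \<phi>: "\<And>i. i < N \<Longrightarrow> (\<phi> i \<longlongrightarrow> A j i) (nhds (z0, z0))"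
      "\<forall>\<^sub>F w in nhds (z0, z0). G j (fst w) - G j (snd w) = (\<Sum>i<N. \<phi> i w * (fst w i - snd w i))"
      using assms(2)[of j] unfolding strict_diff_def by blast
    have "\<forall>\<^sub>F w in nhds (z0, z0). \<forall>i\<in>{..<N}. dist (\<phi> i w) (A j i) < \<epsilon>"
      using \<phi>(1) assms(3) by (intro eventually_ball_finite finite_lessThan ballI tendstoD) auto
    then show "\<forall>\<^sub>F w in nhds (z0, z0). cmod (G j (fst w) - G j (snd w) -
      (\<Sum>i<N. A j i * (fst w i - snd w i))) \<le> \<epsilon> * (\<Sum>i<N. cmod (fst w i - snd w i))"
      using \<phi>(2)
    proof eventually_elim
      case (elim w)
      have "G j (fst w) - G j (snd w) - (\<Sum>i<N. A j i * (fst w i - snd w i)) =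
        (\<Sum>i<N. (\<phi> i w - A j i) * (fst w i - snd w i))"
        unfolding elim(2) by (simp add: left_diff_distrib sum_subtractf)
      also have "cmod \<dots> \<le> (\<Sum>i<N. cmod ((\<phi> i w - A j i) * (fst w i - snd w i)))"
        by (rule norm_sum)
      also have "\<dots> \<le> (\<Sum>i<N. \<epsilon> * cmod (fst w i - snd w i))"
      proof (rule sum_mono)
        fix i assume "i \<in> {..<N}"
        then have "cmod (\<phi> i w - A j i) \<le> \<epsilon>" using elim(1) by (force simp: dist_norm)
        then show "cmod ((\<phi> i w - A j i) * (fst w i - snd w i)) \<le> \<epsilon> * cmod (fst w i - snd w i)"
          unfolding norm_mult by (rule mult_right_mono) simp
      qed
      finally show ?case by (simp add: sum_distrib_left)
    qed
  qed
  from eventually_nhds_pair_box[OF this assms(1)] show ?thesis by (simp add: Ball_def)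
qed

text \<open>With a left inverse \<open>R\<close> of the derivative, \<open>G x = G y\<close> forces \<open>x - y\<close> to be at most a fraction of
its own size.\<close>

lemma locally_injective:
  assumes z0: "z0 \<in> affine_space N" and G: "\<And>j. j < N \<Longrightarrow> strict_diff N (G j) z0 (A j)"
    and A: "indep_rows N N A"
  shows "\<exists>\<delta>>0. \<forall>x\<in>affine_space N. \<forall>y\<in>affine_space N.
    (\<forall>i<N. cmod (x i - z0 i) < \<delta>) \<longrightarrow> (\<forall>i<N. cmod (y i - z0 i) < \<delta>) \<longrightarrow>
    (\<forall>j<N. G j x = G j y) \<longrightarrow> x = y"
proof -
  obtain R where R: "\<And>j l. j < N \<Longrightarrow> l < N \<Longrightarrow> (\<Sum>i<N. A j i * R i l) = (if j = l then 1 else 0)"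
    using indep_rows_right_inverse[OF A] by blast
  define \<rho> where "\<rho> = (\<Sum>i<N. \<Sum>l<N. cmod (R i l))"
  have "\<rho> \<ge> 0" unfolding \<rho>_def by (intro sum_nonneg) auto
  define \<epsilon> where "\<epsilon> = 1 / (2 * (\<rho> + 1))"
  have \<epsilon>: "\<epsilon> > 0" "\<rho> * \<epsilon> < 1" using \<open>\<rho> \<ge> 0\<close> by (auto simp: \<epsilon>_def field_simps)
  obtain \<delta> where \<delta>: "\<delta> > 0" and est: "\<And>x y j. x\<in>affine_space N \<Longrightarrow> y\<in>affine_space N \<Longrightarrow>
    (\<forall>i<N. cmod (x i - z0 i) < \<delta>) \<Longrightarrow> (\<forall>i<N. cmod (y i - z0 i) < \<delta>) \<Longrightarrow> j < N \<Longrightarrow>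
    cmod (G j x - G j y - (\<Sum>i<N. A j i * (x i - y i))) \<le> \<epsilon> * (\<Sum>i<N. cmod (x i - y i))"
    using strict_diff_family_estimate[of z0 N N G A \<epsilon>] z0 G \<epsilon> by blast
  have "x = y" if xy: "x \<in> affine_space N" "y \<in> affine_space N" "\<forall>i<N. cmod (x i - z0 i) < \<delta>"
    "\<forall>i<N. cmod (y i - z0 i) < \<delta>" "\<forall>j<N. G j x = G j y" for x y
  proof -
    define v where "v i = x i - y i" for i
    define V where "V = (\<Sum>i<N. cmod (v i))"
    have "V \<ge> 0" unfolding V_def by (intro sum_nonneg) auto
    have Av: "cmod (\<Sum>i<N. A j i * v i) \<le> \<epsilon> * V" if "j < N" for j
      using est[OF xy(1-4) that] xy(5) that by (simp add: v_def V_def norm_minus_commute)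
    have "V = (\<Sum>i<N. cmod (\<Sum>l<N. R i l * (\<Sum>i<N. A l i * v i)))"
      unfolding V_def using indep_rows_left_inverse[OF A R] by simp
    also have "\<dots> \<le> (\<Sum>i<N. \<Sum>l<N. cmod (R i l) * (\<epsilon> * V))"
      using Av by (intro sum_mono order_trans[OF norm_sum]) (auto simp: norm_mult intro!: mult_left_mono)
    also have "\<dots> = \<rho> * \<epsilon> * V" unfolding \<rho>_def by (simp add: sum_distrib_right mult.assoc)
    finally have "V * (1 - \<rho> * \<epsilon>) \<le> 0" by (simp add: algebra_simps)
    then have "V = 0" using \<open>V \<ge> 0\<close> \<epsilon> by (simp add: mult_le_0_iff)
    then have "\<forall>i<N. v i = 0" unfolding V_def by (simp add: sum_nonneg_eq_0_iff)
    then have "x i = y i" for i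
      using xy(1,2) by (cases "i < N") (auto simp: v_def affine_space_def)
    then show "x = y" by blast
  qed
  then show ?thesis using \<delta> by blast
qed

text \<open>The Tychonoff theorem; compactness of boxes in the product topology replaces local compactness of
\<open>\<complex>\<^sup>N\<close>, which is not a type here.\<close>

lemma compact_box: "compact {u::nat \<Rightarrow> complex. \<forall>i. cmod (u i) \<le> r}"
proof -
  have eq: "{u::nat \<Rightarrow> complex. \<forall>i. cmod (u i) \<le> r} = PiE UNIV (\<lambda>_. cball 0 r)"
    by (auto simp: PiE_def)
  have "compactin (product_topology (\<lambda>_. euclidean) UNIV) (PiE UNIV (\<lambda>_::nat. cball (0::complex) r))"
    unfolding compactin_PiE by auto
  then show ?thesis unfolding eq by (simp add: euclidean_product_topology)
qed

lemma continuous_on_coord: "continuous_on S (\<lambda>u::nat \<Rightarrow> complex. u i)"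
  by (rule continuous_on_subset[OF continuous_on_product_coordinates]) simp

lemma continuous_on_if_coordinate_bound:
  fixes f :: "(nat \<Rightarrow> complex) \<Rightarrow> complex"
  assumes "\<And>u v. u \<in> S \<Longrightarrow> v \<in> S \<Longrightarrow> cmod (f u - f v) \<le> C * (\<Sum>i<k. cmod (u i - v i))"
  shows "continuous_on S f"
  unfolding continuous_on_def
proof
  fix u assume u: "u \<in> S"
  have c: "continuous_on S (\<lambda>v. C * (\<Sum>i<k. cmod (v i - u i)))"
    by (intro continuous_intros continuous_on_coord)
  have "((\<lambda>v. C * (\<Sum>i<k. cmod (v i - u i))) \<longlongrightarrow> C * (\<Sum>i<k. cmod (u i - u i))) (at u within S)"
    using c[unfolded continuous_on_def, rule_format, OF u] .
  then have "((\<lambda>v. C * (\<Sum>i<k. cmod (v i - u i))) \<longlongrightarrow> 0) (at u within S)" by simp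
  then have "((\<lambda>v. f v - f u) \<longlongrightarrow> 0) (at u within S)"
    by (rule Lim_null_comparison[rotated]) (use assms u in \<open>auto simp: eventually_at_filter\<close>)
  then show "(f \<longlongrightarrow> f u) (at u within S)" by (simp add: LIM_zero_iff)
qed

definition near :: "nat \<Rightarrow> real \<Rightarrow> (nat \<Rightarrow> complex) \<Rightarrow> (nat \<Rightarrow> complex) \<Rightarrow> bool" where
  "near k \<delta> a y \<longleftrightarrow> (\<forall>j<k. cmod (y j - a j) < \<delta>)"

text \<open>A local section \<open>s\<close> of \<open>(G 0, \<dots>, G (k - 1))\<close> through \<open>z0\<close>, defined on a box around the value at \<open>z0\<close>,
Lipschitz there and complex differentiable at the centre along every line. Differentiability at the
centre is all that is needed, since sections will be constructed through every point of a fibre.\<close>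

definition right_inverse_near ::
  "nat \<Rightarrow> nat \<Rightarrow> (nat \<Rightarrow> (nat \<Rightarrow> complex) \<Rightarrow> complex) \<Rightarrow> (nat \<Rightarrow> complex) \<Rightarrow> real \<Rightarrow>
     ((nat \<Rightarrow> complex) \<Rightarrow> nat \<Rightarrow> complex) \<Rightarrow> bool" where
  "right_inverse_near N k G z0 \<delta> s \<longleftrightarrow> \<delta> > 0 \<and>
     (\<forall>y. (\<forall>j<k. y j = G j z0) \<longrightarrow> s y = z0) \<and>
     (\<forall>y. near k \<delta> (\<lambda>j. G j z0) y \<longrightarrow> s y \<in> affine_space N \<and> (\<forall>j<k. G j (s y) = y j)) \<and>
     (\<exists>C. \<forall>y y' i. near k \<delta> (\<lambda>j. G j z0) y \<longrightarrow> near k \<delta> (\<lambda>j. G j z0) y' \<longrightarrow>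
        cmod (s y i - s y' i) \<le> C * (\<Sum>j<k. cmod (y j - y' j))) \<and>
     (\<forall>\<beta> i. (\<lambda>t. s (\<lambda>j. G j z0 + t * \<beta> j) i) field_differentiable at 0)"

lemma right_inverse_nearD:
  assumes "right_inverse_near N k G z0 \<delta> s"
  shows "\<delta> > 0" "(\<And>j. j < k \<Longrightarrow> y j = G j z0) \<Longrightarrow> s y = z0"
    "near k \<delta> (\<lambda>j. G j z0) y \<Longrightarrow> s y \<in> affine_space N"
    "near k \<delta> (\<lambda>j. G j z0) y \<Longrightarrow> l < k \<Longrightarrow> G l (s y) = y l"
    "(\<lambda>t. s (\<lambda>j. G j z0 + t * \<beta> j) i) field_differentiable at 0"
  using assms unfolding right_inverse_near_def by auto

lemma right_inverse_near_Lipschitz: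
  "right_inverse_near N k G z0 \<delta> s \<Longrightarrow> \<exists>C. \<forall>y y' i. near k \<delta> (\<lambda>j. G j z0) y \<longrightarrow>
    near k \<delta> (\<lambda>j. G j z0) y' \<longrightarrow> cmod (s y i - s y' i) \<le> C * (\<Sum>j<k. cmod (y j - y' j))"
  unfolding right_inverse_near_def by blast

text \<open>The submersion theorem. On the image of a right inverse \<open>R\<close> of the derivative, which is parametrised by \<open>U\<close>,
\<open>G\<close> differs from the identity of \<open>\<complex>\<^sup>k\<close> by a map \<open>\<Psi>\<close> that contracts by one half. The
equation \<open>G (U u) = y\<close> is a fixed point problem for \<open>u \<mapsto> y - \<Psi> u\<close>; as the space of sequences is not
normed, the fixed point is found by minimising the displacement on a compact set.\<close>

lemma local_section:
  assumes z0: "z0 \<in> affine_space N" and G: "\<And>j. j < k \<Longrightarrow> strict_diff N (G j) z0 (A j)"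
    and A: "indep_rows k N A"
  shows "\<exists>\<delta> s. right_inverse_near N k G z0 \<delta> s"
proof -
  obtain R where R: "\<And>j l. j < k \<Longrightarrow> l < k \<Longrightarrow> (\<Sum>i<N. A j i * R i l) = (if j = l then 1 else 0)"
    using indep_rows_right_inverse[OF A] by blast
  define \<rho> where "\<rho> = (\<Sum>i<N. \<Sum>l<k. cmod (R i l))"
  have \<rho>: "\<rho> \<ge> 0" unfolding \<rho>_def by (intro sum_nonneg) auto
  define U where "U u i = (if i < N then z0 i + (\<Sum>l<k. R i l * u l) else 0)" for u :: "nat \<Rightarrow> complex" and i
  define L where "L u = (\<Sum>l<k. cmod (u l))" for u :: "nat \<Rightarrow> complex"
  have L0: "L u \<ge> 0" for u unfolding L_def by (intro sum_nonneg) auto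
  have Lmem: "l < k \<Longrightarrow> cmod (u l) \<le> L u" for l u
    unfolding L_def by (rule member_le_sum) auto
  have U_aff: "U u \<in> affine_space N" for u by (simp add: U_def affine_space_def)
  have U0: "U u = z0" if "\<forall>l<k. u l = 0" for u
    using z0 that by (auto simp: U_def affine_space_def fun_eq_iff)
  have Udiff: "U u i - U v i = (\<Sum>l<k. R i l * (u l - v l))" if "i < N" for u v i
    using that by (simp add: U_def right_diff_distrib sum_subtractf)
  have Usum: "(\<Sum>i<N. cmod (U u i - U v i)) \<le> \<rho> * L (\<lambda>l. u l - v l)" for u v
  proof -
    have "(\<Sum>i<N. cmod (U u i - U v i)) \<le> (\<Sum>i<N. \<Sum>l<k. cmod (R i l) * L (\<lambda>l. u l - v l))"
      using Lmem[of _ "\<lambda>l. u l - v l"]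
      by (intro sum_mono) (auto simp: Udiff norm_mult intro!: order_trans[OF norm_sum] sum_mono mult_left_mono)
    then show ?thesis by (simp add: \<rho>_def sum_distrib_right)
  qed
  have Ucoord: "cmod (U u i - U v i) \<le> \<rho> * L (\<lambda>l. u l - v l)" for u v i
  proof (cases "i < N")
    case True
    then have "cmod (U u i - U v i) \<le> (\<Sum>i<N. cmod (U u i - U v i))"
      by (intro member_le_sum) auto
    then show ?thesis using Usum order_trans by blast
  next
    case False
    then show ?thesis using \<rho> L0 by (simp add: U_def)
  qed
  have AU: "(\<Sum>i<N. A j i * (U u i - U v i)) = u j - v j" if "j < k" for j u v
  proof -
    have "(\<Sum>i<N. A j i * (U u i - U v i)) = (\<Sum>i<N. \<Sum>l<k. (A j i * R i l) * (u l - v l))"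
      by (simp add: Udiff sum_distrib_left mult.assoc)
    also have "\<dots> = (\<Sum>l<k. (\<Sum>i<N. A j i * R i l) * (u l - v l))"
      by (subst sum.swap) (simp only: sum_distrib_right)
    also have "\<dots> = u j - v j" using R that by (simp add: if_distrib[of "\<lambda>x. x * _"] cong: if_cong)
    finally show ?thesis .
  qed
  define \<Psi> where "\<Psi> u j = G j (U u) - u j" for u j
  have est: "\<exists>r>0. \<forall>u v. L u \<le> r \<longrightarrow> L v \<le> r \<longrightarrow>
    (\<forall>j<k. cmod (\<Psi> u j - \<Psi> v j) \<le> \<epsilon> * (\<rho> * L (\<lambda>l. u l - v l)))" if "\<epsilon> > 0" for \<epsilon>
  proof -
    obtain \<delta> where \<delta>: "\<delta> > 0" and e: "\<And>x y j. x\<in>affine_space N \<Longrightarrow> y\<in>affine_space N \<Longrightarrow>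
      (\<forall>i<N. cmod (x i - z0 i) < \<delta>) \<Longrightarrow> (\<forall>i<N. cmod (y i - z0 i) < \<delta>) \<Longrightarrow> j < k \<Longrightarrow>
      cmod (G j x - G j y - (\<Sum>i<N. A j i * (x i - y i))) \<le> \<epsilon> * (\<Sum>i<N. cmod (x i - y i))"
      using strict_diff_family_estimate[of z0 N k G A \<epsilon>] z0 G \<open>\<epsilon> > 0\<close> by blast
    define r where "r = \<delta> / (2 * (\<rho> + 1))"
    have r: "r > 0" "\<rho> * r < \<delta>" using \<delta> \<rho> by (auto simp: r_def field_simps intro: add_nonneg_pos)
    have close: "\<forall>i<N. cmod (U u i - z0 i) < \<delta>" if "L u \<le> r" for u
    proof -
      have "cmod (U u i - z0 i) \<le> \<rho> * L u" for i
        using Ucoord[of u i "\<lambda>_. 0"] U0[of "\<lambda>_. 0"] by simp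
      moreover have "\<rho> * L u \<le> \<rho> * r" using that \<rho> by (rule mult_left_mono)
      ultimately show ?thesis using r by (meson le_less_trans)
    qed
    have "cmod (\<Psi> u j - \<Psi> v j) \<le> \<epsilon> * (\<rho> * L (\<lambda>l. u l - v l))" if "L u \<le> r" "L v \<le> r" "j < k" for u v j
    proof -
      have "\<Psi> u j - \<Psi> v j = G j (U u) - G j (U v) - (\<Sum>i<N. A j i * (U u i - U v i))"
        unfolding AU[OF that(3)] \<Psi>_def by simp
      then have "cmod (\<Psi> u j - \<Psi> v j) \<le> \<epsilon> * (\<Sum>i<N. cmod (U u i - U v i))"
        using e[OF U_aff U_aff close[OF that(1)] close[OF that(2)] that(3)] by simp
      also have "\<dots> \<le> \<epsilon> * (\<rho> * L (\<lambda>l. u l - v l))"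
        using Usum \<open>\<epsilon> > 0\<close> by (intro mult_left_mono) auto
      finally show ?thesis .
    qed
    then show ?thesis using r(1) by blast
  qed
  define \<epsilon>0 where "\<epsilon>0 = 1 / (2 * (real k * \<rho> + 1))"
  have "real k * \<rho> + 1 > 0" using \<rho> by (intro add_nonneg_pos mult_nonneg_nonneg) auto
  then have "\<epsilon>0 > 0" by (simp add: \<epsilon>0_def)
  then obtain r where r: "r > 0" and est0: "\<And>u v j. L u \<le> r \<Longrightarrow> L v \<le> r \<Longrightarrow> j < k \<Longrightarrow>
     cmod (\<Psi> u j - \<Psi> v j) \<le> \<epsilon>0 * (\<rho> * L (\<lambda>l. u l - v l))"
    using est[OF \<open>\<epsilon>0 > 0\<close>] by blast
  have half: "(\<Sum>j<k. cmod (\<Psi> u j - \<Psi> v j)) \<le> 1 / 2 * L (\<lambda>l. u l - v l)" if "L u \<le> r" "L v \<le> r" for u v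
  proof -
    have "(\<Sum>j<k. cmod (\<Psi> u j - \<Psi> v j)) \<le> (\<Sum>j<k. \<epsilon>0 * (\<rho> * L (\<lambda>l. u l - v l)))"
      using est0[OF that] by (intro sum_mono) auto
    also have "\<dots> = (real k * \<rho> * \<epsilon>0) * L (\<lambda>l. u l - v l)" by simp
    also have "\<dots> \<le> 1 / 2 * L (\<lambda>l. u l - v l)"
    proof (intro mult_right_mono L0)
      have "real k * \<rho> \<ge> 0" using \<rho> by simp
      then show "real k * \<rho> * \<epsilon>0 \<le> 1 / 2" by (simp add: \<epsilon>0_def field_simps)
    qed
    finally show ?thesis .
  qed
  \<comment> \<open>The compact set is a ball for the norm \<open>L\<close> on the sequences supported in the first \<open>k\<close> places.\<close>
  define K where "K = {u. (\<forall>j\<ge>k. u j = 0) \<and> L u \<le> r}"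
  have "compact K"
  proof -
    have "K = {u. \<forall>i. cmod (u i) \<le> r} \<inter> ((\<Inter>j\<in>{k..}. {u. u j = 0}) \<inter> {u. L u \<le> r})"
    proof -
      have "cmod (u i) \<le> r" if "\<forall>j\<ge>k. u j = 0" "L u \<le> r" for u i
        using that Lmem[of i u] r by (cases "i < k") auto
      then show ?thesis unfolding K_def by auto
    qed
    moreover have "closed {u::nat \<Rightarrow> complex. u j = 0}" for j
      by (intro closed_Collect_eq continuous_on_coord continuous_on_const)
    moreover have "closed {u. L u \<le> r}" unfolding L_def
      by (intro closed_Collect_le continuous_intros continuous_on_coord)
    ultimately show ?thesis using compact_box[of r] by (auto intro!: compact_Int_closed closed_Int closed_INT)
  qed
  define y0 where "y0 j = G j z0" for j
  have \<Psi>0: "\<Psi> (\<lambda>_. 0) j = y0 j" for j unfolding \<Psi>_def y0_def by (simp add: U0)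
  define \<delta> where "\<delta> = r / (2 * (real k + 1))"
  have \<delta>: "\<delta> > 0" "real k * \<delta> \<le> r / 2" using r by (auto simp: \<delta>_def field_simps)
  have sol: "\<exists>u\<in>K. \<forall>j<k. G j (U u) = y j" if y: "\<forall>j<k. cmod (y j - y0 j) < \<delta>" for y
  proof -
    define \<Phi> where "\<Phi> u j = (if j < k then y j - \<Psi> u j else 0)" for u j
    have \<Phi>K: "\<Phi> u \<in> K" if "u \<in> K" for u
    proof -
      have "L (\<Phi> u) \<le> (\<Sum>j<k. cmod (y j - y0 j) + cmod (\<Psi> u j - \<Psi> (\<lambda>_. 0) j))"
        unfolding L_def
      proof (rule sum_mono)
        fix j assume "j \<in> {..<k}"
        then have "\<Phi> u j = (y j - y0 j) - (\<Psi> u j - \<Psi> (\<lambda>_. 0) j)" by (simp add: \<Phi>_def \<Psi>0)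
        then show "cmod (\<Phi> u j) \<le> cmod (y j - y0 j) + cmod (\<Psi> u j - \<Psi> (\<lambda>_. 0) j)"
          by (metis norm_triangle_ineq4)
      qed
      also have "\<dots> = (\<Sum>j<k. cmod (y j - y0 j)) + (\<Sum>j<k. cmod (\<Psi> u j - \<Psi> (\<lambda>_. 0) j))"
        by (rule sum.distrib)
      also have "(\<Sum>j<k. cmod (y j - y0 j)) \<le> (\<Sum>j<k. \<delta>)" using y by (intro sum_mono) (auto intro: less_imp_le)
      also have "(\<Sum>j<k. \<delta>) = real k * \<delta>" by simp
      also have "(\<Sum>j<k. cmod (\<Psi> u j - \<Psi> (\<lambda>_. 0) j)) \<le> 1/2 * L u"
        using half[of u "\<lambda>_. 0"] that r by (simp add: K_def L_def)
      also have "1/2 * L u \<le> r / 2" using that by (simp add: K_def)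
      finally have "L (\<Phi> u) \<le> r" using \<delta>(2) by simp
      then show ?thesis by (simp add: K_def \<Phi>_def)
    qed
    \<comment> \<open>The displacement \<open>f\<close> of \<open>\<Phi>\<close> at \<open>\<Phi> u\<close> is at most half of that at \<open>u\<close>, so its minimum is \<open>0\<close>.\<close>
    define f where "f u = L (\<lambda>j. \<Phi> u j - u j)" for u
    have c\<Psi>: "continuous_on K (\<lambda>u. \<Psi> u j)" if "j < k" for j
    proof (rule continuous_on_if_coordinate_bound[of _ _ "\<epsilon>0 * \<rho>" k])
      show "cmod (\<Psi> u j - \<Psi> v j) \<le> \<epsilon>0 * \<rho> * (\<Sum>i<k. cmod (u i - v i))" if "u \<in> K" "v \<in> K" for u v
        using est0[of u v j] that \<open>j < k\<close> by (simp add: K_def L_def mult.assoc)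
    qed
    have "continuous_on K (\<lambda>u. \<Phi> u j - u j)" for j
      unfolding \<Phi>_def by (cases "j < k") (auto intro!: continuous_intros continuous_on_coord c\<Psi>)
    then have "continuous_on K f" unfolding f_def L_def
      by (intro continuous_on_sum continuous_on_norm)
    moreover have "K \<noteq> {}" using r by (auto simp: K_def L_def intro!: exI[of _ "\<lambda>_. 0"])
    ultimately obtain u where u: "u \<in> K" "\<And>v. v \<in> K \<Longrightarrow> f u \<le> f v"
      using continuous_attains_inf[OF \<open>compact K\<close>] by blast
    have "f (\<Phi> u) = (\<Sum>j<k. cmod (\<Psi> (\<Phi> u) j - \<Psi> u j))"
      unfolding f_def L_def by (intro sum.cong) (auto simp: \<Phi>_def norm_minus_commute)
    also have "\<dots> \<le> 1/2 * L (\<lambda>l. \<Phi> u l - u l)"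
      using half \<Phi>K[OF u(1)] u(1) by (auto simp: K_def)
    finally have "f (\<Phi> u) \<le> 1/2 * f u" unfolding f_def .
    then have "f u \<le> 1/2 * f u" using u(2)[OF \<Phi>K[OF u(1)]] by linarith
    moreover have "f u \<ge> 0" unfolding f_def by (rule L0)
    ultimately have "f u = 0" by simp
    then have "\<forall>j<k. \<Phi> u j = u j" unfolding f_def L_def by (simp add: sum_nonneg_eq_0_iff)
    then have "\<forall>j<k. G j (U u) = y j" by (auto simp: \<Phi>_def \<Psi>_def algebra_simps)
    then show ?thesis using u(1) by blast
  qed
  define w where "w y = (SOME u. u \<in> K \<and> (\<forall>j<k. G j (U u) = y j))" for y
  have w: "w y \<in> K" "\<And>j. j < k \<Longrightarrow> G j (U (w y)) = y j" if "\<forall>j<k. cmod (y j - y0 j) < \<delta>" for y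
  proof -
    have "\<exists>u. u \<in> K \<and> (\<forall>j<k. G j (U u) = y j)" using sol[OF that] by blast
    then have "w y \<in> K \<and> (\<forall>j<k. G j (U (w y)) = y j)" unfolding w_def by (rule someI_ex)
    then show "w y \<in> K" "\<And>j. j < k \<Longrightarrow> G j (U (w y)) = y j" by auto
  qed
  have wLip: "L (\<lambda>l. u l - v l) \<le> 2 * L (\<lambda>j. y j - y' j)"
    if "L u \<le> r" "L v \<le> r" "\<And>j. j < k \<Longrightarrow> G j (U u) = y j" "\<And>j. j < k \<Longrightarrow> G j (U v) = y' j" for u v y y'
  proof -
    have "L (\<lambda>l. u l - v l) \<le> (\<Sum>j<k. cmod (y j - y' j) + cmod (\<Psi> u j - \<Psi> v j))"
      unfolding L_def
    proof (rule sum_mono)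
      fix j assume "j \<in> {..<k}"
      then have "u j - v j = (y j - y' j) - (\<Psi> u j - \<Psi> v j)" using that(3,4)[of j] by (simp add: \<Psi>_def)
      then show "cmod (u j - v j) \<le> cmod (y j - y' j) + cmod (\<Psi> u j - \<Psi> v j)"
        by (metis norm_triangle_ineq4)
    qed
    also have "\<dots> = L (\<lambda>j. y j - y' j) + (\<Sum>j<k. cmod (\<Psi> u j - \<Psi> v j))"
      by (simp add: sum.distrib L_def)
    finally show ?thesis using half[OF that(1,2)] by linarith
  qed
  define s where "s y = U (w y)" for y
  have s0: "s y = z0" if "\<forall>j<k. y j = y0 j" for y
  proof -
    have "\<forall>j<k. cmod (y j - y0 j) < \<delta>" using that \<delta> by simp
    note wy = w[OF this]
    have "G j (U (\<lambda>_. 0)) = y0 j" for j by (simp add: U0 y0_def)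
    moreover have "L (w y) \<le> r" "L (\<lambda>_. 0) \<le> r" using wy(1) r by (auto simp: K_def L_def)
    ultimately have "L (\<lambda>l. w y l - 0) \<le> 2 * L (\<lambda>j. y j - y0 j)" using wy(2) by (intro wLip) auto
    also have "\<dots> = 0" using that by (simp add: L_def)
    finally have "L (w y) = 0" using L0[of "w y"] by simp
    then have "\<forall>l<k. w y l = 0" by (simp add: L_def sum_nonneg_eq_0_iff)
    then show ?thesis unfolding s_def by (rule U0)
  qed
  have sLip: "cmod (s y i - s y' i) \<le> (\<rho> * 2) * (\<Sum>j<k. cmod (y j - y' j))"
    if "\<forall>j<k. cmod (y j - y0 j) < \<delta>" "\<forall>j<k. cmod (y' j - y0 j) < \<delta>" for y y' i
  proof -
    have "L (\<lambda>l. w y l - w y' l) \<le> 2 * L (\<lambda>j. y j - y' j)"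
      using w[OF that(1)] w[OF that(2)] by (intro wLip) (auto simp: K_def)
    then have "\<rho> * L (\<lambda>l. w y l - w y' l) \<le> \<rho> * (2 * L (\<lambda>j. y j - y' j))" using \<rho> by (rule mult_left_mono)
    then show ?thesis using Ucoord[of "w y" i "w y'"] unfolding s_def L_def by simp
  qed
  \<comment> \<open>Since \<open>\<Psi>\<close> has derivative zero at the centre, the solution satisfies \<open>u t = t \<beta> + o(t)\<close>.\<close>
  have deriv: "\<exists>D. ((\<lambda>t. s (\<lambda>j. y0 j + t * \<beta> j) i) has_field_derivative D) (at 0)" for \<beta> i
  proof (cases "i < N")
    case False
    then have "(\<lambda>t. s (\<lambda>j. y0 j + t * \<beta> j) i) = (\<lambda>t. 0)" by (simp add: s_def U_def)
    then show ?thesis by (auto intro: exI[of _ 0])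
  next
    case True
    define u where "u t = w (\<lambda>j. y0 j + t * \<beta> j)" for t
    have small: "\<forall>\<^sub>F t in at 0. \<forall>j<k. cmod (y0 j + t * \<beta> j - y0 j) < \<eta>" if "\<eta> > 0" for \<eta>
    proof -
      have "((\<lambda>t. t * \<beta> j) \<longlongrightarrow> 0 * \<beta> j) (at 0)" for j by (intro tendsto_intros)
      then have "\<forall>\<^sub>F t in at 0. dist (t * \<beta> j) 0 < \<eta>" for j using that by (intro tendstoD) auto
      then have "\<forall>\<^sub>F t in at 0. \<forall>j\<in>{..<k}. dist (t * \<beta> j) 0 < \<eta>"
        by (intro eventually_ball_finite) auto
      then show ?thesis by eventually_elim simp
    qed
    have uL: "\<forall>\<^sub>F t in at 0. L (u t) \<le> r \<and> L (u t) \<le> 2 * (cmod t * L \<beta>) \<and> (\<forall>j<k. G j (U (u t)) = y0 j + t * \<beta> j)"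
      using small[OF \<delta>(1)]
    proof eventually_elim
      case (elim t)
      note wy = w[OF elim, folded u_def]
      have "L (u t) \<le> r" "L (\<lambda>_. 0) \<le> r" using wy(1) r by (auto simp: K_def L_def)
      moreover have "G j (U (\<lambda>_. 0)) = y0 j" for j by (simp add: U0 y0_def)
      ultimately have "L (\<lambda>l. u t l - 0) \<le> 2 * L (\<lambda>j. (y0 j + t * \<beta> j) - y0 j)" using wy(2) by (intro wLip) auto
      then show ?case using \<open>L (u t) \<le> r\<close> wy(2) by (simp add: L_def norm_mult sum_distrib_left)
    qed
    have lim: "((\<lambda>t. u t j / t) \<longlongrightarrow> \<beta> j) (at 0)" if j: "j < k" for j
    proof (rule tendstoI)
      fix e :: real assume e: "e > 0"
      define q where "q = 2 * \<rho> * L \<beta>"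
      define \<epsilon> where "\<epsilon> = e / (q + 1)"
      have "q \<ge> 0" using \<rho> L0 by (simp add: q_def)
      then have \<epsilon>: "\<epsilon> > 0" "\<epsilon> * q < e" using e
        by (auto simp: \<epsilon>_def pos_divide_less_eq distrib_left)
      obtain r' where r': "r' > 0" and e': "\<And>u v j. L u \<le> r' \<Longrightarrow> L v \<le> r' \<Longrightarrow> j < k \<Longrightarrow>
        cmod (\<Psi> u j - \<Psi> v j) \<le> \<epsilon> * (\<rho> * L (\<lambda>l. u l - v l))" using est[OF \<epsilon>(1)] by blast
      have "((\<lambda>t::complex. 2 * (cmod t * L \<beta>)) \<longlongrightarrow> 2 * (cmod 0 * L \<beta>)) (at 0)" by (intro tendsto_intros)
      then have "\<forall>\<^sub>F t::complex in at 0. dist (2 * (cmod t * L \<beta>)) 0 < r'" using r' by (intro tendstoD) auto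
      then show "\<forall>\<^sub>F t in at 0. dist (u t j / t) (\<beta> j) < e"
        using uL eventually_neq_at_within[of 0 0 UNIV]
      proof eventually_elim
        case (elim t)
        have "L (u t) \<le> r'" using elim(1,2) by (auto simp: dist_real_def)
        then have "cmod (\<Psi> (u t) j - \<Psi> (\<lambda>_. 0) j) \<le> \<epsilon> * (\<rho> * L (\<lambda>l. u t l - 0))"
          using r' j by (intro e') (auto simp: L_def)
        also have "\<dots> \<le> \<epsilon> * (\<rho> * (2 * (cmod t * L \<beta>)))"
          using elim(2) \<epsilon> \<rho> by (intro mult_left_mono) auto
        also have "\<dots> = \<epsilon> * q * cmod t" by (simp add: q_def)
        also have "\<dots> < e * cmod t" using \<epsilon>(2) elim(3) by (intro mult_strict_right_mono) auto
        finally have "cmod (\<Psi> (u t) j - \<Psi> (\<lambda>_. 0) j) < e * cmod t" .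
        moreover have "\<Psi> (u t) j - \<Psi> (\<lambda>_. 0) j = t * (\<beta> j - u t j / t)"
          using elim(2,3) j unfolding \<Psi>0 by (simp add: \<Psi>_def field_simps)
        ultimately have "cmod (\<beta> j - u t j / t) < e" using elim(3) by (simp add: norm_mult mult.commute)
        then show ?case by (simp add: dist_norm norm_minus_commute)
      qed
    qed
    have "((\<lambda>t. \<Sum>l<k. R i l * (u t l / t)) \<longlongrightarrow> (\<Sum>l<k. R i l * \<beta> l)) (at 0)"
      by (intro tendsto_intros lim) auto
    moreover have "(s (\<lambda>j. y0 j + t * \<beta> j) i - s (\<lambda>j. y0 j + 0 * \<beta> j) i) / (t - 0) = (\<Sum>l<k. R i l * (u t l / t))" for t
      using True s0[of "\<lambda>j. y0 j + 0 * \<beta> j"] by (simp add: s_def u_def U_def sum_divide_distrib)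
    ultimately have "((\<lambda>t. s (\<lambda>j. y0 j + t * \<beta> j) i) has_field_derivative (\<Sum>l<k. R i l * \<beta> l)) (at 0)"
      unfolding has_field_derivative_iff by simp
    then show ?thesis by blast
  qed
  have "near k \<delta> (\<lambda>j. G j z0) y \<longleftrightarrow> (\<forall>j<k. cmod (y j - y0 j) < \<delta>)" for y
    by (simp add: near_def y0_def)
  moreover have "(\<lambda>t. s (\<lambda>j. G j z0 + t * \<beta> j) i) field_differentiable at 0" for \<beta> i
    using deriv unfolding field_differentiable_def y0_def by blast
  moreover have "\<exists>C. \<forall>y y' i. (\<forall>j<k. cmod (y j - y0 j) < \<delta>) \<longrightarrow> (\<forall>j<k. cmod (y' j - y0 j) < \<delta>) \<longrightarrow>
      cmod (s y i - s y' i) \<le> C * (\<Sum>j<k. cmod (y j - y' j))"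
    using sLip by blast
  ultimately have "right_inverse_near N k G z0 \<delta> s"
    unfolding right_inverse_near_def using \<delta>(1) s0 U_aff w(2) by (simp add: s_def y0_def)
  then show ?thesis by blast
qed

lemma poly_funs_strict_diff_partial_deriv:
  assumes "p \<in> poly_funs N"
  shows "strict_diff N p z (\<lambda>i. partial_deriv i p z)"
proof -
  obtain A where A: "\<And>z. strict_diff N p z (\<lambda>i. A i z)" using poly_funs_strict_diff[OF assms] by blast
  show ?thesis by (rule strict_diff_cong[OF A]) (simp add: strict_diff_partial_deriv[OF A])
qed

lemma partial_deriv_poly_funs:
  assumes "p \<in> poly_funs N" "i < N"
  shows "(\<lambda>z. partial_deriv i p z) \<in> poly_funs N"
proof -
  obtain A where A: "\<And>i. A i \<in> poly_funs N" "\<And>z. strict_diff N p z (\<lambda>i. A i z)"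
    using poly_funs_strict_diff[OF assms(1)] by blast
  have "(\<lambda>z. partial_deriv i p z) = A i" using strict_diff_partial_deriv[OF A(2) assms(2)] by auto
  then show ?thesis using A(1) by simp
qed

text \<open>Division of \<open>Q\<close> by the highest power of the last variable that divides it; \<open>b\<close> is the lowest
coefficient, which is the value of the quotient where that variable vanishes.\<close>

section \<open>Algebraic dependence on a smooth zero set\<close>

lemma poly_funs_lowest_term:
  assumes "Q \<in> poly_funs (Suc m)" "Q Y \<noteq> 0"
  shows "\<exists>e b Q'. Q' \<in> poly_funs (Suc m) \<and> b \<in> poly_funs m \<and> (\<exists>X. b X \<noteq> 0) \<and>
    (\<forall>x. Q x = x m ^ e * Q' x) \<and> (\<forall>x. x m = 0 \<longrightarrow> Q' x = b x)"
proof -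
  obtain C d where C: "\<And>k. (\<lambda>x. coeff (C x) k) \<in> poly_funs m" "\<And>x. degree (C x) \<le> d"
    "\<And>x. Q x = poly (C x) (x m)" using poly_funs_last_variable[OF assms(1)] by blast
  define e where "e = (LEAST k. \<exists>x. coeff (C x) k \<noteq> 0)"
  have "C Y \<noteq> 0" using assms(2) C(3) by auto
  then have "\<exists>k x. coeff (C x) k \<noteq> 0" by (meson leading_coeff_neq_0)
  then have e: "\<exists>x. coeff (C x) e \<noteq> 0" unfolding e_def by (rule LeastI_ex)
  have low: "coeff (C x) k = 0" if "k < e" for k x
    using not_less_Least[of k "\<lambda>k. \<exists>x. coeff (C x) k \<noteq> 0"] that unfolding e_def by blast
  define Q' where "Q' x = (\<Sum>k\<le>d. coeff (C x) (k + e) * x m ^ k)" for x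
  have "Q x = x m ^ e * Q' x" for x
  proof -
    have "Q x = (\<Sum>k\<le>degree (C x). coeff (C x) k * x m ^ k)"
      using C(3)[of x] by (simp add: poly_altdef)
    also have "\<dots> = (\<Sum>k\<in>{..d + e}. coeff (C x) k * x m ^ k)"
      using C(2)[of x] by (intro sum.mono_neutral_left) (auto simp: coeff_eq_0)
    also have "\<dots> = (\<Sum>k\<in>{e..d + e}. coeff (C x) k * x m ^ k)"
      using low by (intro sum.mono_neutral_right) (auto simp: not_le)
    also have "\<dots> = (\<Sum>k\<in>{0..d}. coeff (C x) (k + e) * x m ^ (k + e))"
      using sum.shift_bounds_cl_nat_ivl[of "\<lambda>k. coeff (C x) k * x m ^ k" 0 e d] by simp
    also have "\<dots> = x m ^ e * Q' x"
      unfolding Q'_def sum_distrib_left by (intro sum.cong) (auto simp: power_add)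
    finally show ?thesis .
  qed
  moreover have "Q' \<in> poly_funs (Suc m)" unfolding Q'_def
    by (intro poly_funs_intros) (auto intro: poly_funs_mono[OF C(1)])
  moreover have "Q' x = coeff (C x) e" if "x m = 0" for x
  proof -
    have "Q' x = (\<Sum>k\<in>{0}. coeff (C x) (k + e) * x m ^ k)" unfolding Q'_def
      by (intro sum.mono_neutral_right) (auto simp: that power_0_left)
    then show ?thesis by simp
  qed
  ultimately show ?thesis using C(1)[of e] e by blast
qed

lemma poly_funs_highest_term:
  assumes "Q \<in> poly_funs (Suc m)" "Q Y \<noteq> 0"
  shows "\<exists>d c. (\<forall>k. c k \<in> poly_funs m) \<and> (\<exists>X. c d X \<noteq> 0) \<and> (\<forall>x. Q x = (\<Sum>k\<le>d. c k x * x m ^ k))"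
proof -
  obtain C d where C: "\<And>k. (\<lambda>x. coeff (C x) k) \<in> poly_funs m" "\<And>x. degree (C x) \<le> d"
    "\<And>x. Q x = poly (C x) (x m)" using poly_funs_last_variable[OF assms(1)] by blast
  define e where "e = (GREATEST k. \<exists>x. coeff (C x) k \<noteq> 0)"
  have "C Y \<noteq> 0" using assms(2) C(3) by auto
  then have ex: "\<exists>k x. coeff (C x) k \<noteq> 0" by (meson leading_coeff_neq_0)
  have bound: "\<exists>x. coeff (C x) k \<noteq> 0 \<Longrightarrow> k \<le> d" for k
    using C(2) by (meson le_degree order_trans)
  have e: "\<exists>x. coeff (C x) e \<noteq> 0" unfolding e_def
    using ex bound by (intro GreatestI_ex_nat[where P = "\<lambda>k. \<exists>x. coeff (C x) k \<noteq> 0"]) auto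
  have high: "coeff (C x) k = 0" if "k > e" for k x
  proof (rule ccontr)
    assume "coeff (C x) k \<noteq> 0"
    then have "k \<le> e" unfolding e_def
      using bound by (intro Greatest_le_nat[where P = "\<lambda>k. \<exists>x. coeff (C x) k \<noteq> 0"]) auto
    then show False using that by simp
  qed
  have "Q x = (\<Sum>k\<le>e. coeff (C x) k * x m ^ k)" for x
  proof -
    have "degree (C x) \<le> e" using high by (intro degree_le) blast
    then have "(\<Sum>k\<le>degree (C x). coeff (C x) k * x m ^ k) = (\<Sum>k\<le>e. coeff (C x) k * x m ^ k)"
      by (intro sum.mono_neutral_left) (auto simp: coeff_eq_0)
    then show ?thesis using C(3)[of x] by (simp add: poly_altdef)
  qed
  then show ?thesis using C(1) e by (intro exI[of _ e] exI[of _ "\<lambda>k x. coeff (C x) k"]) auto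
qed

text \<open>The condition of the Jacobian criterion in the definition of smoothness.\<close>

definition submersive :: "nat \<Rightarrow> nat \<Rightarrow> (nat \<Rightarrow> (nat \<Rightarrow> complex) \<Rightarrow> complex) \<Rightarrow> bool" where
  "submersive N c f \<longleftrightarrow> (\<forall>j<c. f j \<in> poly_funs N) \<and>
     (\<forall>x \<in> zeros N (f ` {..<c}). indep_rows c N (\<lambda>j i. partial_deriv i (f j) x))"

lemma zeros_iff: "z \<in> zeros N (f ` {..<c}) \<longleftrightarrow> z \<in> affine_space N \<and> (\<forall>j<c. f j z = 0)"
  by (auto simp: zeros_def)

text \<open>The zero set of \<open>c\<close> independent equations in \<open>\<complex>\<^sup>N\<close> has dimension \<open>m = N - c\<close>, so \<open>m + 1\<close> functions are
dependent on it. By the previous section there is a relation \<open>Q\<close> between the \<open>f j\<close> and the \<open>g l\<close> on all of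
\<open>\<complex>\<^sup>N\<close>, but putting \<open>f = 0\<close> in it may give the trivial relation. Instead \<open>f = t Y\<close> is approached along a
line, divided by the highest possible power of \<open>t\<close>, and \<open>t\<close> tends to \<open>0\<close>; near every point of the zero set
the equation \<open>f = t Y\<close> is solvable because the equations are independent.\<close>

lemma algebraic_dependence_on_zeros:
  assumes f: "submersive N c f" and N: "N = c + m"
    and g: "\<And>l. l \<le> m \<Longrightarrow> g l \<in> poly_funs N"
  shows "\<exists>Q\<in>poly_funs (Suc m). (\<exists>Y. Q Y \<noteq> 0) \<and> (\<forall>z\<in>zeros N (f ` {..<c}). Q (\<lambda>l. g l z) = 0)"
proof -
  define h where "h j = (if j < c then f j else g (j - c))" for j
  have "h j \<in> poly_funs N" if "j \<le> N" for j
    using f g that by (auto simp: h_def submersive_def N)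
  then obtain Q Y where Q: "Q \<in> poly_funs (Suc N)" "Q Y \<noteq> 0" "\<And>x. Q (\<lambda>j. h j x) = 0"
    using algebraic_dependence[of N h] by blast
  \<comment> \<open>\<open>Q2\<close> is \<open>Q\<close> along \<open>f = t Y\<close>, with \<open>t\<close> as the variable of index \<open>m + 1\<close> after those for the \<open>g l\<close>.
    It is nonzero because \<open>Q Y \<noteq> 0\<close>.\<close>
  define Q2 where "Q2 x = Q (\<lambda>j. if j < c then x (Suc m) * Y j else x (j - c))" for x
  have Q2: "Q2 \<in> poly_funs (Suc (Suc m))" unfolding Q2_def
  proof (rule poly_funs_subst[OF Q(1)])
    fix j assume "j < Suc N"
    then show "(\<lambda>x. if j < c then x (Suc m) * Y j else x (j - c)) \<in> poly_funs (Suc (Suc m))"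
      by (cases "j < c") (auto intro!: poly_funs_intros simp: N)
  qed
  define X where "X l = (if l = Suc m then 1 else Y (l + c))" for l
  have "Q2 X = Q Y" unfolding Q2_def
    by (rule poly_funs_cong[OF Q(1)]) (auto simp: X_def N)
  then have "Q2 X \<noteq> 0" using Q(2) by simp
  from poly_funs_lowest_term[OF Q2 this]
  obtain e b Q' where Q': "Q' \<in> poly_funs (Suc (Suc m))" "b \<in> poly_funs (Suc m)" "\<exists>X. b X \<noteq> 0"
    "\<And>x. Q2 x = x (Suc m) ^ e * Q' x" "\<And>x. x (Suc m) = 0 \<Longrightarrow> Q' x = b x" by blast
  have "b (\<lambda>l. g l z) = 0" if z: "z \<in> zeros N (f ` {..<c})" for z
  proof -
    have z': "z \<in> affine_space N" "\<And>j. j < c \<Longrightarrow> f j z = 0" using z by (auto simp: zeros_iff)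
    have sd: "\<And>j. j < c \<Longrightarrow> strict_diff N (f j) z (\<lambda>i. partial_deriv i (f j) z)"
      using f by (auto simp: submersive_def intro: poly_funs_strict_diff_partial_deriv)
    have ir: "indep_rows c N (\<lambda>j i. partial_deriv i (f j) z)" using f z by (auto simp: submersive_def)
    obtain \<delta> s where s: "right_inverse_near N c f z \<delta> s"
      using local_section[OF z'(1) sd ir] by blast
    note \<delta> = right_inverse_nearD(1)[OF s] and s0 = right_inverse_nearD(2)[OF s]
      and ds = right_inverse_nearD(5)[OF s]
    \<comment> \<open>A curve through \<open>z\<close> on which \<open>f = t Y\<close>; along it \<open>Q2\<close> vanishes, hence \<open>Q'\<close> does for \<open>t \<noteq> 0\<close>.\<close>
    define w where "w t = s (\<lambda>j. f j z + t * Y j)" for t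
    define \<gamma> where "\<gamma> t l = (if l \<le> m then g l (w t) else t)" for t l
    have w0: "w 0 = z" unfolding w_def by (rule s0) simp
    have dw: "(\<lambda>t. w t i) field_differentiable at 0" for i
      using ds unfolding w_def by blast
    have "(\<lambda>t. \<gamma> t l) field_differentiable at 0" for l
    proof (cases "l \<le> m")
      case True
      then show ?thesis
        using poly_funs_field_differentiable[OF g[OF True], of w 0] dw by (simp add: \<gamma>_def)
    qed (simp add: \<gamma>_def)
    then have "(\<lambda>t. Q' (\<gamma> t)) field_differentiable at 0"
      by (intro poly_funs_field_differentiable[OF Q'(1)])
    then have "((\<lambda>t. Q' (\<gamma> t)) \<longlongrightarrow> Q' (\<gamma> 0)) (at 0)"
      using field_differentiable_imp_continuous_at isContD by fastforce
    moreover have "\<forall>\<^sub>F t in at 0. Q' (\<gamma> t) = 0"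
    proof -
      have "((\<lambda>t. t * Y j) \<longlongrightarrow> 0 * Y j) (at 0)" for j by (intro tendsto_intros)
      then have "\<forall>\<^sub>F t in at 0. dist (t * Y j) 0 < \<delta>" for j using \<delta> by (intro tendstoD) auto
      then have "\<forall>\<^sub>F t in at 0. \<forall>j\<in>{..<c}. dist (t * Y j) 0 < \<delta>" by (intro eventually_ball_finite) auto
      then show ?thesis using eventually_neq_at_within[of 0 0 UNIV]
      proof eventually_elim
        case (elim t)
        have "f j (w t) = t * Y j" if "j < c" for j
          using right_inverse_nearD(4)[OF s, of "\<lambda>j. f j z + t * Y j" j] elim(1) that z'(2)
          unfolding w_def near_def by simp
        then have "Q2 (\<gamma> t) = Q (\<lambda>j. h j (w t))"
          unfolding Q2_def by (intro poly_funs_cong[OF Q(1)]) (auto simp: \<gamma>_def h_def N)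
        then have "t ^ e * Q' (\<gamma> t) = 0" using Q(3) Q'(4)[of "\<gamma> t"] by (simp add: \<gamma>_def)
        then show ?case using elim(2) by simp
      qed
    qed
    then have "((\<lambda>t. Q' (\<gamma> t)) \<longlongrightarrow> 0) (at 0)" by (rule tendsto_eventually)
    ultimately have "Q' (\<gamma> 0) = 0" using tendsto_unique[OF at_neq_bot] by blast
    moreover have "Q' (\<gamma> 0) = b (\<gamma> 0)" by (rule Q'(5)) (simp add: \<gamma>_def)
    moreover have "b (\<gamma> 0) = b (\<lambda>l. g l z)"
      by (rule poly_funs_cong[OF Q'(2)]) (simp add: \<gamma>_def w0)
    ultimately show ?thesis by simp
  qed
  then show ?thesis using Q'(2,3) by blast
qed

section \<open>Functions that are polynomial on lines\<close>

lemma lagrange_interpolation: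
  fixes q :: "complex poly"
  assumes "finite S" "card S = Suc M" "degree q \<le> M"
  shows "poly q t = (\<Sum>\<tau>\<in>S. poly q \<tau> * (\<Prod>\<sigma>\<in>S-{\<tau>}. (t - \<sigma>) / (\<tau> - \<sigma>)))"
proof -
  define l where "l \<tau> = (\<Prod>\<sigma>\<in>S-{\<tau>}. [:- \<sigma> / (\<tau> - \<sigma>), 1 / (\<tau> - \<sigma>):])" for \<tau>
  have pl: "poly (l \<tau>) t = (\<Prod>\<sigma>\<in>S-{\<tau>}. (t - \<sigma>) / (\<tau> - \<sigma>))" for \<tau> t
    unfolding l_def poly_prod by (intro prod.cong) (auto simp: diff_divide_distrib)
  have dl: "degree (l \<tau>) \<le> M" if "\<tau> \<in> S" for \<tau>
  proof -
    have "degree (l \<tau>) \<le> (\<Sum>\<sigma>\<in>S-{\<tau>}. degree [:- \<sigma> / (\<tau> - \<sigma>), 1 / (\<tau> - \<sigma>):])"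
      unfolding l_def
      using degree_prod_sum_le[OF finite_Diff[OF assms(1)], of "\<lambda>\<sigma>. [:- \<sigma> / (\<tau> - \<sigma>), 1 / (\<tau> - \<sigma>):]" "{\<tau>}"]
      unfolding o_def .
    also have "\<dots> \<le> (\<Sum>\<sigma>\<in>S-{\<tau>}. 1)" by (intro sum_mono) auto
    also have "\<dots> = M" using assms that by simp
    finally show ?thesis .
  qed
  define r where "r = (\<Sum>\<tau>\<in>S. smult (poly q \<tau>) (l \<tau>))"
  have "q = r"
  proof (rule poly_eqI_degree)
    show "degree q < card S" using assms by simp
    have "degree r \<le> M" unfolding r_def
      by (intro degree_sum_le assms(1)) (metis degree_smult_le dl order_trans)
    then show "degree r < card S" using assms by simp
    fix x assume x: "x \<in> S"
    have "poly r x = (\<Sum>\<tau>\<in>S. if \<tau> = x then poly q x else 0)"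
      unfolding r_def poly_sum poly_smult pl
    proof (intro sum.cong refl)
      fix \<tau> assume \<tau>: "\<tau> \<in> S"
      show "poly q \<tau> * (\<Prod>\<sigma>\<in>S-{\<tau>}. (x - \<sigma>) / (\<tau> - \<sigma>)) = (if \<tau> = x then poly q x else 0)"
      proof (cases "\<tau> = x")
        case True
        have "(\<Prod>\<sigma>\<in>S-{x}. (x - \<sigma>) / (x - \<sigma>)) = 1" by (intro prod.neutral) auto
        then show ?thesis using True by simp
      next
        case False
        then have "(\<Prod>\<sigma>\<in>S-{\<tau>}. (x - \<sigma>) / (\<tau> - \<sigma>)) = 0" using x assms(1) by (auto intro!: prod_zero)
        then show ?thesis using False by simp
      qed
    qed
    then show "poly q x = poly r x" using x assms(1) by simp
  qed
  then have "poly q t = poly r t" by simp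
  also have "\<dots> = (\<Sum>\<tau>\<in>S. poly q \<tau> * (\<Prod>\<sigma>\<in>S-{\<tau>}. (t - \<sigma>) / (\<tau> - \<sigma>)))"
    unfolding r_def by (simp add: poly_sum pl)
  finally show ?thesis .
qed

text \<open>Induction on the number of variables: \<open>M + 1\<close> slices parallel to a hyperplane are polynomial by
induction, and Lagrange interpolation between them is exact on lines transversal to the hyperplane.
The slices must avoid the zeros of \<open>D\<close>, so the interpolation formula is known first only off the zeros
of the larger polynomial \<open>D'\<close>; it extends along lines to all points with \<open>D \<noteq> 0\<close>.\<close>

lemma polynomial_if_polynomial_on_lines:
  assumes "D \<in> poly_funs n" "D w \<noteq> 0"
    and "\<And>x y. (\<forall>i<n. x i = y i) \<Longrightarrow> e x = e y"
    and "\<And>a b. \<exists>q. degree q \<le> M \<and> (\<forall>t. D (\<lambda>i. a i + t * b i) \<noteq> 0 \<longrightarrow> e (\<lambda>i. a i + t * b i) = poly q t)"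
  shows "\<exists>Q\<in>poly_funs n. \<forall>x. D x \<noteq> 0 \<longrightarrow> e x = Q x"
  using assms
proof (induct n arbitrary: D e w)
  case 0
  have "e x = e w" for x using 0(3) by simp
  then show ?case by (intro bexI[of _ "\<lambda>_. e w"]) (auto intro: poly_funs.const)
next
  case (Suc n)
  have upd: "x(n := t) = (\<lambda>i. (x(n := 0)) i + t * (if i = n then 1 else 0))" for x :: "nat \<Rightarrow> complex" and t
    by (auto simp: fun_eq_iff)
  have "D (w(n := w n)) \<noteq> 0" using Suc(3) by simp
  then have "finite {t. D (\<lambda>i. (w(n := 0)) i + t * (if i = n then 1 else 0)) = 0}"
    unfolding upd[of w "w n"] by (rule finite_zeros_on_line[OF Suc(2)])
  then have "finite {t. D (w(n := t)) = 0}" unfolding upd[symmetric] .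
  then have "infinite (UNIV - {t. D (w(n := t)) = 0})"
    using infinite_UNIV_char_0 by (metis Diff_infinite_finite)
  then obtain S where S: "finite S" "card S = Suc M" "S \<subseteq> UNIV - {t. D (w(n := t)) = 0}"
    using infinite_arbitrarily_large by blast
  have "\<exists>Q\<in>poly_funs n. \<forall>x. D (x(n := \<tau>)) \<noteq> 0 \<longrightarrow> e (x(n := \<tau>)) = Q x" if "\<tau> \<in> S" for \<tau>
  proof (rule Suc(1))
    have "(\<lambda>x. D (\<lambda>i. if i = n then \<tau> else x i)) \<in> poly_funs n"
    proof (rule poly_funs_subst[OF Suc(2)])
      fix i assume "i < Suc n"
      then show "(\<lambda>x. if i = n then \<tau> else x i) \<in> poly_funs n"
        by (cases "i = n") (auto intro: poly_funs.intros)
    qed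
    then show "(\<lambda>x. D (x(n := \<tau>))) \<in> poly_funs n" by (simp add: fun_upd_def)
    show "D (w(n := \<tau>)) \<noteq> 0" using S that by blast
    show "e (x(n := \<tau>)) = e (y(n := \<tau>))" if "\<forall>i<n. x i = y i" for x y
      using that by (intro Suc(4)) auto
    fix a b :: "nat \<Rightarrow> complex"
    have "(\<lambda>i. a i + t * b i)(n := \<tau>) = (\<lambda>i. (a(n := \<tau>)) i + t * (b(n := 0)) i)" for t
      by (auto simp: fun_eq_iff)
    then show "\<exists>q. degree q \<le> M \<and> (\<forall>t. D ((\<lambda>i. a i + t * b i)(n := \<tau>)) \<noteq> 0 \<longrightarrow>
      e ((\<lambda>i. a i + t * b i)(n := \<tau>)) = poly q t)"
      using Suc(5)[of "a(n := \<tau>)" "b(n := 0)"] by simp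
  qed
  then obtain Q\<tau> where Q\<tau>: "\<And>\<tau>. \<tau> \<in> S \<Longrightarrow> Q\<tau> \<tau> \<in> poly_funs n"
    "\<And>\<tau> x. \<tau> \<in> S \<Longrightarrow> D (x(n := \<tau>)) \<noteq> 0 \<Longrightarrow> e (x(n := \<tau>)) = Q\<tau> \<tau> x" by metis
  define Q where "Q x = (\<Sum>\<tau>\<in>S. Q\<tau> \<tau> x * (\<Prod>\<sigma>\<in>S-{\<tau>}. (x n - \<sigma>) * (1 / (\<tau> - \<sigma>))))" for x
  have Q: "Q \<in> poly_funs (Suc n)" unfolding Q_def
    by (intro poly_funs_intros) (auto intro: poly_funs_mono[OF Q\<tau>(1)])
  \<comment> \<open>Off the zeros of \<open>D'\<close> the line parallel to the last axis meets all slices outside the zeros of \<open>D\<close>.\<close>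
  define D' where "D' x = D x * (\<Prod>\<tau>\<in>S. D (x(n := \<tau>)))" for x
  have D': "D' \<in> poly_funs (Suc n)" unfolding D'_def
  proof (intro poly_funs_intros Suc(2))
    fix \<tau>
    have "(\<lambda>x. D (\<lambda>i. if i = n then \<tau> else x i)) \<in> poly_funs (Suc n)"
    proof (rule poly_funs_subst[OF Suc(2)])
      fix i assume "i < Suc n"
      then show "(\<lambda>x. if i = n then \<tau> else x i) \<in> poly_funs (Suc n)"
        by (cases "i = n") (auto intro: poly_funs.intros)
    qed
    then show "(\<lambda>x. D (x(n := \<tau>))) \<in> poly_funs (Suc n)" by (simp add: fun_upd_def)
  qed
  have "D' w \<noteq> 0" using S Suc(3) by (auto simp: D'_def)
  have eQ': "e x = Q x" if "D' x \<noteq> 0" for x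
  proof -
    have Dx: "D x \<noteq> 0" "\<And>\<tau>. \<tau> \<in> S \<Longrightarrow> D (x(n := \<tau>)) \<noteq> 0" using that S(1) by (auto simp: D'_def)
    obtain q where q: "degree q \<le> M" "\<And>t. D (x(n := t)) \<noteq> 0 \<Longrightarrow> e (x(n := t)) = poly q t"
      using Suc(5)[of "x(n := 0)" "\<lambda>i. if i = n then 1 else 0"] unfolding upd[symmetric] by blast
    have "e x = poly q (x n)" using q(2)[of "x n"] Dx(1) by simp
    also have "\<dots> = (\<Sum>\<tau>\<in>S. poly q \<tau> * (\<Prod>\<sigma>\<in>S-{\<tau>}. (x n - \<sigma>) / (\<tau> - \<sigma>)))"
      by (rule lagrange_interpolation[OF S(1,2) q(1)])
    also have "\<dots> = Q x" unfolding Q_def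
    proof (intro sum.cong refl)
      fix \<tau> assume \<tau>: "\<tau> \<in> S"
      then have "poly q \<tau> = Q\<tau> \<tau> x" using q(2) Q\<tau>(2) Dx(2) by metis
      then show "poly q \<tau> * (\<Prod>\<sigma>\<in>S-{\<tau>}. (x n - \<sigma>) / (\<tau> - \<sigma>)) =
        Q\<tau> \<tau> x * (\<Prod>\<sigma>\<in>S-{\<tau>}. (x n - \<sigma>) * (1 / (\<tau> - \<sigma>)))" by simp
    qed
    finally show ?thesis .
  qed
  have "e x = Q x" if x: "D x \<noteq> 0" for x
  proof -
    \<comment> \<open>On the line from \<open>x\<close> to \<open>w\<close> the two polynomials agree at all but finitely many points.\<close>
    define b where "b i = w i - x i" for i
    obtain q where q: "\<And>t. D (\<lambda>i. x i + t * b i) \<noteq> 0 \<Longrightarrow> e (\<lambda>i. x i + t * b i) = poly q t"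
      using Suc(5)[of x b] by blast
    obtain q' where q': "\<And>t. Q (\<lambda>i. x i + t * b i) = poly q' t"
      using poly_funs_line_deg[OF Q] unfolding line_deg_def by blast
    have "D' (\<lambda>i. x i + 1 * b i) \<noteq> 0" using \<open>D' w \<noteq> 0\<close> by (simp add: b_def)
    then have fin: "finite {t. D' (\<lambda>i. x i + t * b i) = 0}" by (rule finite_zeros_on_line[OF D'])
    have "poly q t = poly q' t" if "D' (\<lambda>i. x i + t * b i) \<noteq> 0" for t
      using eQ'[OF that] q[of t] q'[of t] that by (simp add: D'_def)
    then have "{t. poly (q - q') t \<noteq> 0} \<subseteq> {t. D' (\<lambda>i. x i + t * b i) = 0}" by auto
    then have "finite {t. poly (q - q') t \<noteq> 0}" using fin finite_subset by blast
    moreover have "UNIV = {t. poly (q - q') t \<noteq> 0} \<union> {t. poly (q - q') t = 0}" by auto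
    ultimately have "infinite {t. poly (q - q') t = 0}"
      using infinite_UNIV_char_0[where 'a = complex] by (metis finite_UnI)
    then have "q = q'" using poly_roots_finite[of "q - q'"] by auto
    then show ?thesis using q[of 0] q'[of 0] x by simp
  qed
  then show ?case using Q by blast
qed

text \<open>Riemann's theorem on removable singularities followed by Liouville's theorem.\<close>

lemma polynomial_if_holomorphic_polynomial_growth:
  assumes "finite Z" "\<phi> holomorphic_on (- Z)" "\<And>t. t \<notin> Z \<Longrightarrow> cmod (\<phi> t) \<le> C * (1 + cmod t) ^ M"
  shows "\<exists>q. degree q \<le> M \<and> (\<forall>t. t \<notin> Z \<longrightarrow> \<phi> t = poly q t)"
proof -
  have "\<phi> \<in> O[at z](\<lambda>_. 1)" for z
  proof -
    have "((\<lambda>t. C * (1 + cmod t) ^ M) \<longlongrightarrow> C * (1 + cmod z) ^ M) (at z)" by (intro tendsto_intros)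
    then have "\<forall>\<^sub>F t in at z. dist (C * (1 + cmod t) ^ M) (C * (1 + cmod z) ^ M) < 1"
      by (rule tendstoD) simp
    moreover have "\<forall>\<^sub>F t in at z. t \<notin> Z"
      using islimpt_finite[OF assms(1), of z] by (simp add: islimpt_iff_eventually)
    ultimately have "\<forall>\<^sub>F t in at z. cmod (\<phi> t) \<le> (C * (1 + cmod z) ^ M + 1) * cmod 1"
    proof eventually_elim
      case (elim t)
      then show ?case using assms(3)[of t] by (auto simp: dist_real_def)
    qed
    then show ?thesis by (rule bigoI)
  qed
  then have "\<exists>g. g holomorphic_on UNIV \<and> (\<forall>z\<in>UNIV-Z. g z = \<phi> z)"
    using assms(1,2) by (intro removable_singularities) (auto simp: Compl_eq_Diff_UNIV)
  then obtain g where g: "g holomorphic_on UNIV" "\<And>z. z \<notin> Z \<Longrightarrow> g z = \<phi> z" by blast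
  obtain B where B: "\<And>z. z \<in> Z \<Longrightarrow> cmod z \<le> B"
    using finite_imp_bounded[OF assms(1)] by (auto simp: bounded_iff)
  have "cmod (g z) \<le> (\<bar>C\<bar> * 2 ^ M) * cmod z ^ M" if "max 1 (B + 1) \<le> cmod z" for z
  proof -
    have "z \<notin> Z" using B that by force
    then have "cmod (g z) \<le> C * (1 + cmod z) ^ M" using assms(3) g(2) by simp
    also have "\<dots> \<le> \<bar>C\<bar> * (2 * cmod z) ^ M"
      using that by (intro mult_mono power_mono) auto
    finally show ?thesis by (simp add: power_mult_distrib)
  qed
  from Liouville_polynomial[OF g(1) this]
  have gp: "g z = (\<Sum>k\<le>M. (deriv ^^ k) g 0 / fact k * z ^ k)" for z by blast
  define q where "q = (\<Sum>k\<le>M. monom ((deriv ^^ k) g 0 / fact k) k)"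
  have "degree q \<le> M" unfolding q_def by (intro degree_sum_le) (auto intro: order_trans[OF degree_monom_le])
  moreover have "g z = poly q z" for z
    by (subst gp) (simp add: q_def poly_sum poly_monom)
  ultimately show ?thesis using g(2) by metis
qed

section \<open>Polynomial functions on small boxes\<close>

lemma poly_funs_tendsto:
  assumes "p \<in> poly_funs m" "\<And>l. l < m \<Longrightarrow> ((\<lambda>n. x n l) \<longlongrightarrow> x0 l) F"
  shows "((\<lambda>n. p (x n)) \<longlongrightarrow> p x0) F"
  using assms by (induct rule: poly_funs.induct) (auto intro: tendsto_add tendsto_mult)

text \<open>The radii \<open>1 / (n + 1)\<close> are those met when a statement about small boxes is refuted for every size.\<close>

lemma near_sequence_tendsto:
  assumes "\<And>n. near m (1 / real (Suc n)) x0 (x n)" "l < m"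
  shows "(\<lambda>n. x n l) \<longlonglongrightarrow> x0 l"
proof (rule LIM_zero_cancel, rule Lim_null_comparison)
  show "\<forall>\<^sub>F n in sequentially. norm (x n l - x0 l) \<le> 1 / real (Suc n)"
    using assms unfolding near_def by (auto intro!: always_eventually less_imp_le)
  show "(\<lambda>n. 1 / real (Suc n)) \<longlonglongrightarrow> 0" using LIMSEQ_inverse_real_of_nat by (simp add: inverse_eq_divide)
qed

lemma near_mono: "near m \<delta> x0 x \<Longrightarrow> \<delta> \<le> \<epsilon> \<Longrightarrow> near m \<epsilon> x0 x"
  unfolding near_def by force

lemma poly_funs_nonzero_near:
  assumes "b \<in> poly_funs m" "b x0 \<noteq> 0"
  shows "\<exists>\<delta>>0. \<forall>x. near m \<delta> x0 x \<longrightarrow> b x \<noteq> 0"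
proof (rule ccontr)
  assume "\<not> ?thesis"
  then have "\<forall>n. \<exists>x. near m (1 / real (Suc n)) x0 x \<and> b x = 0"
    by (metis of_nat_0_less_iff zero_less_Suc zero_less_divide_1_iff)
  then obtain x where x: "\<And>n. near m (1 / real (Suc n)) x0 (x n)" "\<And>n. b (x n) = 0" by metis
  have "(\<lambda>n. b (x n)) \<longlonglongrightarrow> b x0"
    by (rule poly_funs_tendsto[OF assms(1)]) (rule near_sequence_tendsto[OF x(1)])
  then show False using x(2) assms(2) LIMSEQ_unique[of "\<lambda>n. 0" 0 "b x0"] by simp
qed

lemma near_finite_all:
  assumes "finite I" "\<And>i. i \<in> I \<Longrightarrow> \<exists>\<delta>>0. \<forall>x. near m \<delta> x0 x \<longrightarrow> P i x"
  shows "\<exists>\<delta>>0. \<forall>x. near m \<delta> x0 x \<longrightarrow> (\<forall>i\<in>I. P i x)"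
  using assms
proof (induct I rule: finite_induct)
  case empty
  then show ?case by (auto intro: exI[of _ 1])
next
  case (insert i I)
  then obtain d e where "d > 0" "\<forall>x. near m d x0 x \<longrightarrow> P i x" "e > 0"
    "\<forall>x. near m e x0 x \<longrightarrow> (\<forall>i\<in>I. P i x)" by (metis insertCI)
  then show ?case by (intro exI[of _ "min d e"]) (auto dest: near_mono[of m "min d e" x0 _ d] near_mono[of m "min d e" x0 _ e])
qed

lemma right_inverse_near_continuous:
  assumes s: "right_inverse_near N k G z0 \<delta> s"
    and \<gamma>: "\<And>j. j < k \<Longrightarrow> continuous_on S (\<lambda>t. \<gamma> t j)"
    and near: "\<And>t. t \<in> S \<Longrightarrow> near k \<delta> (\<lambda>j. G j z0) (\<gamma> t)"
  shows "continuous_on S (\<lambda>t. s (\<gamma> t))"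
proof (rule continuous_on_coordinatewise_then_product)
  fix i
  obtain C where C: "\<And>y y' i. near k \<delta> (\<lambda>j. G j z0) y \<Longrightarrow> near k \<delta> (\<lambda>j. G j z0) y' \<Longrightarrow>
    cmod (s y i - s y' i) \<le> C * (\<Sum>j<k. cmod (y j - y' j))"
    using right_inverse_near_Lipschitz[OF s] by blast
  show "continuous_on S (\<lambda>t. s (\<gamma> t) i)"
    unfolding continuous_on_def
  proof
    fix t0 assume t0: "t0 \<in> S"
    have "((\<lambda>t. C * (\<Sum>j<k. cmod (\<gamma> t j - \<gamma> t0 j))) \<longlongrightarrow> C * (\<Sum>j<k. cmod (\<gamma> t0 j - \<gamma> t0 j))) (at t0 within S)"
      using \<gamma> t0 unfolding continuous_on_def by (intro tendsto_intros) auto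
    then have "((\<lambda>t. C * (\<Sum>j<k. cmod (\<gamma> t j - \<gamma> t0 j))) \<longlongrightarrow> 0) (at t0 within S)" by simp
    then have "((\<lambda>t. s (\<gamma> t) i - s (\<gamma> t0) i) \<longlongrightarrow> 0) (at t0 within S)"
      by (rule Lim_null_comparison[rotated]) (use C near t0 in \<open>auto simp: eventually_at_filter\<close>)
    then show "((\<lambda>t. s (\<gamma> t) i) \<longlongrightarrow> s (\<gamma> t0) i) (at t0 within S)" by (simp add: LIM_zero_iff)
  qed
qed

text \<open>Coordinates of the points of a fibre satisfy equations with leading coefficient \<open>a d\<close>; after multiplication by
it they are bounded by the coefficients.\<close>

section \<open>Polynomial growth along lines\<close>

lemma root_bound:
  assumes "(\<Sum>k\<le>d. a k * t ^ k) = (0::complex)"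
  shows "cmod (a d * t) \<le> (\<Sum>k\<le>d. cmod (a k))"
proof (cases "cmod t \<le> 1")
  case True
  then have "cmod (a d * t) \<le> cmod (a d)" by (simp add: norm_mult mult_left_le)
  also have "\<dots> \<le> (\<Sum>k\<le>d. cmod (a k))" by (rule member_le_sum) auto
  finally show ?thesis .
next
  case False
  then have t: "cmod t \<ge> 1" "t \<noteq> 0" by auto
  have "(\<Sum>k\<le>d. a k * t ^ k) = (\<Sum>k<d. a k * t ^ k) + a d * t ^ d"
    by (simp add: lessThan_Suc_atMost[symmetric])
  then have "a d * t ^ d = - (\<Sum>k<d. a k * t ^ k)" using assms by (simp add: eq_neg_iff_add_eq_0 add.commute)
  then have "cmod (a d) * cmod t ^ d \<le> (\<Sum>k<d. cmod (a k) * cmod t ^ k)"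
  proof -
    assume *: "a d * t ^ d = - (\<Sum>k<d. a k * t ^ k)"
    have "cmod (a d) * cmod t ^ d = cmod (a d * t ^ d)" by (simp add: norm_mult norm_power)
    also have "\<dots> = cmod (\<Sum>k<d. a k * t ^ k)" unfolding * by simp
    also have "\<dots> \<le> (\<Sum>k<d. cmod (a k * t ^ k))" by (rule norm_sum)
    finally show ?thesis by (simp add: norm_mult norm_power)
  qed
  also have "\<dots> \<le> (\<Sum>k<d. cmod (a k) * cmod t ^ (d - 1))"
    using t by (intro sum_mono mult_left_mono power_increasing) auto
  finally have *: "cmod (a d) * cmod t ^ d \<le> (\<Sum>k<d. cmod (a k)) * cmod t ^ (d - 1)"
    by (simp add: sum_distrib_right)
  have "cmod (a d * t) \<le> (\<Sum>k<d. cmod (a k))"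
  proof (cases d)
    case 0
    then show ?thesis using assms by simp
  next
    case (Suc e)
    have "cmod t ^ e > 0" using t by simp
    then show ?thesis using * Suc by (simp add: norm_mult mult.assoc[symmetric])
  qed
  also have "\<dots> \<le> (\<Sum>k\<le>d. cmod (a k))" by (intro sum_mono2) auto
  finally show ?thesis .
qed

text \<open>Polynomial growth along each line, with a constant depending on the line but with a common exponent.\<close>

definition line_growth :: "((nat \<Rightarrow> complex) \<Rightarrow> real) \<Rightarrow> nat \<Rightarrow> bool" where
  "line_growth g M \<longleftrightarrow> (\<forall>a b. \<exists>C\<ge>0. \<forall>t. \<bar>g (\<lambda>i. a i + t * b i)\<bar> \<le> C * (1 + cmod t) ^ M)"

lemma line_growth_mono: "line_growth g M \<Longrightarrow> M \<le> K \<Longrightarrow> line_growth g K"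
  unfolding line_growth_def
proof (intro allI)
  fix a b assume "\<forall>a b. \<exists>C\<ge>0. \<forall>t. \<bar>g (\<lambda>i. a i + t * b i)\<bar> \<le> C * (1 + cmod t) ^ M" and MK: "M \<le> K"
  then obtain C where C: "C \<ge> 0" "\<And>t. \<bar>g (\<lambda>i. a i + t * b i)\<bar> \<le> C * (1 + cmod t) ^ M" by blast
  have "C * (1 + cmod t) ^ M \<le> C * (1 + cmod t) ^ K" for t
    using C(1) MK by (intro mult_left_mono power_increasing) auto
  then show "\<exists>C\<ge>0. \<forall>t. \<bar>g (\<lambda>i. a i + t * b i)\<bar> \<le> C * (1 + cmod t) ^ K"
    using C order_trans by blast
qed

lemma line_growth_mult:
  assumes "line_growth g M" "line_growth h K"
  shows "line_growth (\<lambda>x. g x * h x) (M + K)"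
  unfolding line_growth_def
proof (intro allI)
  fix a b
  obtain C D where C: "C \<ge> 0" "\<And>t. \<bar>g (\<lambda>i. a i + t * b i)\<bar> \<le> C * (1 + cmod t) ^ M"
    "D \<ge> 0" "\<And>t. \<bar>h (\<lambda>i. a i + t * b i)\<bar> \<le> D * (1 + cmod t) ^ K"
    using assms unfolding line_growth_def by meson
  have "\<bar>g (\<lambda>i. a i + t * b i) * h (\<lambda>i. a i + t * b i)\<bar> \<le> C * D * (1 + cmod t) ^ (M + K)" for t
  proof -
    have "\<bar>g (\<lambda>i. a i + t * b i)\<bar> * \<bar>h (\<lambda>i. a i + t * b i)\<bar> \<le> (C * (1 + cmod t) ^ M) * (D * (1 + cmod t) ^ K)"
      using C by (intro mult_mono) auto
    then show ?thesis by (simp add: abs_mult power_add mult_ac)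
  qed
  then show "\<exists>C\<ge>0. \<forall>t. \<bar>g (\<lambda>i. a i + t * b i) * h (\<lambda>i. a i + t * b i)\<bar> \<le> C * (1 + cmod t) ^ (M + K)"
    using C(1,3) by (intro exI[of _ "C * D"]) auto
qed

lemma line_growth_add:
  assumes "line_growth g M" "line_growth h M"
  shows "line_growth (\<lambda>x. g x + h x) M"
  unfolding line_growth_def
proof (intro allI)
  fix a b
  obtain C D where C: "C \<ge> 0" "\<And>t. \<bar>g (\<lambda>i. a i + t * b i)\<bar> \<le> C * (1 + cmod t) ^ M"
    "D \<ge> 0" "\<And>t. \<bar>h (\<lambda>i. a i + t * b i)\<bar> \<le> D * (1 + cmod t) ^ M"
    using assms unfolding line_growth_def by meson
  have "\<bar>g (\<lambda>i. a i + t * b i) + h (\<lambda>i. a i + t * b i)\<bar> \<le> (C + D) * (1 + cmod t) ^ M" for t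
    using C(2)[of t] C(4)[of t] by (simp add: distrib_right)
  then show "\<exists>C\<ge>0. \<forall>t. \<bar>g (\<lambda>i. a i + t * b i) + h (\<lambda>i. a i + t * b i)\<bar> \<le> C * (1 + cmod t) ^ M"
    using C(1,3) by (intro exI[of _ "C + D"]) auto
qed

lemma line_growth_const: "line_growth (\<lambda>x. c) M"
proof -
  have "line_growth (\<lambda>x. c) 0" unfolding line_growth_def by (intro allI exI[of _ "\<bar>c\<bar>"]) auto
  then show ?thesis by (rule line_growth_mono) simp
qed

lemma line_growth_power: "line_growth g M \<Longrightarrow> line_growth (\<lambda>x. g x ^ k) (k * M)"
  by (induct k) (auto intro: line_growth_const line_growth_mult)

lemma poly_growth:
  assumes "degree q \<le> D"
  shows "\<exists>C\<ge>0. \<forall>t. cmod (poly q t) \<le> C * (1 + cmod t) ^ D"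
proof (intro exI conjI allI)
  show "(\<Sum>k\<le>degree q. cmod (coeff q k)) \<ge> 0" by (intro sum_nonneg) auto
  fix t
  have "cmod (poly q t) \<le> (\<Sum>k\<le>degree q. cmod (coeff q k * t ^ k))"
    unfolding poly_altdef by (rule norm_sum)
  also have "\<dots> \<le> (\<Sum>k\<le>degree q. cmod (coeff q k) * (1 + cmod t) ^ D)"
  proof (rule sum_mono)
    fix k assume "k \<in> {..degree q}"
    then have "cmod t ^ k \<le> (1 + cmod t) ^ k" "(1 + cmod t) ^ k \<le> (1 + cmod t) ^ D"
      using assms by (auto intro!: power_mono power_increasing)
    then show "cmod (coeff q k * t ^ k) \<le> cmod (coeff q k) * (1 + cmod t) ^ D"
      unfolding norm_mult norm_power by (intro mult_left_mono) auto
  qed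
  finally show "cmod (poly q t) \<le> (\<Sum>k\<le>degree q. cmod (coeff q k)) * (1 + cmod t) ^ D"
    by (simp add: sum_distrib_right)
qed

lemma poly_funs_line_growth: "p \<in> poly_funs n \<Longrightarrow> \<exists>M. line_growth (\<lambda>x. cmod (p x)) M"
proof -
  assume "p \<in> poly_funs n"
  then obtain D where D: "line_deg p D" using poly_funs_line_deg by blast
  have "line_growth (\<lambda>x. cmod (p x)) D"
    unfolding line_growth_def
  proof (intro allI)
    fix a b
    obtain q where q: "degree q \<le> D" "\<And>t. p (\<lambda>i. a i + t * b i) = poly q t"
      using D unfolding line_deg_def by blast
    show "\<exists>C\<ge>0. \<forall>t. \<bar>cmod (p (\<lambda>i. a i + t * b i))\<bar> \<le> C * (1 + cmod t) ^ D"
      unfolding q(2) using poly_growth[OF q(1)] by simp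
  qed
  then show ?thesis by blast
qed

lemma line_growth_ex_add:
  assumes "\<exists>M. line_growth g M" "\<exists>M. line_growth h M"
  shows "\<exists>M. line_growth (\<lambda>x. g x + h x) M"
proof -
  obtain M K where "line_growth g M" "line_growth h K" using assms by blast
  then have "line_growth (\<lambda>x. g x + h x) (max M K)"
    by (intro line_growth_add) (auto intro: line_growth_mono)
  then show ?thesis by blast
qed

lemma line_growth_ex_mult:
  assumes "\<exists>M. line_growth g M" "\<exists>M. line_growth h M"
  shows "\<exists>M. line_growth (\<lambda>x. g x * h x) M"
proof -
  obtain M K where "line_growth g M" "line_growth h K" using assms by blast
  then have "line_growth (\<lambda>x. g x * h x) (M + K)" by (rule line_growth_mult)
  then show ?thesis by blast
qed

lemma line_growth_ex_sum:
  assumes "finite I" "\<And>i. i \<in> I \<Longrightarrow> \<exists>M. line_growth (g i) M"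
  shows "\<exists>M. line_growth (\<lambda>x. \<Sum>i\<in>I. g i x) M"
  using assms
proof (induct I rule: finite_induct)
  case empty
  then show ?case using line_growth_const[of 0 0] by auto
next
  case (insert i I)
  have "\<exists>M. line_growth (\<lambda>x. g i x + (\<Sum>i\<in>I. g i x)) M"
    by (rule line_growth_ex_add) (use insert in auto)
  then show ?case using insert by simp
qed

text \<open>The values \<open>\<mu>\<close> to be avoided are zeros of finitely many nonzero linear polynomials.\<close>

section \<open>Etale coordinates on a smooth irreducible affine variety\<close>

lemma separating_linear_form:
  fixes F :: "(nat \<Rightarrow> complex) set" and N :: nat
  assumes "finite F" "\<And>v. v \<in> F \<Longrightarrow> \<exists>i<N. v i \<noteq> (0::complex)"
  shows "\<exists>\<mu>. \<forall>v\<in>F. (\<Sum>i<N. v i * \<mu> i) \<noteq> 0"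
proof (rule poly_funs_common_nonzero_finite[where n = N, OF assms(1)])
  fix v assume "v \<in> F"
  show "(\<lambda>\<mu>. \<Sum>i<N. v i * \<mu> i) \<in> poly_funs N" by (intro poly_funs_intros) auto
  obtain i where "i < N" "v i \<noteq> 0" using assms(2)[OF \<open>v \<in> F\<close>] by blast
  then have "(\<Sum>k<N. v k * (if k = i then 1 else 0)) \<noteq> 0"
    by (simp add: if_distrib[of "\<lambda>x. _ * x"] cong: if_cong)
  then show "\<exists>\<mu>. (\<Sum>i<N. v i * \<mu> i) \<noteq> 0" by (rule exI[of _ "\<lambda>k. if k = i then 1 else 0"])
qed

text \<open>A smooth affine variety in \<open>\<complex>\<^sup>N\<close> of codimension \<open>c\<close>. Irreducibility is expressed by products of polynomials;
it does not exclude the empty set.\<close>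

locale smooth_irreducible_zeros =
  fixes N c :: nat and f :: "nat \<Rightarrow> (nat \<Rightarrow> complex) \<Rightarrow> complex" and V
  defines "V \<equiv> zeros N (f ` {..<c})"
  assumes sub: "submersive N c f"
    and irreducible: "\<And>p q. p \<in> poly_funs N \<Longrightarrow> q \<in> poly_funs N \<Longrightarrow> \<forall>z\<in>V. p z * q z = 0 \<Longrightarrow>
      (\<forall>z\<in>V. p z = 0) \<or> (\<forall>z\<in>V. q z = 0)"
begin

lemma V_iff: "z \<in> V \<longleftrightarrow> z \<in> affine_space N \<and> (\<forall>j<c. f j z = 0)"
  unfolding V_def by (rule zeros_iff)

lemma f_poly: "j < c \<Longrightarrow> f j \<in> poly_funs N"
  using sub by (simp add: submersive_def)

lemma indep_rows_V: "z \<in> V \<Longrightarrow> indep_rows c N (\<lambda>j i. partial_deriv i (f j) z)"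
  using sub by (simp add: submersive_def V_def)

lemma nonvanishing_power:
  assumes "p \<in> poly_funs N" "v \<in> V" "p v \<noteq> 0" "q \<in> poly_funs N" "\<forall>z\<in>V. p z ^ e * q z = 0"
  shows "\<forall>z\<in>V. q z = 0"
  using irreducible[OF poly_funs_power[OF assms(1)] assms(4,5)] assms(2,3) by auto

text \<open>The projection of the zero set of \<open>D\<close> lies in a hypersurface \<open>b = 0\<close>: in a relation between \<open>D\<close> and the \<open>\<pi> l\<close>,
divided by powers of \<open>D\<close> using irreducibility, the constant term \<open>b\<close> vanishes where \<open>D\<close> does.\<close>

lemma nonvanishing_detected_below:
  assumes N: "N = c + m" and \<pi>: "\<And>l. l < m \<Longrightarrow> \<pi> l \<in> poly_funs N"
    and D: "D \<in> poly_funs N" "v \<in> V" "D v \<noteq> 0"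
  shows "\<exists>b\<in>poly_funs m. (\<exists>X. b X \<noteq> 0) \<and> (\<forall>z\<in>V. b (\<lambda>l. \<pi> l z) \<noteq> 0 \<longrightarrow> D z \<noteq> 0)"
proof -
  define g where "g l = (if l < m then \<pi> l else D)" for l
  have g: "g l \<in> poly_funs N" for l using \<pi> D by (simp add: g_def)
  obtain Q Y where Q: "Q \<in> poly_funs (Suc m)" "Q Y \<noteq> 0" "\<And>z. z \<in> V \<Longrightarrow> Q (\<lambda>l. g l z) = 0"
    using algebraic_dependence_on_zeros[OF sub N, of g] g unfolding V_def by blast
  obtain e b Q' where Q': "Q' \<in> poly_funs (Suc m)" "b \<in> poly_funs m" "\<exists>X. b X \<noteq> 0"
    "\<And>x. Q x = x m ^ e * Q' x" "\<And>x. x m = 0 \<Longrightarrow> Q' x = b x"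
    using poly_funs_lowest_term[OF Q(1,2)] by blast
  have "(\<lambda>z. Q' (\<lambda>l. g l z)) \<in> poly_funs N" by (rule poly_funs_subst[OF Q'(1)]) (rule g)
  moreover have "\<forall>z\<in>V. D z ^ e * Q' (\<lambda>l. g l z) = 0"
    using Q(3) Q'(4) by (auto simp: g_def)
  ultimately have *: "\<forall>z\<in>V. Q' (\<lambda>l. g l z) = 0"
    by (rule nonvanishing_power[OF D])
  have "b (\<lambda>l. \<pi> l z) = 0" if "z \<in> V" "D z = 0" for z
  proof -
    have "b (\<lambda>l. \<pi> l z) = b (\<lambda>l. g l z)" by (rule poly_funs_cong[OF Q'(2)]) (simp add: g_def)
    also have "\<dots> = Q' (\<lambda>l. g l z)" using Q'(5)[of "\<lambda>l. g l z"] that(2) by (simp add: g_def)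
    finally show ?thesis using * that(1) by simp
  qed
  then show ?thesis using Q'(2,3) by blast
qed

text \<open>The relation between \<open>y\<close> and the \<open>\<pi> l\<close> read as a polynomial in \<open>y\<close>. Its leading coefficient is nonzero as
a polynomial of \<open>m\<close> variables.\<close>

lemma algebraic_over_projection:
  assumes N: "N = c + m" and \<pi>: "\<And>l. l < m \<Longrightarrow> \<pi> l \<in> poly_funs N" and y: "y \<in> poly_funs N"
  shows "\<exists>d a. (\<forall>k. a k \<in> poly_funs m) \<and> (\<exists>X. a d X \<noteq> 0) \<and>
    (\<forall>z\<in>V. (\<Sum>k\<le>d. a k (\<lambda>l. \<pi> l z) * y z ^ k) = 0)"
proof -
  define g where "g l = (if l < m then \<pi> l else y)" for l
  have g: "g l \<in> poly_funs N" for l using \<pi> y by (simp add: g_def)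
  obtain Q Y where Q: "Q \<in> poly_funs (Suc m)" "Q Y \<noteq> 0" "\<And>z. z \<in> V \<Longrightarrow> Q (\<lambda>l. g l z) = 0"
    using algebraic_dependence_on_zeros[OF sub N, of g] g unfolding V_def by blast
  obtain d a where a: "\<And>k. a k \<in> poly_funs m" "\<exists>X. a d X \<noteq> 0"
    "\<And>x. Q x = (\<Sum>k\<le>d. a k x * x m ^ k)"
    using poly_funs_highest_term[OF Q(1,2)] by blast
  have "(\<Sum>k\<le>d. a k (\<lambda>l. \<pi> l z) * y z ^ k) = 0" if "z \<in> V" for z
  proof -
    have "a k (\<lambda>l. \<pi> l z) = a k (\<lambda>l. g l z)" for k
      by (rule poly_funs_cong[OF a(1)]) (simp add: g_def)
    then show ?thesis using Q(3)[OF that] a(3)[of "\<lambda>l. g l z"] by (simp add: g_def)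
  qed
  then show ?thesis using a(1,2) by blast
qed

text \<open>The Jacobian matrix of \<open>coords\<close>.\<close>

definition rows :: "(nat \<Rightarrow> nat) \<Rightarrow> (nat \<Rightarrow> complex) \<Rightarrow> nat \<Rightarrow> nat \<Rightarrow> complex" where
  "rows \<iota> z j i = (if j < c then partial_deriv i (f j) z else if i = \<iota> (j - c) then 1 else 0)"

text \<open>The equations of \<open>V\<close> completed by the coordinates with indices \<open>\<iota> 0, \<iota> 1, \<dots>\<close> to a map \<open>\<complex>\<^sup>N \<rightarrow> \<complex>\<^sup>N\<close>.
Where its Jacobian matrix is invertible, these coordinates are local parameters on \<open>V\<close>.\<close>

definition coords :: "(nat \<Rightarrow> nat) \<Rightarrow> nat \<Rightarrow> (nat \<Rightarrow> complex) \<Rightarrow> complex" where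
  "coords \<iota> j z = (if j < c then f j z else z (\<iota> (j - c)))"

text \<open>The target value of \<open>coords\<close> that describes a point of \<open>V\<close> with parameters \<open>x\<close>.\<close>

definition pad :: "(nat \<Rightarrow> complex) \<Rightarrow> nat \<Rightarrow> complex" where
  "pad x j = (if j < c then 0 else x (j - c))"

lemma coords_strict_diff:
  assumes "\<And>l. l < N - c \<Longrightarrow> \<iota> l < N" "j < N"
  shows "strict_diff N (coords \<iota> j) z (rows \<iota> z j)"
proof (cases "j < c")
  case True
  then have "coords \<iota> j = f j" "rows \<iota> z j = (\<lambda>i. partial_deriv i (f j) z)"
    by (auto simp: coords_def rows_def fun_eq_iff)
  then show ?thesis using poly_funs_strict_diff_partial_deriv[OF f_poly[OF True]] by simp
next
  case False
  then have "coords \<iota> j = (\<lambda>z. z (\<iota> (j - c)))" "rows \<iota> z j = (\<lambda>i. if i = \<iota> (j - c) then 1 else 0)"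
    by (auto simp: coords_def rows_def fun_eq_iff)
  moreover have "\<iota> (j - c) < N" using assms False by simp
  ultimately show ?thesis using strict_diff_coord by simp
qed

lemma etale_coordinates:
  assumes "z \<in> V"
  shows "\<exists>\<iota>. (\<forall>l<N-c. \<iota> l < N) \<and> indep_rows N N (rows \<iota> z)"
proof -
  have "rows \<iota> z = (\<lambda>j i. if j < c then partial_deriv i (f j) z else if i = \<iota> (j - c) then 1 else 0)" for \<iota>
    by (intro ext) (simp add: rows_def)
  then show ?thesis using extend_rows_by_coordinates[OF indep_rows_V[OF assms]] by simp
qed

lemma c_le_N: "z \<in> V \<Longrightarrow> c \<le> N"
  using indep_rows_V indep_rows_le by blast

lemma coords_section:
  assumes z: "z \<in> V" and \<iota>: "\<And>l. l < N - c \<Longrightarrow> \<iota> l < N" and rows: "indep_rows N N (rows \<iota> z)"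
  shows "\<exists>\<delta> s. right_inverse_near N N (coords \<iota>) z \<delta> s"
proof (rule local_section[OF _ _ rows])
  show "z \<in> affine_space N" using z V_iff by blast
  show "strict_diff N (coords \<iota> j) z (rows \<iota> z j)" if "j < N" for j
    using coords_strict_diff[of \<iota>, OF \<iota> that] .
qed

lemma near_pad:
  assumes z: "z \<in> V" and x0: "\<And>l. l < N - c \<Longrightarrow> z (\<iota> l) = x0 l" and x: "near (N - c) \<delta> x0 x" and "\<delta> > 0"
  shows "near N \<delta> (\<lambda>j. coords \<iota> j z) (pad x)"
  unfolding near_def
proof (intro allI impI)
  fix j assume "j < N"
  then show "cmod (pad x j - coords \<iota> j z) < \<delta>"
    using assms V_iff[of z] unfolding near_def pad_def coords_def by (cases "j < c") auto
qed

lemma coords_section_in_V: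
  assumes s: "right_inverse_near N N (coords \<iota>) z \<delta> s" and z: "z \<in> V"
    and x: "near N \<delta> (\<lambda>j. coords \<iota> j z) (pad x)"
  shows "s (pad x) \<in> V" "l < N - c \<Longrightarrow> s (pad x) (\<iota> l) = x l"
proof -
  have "coords \<iota> j (s (pad x)) = pad x j" if "j < N" for j
    using right_inverse_nearD(4)[OF s x that] .
  then have *: "j < N \<Longrightarrow> (if j < c then f j (s (pad x)) else s (pad x) (\<iota> (j - c))) = (if j < c then 0 else x (j - c))" for j
    by (simp only: coords_def pad_def)
  have "f j (s (pad x)) = 0" if "j < c" for j using *[of j] that c_le_N[OF z] by simp
  then show "s (pad x) \<in> V" using right_inverse_nearD(3)[OF s x] by (simp add: V_iff)
  show "l < N - c \<Longrightarrow> s (pad x) (\<iota> l) = x l" using *[of "l + c"] by simp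
qed

text \<open>In local parameters at \<open>y\<close> the zeros of \<open>D\<close> are contained in a hypersurface \<open>b = 0\<close>. Moving \<open>y\<close> along
a line not contained in it leaves the hypersurface at once, and \<open>q\<close> stays nonzero for a short time.\<close>

lemma connect_to_dense_open:
  assumes D: "D \<in> poly_funs N" "v \<in> V" "D v \<noteq> 0" and q: "q \<in> poly_funs N" and y: "y \<in> V" "q y \<noteq> 0"
  shows "\<exists>z\<in>V. D z \<noteq> 0 \<and> path_component {z\<in>V. q z \<noteq> 0} y z"
proof -
  define m where "m = N - c"
  have N: "N = c + m" using c_le_N[OF y(1)] by (simp add: m_def)
  obtain \<iota> where \<iota>: "\<And>l. l < N - c \<Longrightarrow> \<iota> l < N" "indep_rows N N (rows \<iota> y)"
    using etale_coordinates[OF y(1)] by blast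
  obtain \<delta> s where s: "right_inverse_near N N (coords \<iota>) y \<delta> s"
    using coords_section[OF y(1) \<iota>] by blast
  have "(\<lambda>z. z (\<iota> l)) \<in> poly_funs N" if "l < m" for l
    using \<iota>(1) that by (intro poly_funs.coord) (simp add: m_def)
  then obtain b X where b: "b \<in> poly_funs m" "b X \<noteq> 0" "\<And>z. z \<in> V \<Longrightarrow> b (\<lambda>l. z (\<iota> l)) \<noteq> 0 \<Longrightarrow> D z \<noteq> 0"
    using nonvanishing_detected_below[OF N, of "\<lambda>l z. z (\<iota> l)" D v] D by blast
  define x0 where "x0 l = y (\<iota> l)" for l
  \<comment> \<open>The segment in parameter space from \<open>y\<close> towards a point \<open>X\<close> with \<open>b X \<noteq> 0\<close>.\<close>
  define \<gamma> where "\<gamma> t l = x0 l + complex_of_real t * (X l - x0 l)" for t l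
  have "b (\<lambda>i. x0 i + 1 * (X i - x0 i)) \<noteq> 0" using b(2) by simp
  then have fin: "finite {t. b (\<lambda>i. x0 i + t * (X i - x0 i)) = 0}" by (rule finite_zeros_on_line[OF b(1)])
  have \<delta>: "\<delta> > 0" using right_inverse_nearD(1)[OF s] .
  have "\<forall>\<^sub>F t in at_right (0::real). near m \<delta> x0 (\<gamma> t)"
  proof -
    have "((\<lambda>t. complex_of_real t * (X l - x0 l)) \<longlongrightarrow> complex_of_real 0 * (X l - x0 l)) (at_right 0)" for l
      by (intro tendsto_intros)
    then have "\<forall>\<^sub>F t in at_right (0::real). dist (complex_of_real t * (X l - x0 l)) 0 < \<delta>" for l
      using \<delta> by (intro tendstoD) auto
    then have "\<forall>\<^sub>F t in at_right (0::real). \<forall>l\<in>{..<m}. dist (complex_of_real t * (X l - x0 l)) 0 < \<delta>"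
      by (intro eventually_ball_finite) auto
    then show ?thesis by eventually_elim (auto simp: near_def \<gamma>_def)
  qed
  then obtain \<tau>0 where \<tau>0: "\<tau>0 > 0" "\<And>t. 0 < t \<Longrightarrow> t < \<tau>0 \<Longrightarrow> near m \<delta> x0 (\<gamma> t)"
    unfolding eventually_at_right_field by blast
  have near: "near N \<delta> (\<lambda>j. coords \<iota> j y) (pad (\<gamma> t))" if "t \<in> {0..<\<tau>0}" for t
  proof (rule near_pad[OF y(1) _ _ \<delta>])
    show "y (\<iota> l) = x0 l" for l by (simp add: x0_def)
    show "near (N - c) \<delta> x0 (\<gamma> t)"
      using \<tau>0(2)[of t] that \<delta> by (cases "t = 0") (auto simp: near_def \<gamma>_def m_def)
  qed
  define w where "w t = s (pad (\<gamma> t))" for t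
  have cw: "continuous_on {0..<\<tau>0} w" unfolding w_def
  proof (rule right_inverse_near_continuous[OF s])
    show "continuous_on {0..<\<tau>0} (\<lambda>t. pad (\<gamma> t) j)" for j
      unfolding pad_def \<gamma>_def by (cases "j < c") (auto intro!: continuous_intros)
  qed (rule near)
  have wV: "w t \<in> V" "l < m \<Longrightarrow> w t (\<iota> l) = \<gamma> t l" if "t \<in> {0..<\<tau>0}" for t l
    using coords_section_in_V[OF s y(1) near[OF that]] by (auto simp: w_def m_def)
  have w0: "w 0 = y" unfolding w_def
  proof (rule right_inverse_nearD(2)[OF s])
    fix j assume "j < N"
    then show "pad (\<gamma> 0) j = coords \<iota> j y"
      using y(1) by (auto simp: pad_def coords_def \<gamma>_def x0_def V_iff)
  qed
  have "continuous_on {0..<\<tau>0} (\<lambda>t. q (w t))"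
    by (rule continuous_on_compose2[OF continuous_on_poly_funs[OF q] cw]) auto
  then have "((\<lambda>t. q (w t)) \<longlongrightarrow> q (w 0)) (at 0 within {0..<\<tau>0})"
    using \<tau>0(1) by (simp add: continuous_on_def)
  then have "\<forall>\<^sub>F t in at 0 within {0..<\<tau>0}. q (w t) \<noteq> 0"
    using y(2) w0 by (intro tendsto_imp_eventually_ne) auto
  then obtain \<tau>1 where \<tau>1: "\<tau>1 > 0" "\<And>t. t \<in> {0..<\<tau>0} \<Longrightarrow> t \<noteq> 0 \<Longrightarrow> dist t 0 < \<tau>1 \<Longrightarrow> q (w t) \<noteq> 0"
    unfolding eventually_at by blast
  have "finite (complex_of_real -` {t. b (\<lambda>i. x0 i + t * (X i - x0 i)) = 0})"
    by (rule finite_vimageI[OF fin]) (simp add: inj_on_def)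
  moreover have "infinite {0<..<min \<tau>0 \<tau>1}" using \<tau>0(1) \<tau>1(1) by simp
  ultimately have inf: "infinite ({0<..<min \<tau>0 \<tau>1} - complex_of_real -` {t. b (\<lambda>i. x0 i + t * (X i - x0 i)) = 0})"
    by (rule Diff_infinite_finite)
  have "{0<..<min \<tau>0 \<tau>1} - complex_of_real -` {t. b (\<lambda>i. x0 i + t * (X i - x0 i)) = 0} \<noteq> {}"
  proof
    assume "{0<..<min \<tau>0 \<tau>1} - complex_of_real -` {t. b (\<lambda>i. x0 i + t * (X i - x0 i)) = 0} = {}"
    with inf show False by (simp only: finite.emptyI not_True_eq_False)
  qed
  then obtain \<tau> where *: "\<tau> \<in> {0<..<min \<tau>0 \<tau>1}" "b (\<lambda>i. x0 i + complex_of_real \<tau> * (X i - x0 i)) \<noteq> 0"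
    by blast
  have "\<gamma> \<tau> = (\<lambda>i. x0 i + complex_of_real \<tau> * (X i - x0 i))" by (intro ext) (simp add: \<gamma>_def)
  with * have \<tau>: "0 < \<tau>" "\<tau> < \<tau>0" "\<tau> < \<tau>1" "b (\<gamma> \<tau>) \<noteq> 0" by auto
  have "D (w \<tau>) \<noteq> 0"
  proof (rule b(3))
    show "w \<tau> \<in> V" using wV \<tau> by simp
    have "b (\<lambda>l. w \<tau> (\<iota> l)) = b (\<gamma> \<tau>)" by (rule poly_funs_cong[OF b(1)]) (use wV(2)[of \<tau>] \<tau> in simp)
    then show "b (\<lambda>l. w \<tau> (\<iota> l)) \<noteq> 0" using \<tau> by simp
  qed
  moreover have "path_component {z\<in>V. q z \<noteq> 0} y (w \<tau>)"
    unfolding path_component_def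
  proof (intro exI[of _ "\<lambda>t. w (\<tau> * t)"] conjI)
    have sub: "(*) \<tau> ` {0..1} \<subseteq> {0..<\<tau>0}"
    proof
      fix u assume "u \<in> (*) \<tau> ` {0..1}"
      then obtain t where t: "u = \<tau> * t" "t \<in> {0..1}" by (rule imageE)
      then have le: "\<tau> * t \<le> \<tau>" "0 \<le> \<tau> * t" using \<tau> by (auto simp: mult_left_le)
      show "u \<in> {0..<\<tau>0}" unfolding t(1) atLeastLessThan_iff
        using le(2) le_less_trans[OF le(1) \<tau>(2)] by blast
    qed
    show "path (\<lambda>t. w (\<tau> * t))" unfolding path_def
      by (rule continuous_on_compose2[OF cw]) (auto intro!: continuous_intros sub)
    show "path_image (\<lambda>t. w (\<tau> * t)) \<subseteq> {z \<in> V. q z \<noteq> 0}"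
    proof -
      have "w (\<tau> * t) \<in> V \<and> q (w (\<tau> * t)) \<noteq> 0" if "t \<in> {0..1}" for t
      proof
        have u: "\<tau> * t \<in> {0..<\<tau>0}" using sub that by blast
        then show "w (\<tau> * t) \<in> V" by (rule wV)
        have "\<tau> * t \<le> \<tau>" using \<tau> that by (simp add: mult_left_le)
        then have "dist (\<tau> * t) 0 < \<tau>1"
          using le_less_trans[OF _ \<tau>(3)] u unfolding dist_real_def by (metis abs_of_nonneg atLeastLessThan_iff diff_zero)
        then show "q (w (\<tau> * t)) \<noteq> 0"
          using \<tau>1(2)[OF u] w0 y(2) by (cases "\<tau> * t = 0") auto
      qed
      then show ?thesis by (auto simp: path_image_def)
    qed
  qed (auto simp: pathstart_def pathfinish_def w0)
  ultimately show ?thesis using wV(1)[of \<tau>] \<tau> by auto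
qed

end

section \<open>Connectedness of a finite etale cover\<close>

lemma right_inverse_near_cong:
  assumes s: "right_inverse_near N k G z0 \<delta> s" and y: "near k \<delta> (\<lambda>j. G j z0) y"
    and eq: "\<And>j. j < k \<Longrightarrow> y j = y' j"
  shows "s y = s y'"
proof
  fix i
  obtain C where C: "\<forall>y y' i. near k \<delta> (\<lambda>j. G j z0) y \<longrightarrow> near k \<delta> (\<lambda>j. G j z0) y' \<longrightarrow>
    cmod (s y i - s y' i) \<le> C * (\<Sum>j<k. cmod (y j - y' j))"
    using right_inverse_near_Lipschitz[OF s] by blast
  have "near k \<delta> (\<lambda>j. G j z0) y'" using y eq by (simp add: near_def)
  then have "cmod (s y i - s y' i) \<le> C * (\<Sum>j<k. cmod (y j - y' j))" using C y by blast
  then show "s y i = s y' i" using eq by simp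
qed

lemma near_line_eventually:
  fixes x0 \<beta> :: "nat \<Rightarrow> complex"
  assumes "\<delta> > 0"
  shows "\<forall>\<^sub>F t in nhds 0. near m \<delta> x0 (\<lambda>l. x0 l + t * \<beta> l)"
proof -
  have "((\<lambda>t. t * \<beta> l) \<longlongrightarrow> 0 * \<beta> l) (nhds 0)" for l by (intro tendsto_intros filterlim_ident)
  then have "\<forall>\<^sub>F t in nhds 0. dist (t * \<beta> l) 0 < \<delta>" for l using assms by (intro tendstoD) auto
  then have "\<forall>\<^sub>F t in nhds 0. \<forall>l\<in>{..<m}. dist (t * \<beta> l) 0 < \<delta>" by (intro eventually_ball_finite) auto
  then show ?thesis by eventually_elim (simp add: near_def)
qed

lemma field_differentiable_finite_prod:
  "finite I \<Longrightarrow> (\<And>i. i \<in> I \<Longrightarrow> (g i) field_differentiable at z) \<Longrightarrow>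
    (\<lambda>t. \<Prod>i\<in>I. g i t) field_differentiable at (z::complex)"
  by (induct I rule: finite_induct) (auto intro: field_differentiable_const field_differentiable_mult)

lemma field_differentiable_eventually_cong:
  assumes "g field_differentiable at z" "\<forall>\<^sub>F t in nhds z. f t = g t"
  shows "f field_differentiable at z"
  using assms DERIV_cong_ev[of z z f g] unfolding field_differentiable_def by blast

text \<open>Projection to the coordinates \<open>\<iota> 0, \<dots>, \<iota> (m - 1)\<close> as a finite etale cover over \<open>{b \<noteq> 0}\<close>. The coordinates are
local parameters there by \<open>etale\<close>, while \<open>rel\<close> and \<open>lead\<close> are equations for all coordinates with leading
coefficients that do not vanish over \<open>{b \<noteq> 0}\<close>; they make the fibres finite and the projection proper.\<close>

locale etale_cover = smooth_irreducible_zeros +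
  fixes m :: nat and \<iota> :: "nat \<Rightarrow> nat" and b :: "(nat \<Rightarrow> complex) \<Rightarrow> complex"
    and d :: "nat \<Rightarrow> nat" and a :: "nat \<Rightarrow> nat \<Rightarrow> (nat \<Rightarrow> complex) \<Rightarrow> complex"
  assumes N: "N = c + m" and \<iota>: "\<And>l. l < m \<Longrightarrow> \<iota> l < N" and b: "b \<in> poly_funs m"
    and etale: "\<And>z. z \<in> V \<Longrightarrow> b (\<lambda>l. z (\<iota> l)) \<noteq> 0 \<Longrightarrow> indep_rows N N (rows \<iota> z)"
    and a: "\<And>j k. j < N \<Longrightarrow> a j k \<in> poly_funs m"
    and rel: "\<And>z j. z \<in> V \<Longrightarrow> j < N \<Longrightarrow> (\<Sum>k\<le>d j. a j k (\<lambda>l. z (\<iota> l)) * z j ^ k) = 0"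
    and lead: "\<And>x j. b x \<noteq> 0 \<Longrightarrow> j < N \<Longrightarrow> a j (d j) x \<noteq> 0"
begin

lemma N_minus_c: "N - c = m"
  using N by simp

lemma index_less: "j < N \<Longrightarrow> \<not> j < c \<Longrightarrow> j - c < m"
  using N by simp

definition fibre :: "(nat \<Rightarrow> complex) \<Rightarrow> (nat \<Rightarrow> complex) set" where
  "fibre x = {z \<in> V. \<forall>l<m. z (\<iota> l) = x l}"

definition Vb :: "(nat \<Rightarrow> complex) set" where
  "Vb = {z \<in> V. b (\<lambda>l. z (\<iota> l)) \<noteq> 0}"

lemma fibre_cong: "p \<in> poly_funs m \<Longrightarrow> z \<in> fibre x \<Longrightarrow> p (\<lambda>l. z (\<iota> l)) = p x"
  by (rule poly_funs_cong) (auto simp: fibre_def)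

lemma fibre_subset_Vb: "b x \<noteq> 0 \<Longrightarrow> fibre x \<subseteq> Vb"
  using fibre_cong[OF b] by (auto simp: Vb_def) (auto simp: fibre_def)

lemma finite_fibre:
  assumes "b x \<noteq> 0"
  shows "finite (fibre x)" "card (fibre x) \<le> (\<Prod>j<N. d j)"
proof -
  define P where "P j = (\<Sum>k\<le>d j. monom (a j k x) k)" for j
  have coeffP: "coeff (P j) (d j) = a j (d j) x" for j
    unfolding P_def coeff_sum by simp
  have P0: "P j \<noteq> 0" if "j < N" for j using lead[OF assms that] coeffP[of j] by auto
  have Pd: "degree (P j) \<le> d j" for j
    unfolding P_def by (intro degree_sum_le) (auto intro: order_trans[OF degree_monom_le])
  define Rt where "Rt j = {t. poly (P j) t = 0}" for j
  have Rt: "finite (Rt j)" "card (Rt j) \<le> d j" if "j < N" for j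
    using poly_roots_finite[OF P0[OF that]] card_poly_roots_bound[OF P0[OF that]] Pd[of j]
    unfolding Rt_def by auto
  let ?r = "\<lambda>z. restrict z {..<N}"
  have sub: "?r ` fibre x \<subseteq> PiE {..<N} Rt"
  proof
    fix w assume "w \<in> ?r ` fibre x"
    then obtain z where z: "z \<in> fibre x" "w = ?r z" by blast
    have "poly (P j) (z j) = 0" if "j < N" for j
      using rel[of z j] z(1) that fibre_cong[OF a z(1)]
      by (simp add: P_def poly_sum poly_monom fibre_def)
    then show "w \<in> PiE {..<N} Rt" unfolding z(2) by (auto simp: Rt_def)
  qed
  have inj: "inj_on ?r (fibre x)"
  proof (rule inj_onI)
    fix z w assume zw: "z \<in> fibre x" "w \<in> fibre x" "?r z = ?r w"
    show "z = w"
    proof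
      fix i show "z i = w i"
      proof (cases "i < N")
        case True
        then show ?thesis using fun_cong[OF zw(3), of i] by simp
      next
        case False
        then show ?thesis using zw(1,2) by (simp add: fibre_def V_iff affine_space_def)
      qed
    qed
  qed
  have fin: "finite (PiE {..<N} Rt)" by (intro finite_PiE) (auto intro: Rt)
  then show "finite (fibre x)" using inj sub by (metis finite_imageD finite_subset)
  have "card (fibre x) \<le> card (PiE {..<N} Rt)" using card_inj_on_le[OF inj sub fin] .
  also have "\<dots> = (\<Prod>j<N. card (Rt j))" by (simp add: card_PiE)
  also have "\<dots> \<le> (\<Prod>j<N. d j)" by (intro prod_mono) (auto intro: Rt)
  finally show "card (fibre x) \<le> (\<Prod>j<N. d j)" .
qed

lemma coordinate_bound:
  assumes "z \<in> fibre x" "j < N"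
  shows "cmod (a j (d j) x * z j) \<le> (\<Sum>k\<le>d j. cmod (a j k x))"
proof (rule root_bound)
  show "(\<Sum>k\<le>d j. a j k x * z j ^ k) = 0"
    using rel[of z j] assms fibre_cong[OF a assms(1)] by (simp add: fibre_def)
qed

lemma fibre_near_pad:
  assumes "p \<in> fibre x0" "near m \<delta> x0 x" "\<delta> > 0"
  shows "near N \<delta> (\<lambda>j. coords \<iota> j p) (pad x)"
  using assms by (intro near_pad[of p \<iota> x0]) (auto simp: fibre_def N_minus_c)

text \<open>Properness: points of nearby fibres that lie on none of the local sections through the points of the central
fibre would stay bounded by the equations \<open>rel\<close> and accumulate at a point of that fibre, near which the
projection is injective.\<close>

lemma fibre_exhausted:
  assumes b0: "b x0 \<noteq> 0"
    and s: "\<And>p. p \<in> fibre x0 \<Longrightarrow> right_inverse_near N N (coords \<iota>) p (dl p) (s p)"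
  shows "\<exists>\<delta>>0. \<forall>x. near m \<delta> x0 x \<longrightarrow> (\<forall>z\<in>fibre x. \<exists>p\<in>fibre x0. z = s p (pad x))"
proof (rule ccontr)
  assume "\<not> ?thesis"
  then have "\<forall>n. \<exists>x z. near m (1 / real (Suc n)) x0 x \<and> z \<in> fibre x \<and> (\<forall>p\<in>fibre x0. z \<noteq> s p (pad x))"
    by (metis of_nat_0_less_iff zero_less_Suc zero_less_divide_1_iff)
  then obtain x z where x: "\<And>n. near m (1 / real (Suc n)) x0 (x n)" and z: "\<And>n. z n \<in> fibre (x n)"
    and ne: "\<And>n p. p \<in> fibre x0 \<Longrightarrow> z n \<noteq> s p (pad (x n))" by metis
  have xlim: "(\<lambda>n. x n l) \<longlonglongrightarrow> x0 l" if "l < m" for l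
    using near_sequence_tendsto[OF x that] .
  have plim: "(\<lambda>n. p (x n)) \<longlonglongrightarrow> p x0" if "p \<in> poly_funs m" for p
    by (rule poly_funs_tendsto[OF that xlim])
  \<comment> \<open>The leading coefficient stays away from zero near \<open>x0\<close>, so \<open>root_bound\<close> applies uniformly.\<close>
  have "\<exists>B. \<forall>n. cmod (z n j) \<le> B" if j: "j < N" for j
  proof -
    have "(\<lambda>n. (\<Sum>k\<le>d j. cmod (a j k (x n))) / cmod (a j (d j) (x n))) \<longlonglongrightarrow>
       (\<Sum>k\<le>d j. cmod (a j k x0)) / cmod (a j (d j) x0)"
      using lead[OF b0 j] by (intro tendsto_intros plim a j) auto
    then have "Bseq (\<lambda>n. (\<Sum>k\<le>d j. cmod (a j k (x n))) / cmod (a j (d j) (x n)))"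
      by (meson convergentI convergent_imp_Bseq)
    then obtain B where B: "\<And>n. (\<Sum>k\<le>d j. cmod (a j k (x n))) / cmod (a j (d j) (x n)) \<le> B"
      unfolding Bseq_def by (metis abs_le_D1 real_norm_def)
    have "\<forall>\<^sub>F n in sequentially. a j (d j) (x n) \<noteq> 0"
      using plim[OF a[OF j]] lead[OF b0 j] by (rule tendsto_imp_eventually_ne)
    then obtain n0 where n0: "\<And>n. n \<ge> n0 \<Longrightarrow> a j (d j) (x n) \<noteq> 0"
      unfolding eventually_sequentially by blast
    have "cmod (z n j) \<le> B" if "n \<ge> n0" for n
    proof -
      have "cmod (a j (d j) (x n)) * cmod (z n j) \<le> (\<Sum>k\<le>d j. cmod (a j k (x n)))"
        using coordinate_bound[OF z j] by (simp add: norm_mult)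
      then have "cmod (z n j) \<le> (\<Sum>k\<le>d j. cmod (a j k (x n))) / cmod (a j (d j) (x n))"
        using n0[OF that] by (simp add: field_simps)
      then show ?thesis using B order_trans by blast
    qed
    then have "cmod (z n j) \<le> \<bar>B\<bar> + (\<Sum>k\<le>n0. cmod (z k j))" for n
    proof (cases "n \<ge> n0")
      case True
      have "(\<Sum>k\<le>n0. cmod (z k j)) \<ge> 0" by (intro sum_nonneg) auto
      then show ?thesis using \<open>\<And>n. n \<ge> n0 \<Longrightarrow> cmod (z n j) \<le> B\<close>[OF True] by linarith
    next
      case False
      then have "cmod (z n j) \<le> (\<Sum>k\<le>n0. cmod (z k j))" by (intro member_le_sum) auto
      then show ?thesis by linarith
    qed
    then show ?thesis by blast
  qed
  then obtain B where B: "\<And>j n. j < N \<Longrightarrow> cmod (z n j) \<le> B j" by metis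
  define r where "r = (\<Sum>j<N. \<bar>B j\<bar>)"
  have zbox: "z n \<in> {u. \<forall>i. cmod (u i) \<le> r}" for n
  proof -
    have "cmod (z n i) \<le> r" for i
    proof (cases "i < N")
      case True
      have "\<bar>B i\<bar> \<le> r" unfolding r_def using True by (intro member_le_sum) auto
      then show ?thesis using B[OF True, of n] by linarith
    next
      case False
      then show ?thesis using z[of n] by (auto simp: fibre_def V_iff affine_space_def r_def intro!: sum_nonneg)
    qed
    then show ?thesis by blast
  qed
  obtain p \<phi> where \<phi>: "strict_mono \<phi>" "(z \<circ> \<phi>) \<longlonglongrightarrow> p"
    using compact_box[of r] zbox unfolding compact_eq_seq_compact_metric seq_compact_def by metis
  have clim: "(\<lambda>n. z (\<phi> n) i) \<longlonglongrightarrow> p i" for i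
    using continuous_on_tendsto_compose[OF continuous_on_coord[of UNIV i] \<phi>(2)] by (simp add: o_def)
  have p: "p \<in> fibre x0"
  proof -
    have "p i = 0" if "i \<ge> N" for i
      using clim[of i] z that LIMSEQ_unique[of "\<lambda>n. 0" 0 "p i"] by (simp add: fibre_def V_iff affine_space_def)
    moreover have "f j p = 0" if "j < c" for j
    proof -
      have "(\<lambda>n. f j (z (\<phi> n))) \<longlonglongrightarrow> f j p"
        using poly_funs_tendsto[OF f_poly[OF that] clim] .
      then show ?thesis using z that LIMSEQ_unique[of "\<lambda>n. 0" 0 "f j p"] by (simp add: fibre_def V_iff)
    qed
    moreover have "p (\<iota> l) = x0 l" if "l < m" for l
    proof -
      have "(\<lambda>n. x (\<phi> n) l) \<longlonglongrightarrow> p (\<iota> l)"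
        using clim[of "\<iota> l"] z that by (simp add: fibre_def)
      moreover have "(\<lambda>n. x (\<phi> n) l) \<longlonglongrightarrow> x0 l"
        using LIMSEQ_subseq_LIMSEQ[OF xlim[OF that] \<phi>(1)] by (simp add: o_def)
      ultimately show ?thesis by (rule LIMSEQ_unique)
    qed
    ultimately show ?thesis by (auto simp: fibre_def V_iff affine_space_def)
  qed
  note sp = s[OF p]
  have pV: "p \<in> V" "p \<in> affine_space N" using p by (auto simp: fibre_def V_iff)
  have ir: "indep_rows N N (rows \<iota> p)" using etale[OF pV(1)] fibre_cong[OF b p] b0 by simp
  obtain \<rho> where \<rho>: "\<rho> > 0" and inj: "\<And>u v. u\<in>affine_space N \<Longrightarrow> v\<in>affine_space N \<Longrightarrow>
    (\<forall>i<N. cmod (u i - p i) < \<rho>) \<Longrightarrow> (\<forall>i<N. cmod (v i - p i) < \<rho>) \<Longrightarrow>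
    (\<forall>j<N. coords \<iota> j u = coords \<iota> j v) \<Longrightarrow> u = v"
    using locally_injective[OF pV(2) coords_strict_diff[of \<iota>] ir] \<iota> N by auto
  have dl: "dl p > 0" using right_inverse_nearD(1)[OF sp] .
  have ev1: "\<forall>\<^sub>F n in sequentially. \<forall>i\<in>{..<N}. dist (z (\<phi> n) i) (p i) < \<rho>"
    by (intro eventually_ball_finite finite_lessThan ballI tendstoD[OF clim \<rho>])
  have ev2: "\<forall>\<^sub>F n in sequentially. \<forall>l\<in>{..<m}. dist (x (\<phi> n) l) (x0 l) < dl p"
  proof (intro eventually_ball_finite finite_lessThan ballI)
    fix l assume "l \<in> {..<m}"
    then have "(\<lambda>n. x (\<phi> n) l) \<longlonglongrightarrow> x0 l"
      using LIMSEQ_subseq_LIMSEQ[OF xlim \<phi>(1)] by (simp add: o_def)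
    then show "\<forall>\<^sub>F n in sequentially. dist (x (\<phi> n) l) (x0 l) < dl p" using dl by (rule tendstoD)
  qed
  obtain C where C: "\<forall>y y' i. near N (dl p) (\<lambda>j. coords \<iota> j p) y \<longrightarrow> near N (dl p) (\<lambda>j. coords \<iota> j p) y' \<longrightarrow>
    cmod (s p y i - s p y' i) \<le> C * (\<Sum>j<N. cmod (y j - y' j))"
    using right_inverse_near_Lipschitz[OF sp] by blast
  have lp: "coords \<iota> j p = pad x0 j" if "j < N" for j
    using p that by (auto simp: coords_def pad_def fibre_def V_iff N_minus_c index_less)
  have sp0: "s p (pad x0) = p" by (rule right_inverse_nearD(2)[OF sp]) (simp add: lp)
  have "(\<lambda>n. C * (\<Sum>j<N. cmod (pad (x (\<phi> n)) j - pad x0 j))) \<longlonglongrightarrow> C * (\<Sum>j<N. cmod (pad x0 j - pad x0 j))"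
  proof (intro tendsto_intros)
    fix j assume "j \<in> {..<N}"
    then show "(\<lambda>n. pad (x (\<phi> n)) j) \<longlonglongrightarrow> pad x0 j"
      using LIMSEQ_subseq_LIMSEQ[OF xlim \<phi>(1), of "j - c"] N by (auto simp: pad_def o_def)
  qed
  then have "(\<lambda>n. C * (\<Sum>j<N. cmod (pad (x (\<phi> n)) j - pad x0 j))) \<longlonglongrightarrow> 0" by simp
  then have ev3: "\<forall>\<^sub>F n in sequentially. dist (C * (\<Sum>j<N. cmod (pad (x (\<phi> n)) j - pad x0 j))) 0 < \<rho>"
    using \<rho> by (rule tendstoD)
  \<comment> \<open>Both \<open>z\<close> and the section through \<open>p\<close> are near \<open>p\<close> and have the same image under \<open>coords\<close>.\<close>
  have "\<forall>\<^sub>F n in sequentially. False"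
    using ev1 ev2 ev3
  proof eventually_elim
    case (elim n)
    have nr: "near m (dl p) x0 (x (\<phi> n))" using elim(2) by (auto simp: near_def dist_norm)
    note nrl = fibre_near_pad[OF p nr dl]
    have nr0: "near N (dl p) (\<lambda>j. coords \<iota> j p) (pad x0)"
      using fibre_near_pad[OF p _ dl, of x0] dl by (simp add: near_def)
    have "z (\<phi> n) = s p (pad (x (\<phi> n)))"
    proof (rule inj)
      show "z (\<phi> n) \<in> affine_space N" using z[of "\<phi> n"] by (simp add: fibre_def V_iff)
      show "s p (pad (x (\<phi> n))) \<in> affine_space N" using right_inverse_nearD(3)[OF sp nrl] .
      show "\<forall>i<N. cmod (z (\<phi> n) i - p i) < \<rho>" using elim(1) by (auto simp: dist_norm)
      show "\<forall>i<N. cmod (s p (pad (x (\<phi> n))) i - p i) < \<rho>"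
      proof (intro allI impI)
        fix i
        have "cmod (s p (pad (x (\<phi> n))) i - s p (pad x0) i) \<le> C * (\<Sum>j<N. cmod (pad (x (\<phi> n)) j - pad x0 j))"
          using C nrl nr0 by blast
        then show "cmod (s p (pad (x (\<phi> n))) i - p i) < \<rho>" using elim(3) sp0 by (auto simp: dist_real_def)
      qed
      show "\<forall>j<N. coords \<iota> j (z (\<phi> n)) = coords \<iota> j (s p (pad (x (\<phi> n))))"
      proof (intro allI impI)
        fix j assume j: "j < N"
        have "coords \<iota> j (z (\<phi> n)) = pad (x (\<phi> n)) j"
          using z[of "\<phi> n"] j by (auto simp: coords_def pad_def fibre_def V_iff index_less)
        then show "coords \<iota> j (z (\<phi> n)) = coords \<iota> j (s p (pad (x (\<phi> n))))"
          using right_inverse_nearD(4)[OF sp nrl j] by simp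
      qed
    qed
    then show False using ne[OF p] by blast
  qed
  then show False by simp
qed

text \<open>The sections \<open>\<sigma> p\<close> through the points of a fibre are disjoint for small parameters and exhaust the neighbouring
fibres. Their differentiability at the centre only is claimed, because every point can be made a centre.\<close>

lemma evenly_covered:
  assumes b0: "b x0 \<noteq> 0"
  shows "\<exists>\<delta>>0. \<exists>\<sigma>. (\<forall>x. near m \<delta> x0 x \<longrightarrow> b x \<noteq> 0 \<and> bij_betw (\<lambda>p. \<sigma> p x) (fibre x0) (fibre x) \<and>
      (\<forall>p\<in>fibre x0. path_component Vb p (\<sigma> p x))) \<and>
    (\<forall>p\<in>fibre x0. \<forall>\<beta> i. (\<lambda>t. \<sigma> p (\<lambda>l. x0 l + t * \<beta> l) i) field_differentiable at 0)"
proof -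
  have "\<exists>dl s. right_inverse_near N N (coords \<iota>) p dl s" if p: "p \<in> fibre x0" for p
  proof -
    have pV: "p \<in> V" using p by (simp add: fibre_def)
    have "indep_rows N N (rows \<iota> p)" using etale[OF pV] fibre_cong[OF b p] b0 by simp
    then show ?thesis using coords_section[OF pV, of \<iota>] \<iota> N by simp
  qed
  then obtain dl s where s: "\<And>p. p \<in> fibre x0 \<Longrightarrow> right_inverse_near N N (coords \<iota>) p (dl p) (s p)" by metis
  define \<sigma> where "\<sigma> p x = s p (pad x)" for p x
  have fin: "finite (fibre x0)" using finite_fibre[OF b0] by simp
  note dl = right_inverse_nearD(1)[OF s]
  have lp: "coords \<iota> j p = pad x0 j" if "j < N" "p \<in> fibre x0" for j p
    using that by (auto simp: coords_def pad_def fibre_def V_iff N_minus_c index_less)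
  have \<sigma>0: "\<sigma> p x0 = p" if p: "p \<in> fibre x0" for p
    unfolding \<sigma>_def by (rule right_inverse_nearD(2)[OF s[OF p]]) (simp add: lp p)
  have \<sigma>fib: "\<sigma> p x \<in> fibre x" if p: "p \<in> fibre x0" and x: "near m (dl p) x0 x" for p x
    using coords_section_in_V[OF s[OF p] _ fibre_near_pad[OF p x dl[OF p]]] p
    unfolding \<sigma>_def fibre_def N_minus_c by auto
  have \<sigma>cont: "\<exists>\<delta>>0. \<forall>x. near m \<delta> x0 x \<longrightarrow> cmod (\<sigma> p x i - p i) < \<eta>" if p: "p \<in> fibre x0" and \<eta>: "\<eta> > 0" for p i \<eta>
  proof -
    obtain C where C: "\<forall>y y' i. near N (dl p) (\<lambda>j. coords \<iota> j p) y \<longrightarrow> near N (dl p) (\<lambda>j. coords \<iota> j p) y' \<longrightarrow>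
      cmod (s p y i - s p y' i) \<le> C * (\<Sum>j<N. cmod (y j - y' j))"
      using right_inverse_near_Lipschitz[OF s[OF p]] by blast
    define \<delta> where "\<delta> = min (dl p) (\<eta> / ((\<bar>C\<bar> + 1) * (real N + 1)))"
    have pos: "(\<bar>C\<bar> + 1) * (real N + 1) > 0" by (intro mult_pos_pos) auto
    then have \<delta>: "\<delta> > 0" using dl[OF p] \<eta> by (simp add: \<delta>_def)
    have "cmod (\<sigma> p x i - p i) < \<eta>" if x: "near m \<delta> x0 x" for x
    proof -
      have "near m (dl p) x0 x" using near_mono[OF x] by (simp add: \<delta>_def)
      note nx = fibre_near_pad[OF p this dl[OF p]]
      have n0: "near N (dl p) (\<lambda>j. coords \<iota> j p) (pad x0)"
        using fibre_near_pad[OF p _ dl[OF p], of x0] dl[OF p] by (simp add: near_def)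
      have "cmod (\<sigma> p x i - p i) \<le> C * (\<Sum>j<N. cmod (pad x j - pad x0 j))"
        using C[rule_format, OF nx n0, of i] \<sigma>0[OF p] unfolding \<sigma>_def by simp
      also have "\<dots> \<le> \<bar>C\<bar> * (\<Sum>j<N. cmod (pad x j - pad x0 j))"
        by (intro mult_right_mono sum_nonneg) auto
      also have "\<dots> \<le> \<bar>C\<bar> * (\<Sum>j<N. \<delta>)"
      proof (intro mult_left_mono sum_mono)
        fix j assume "j \<in> {..<N}"
        then show "cmod (pad x j - pad x0 j) \<le> \<delta>" using x \<delta> N
          by (cases "j < c") (auto simp: pad_def near_def less_imp_le)
      qed simp
      also have "\<dots> = \<bar>C\<bar> * real N * \<delta>" by simp
      also have "\<dots> < (\<bar>C\<bar> + 1) * (real N + 1) * \<delta>"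
        using \<delta> by (intro mult_strict_right_mono) (auto simp: algebra_simps intro: add_nonneg_pos)
      also have "\<dots> \<le> (\<bar>C\<bar> + 1) * (real N + 1) * (\<eta> / ((\<bar>C\<bar> + 1) * (real N + 1)))"
        using pos by (intro mult_left_mono) (auto simp: \<delta>_def)
      also have "\<dots> = \<eta>" using pos by simp
      finally show ?thesis .
    qed
    then show ?thesis using \<delta> by blast
  qed
  have inj: "\<exists>\<delta>>0. \<forall>x. near m \<delta> x0 x \<longrightarrow> (\<forall>pq\<in>fibre x0 \<times> fibre x0. fst pq \<noteq> snd pq \<longrightarrow> \<sigma> (fst pq) x \<noteq> \<sigma> (snd pq) x)"
  proof (rule near_finite_all)
    show "finite (fibre x0 \<times> fibre x0)" using fin by blast
    fix pq assume "pq \<in> fibre x0 \<times> fibre x0"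
    then obtain p q where pq: "pq = (p, q)" "p \<in> fibre x0" "q \<in> fibre x0" by blast
    show "\<exists>\<delta>>0. \<forall>x. near m \<delta> x0 x \<longrightarrow> fst pq \<noteq> snd pq \<longrightarrow> \<sigma> (fst pq) x \<noteq> \<sigma> (snd pq) x"
    proof (cases "p = q")
      case True
      then show ?thesis using pq by (auto intro: exI[of _ 1])
    next
      case False
      then obtain i where i: "p i \<noteq> q i" by blast
      define \<eta> where "\<eta> = cmod (p i - q i) / 2"
      have \<eta>: "\<eta> > 0" using i by (simp add: \<eta>_def)
      obtain \<delta>1 \<delta>2 where d: "\<delta>1 > 0" "\<forall>x. near m \<delta>1 x0 x \<longrightarrow> cmod (\<sigma> p x i - p i) < \<eta>"
        "\<delta>2 > 0" "\<forall>x. near m \<delta>2 x0 x \<longrightarrow> cmod (\<sigma> q x i - q i) < \<eta>"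
        using \<sigma>cont[OF pq(2) \<eta>, of i] \<sigma>cont[OF pq(3) \<eta>, of i] by blast
      have "\<sigma> p x \<noteq> \<sigma> q x" if "near m (min \<delta>1 \<delta>2) x0 x" for x
      proof
        assume eq: "\<sigma> p x = \<sigma> q x"
        have "cmod (\<sigma> p x i - p i) < \<eta>" "cmod (\<sigma> q x i - q i) < \<eta>"
          using d(2,4) near_mono[OF that] by auto
        then have "cmod ((\<sigma> q x i - q i) - (\<sigma> p x i - p i)) < \<eta> + \<eta>"
          by (meson add_strict_mono le_less_trans norm_triangle_ineq4)
        then show False using eq by (simp add: \<eta>_def)
      qed
      then show ?thesis using d(1,3) pq by (intro exI[of _ "min \<delta>1 \<delta>2"]) auto
    qed
  qed
  obtain \<delta>1 where \<delta>1: "\<delta>1 > 0" "\<And>x. near m \<delta>1 x0 x \<Longrightarrow> b x \<noteq> 0"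
    using poly_funs_nonzero_near[OF b b0] by blast
  obtain \<delta>2 where \<delta>2: "\<delta>2 > 0" "\<And>x p q. near m \<delta>2 x0 x \<Longrightarrow> p \<in> fibre x0 \<Longrightarrow> q \<in> fibre x0 \<Longrightarrow> p \<noteq> q \<Longrightarrow> \<sigma> p x \<noteq> \<sigma> q x"
    using inj by auto
  obtain \<delta>3 where \<delta>3: "\<delta>3 > 0" "\<And>x z. near m \<delta>3 x0 x \<Longrightarrow> z \<in> fibre x \<Longrightarrow> \<exists>p\<in>fibre x0. z = \<sigma> p x"
    using fibre_exhausted[OF b0 s] unfolding \<sigma>_def by blast
  obtain \<delta>4 where \<delta>4: "\<delta>4 > 0" "\<And>x p. near m \<delta>4 x0 x \<Longrightarrow> p \<in> fibre x0 \<Longrightarrow> near m (dl p) x0 x"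
    using near_finite_all[OF fin, of m x0 "\<lambda>p x. near m (dl p) x0 x"] dl by blast
  define \<delta> where "\<delta> = min (min \<delta>1 \<delta>2) (min \<delta>3 \<delta>4)"
  have \<delta>: "\<delta> > 0" "\<delta> \<le> \<delta>1" "\<delta> \<le> \<delta>2" "\<delta> \<le> \<delta>3" "\<delta> \<le> \<delta>4" using \<delta>1 \<delta>2 \<delta>3 \<delta>4 by (auto simp: \<delta>_def)
  have bij: "bij_betw (\<lambda>p. \<sigma> p x) (fibre x0) (fibre x)" if x: "near m \<delta> x0 x" for x
    unfolding bij_betw_def
  proof
    show "inj_on (\<lambda>p. \<sigma> p x) (fibre x0)"
      using \<delta>2(2)[OF near_mono[OF x \<delta>(3)]] by (auto simp: inj_on_def)
    show "(\<lambda>p. \<sigma> p x) ` fibre x0 = fibre x"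
      using \<delta>3(2)[OF near_mono[OF x \<delta>(4)]] \<sigma>fib \<delta>4(2)[OF near_mono[OF x \<delta>(5)]] by blast
  qed
  have pc: "path_component Vb p (\<sigma> p x)" if x: "near m \<delta> x0 x" and p: "p \<in> fibre x0" for x p
  proof -
    \<comment> \<open>The image of the segment from \<open>x0\<close> to \<open>x\<close> under the section \<open>\<sigma> p\<close> is the connecting path.\<close>
    define \<gamma> where "\<gamma> t l = x0 l + complex_of_real t * (x l - x0 l)" for t l
    have n\<gamma>: "near m \<delta> x0 (\<gamma> t)" if "t \<in> {0..1}" for t
      unfolding near_def
    proof (intro allI impI)
      fix l assume "l < m"
      have "cmod (\<gamma> t l - x0 l) = t * cmod (x l - x0 l)" using that by (simp add: \<gamma>_def norm_mult)
      also have "\<dots> \<le> cmod (x l - x0 l)" using that by (simp add: mult_left_le_one_le)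
      also have "\<dots> < \<delta>" using x \<open>l < m\<close> by (simp add: near_def)
      finally show "cmod (\<gamma> t l - x0 l) < \<delta>" .
    qed
    have nd: "near m (dl p) x0 (\<gamma> t)" if "t \<in> {0..1}" for t
      using \<delta>4(2)[OF near_mono[OF n\<gamma>[OF that] \<delta>(5)] p] .
    have \<gamma>01: "\<gamma> 0 = x0" "\<gamma> 1 = x" by (auto simp: \<gamma>_def)
    show ?thesis unfolding path_component_def
    proof (intro exI[of _ "\<lambda>t. \<sigma> p (\<gamma> t)"] conjI)
      show "path (\<lambda>t. \<sigma> p (\<gamma> t))" unfolding path_def \<sigma>_def
      proof (rule right_inverse_near_continuous[OF s[OF p]])
        show "continuous_on {0..1} (\<lambda>t. pad (\<gamma> t) j)" for j
          unfolding pad_def \<gamma>_def by (cases "j < c") (auto intro!: continuous_intros)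
        show "near N (dl p) (\<lambda>j. coords \<iota> j p) (pad (\<gamma> t))" if "t \<in> {0..1}" for t
          using fibre_near_pad[OF p nd[OF that] dl[OF p]] .
      qed
      show "path_image (\<lambda>t. \<sigma> p (\<gamma> t)) \<subseteq> Vb"
        using \<sigma>fib[OF p nd] fibre_subset_Vb \<delta>1(2)[OF near_mono[OF n\<gamma> \<delta>(2)]]
        by (fastforce simp: path_image_def)
    qed (auto simp: pathstart_def pathfinish_def \<gamma>01 \<sigma>0 p)
  qed
  have fd: "(\<lambda>t. \<sigma> p (\<lambda>l. x0 l + t * \<beta> l) i) field_differentiable at 0" if p: "p \<in> fibre x0" for p \<beta> i
  proof (rule field_differentiable_eventually_cong[OF right_inverse_nearD(5)[OF s[OF p], of "pad \<beta>" i]])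
    show "\<forall>\<^sub>F t in nhds 0. \<sigma> p (\<lambda>l. x0 l + t * \<beta> l) i = s p (\<lambda>j. coords \<iota> j p + t * pad \<beta> j) i"
      using near_line_eventually[OF dl[OF p], of m x0 \<beta>]
    proof eventually_elim
      case (elim t)
      show ?case unfolding \<sigma>_def
        by (rule fun_cong[OF right_inverse_near_cong[OF s[OF p] fibre_near_pad[OF p elim dl[OF p]]]])
           (simp add: lp p pad_def)
    qed
  qed
  show ?thesis
    using \<delta>(1) bij pc fd \<delta>1(2) near_mono[OF _ \<delta>(2)] by (intro exI[of _ \<delta>] conjI exI[of _ \<sigma>]) auto
qed

lemma fibre_product_cong: "(\<And>l. l < m \<Longrightarrow> x l = y l) \<Longrightarrow> fibre x = fibre y"
  by (auto simp: fibre_def)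

text \<open>The local sections enumerate the points of \<open>X\<close> in nearby fibres, since \<open>X\<close> is a union of path components; hence
the product is holomorphic along lines off \<open>{b = 0}\<close>. The function \<open>H\<close> bounds \<open>h\<close> on the fibres and gives
polynomial growth, which also rules out poles on \<open>{b = 0}\<close>. The coordinate \<open>x m\<close> is the additional variable.\<close>

lemma fibre_product_polynomial:
  assumes X: "X \<subseteq> Vb" and closed: "\<And>z z'. z \<in> X \<Longrightarrow> path_component Vb z z' \<Longrightarrow> z' \<in> X"
    and h: "h \<in> poly_funs N"
    and H: "\<exists>M. line_growth H M" "\<And>x. H x \<ge> 0" "\<And>x z. b x \<noteq> 0 \<Longrightarrow> z \<in> fibre x \<Longrightarrow> cmod (h z) \<le> H x"
    and X0: "b X0 \<noteq> 0"
  shows "\<exists>Q\<in>poly_funs (Suc m). \<forall>x. b x \<noteq> 0 \<longrightarrow> (\<Prod>p\<in>fibre x \<inter> X. x m - h p) = Q x"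
proof -
  define e where "e x = (\<Prod>p\<in>fibre x \<inter> X. x m - h p)" for x
  define K where "K = (\<Prod>j<N. d j)"
  obtain M1 M2 where M: "line_growth H M1" "line_growth (\<lambda>x. cmod (x m)) M2"
    using H(1) poly_funs_line_growth[OF poly_funs.coord[of m "Suc m"]] by auto
  define M where "M = K * max M1 M2"
  have Hg: "line_growth (\<lambda>x. (1 + cmod (x m) + H x) ^ K) M"
    unfolding M_def
    by (intro line_growth_power line_growth_add line_growth_const)
       (auto intro: line_growth_mono[OF M(1)] line_growth_mono[OF M(2)])
  have bound: "cmod (e x) \<le> (1 + cmod (x m) + H x) ^ K" if bx: "b x \<noteq> 0" for x
  proof -
    have H0: "H x \<ge> 0" by (rule H(2))
    have fin: "finite (fibre x \<inter> X)" using finite_fibre(1)[OF bx] by blast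
    have "cmod (e x) = (\<Prod>p\<in>fibre x \<inter> X. cmod (x m - h p))" unfolding e_def by (rule prod_norm[symmetric])
    also have "\<dots> \<le> (\<Prod>p\<in>fibre x \<inter> X. 1 + cmod (x m) + H x)"
    proof (rule prod_mono)
      fix p assume "p \<in> fibre x \<inter> X"
      then have "cmod (h p) \<le> H x" using H(3)[OF bx] by blast
      then show "0 \<le> cmod (x m - h p) \<and> cmod (x m - h p) \<le> 1 + cmod (x m) + H x"
        using norm_triangle_ineq4[of "x m" "h p"] by auto
    qed
    also have "\<dots> = (1 + cmod (x m) + H x) ^ card (fibre x \<inter> X)" by simp
    also have "\<dots> \<le> (1 + cmod (x m) + H x) ^ K"
    proof (rule power_increasing)
      show "card (fibre x \<inter> X) \<le> K"
        using finite_fibre[OF bx] card_mono[of "fibre x" "fibre x \<inter> X"] unfolding K_def by auto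
    qed (use H0 in simp)
    finally show ?thesis .
  qed
  have diff: "(\<lambda>t. e (\<lambda>i. a0 i + t * \<beta> i)) field_differentiable at t0"
    if bt: "b (\<lambda>i. a0 i + t0 * \<beta> i) \<noteq> 0" for a0 \<beta> :: "nat \<Rightarrow> complex" and t0
  proof -
    define x0 where "x0 i = a0 i + t0 * \<beta> i" for i
    have bx0: "b x0 \<noteq> 0" using bt unfolding x0_def .
    obtain \<delta> \<sigma> where \<delta>: "\<delta> > 0"
      and cov: "\<And>x. near m \<delta> x0 x \<Longrightarrow> bij_betw (\<lambda>p. \<sigma> p x) (fibre x0) (fibre x)"
        "\<And>x p. near m \<delta> x0 x \<Longrightarrow> p \<in> fibre x0 \<Longrightarrow> path_component Vb p (\<sigma> p x)"
      and fd: "\<And>p \<beta> i. p \<in> fibre x0 \<Longrightarrow> (\<lambda>t. \<sigma> p (\<lambda>l. x0 l + t * \<beta> l) i) field_differentiable at 0"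
      using evenly_covered[OF bx0] by blast
    have fin: "finite (fibre x0 \<inter> X)" using finite_fibre(1)[OF bx0] by blast
    \<comment> \<open>The same product computed with the sections through the points of the fibre over \<open>x0\<close>.\<close>
    define g where "g u = (\<Prod>p\<in>fibre x0 \<inter> X. (x0 m + u * \<beta> m) - h (\<sigma> p (\<lambda>l. x0 l + u * \<beta> l)))" for u
    have "g field_differentiable at 0" unfolding g_def
    proof (rule field_differentiable_finite_prod[OF fin])
      fix p assume "p \<in> fibre x0 \<inter> X"
      then have "(\<lambda>u. h (\<sigma> p (\<lambda>l. x0 l + u * \<beta> l))) field_differentiable at 0"
        by (intro poly_funs_field_differentiable[OF h] fd) auto
      then show "(\<lambda>u. x0 m + u * \<beta> m - h (\<sigma> p (\<lambda>l. x0 l + u * \<beta> l))) field_differentiable at 0"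
        by (intro field_differentiable_diff field_differentiable_add field_differentiable_mult
              field_differentiable_const field_differentiable_ident)
    qed
    moreover have "\<forall>\<^sub>F u in nhds 0. e (\<lambda>l. x0 l + u * \<beta> l) = g u"
      using near_line_eventually[OF \<delta>, of m x0 \<beta>]
    proof eventually_elim
      case (elim u)
      let ?x = "\<lambda>l. x0 l + u * \<beta> l"
      note bij = cov(1)[OF elim] and pc = cov(2)[OF elim]
      have inX: "\<sigma> p ?x \<in> X \<longleftrightarrow> p \<in> X" if "p \<in> fibre x0" for p
        using closed[OF _ pc[OF that]] closed[OF _ path_component_sym[OF pc[OF that]]] by blast
      have img: "(\<lambda>p. \<sigma> p ?x) ` fibre x0 = fibre ?x" using bij by (rule bij_betw_imp_surj_on)
      have "fibre ?x \<inter> X = (\<lambda>p. \<sigma> p ?x) ` (fibre x0 \<inter> X)"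
        unfolding img[symmetric] using inX by auto
      moreover have "inj_on (\<lambda>p. \<sigma> p ?x) (fibre x0 \<inter> X)"
        using bij unfolding bij_betw_def by (meson inf_le1 inj_on_subset)
      ultimately show ?case unfolding e_def g_def by (simp add: prod.reindex)
    qed
    ultimately have "(\<lambda>u. e (\<lambda>l. x0 l + u * \<beta> l)) field_differentiable at 0"
      by (rule field_differentiable_eventually_cong)
    then obtain D where "((\<lambda>u. e (\<lambda>l. x0 l + u * \<beta> l)) has_field_derivative D) (at (t0 - t0))"
      unfolding field_differentiable_def by auto
    moreover have "((\<lambda>t. t - t0) has_field_derivative 1) (at t0)"
      by (auto intro!: derivative_eq_intros)
    ultimately have "((\<lambda>t. e (\<lambda>l. x0 l + (t - t0) * \<beta> l)) has_field_derivative D * 1) (at t0)"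
      by (rule DERIV_chain2[where g = "\<lambda>t. t - t0"])
    moreover have "(\<lambda>l. x0 l + (t - t0) * \<beta> l) = (\<lambda>i. a0 i + t * \<beta> i)" for t
      by (auto simp: x0_def algebra_simps)
    ultimately show ?thesis unfolding field_differentiable_def by auto
  qed
  have "\<exists>Q\<in>poly_funs (Suc m). \<forall>x. b x \<noteq> 0 \<longrightarrow> e x = Q x"
  proof (rule polynomial_if_polynomial_on_lines[where M = M])
    show "b \<in> poly_funs (Suc m)" using b by (rule poly_funs_mono) simp
    show "b X0 \<noteq> 0" by (rule X0)
    show "e x = e y" if "\<forall>i<Suc m. x i = y i" for x y
      using that fibre_product_cong[of x y] by (simp add: e_def)
    fix a0 \<beta> :: "nat \<Rightarrow> complex"
    show "\<exists>q. degree q \<le> M \<and> (\<forall>t. b (\<lambda>i. a0 i + t * \<beta> i) \<noteq> 0 \<longrightarrow> e (\<lambda>i. a0 i + t * \<beta> i) = poly q t)"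
    proof (cases "\<exists>t. b (\<lambda>i. a0 i + t * \<beta> i) \<noteq> 0")
      case False
      then show ?thesis by (intro exI[of _ 0]) auto
    next
      case True
      define Z where "Z = {t. b (\<lambda>i. a0 i + t * \<beta> i) = 0}"
      have "finite Z" using True finite_zeros_on_line[OF b] unfolding Z_def by blast
      moreover have "(\<lambda>t. e (\<lambda>i. a0 i + t * \<beta> i)) holomorphic_on - Z"
        unfolding holomorphic_on_def
        using diff by (auto simp: Z_def intro: field_differentiable_at_within)
      moreover obtain C where C: "\<And>t. \<bar>(1 + cmod (a0 m + t * \<beta> m) + H (\<lambda>i. a0 i + t * \<beta> i)) ^ K\<bar> \<le> C * (1 + cmod t) ^ M"
        using Hg unfolding line_growth_def by blast
      have "cmod (e (\<lambda>i. a0 i + t * \<beta> i)) \<le> C * (1 + cmod t) ^ M" if "t \<notin> Z" for t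
        using bound[of "\<lambda>i. a0 i + t * \<beta> i"] C[of t] that by (fastforce simp: Z_def)
      ultimately have "\<exists>q. degree q \<le> M \<and> (\<forall>t. t \<notin> Z \<longrightarrow> e (\<lambda>i. a0 i + t * \<beta> i) = poly q t)"
        by (intro polynomial_if_holomorphic_polynomial_growth)
      then show ?thesis by (simp add: Z_def)
    qed
  qed
  then show ?thesis unfolding e_def .
qed

text \<open>If \<open>p1\<close> and \<open>p2\<close> were not connected, let \<open>X1\<close> be the component of \<open>p1\<close> and \<open>X2\<close> the rest. The two fibre products are
polynomials \<open>Q1\<close> and \<open>Q2\<close>. Every point \<open>z\<close> is in \<open>X1\<close> or \<open>X2\<close>, so \<open>Q1 Q2\<close> vanishes on \<open>V\<close> at \<open>T = h z\<close>, and so does one of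
the factors. But \<open>Q1\<close> does not vanish at \<open>p2\<close>, nor \<open>Q2\<close> at \<open>p1\<close>, for \<open>h\<close> separates \<open>p2\<close> from the points of
\<open>X1\<close> in its fibre and \<open>p1\<close> from those of \<open>X2\<close>.\<close>

lemma Vb_path_connected:
  assumes p1: "p1 \<in> Vb" and p2: "p2 \<in> Vb"
  shows "path_component Vb p1 p2"
proof (rule ccontr)
  assume np: "\<not> path_component Vb p1 p2"
  define X1 where "X1 = {z. path_component Vb p1 z}"
  define X2 where "X2 = Vb - X1"
  have X1: "X1 \<subseteq> Vb" unfolding X1_def using path_component_mem(2) by blast
  have c1: "z' \<in> X1" if "z \<in> X1" "path_component Vb z z'" for z z'
    using that path_component_trans unfolding X1_def by blast
  have c2: "z' \<in> X2" if "z \<in> X2" "path_component Vb z z'" for z z'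
    using that(1) c1[OF _ path_component_sym[OF that(2)]] path_component_mem(2)[OF that(2)]
    unfolding X2_def by blast
  have pX: "p1 \<in> X1" "p2 \<in> X2" using p1 p2 np by (auto simp: X1_def X2_def path_component_refl)
  have disj: "z \<notin> X2" if "z \<in> X1" for z using that by (simp add: X2_def)
  define \<pi> where "\<pi> z l = z (\<iota> l)" for z :: "nat \<Rightarrow> complex" and l
  have b\<pi>: "b (\<pi> p1) \<noteq> 0" "b (\<pi> p2) \<noteq> 0" using p1 p2 by (auto simp: Vb_def \<pi>_def[abs_def])
  have self: "z \<in> fibre (\<pi> z)" if "z \<in> V" for z using that by (simp add: fibre_def \<pi>_def)
  \<comment> \<open>The differences that a linear form has to detect.\<close>
  define F where "F = (\<lambda>p i. p2 i - p i) ` (fibre (\<pi> p2) \<inter> X1) \<union> (\<lambda>p i. p1 i - p i) ` (fibre (\<pi> p1) \<inter> X2)"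
  have "finite F" unfolding F_def using finite_fibre(1)[OF b\<pi>(1)] finite_fibre(1)[OF b\<pi>(2)] by auto
  moreover have "\<exists>i<N. v i \<noteq> 0" if v: "v \<in> F" for v
  proof -
    obtain p q where pq: "v = (\<lambda>i. p i - q i)" "p \<noteq> q" "p \<in> V" "q \<in> V"
    proof -
      from v consider p where "p \<in> fibre (\<pi> p2)" "p \<in> X1" "v = (\<lambda>i. p2 i - p i)"
        | p where "p \<in> fibre (\<pi> p1)" "p \<in> X2" "v = (\<lambda>i. p1 i - p i)" unfolding F_def by blast
      then show thesis
      proof cases
        case (1 p)
        then show thesis using that[of p2 p] pX disj p2 by (auto simp: fibre_def Vb_def)
      next
        case (2 p)
        then show thesis using that[of p1 p] pX disj p1 by (auto simp: fibre_def Vb_def)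
      qed
    qed
    then obtain i where i: "p i \<noteq> q i" by blast
    moreover have "i < N" using i pq(3,4) by (cases "i < N") (auto simp: V_iff affine_space_def)
    ultimately show ?thesis using pq(1) by auto
  qed
  ultimately have "\<exists>\<mu>. \<forall>v\<in>F. (\<Sum>i<N. v i * \<mu> i) \<noteq> 0" by (rule separating_linear_form)
  then obtain \<mu> where \<mu>: "\<forall>v\<in>F. (\<Sum>i<N. v i * \<mu> i) \<noteq> 0" ..
  \<comment> \<open>Multiplied by the leading coefficients, the linear form is bounded on fibres in terms of polynomials in the base point;
    on each fibre over \<open>{b \<noteq> 0}\<close> the factor is a nonzero constant, so separation is not affected.\<close>
  define L where "L x = (\<Prod>j<N. a j (d j) x)" for x
  have L: "L \<in> poly_funs m" unfolding L_def using a by (intro poly_funs_intros) auto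
  have L0: "L x \<noteq> 0" if "b x \<noteq> 0" for x using lead[OF that] by (simp add: L_def)
  define h where "h z = L (\<pi> z) * (\<Sum>j<N. z j * \<mu> j)" for z
  have \<pi>P: "(\<lambda>z. p (\<pi> z)) \<in> poly_funs N" if "p \<in> poly_funs m" for p
    unfolding \<pi>_def by (rule poly_funs_subst[OF that]) (auto intro: poly_funs.coord \<iota>)
  have h: "h \<in> poly_funs N" unfolding h_def
    by (intro poly_funs_intros \<pi>P[OF L]) auto
  define H where "H x = (\<Sum>j<N. cmod (\<mu> j) * (cmod (\<Prod>i\<in>{..<N}-{j}. a i (d i) x) * (\<Sum>k\<le>d j. cmod (a j k x))))" for x
  have H0: "H x \<ge> 0" for x unfolding H_def by (intro sum_nonneg mult_nonneg_nonneg) auto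
  have Hg: "\<exists>M. line_growth H M"
    unfolding H_def
  proof (intro line_growth_ex_sum line_growth_ex_mult finite_lessThan finite_atMost)
    fix j assume j: "j \<in> {..<N}"
    show "\<exists>M. line_growth (\<lambda>x. cmod (\<mu> j)) M" using line_growth_const by blast
    show "\<exists>M. line_growth (\<lambda>x. cmod (\<Prod>i\<in>{..<N}-{j}. a i (d i) x)) M"
      by (rule poly_funs_line_growth) (auto intro!: poly_funs_prod a)
    show "\<exists>M. line_growth (\<lambda>x. cmod (a j k x)) M" for k
      using j by (intro poly_funs_line_growth[OF a]) auto
  qed
  have Hb: "cmod (h z) \<le> H x" if "b x \<noteq> 0" "z \<in> fibre x" for x z
  proof -
    have "L (\<pi> z) = L x" unfolding \<pi>_def using fibre_cong[OF L that(2)] .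
    then have "h z = (\<Sum>j<N. \<mu> j * (L x * z j))" unfolding h_def by (simp add: sum_distrib_left mult_ac)
    then have "cmod (h z) \<le> (\<Sum>j<N. cmod (\<mu> j * (L x * z j)))" using norm_sum by simp
    also have "\<dots> \<le> H x" unfolding H_def
    proof (rule sum_mono)
      fix j assume j: "j \<in> {..<N}"
      have "L x * z j = (\<Prod>i\<in>{..<N}-{j}. a i (d i) x) * (a j (d j) x * z j)"
        unfolding L_def using prod.remove[of "{..<N}" j "\<lambda>i. a i (d i) x"] j by simp
      then have "cmod (L x * z j) \<le> cmod (\<Prod>i\<in>{..<N}-{j}. a i (d i) x) * (\<Sum>k\<le>d j. cmod (a j k x))"
        using mult_left_mono[OF coordinate_bound[OF that(2), of j] norm_ge_zero[of "\<Prod>i\<in>{..<N}-{j}. a i (d i) x"]] j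
        by (simp only: norm_mult lessThan_iff)
      then show "cmod (\<mu> j * (L x * z j)) \<le> cmod (\<mu> j) * (cmod (\<Prod>i\<in>{..<N}-{j}. a i (d i) x) * (\<Sum>k\<le>d j. cmod (a j k x)))"
        unfolding norm_mult[of "\<mu> j"] by (rule mult_left_mono) simp
    qed
    finally show ?thesis .
  qed
  have X2: "X2 \<subseteq> Vb" by (auto simp: X2_def)
  obtain Q1 where Q1: "Q1 \<in> poly_funs (Suc m)" "\<And>x. b x \<noteq> 0 \<Longrightarrow> (\<Prod>p\<in>fibre x \<inter> X1. x m - h p) = Q1 x"
  proof -
    have "\<exists>Q\<in>poly_funs (Suc m). \<forall>x. b x \<noteq> 0 \<longrightarrow> (\<Prod>p\<in>fibre x \<inter> X1. x m - h p) = Q x"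
      by (rule fibre_product_polynomial[OF X1 _ h Hg H0 _ b\<pi>(1)]) (erule (1) c1, erule (1) Hb)
    then show thesis using that by blast
  qed
  obtain Q2 where Q2: "Q2 \<in> poly_funs (Suc m)" "\<And>x. b x \<noteq> 0 \<Longrightarrow> (\<Prod>p\<in>fibre x \<inter> X2. x m - h p) = Q2 x"
  proof -
    have "\<exists>Q\<in>poly_funs (Suc m). \<forall>x. b x \<noteq> 0 \<longrightarrow> (\<Prod>p\<in>fibre x \<inter> X2. x m - h p) = Q x"
      by (rule fibre_product_polynomial[OF X2 _ h Hg H0 _ b\<pi>(1)]) (erule (1) c2, erule (1) Hb)
    then show thesis using that by blast
  qed
  \<comment> \<open>The point of \<open>\<complex>\<^sup>m \<times> \<complex>\<close> at which \<open>Q1\<close> and \<open>Q2\<close> are evaluated: the projection of \<open>z\<close>, and \<open>T = h z\<close>.\<close>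
  define pt where "pt z l = (if l < m then z (\<iota> l) else h z)" for z l
  have ptm: "pt z m = h z" for z by (simp add: pt_def)
  have fpt: "fibre (pt z) = fibre (\<pi> z)" for z by (rule fibre_product_cong) (simp add: pt_def \<pi>_def)
  have bpt: "b (pt z) = b (\<pi> z)" for z by (rule poly_funs_cong[OF b]) (simp add: pt_def \<pi>_def)
  have ptP: "(\<lambda>z. Q (pt z)) \<in> poly_funs N" if "Q \<in> poly_funs (Suc m)" for Q
    unfolding pt_def
  proof (rule poly_funs_subst[OF that])
    fix l show "(\<lambda>z. if l < m then z (\<iota> l) else h z) \<in> poly_funs N"
      by (cases "l < m") (auto intro: poly_funs.coord \<iota> h)
  qed
  have prod0: "\<forall>z\<in>V. (Q1 (pt z) * Q2 (pt z)) * b (\<pi> z) = 0"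
  proof
    fix z assume z: "z \<in> V"
    show "(Q1 (pt z) * Q2 (pt z)) * b (\<pi> z) = 0"
    proof (cases "b (\<pi> z) = 0")
      case False
      have zVb: "z \<in> Vb" using z False by (simp add: Vb_def \<pi>_def[abs_def])
      have fin: "finite (fibre (\<pi> z))" using finite_fibre(1)[OF False] .
      have "(\<Prod>p\<in>fibre (\<pi> z) \<inter> X1. h z - h p) = 0 \<or> (\<Prod>p\<in>fibre (\<pi> z) \<inter> X2. h z - h p) = 0"
      proof (cases "z \<in> X1")
        case True
        then show ?thesis using self[OF z] fin by (intro disjI1 prod_zero) auto
      next
        case False
        then have "z \<in> X2" using zVb by (simp add: X2_def)
        then show ?thesis using self[OF z] fin by (intro disjI2 prod_zero) auto
      qed
      then show ?thesis using Q1(2)[of "pt z"] Q2(2)[of "pt z"] False by (auto simp: bpt fpt ptm)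
    qed simp
  qed
  have "(\<forall>z\<in>V. Q1 (pt z) * Q2 (pt z) = 0) \<or> (\<forall>z\<in>V. b (\<pi> z) = 0)"
    by (rule irreducible[OF _ _ prod0]) (intro poly_funs.mult ptP Q1 Q2 \<pi>P b)+
  then have "\<forall>z\<in>V. Q1 (pt z) * Q2 (pt z) = 0" using b\<pi> p1 by (auto simp: Vb_def)
  then have "(\<forall>z\<in>V. Q1 (pt z) = 0) \<or> (\<forall>z\<in>V. Q2 (pt z) = 0)"
    by (intro irreducible ptP Q1 Q2) auto
  moreover have sep: "(\<Prod>p\<in>fibre (\<pi> q) \<inter> X. h q - h p) \<noteq> 0"
    if q: "q \<in> V" "b (\<pi> q) \<noteq> 0" and F: "\<And>p. p \<in> fibre (\<pi> q) \<inter> X \<Longrightarrow> (\<lambda>i. q i - p i) \<in> F" for q X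
  proof -
    have "h q - h p \<noteq> 0" if p: "p \<in> fibre (\<pi> q) \<inter> X" for p
    proof -
      have "L (\<pi> p) = L (\<pi> q)" using fibre_cong[OF L, of p "\<pi> q"] p unfolding \<pi>_def by blast
      then have "h q - h p = L (\<pi> q) * (\<Sum>i<N. (q i - p i) * \<mu> i)"
        unfolding h_def by (simp add: left_diff_distrib right_diff_distrib sum_subtractf)
      then show ?thesis using bspec[OF \<mu> F[OF p]] L0[OF q(2)] by simp
    qed
    then show ?thesis using finite_fibre(1)[OF q(2)] by (subst prod_zero_iff) auto
  qed
  ultimately show False
  proof (elim disjE)
    assume "\<forall>z\<in>V. Q1 (pt z) = 0"
    then have "Q1 (pt p2) = 0" using p2 by (simp add: Vb_def)
    then have "(\<Prod>p\<in>fibre (\<pi> p2) \<inter> X1. h p2 - h p) = 0"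
      using Q1(2)[of "pt p2"] b\<pi>(2) by (simp add: bpt fpt ptm)
    moreover have "(\<Prod>p\<in>fibre (\<pi> p2) \<inter> X1. h p2 - h p) \<noteq> 0"
      by (rule sep) (use p2 b\<pi>(2) in \<open>auto simp: Vb_def F_def\<close>)
    ultimately show False by simp
  next
    assume "\<forall>z\<in>V. Q2 (pt z) = 0"
    then have "Q2 (pt p1) = 0" using p1 by (simp add: Vb_def)
    then have "(\<Prod>p\<in>fibre (\<pi> p1) \<inter> X2. h p1 - h p) = 0"
      using Q2(2)[of "pt p1"] b\<pi>(1) by (simp add: bpt fpt ptm)
    moreover have "(\<Prod>p\<in>fibre (\<pi> p1) \<inter> X2. h p1 - h p) \<noteq> 0"
      by (rule sep) (use p1 b\<pi>(1) in \<open>auto simp: Vb_def F_def\<close>)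
    ultimately show False by simp
  qed
qed

end

section \<open>Principal open sets are path connected\<close>

lemma poly_funs_nonzero_in_box:
  assumes "b \<in> poly_funs m" "b X \<noteq> 0" "\<delta> > 0"
  shows "\<exists>x. near m \<delta> x0 x \<and> b x \<noteq> 0"
proof -
  let ?\<gamma> = "\<lambda>t. \<lambda>l. x0 l + t * (X l - x0 l)"
  have "b (?\<gamma> 1) \<noteq> 0" using assms(2) by simp
  then have "finite {t. b (?\<gamma> t) = 0}" by (rule finite_zeros_on_line[OF assms(1)])
  then have "\<forall>\<^sub>F t in at 0. t \<notin> {t. b (?\<gamma> t) = 0}"
    using islimpt_finite[of _ 0] unfolding islimpt_iff_eventually by blast
  moreover have "\<forall>\<^sub>F t in at 0. near m \<delta> x0 (?\<gamma> t)"
    using near_line_eventually[OF assms(3), of m x0 "\<lambda>l. X l - x0 l"]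
    by (simp add: eventually_at_filter eventually_mono)
  ultimately have "\<forall>\<^sub>F t in at 0. near m \<delta> x0 (?\<gamma> t) \<and> b (?\<gamma> t) \<noteq> 0"
    by eventually_elim auto
  then show ?thesis using eventually_happens'[OF at_neq_bot] by blast
qed

context smooth_irreducible_zeros
begin

text \<open>Coordinates that are local parameters at \<open>p1\<close> are so off the zeros of a polynomial \<open>J\<close>. Let \<open>b\<close> vanish
on the projections of the zeros of \<open>J\<close> and \<open>q\<close> and be divisible by all leading coefficients of the equations of
the coordinates; then \<open>b\<close> defines a finite etale cover contained in \<open>{q \<noteq> 0}\<close>, which is path connected, and
each of the two points is joined to it.\<close>

theorem principal_open_path_connected:
  assumes q: "q \<in> poly_funs N" and p1: "p1 \<in> V" "q p1 \<noteq> 0" and p2: "p2 \<in> V" "q p2 \<noteq> 0"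
  shows "path_component {z\<in>V. q z \<noteq> 0} p1 p2"
proof -
  define m where "m = N - c"
  have N: "N = c + m" using c_le_N[OF p1(1)] by (simp add: m_def)
  obtain \<iota> where \<iota>': "\<And>l. l < N - c \<Longrightarrow> \<iota> l < N" and ir: "indep_rows N N (rows \<iota> p1)"
    using etale_coordinates[OF p1(1)] by blast
  have \<iota>: "\<iota> l < N" if "l < m" for l using \<iota>' that by (simp add: m_def)
  have \<pi>: "(\<lambda>z. z (\<iota> l)) \<in> poly_funs N" if "l < m" for l using \<iota>[OF that] by (rule poly_funs.coord)
  obtain b1 X1 where b1: "b1 \<in> poly_funs m" "b1 X1 \<noteq> 0" "\<And>z. z \<in> V \<Longrightarrow> b1 (\<lambda>l. z (\<iota> l)) \<noteq> 0 \<Longrightarrow> q z \<noteq> 0"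
    using nonvanishing_detected_below[OF N, of "\<lambda>l z. z (\<iota> l)", OF \<pi> q p1] by blast
  have "(\<lambda>z. rows \<iota> z j i) \<in> poly_funs N" if "i < N" for j i
    unfolding rows_def using partial_deriv_poly_funs[OF f_poly that]
    by (cases "j < c") (auto intro: poly_funs.const)
  then obtain R J where J: "J \<in> poly_funs N" "J p1 \<noteq> 0" and
    R: "\<forall>z. \<forall>j<N. \<forall>l<N. (\<Sum>i<N. rows \<iota> z j i * R i l z) = (if j = l then J z else 0)"
    using polynomial_right_inverse[of N N "\<lambda>j i z. rows \<iota> z j i" N p1] ir by auto
  have Jir: "indep_rows N N (rows \<iota> z)" if "J z \<noteq> 0" for z
    by (rule right_inverse_imp_indep_rows[where R = "\<lambda>i l. R i l z" and c = "J z"]) (use R that in auto)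
  obtain b2 X2 where b2: "b2 \<in> poly_funs m" "b2 X2 \<noteq> 0" "\<And>z. z \<in> V \<Longrightarrow> b2 (\<lambda>l. z (\<iota> l)) \<noteq> 0 \<Longrightarrow> J z \<noteq> 0"
    using nonvanishing_detected_below[OF N, of "\<lambda>l z. z (\<iota> l)", OF \<pi> J(1) p1(1) J(2)] by blast
  have "\<exists>da. (\<forall>k. snd da k \<in> poly_funs m) \<and> (\<exists>X. snd da (fst da) X \<noteq> 0) \<and>
    (\<forall>z\<in>V. (\<Sum>k\<le>fst da. snd da k (\<lambda>l. z (\<iota> l)) * z j ^ k) = 0)" if jN: "j < N" for j
  proof -
    obtain d a where "\<forall>k. a k \<in> poly_funs m" "\<exists>X. a d X \<noteq> 0"
      "\<forall>z\<in>V. (\<Sum>k\<le>d. a k (\<lambda>l. z (\<iota> l)) * z j ^ k) = 0"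
      using algebraic_over_projection[OF N, of "\<lambda>l z. z (\<iota> l)" "\<lambda>z. z j", OF \<pi> poly_funs.coord[OF jN]]
      by blast
    then show ?thesis by (intro exI[of _ "(d, a)"]) simp
  qed
  then have "\<forall>j\<in>{..<N}. \<exists>da. (\<forall>k. snd da k \<in> poly_funs m) \<and> (\<exists>X. snd da (fst da) X \<noteq> 0) \<and>
    (\<forall>z\<in>V. (\<Sum>k\<le>fst da. snd da k (\<lambda>l. z (\<iota> l)) * z j ^ k) = 0)" by simp
  from bchoice[OF this] obtain da where da': "\<forall>j\<in>{..<N}. (\<forall>k. snd (da j) k \<in> poly_funs m) \<and>
    (\<exists>X. snd (da j) (fst (da j)) X \<noteq> 0) \<and>
    (\<forall>z\<in>V. (\<Sum>k\<le>fst (da j). snd (da j) k (\<lambda>l. z (\<iota> l)) * z j ^ k) = 0)" ..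
  have da: "\<And>j k. j < N \<Longrightarrow> snd (da j) k \<in> poly_funs m"
    "\<And>j. j < N \<Longrightarrow> \<exists>X. snd (da j) (fst (da j)) X \<noteq> 0"
    "\<And>j z. j < N \<Longrightarrow> z \<in> V \<Longrightarrow> (\<Sum>k\<le>fst (da j). snd (da j) k (\<lambda>l. z (\<iota> l)) * z j ^ k) = 0"
    using da' by simp_all
  define d where "d j = fst (da j)" for j
  define a where "a j = snd (da j)" for j
  define b where "b x = b1 x * b2 x * (\<Prod>j<N. a j (d j) x)" for x
  have b: "b \<in> poly_funs m" unfolding b_def using b1(1) b2(1) da(1)
    by (intro poly_funs_intros) (auto simp: a_def)
  obtain X3 where X3: "b1 X3 * b2 X3 \<noteq> 0"
    using poly_funs_common_nonzero[OF b1(1) b2(1) b1(2) b2(2)] by auto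
  have "\<exists>X. \<forall>j\<in>{..<N}. a j (d j) X \<noteq> 0"
    using da(1,2) by (intro poly_funs_common_nonzero_finite[where n = m]) (auto simp: a_def d_def)
  then obtain X4 where X4: "(\<Prod>j<N. a j (d j) X4) \<noteq> 0" by auto
  obtain X where X: "b X \<noteq> 0"
  proof -
    have "(\<lambda>x. b1 x * b2 x) \<in> poly_funs m" "(\<lambda>x. \<Prod>j<N. a j (d j) x) \<in> poly_funs m"
      using b1(1) b2(1) da(1) by (auto intro!: poly_funs_intros simp: a_def)
    from poly_funs_common_nonzero[OF this X3 X4] show thesis using that unfolding b_def by auto
  qed
  interpret etale_cover N c f V m \<iota> b d a
  proof unfold_locales
    fix z assume "z \<in> zeros N (f ` {..<c})" "b (\<lambda>l. z (\<iota> l)) \<noteq> 0"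
    moreover from this have "z \<in> V" by (simp add: V_def)
    ultimately show "indep_rows N N (rows \<iota> z)" using b2(3) Jir by (auto simp: b_def)
  next
    fix x j assume "b x \<noteq> 0" "j < N"
    then show "a j (d j) x \<noteq> 0" by (auto simp: b_def)
  qed (use N \<iota> b da[unfolded V_def] in \<open>auto simp: a_def d_def\<close>)
  have Vbq: "Vb \<subseteq> {z\<in>V. q z \<noteq> 0}" using b1(3) by (auto simp: Vb_def b_def)
  define D where "D z = b (\<lambda>l. z (\<iota> l))" for z
  have D: "D \<in> poly_funs N" unfolding D_def by (rule poly_funs_subst[OF b \<pi>])
  \<comment> \<open>That \<open>b\<close> is a nonzero polynomial does not yet show that it is nonzero on \<open>V\<close>; a section
    at \<open>p1\<close> hits a point over \<open>{b \<noteq> 0}\<close>.\<close>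
  obtain v where v: "v \<in> V" "D v \<noteq> 0"
  proof -
    obtain \<delta> s where s: "right_inverse_near N N (coords \<iota>) p1 \<delta> s"
      using coords_section[OF p1(1) \<iota>' ir] by blast
    obtain x where x: "near m \<delta> (\<lambda>l. p1 (\<iota> l)) x" "b x \<noteq> 0"
      using poly_funs_nonzero_in_box[OF b X right_inverse_nearD(1)[OF s]] by blast
    have n: "near N \<delta> (\<lambda>j. coords \<iota> j p1) (pad x)"
      using x(1) right_inverse_nearD(1)[OF s] by (intro near_pad[OF p1(1)]) (auto simp: m_def)
    note sV = coords_section_in_V[OF s p1(1) n]
    have "D (s (pad x)) = b x" unfolding D_def
      by (rule poly_funs_cong[OF b]) (use sV(2) in \<open>simp add: m_def\<close>)
    then show thesis using that[OF sV(1)] x(2) by simp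
  qed
  obtain z1 where z1: "z1 \<in> V" "D z1 \<noteq> 0" "path_component {z\<in>V. q z \<noteq> 0} p1 z1"
    using connect_to_dense_open[OF D v q p1] by blast
  obtain z2 where z2: "z2 \<in> V" "D z2 \<noteq> 0" "path_component {z\<in>V. q z \<noteq> 0} p2 z2"
    using connect_to_dense_open[OF D v q p2] by blast
  have "path_component Vb z1 z2"
    by (rule Vb_path_connected) (use z1 z2 in \<open>auto simp: Vb_def D_def\<close>)
  then have "path_component {z\<in>V. q z \<noteq> 0} z1 z2" using Vbq path_component_of_subset by blast
  then show ?thesis using z1(3) z2(3) path_component_trans path_component_sym by blast
qed

end

section \<open>The dihedral group acting on pairs of complex numbers\<close>

definition rot :: "nat \<Rightarrow> int \<Rightarrow> complex" where
  "rot n k = cis (2 * pi * real_of_int k / real n)"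

lemma rot_0 [simp]: "rot n 0 = 1"
  by (simp add: rot_def)

lemma rot_add: "rot n (k + l) = rot n k * rot n l"
  unfolding rot_def by (simp add: cis_mult add_divide_distrib distrib_left)

lemma rot_minus: "rot n k * rot n (- k) = 1" "rot n (- k) * rot n k = 1"
  using rot_add[of n k "- k"] rot_add[of n "- k" k] by simp_all

lemma rot_nonzero [simp]: "rot n k \<noteq> 0"
  by (simp add: rot_def)

lemma rot_multiple: "n \<ge> 1 \<Longrightarrow> rot n (int n * k) = 1"
proof -
  assume "n \<ge> 1"
  then have "2 * pi * real_of_int (int n * k) / real n = 2 * pi * real_of_int k" by simp
  then show ?thesis unfolding rot_def using cis_multiple_2pi[OF Ints_of_int] by metis
qed

lemma rot_power: "n \<ge> 1 \<Longrightarrow> rot n k ^ n = 1"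
proof -
  have "rot n k ^ j = rot n (int j * k)" for j
    by (induct j) (simp_all add: distrib_right rot_add)
  then show "n \<ge> 1 \<Longrightarrow> rot n k ^ n = 1" by (simp add: rot_multiple)
qed

lemma rot_mod:
  assumes "n \<ge> 1"
  shows "rot n (k mod int n) = rot n k"
proof -
  have "rot n k = rot n (int n * (k div int n) + k mod int n)" by simp
  also have "\<dots> = rot n (k mod int n)" unfolding rot_add rot_multiple[OF assms] by simp
  finally show ?thesis by simp
qed

lemma rot_nat: "rot n (int j) = exp (2 * of_real pi * \<i> * of_nat j / of_nat n)"
  unfolding rot_def cis_conv_exp by (simp add: mult_ac)

lemma rot_inj:
  assumes "n \<ge> 1" "0 \<le> k" "k < int n" "0 \<le> l" "l < int n" "rot n k = rot n l"
  shows "k = l"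
proof -
  obtain i j where ij: "k = int i" "l = int j" using assms(2,4) by (meson nonneg_eq_int)
  then have "i mod n = j mod n"
    using assms(1,6) complex_root_unity_eq[of n i j] by (simp add: rot_nat)
  then show ?thesis using ij assms by simp
qed

lemma same_power_rot:
  assumes "n \<ge> 1" "x ^ n = y ^ n"
  shows "\<exists>k\<in>{0..<int n}. x = rot n k * y"
proof (cases "y = 0")
  case True
  then have "x = 0" using assms by (simp add: power_0_left)
  then show ?thesis using True assms by (intro bexI[of _ 0]) auto
next
  case False
  then have "(x / y) ^ n = 1" using assms by (simp add: power_divide)
  then obtain j where "j < n" "x / y = exp (2 * of_real pi * \<i> * of_nat j / of_nat n)"
    using complex_roots_unity[OF assms(1)] by blast
  then have "x = rot n (int j) * y" using False by (simp add: rot_nat field_simps)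
  then show ?thesis using \<open>j < n\<close> by (intro bexI[of _ "int j"]) auto
qed

text \<open>The pair \<open>(k, e)\<close> stands for the rotation \<open>(\<zeta>\<^sup>k w, \<zeta>\<^sup>-\<^sup>k w')\<close>, preceded by the exchange of \<open>w\<close> and \<open>w'\<close> if \<open>e\<close> holds.\<close>

definition act :: "nat \<Rightarrow> int \<times> bool \<Rightarrow> complex \<times> complex \<Rightarrow> complex \<times> complex" where
  "act n g w = (rot n (fst g) * (if snd g then snd w else fst w),
     rot n (- fst g) * (if snd g then fst w else snd w))"

text \<open>The fibre of the dihedral cover over a point where the two functions have the values \<open>a\<close> and \<open>f\<close>.\<close>

definition fib :: "nat \<Rightarrow> complex \<Rightarrow> complex \<Rightarrow> (complex \<times> complex) set" where
  "fib n a f = {w. fst w * snd w = f \<and> fst w ^ n + snd w ^ n = 2 * a}"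

definition dilate :: "complex \<Rightarrow> complex \<times> complex \<Rightarrow> complex \<times> complex" where
  "dilate c w = (c * fst w, c * snd w)"

lemma dilate_dilate: "dilate c (dilate d w) = dilate (c * d) w"
  by (simp add: dilate_def)

lemma dilate_act: "dilate c (act n g w) = act n g (dilate c w)"
  by (simp add: dilate_def act_def)

text \<open>The equations of the fibre are weighted homogeneous, with \<open>a\<close> of weight \<open>n\<close> and \<open>f\<close> of weight \<open>2\<close>. This is
why they make sense for sections of \<open>n L\<close> and \<open>2 L\<close>, with \<open>w\<close> and \<open>w'\<close> sections of \<open>L\<close>.\<close>

lemma dilate_fib: "w \<in> fib n a f \<Longrightarrow> dilate c w \<in> fib n (c ^ n * a) (c ^ 2 * f)"
  by (auto simp: fib_def dilate_def power_mult_distrib power2_eq_square distrib_left[symmetric])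

lemma act_one: "act n (0, False) w = w"
  by (simp add: act_def)

lemma act_mult:
  assumes "n \<ge> 1"
  shows "act n (g \<otimes>\<^bsub>dihedral_group n\<^esub> h) w = act n g (act n h w)"
proof -
  obtain k e l e' where gh: "g = (k, e)" "h = (l, e')" by (metis surj_pair)
  have neg: "rot n (- (k mod int n)) = rot n (- k)" for k
    using rot_mod[OF assms, of k] rot_minus[of n k] rot_minus[of n "k mod int n"]
    by (metis mult.assoc mult.right_neutral mult_1)
  show ?thesis unfolding gh
    by (cases e; cases e')
       (simp_all add: dihedral_group_def act_def rot_mod[OF assms] neg rot_add[symmetric] mult.assoc[symmetric] add.commute)
qed

lemma act_fib: "n \<ge> 1 \<Longrightarrow> w \<in> fib n a f \<Longrightarrow> act n g w \<in> fib n a f"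
  using rot_minus[of n "fst g"]
  by (auto simp: fib_def act_def power_mult_distrib rot_power add.commute mult_ac)

text \<open>The discriminant of \<open>T\<^sup>2 - 2 a T + f\<^sup>n\<close>, whose roots are the \<open>n\<close>-th powers of the two components.\<close>

lemma fib_discriminant: "w \<in> fib n a f \<Longrightarrow> (fst w ^ n - snd w ^ n)\<^sup>2 = 4 * (a\<^sup>2 - f ^ n)"
proof -
  assume w: "w \<in> fib n a f"
  have "(fst w ^ n - snd w ^ n)\<^sup>2 = (fst w ^ n + snd w ^ n)\<^sup>2 - 4 * (fst w * snd w) ^ n"
    by (simp add: power2_eq_square algebra_simps power_mult_distrib)
  also have "\<dots> = (2 * a)\<^sup>2 - 4 * f ^ n" using w by (simp add: fib_def)
  finally show ?thesis by (simp add: power_mult_distrib)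
qed

lemma fib_powers_neq: "w \<in> fib n a f \<Longrightarrow> a\<^sup>2 \<noteq> f ^ n \<Longrightarrow> fst w ^ n \<noteq> snd w ^ n"
  using fib_discriminant[of w n a f] by auto

lemma carrier_dihedral: "carrier (dihedral_group n) = {0..<int n} \<times> UNIV"
  by (simp add: dihedral_group_def)

lemma finite_carrier_dihedral: "finite (carrier (dihedral_group n))"
  by (simp add: carrier_dihedral)

lemma dihedral_mult_closed:
  "n \<ge> 1 \<Longrightarrow> g \<otimes>\<^bsub>dihedral_group n\<^esub> h \<in> carrier (dihedral_group n)"
  by (cases g; cases h) (simp add: dihedral_group_def)

text \<open>Comparing \<open>n\<close>-th powers detects the reflection. One of the components is nonzero and detects the rotation.\<close>

lemma act_free:
  assumes n: "n \<ge> 1" and w: "fst w ^ n \<noteq> snd w ^ n"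
    and g: "g \<in> carrier (dihedral_group n)" "h \<in> carrier (dihedral_group n)" and eq: "act n g w = act n h w"
  shows "g = h"
proof -
  obtain k e l e' where gh: "g = (k, e)" "h = (l, e')" by (metis surj_pair)
  have kl: "0 \<le> k" "k < int n" "0 \<le> l" "l < int n" using g by (auto simp: gh carrier_dihedral)
  have f: "rot n k * (if e then snd w else fst w) = rot n l * (if e' then snd w else fst w)"
    "rot n (- k) * (if e then fst w else snd w) = rot n (- l) * (if e' then fst w else snd w)"
    using eq by (auto simp: gh act_def)
  have "(rot n k * (if e then snd w else fst w)) ^ n = (rot n l * (if e' then snd w else fst w)) ^ n"
    using f(1) by simp
  then have "(if e then snd w else fst w) ^ n = (if e' then snd w else fst w) ^ n"
    by (simp add: power_mult_distrib rot_power[OF n] del: if_splits)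
  then have e: "e = e'" using w by (auto split: if_splits)
  have "rot n k = rot n l"
  proof (cases "(if e then snd w else fst w) = 0")
    case False
    then show ?thesis using f(1) e by simp
  next
    case True
    then have "(if e then fst w else snd w) \<noteq> 0" using w by (auto split: if_splits)
    then have "rot n (- k) = rot n (- l)" using f(2) e by simp
    then show ?thesis using rot_minus[of n k] rot_minus[of n l] by (metis mult.assoc mult.right_neutral mult_1)
  qed
  then have "k = l" using rot_inj[OF n] kl by blast
  then show ?thesis using e gh by simp
qed

text \<open>The \<open>n\<close>-th powers of the components are the same two roots for \<open>w\<close> and for \<open>v\<close>; after an exchange the components
differ by an \<open>n\<close>-th root of unity.\<close>

lemma act_transitive:
  assumes n: "n \<ge> 1" and w: "w \<in> fib n a f" and v: "v \<in> fib n a f"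
  shows "\<exists>g\<in>carrier (dihedral_group n). v = act n g w"
proof -
  let ?x = "fst w" and ?y = "snd w" and ?p = "fst v" and ?q = "snd v"
  have 1: "?x * ?y = f" "?x ^ n + ?y ^ n = 2 * a" "?p * ?q = f" "?p ^ n + ?q ^ n = 2 * a"
    using w v by (auto simp: fib_def)
  have base: "\<exists>k\<in>{0..<int n}. p = rot n k * x \<and> q = rot n (- k) * y"
    if pow: "p ^ n = x ^ n" "q ^ n = y ^ n" and pq: "p * q = x * y" for p q x y
  proof (cases "x = 0")
    case False
    obtain k where k: "k \<in> {0..<int n}" "p = rot n k * x" using same_power_rot[OF n pow(1)] by blast
    have "rot n k * x * q = x * y" using pq k(2) by simp
    then have "rot n k * q = y" using False by (simp add: mult_ac)
    then have "q = rot n (- k) * y" using rot_minus(2)[of n k] by (metis mult.assoc mult_1)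
    then show ?thesis using k by blast
  next
    case True
    then have p: "p = 0" using pow(1) n by (simp add: power_0_left)
    obtain k where k: "k \<in> {0..<int n}" "y = rot n k * q" using same_power_rot[OF n pow(2)[symmetric]] by blast
    then have "q = rot n (- k) * y" using rot_minus(2)[of n k] by (metis mult.assoc mult_1)
    then show ?thesis using k(1) p True by auto
  qed
  \<comment> \<open>\<open>p\<^sup>n\<close> is a root of the quadratic polynomial with roots \<open>x\<^sup>n\<close> and \<open>y\<^sup>n\<close>.\<close>
  have "(?p ^ n - ?x ^ n) * (?p ^ n - ?y ^ n) = ?p ^ n * ?p ^ n - (?x ^ n + ?y ^ n) * ?p ^ n + (?x * ?y) ^ n"
    by (simp add: algebra_simps power_mult_distrib)
  also have "\<dots> = ?p ^ n * ?p ^ n - (?p ^ n + ?q ^ n) * ?p ^ n + (?p * ?q) ^ n" using 1 by simp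
  also have "\<dots> = 0" by (simp add: algebra_simps power_mult_distrib)
  finally consider "?p ^ n = ?x ^ n" | "?p ^ n = ?y ^ n" by auto
  then show ?thesis
  proof cases
    case 1
    then have "?q ^ n = ?y ^ n" using \<open>?x ^ n + ?y ^ n = 2 * a\<close> \<open>?p ^ n + ?q ^ n = 2 * a\<close> by (metis add_left_cancel)
    then obtain k where "k \<in> {0..<int n}" "?p = rot n k * ?x" "?q = rot n (- k) * ?y"
      using base[OF 1, of ?q ?y] \<open>?x * ?y = f\<close> \<open>?p * ?q = f\<close> by auto
    then show ?thesis
      by (intro bexI[of _ "(k, False)"]) (auto simp: act_def carrier_dihedral prod_eq_iff)
  next
    case 2
    then have "?q ^ n = ?x ^ n" using \<open>?x ^ n + ?y ^ n = 2 * a\<close> \<open>?p ^ n + ?q ^ n = 2 * a\<close>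
      by (metis add.commute add_left_cancel)
    then obtain k where "k \<in> {0..<int n}" "?p = rot n k * ?y" "?q = rot n (- k) * ?x"
      using base[OF 2, of ?q ?x] \<open>?x * ?y = f\<close> \<open>?p * ?q = f\<close> by (auto simp: mult.commute)
    then show ?thesis
      by (intro bexI[of _ "(k, True)"]) (auto simp: act_def carrier_dihedral prod_eq_iff)
  qed
qed

lemma fib_nonempty:
  assumes "n \<ge> 1"
  shows "\<exists>w. w \<in> fib n a f"
proof -
  define z where "z = csqrt (a\<^sup>2 - f ^ n)"
  have z: "z\<^sup>2 = a\<^sup>2 - f ^ n" by (simp add: z_def)
  have root: "\<exists>w. w ^ n = u" for u :: complex
    using assms by (metis exists_complex_root not_one_le_zero)
  show ?thesis
  proof (cases "a + z = 0")
    case False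
    obtain w where w: "w ^ n = a + z" using root by blast
    then have "w \<noteq> 0" using False assms by (auto simp: power_0_left)
    have "f ^ n = (a + z) * (a - z)" using z by (simp add: power2_eq_square algebra_simps)
    then have "(f / w) ^ n = a - z" using w False by (simp add: power_divide)
    then have "(w, f / w) \<in> fib n a f" using w \<open>w \<noteq> 0\<close> by (simp add: fib_def)
    then show ?thesis by blast
  next
    case True
    then have "f ^ n = 0" using z by (simp add: power2_eq_square add_eq_0_iff2)
    then have "f = 0" by simp
    obtain w where "w ^ n = 2 * a" using root by blast
    then have "(w, 0) \<in> fib n a f" using \<open>f = 0\<close> assms by (simp add: fib_def power_0_left)
    then show ?thesis by blast
  qed
qed

text \<open>Solve for \<open>w\<^sup>n = a + z\<close> with \<open>z\<^sup>2 = a\<^sup>2 - f\<^sup>n\<close> by principal branches of the square root and the logarithm.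
They are applied to quotients that are \<open>1\<close> at the centre, where these branches are continuous.\<close>

lemma local_branch_fst:
  assumes n: "n \<ge> 1" and w0: "w0 \<in> fib n a0 f0" and d: "a0\<^sup>2 \<noteq> f0 ^ n" and nz: "fst w0 \<noteq> 0"
  shows "\<exists>\<epsilon>>0. \<exists>\<sigma>. continuous_on (ball (a0, f0) \<epsilon>) \<sigma> \<and>
    (\<forall>p\<in>ball (a0, f0) \<epsilon>. \<sigma> p \<in> fib n (fst p) (snd p))"
proof -
  define z0 where "z0 = (fst w0 ^ n - snd w0 ^ n) / 2"
  have z0: "z0\<^sup>2 = a0\<^sup>2 - f0 ^ n" "z0 \<noteq> 0"
    using fib_discriminant[OF w0] fib_powers_neq[OF w0 d] by (auto simp: z0_def power_divide)
  have az0: "a0 + z0 = fst w0 ^ n" using w0 by (auto simp: z0_def fib_def field_simps)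
  define \<phi> where "\<phi> p = ((fst p)\<^sup>2 - snd p ^ n) / z0\<^sup>2" for p :: "complex \<times> complex"
  have c\<phi>: "continuous_on S \<phi>" for S unfolding \<phi>_def using z0 by (intro continuous_intros) auto
  have ball_ex: "\<exists>\<epsilon>>0. \<epsilon> \<le> \<eta> \<and> g ` ball (a0, f0) \<epsilon> \<subseteq> ball 1 1"
    if "continuous_on (ball (a0, f0) \<eta>) g" "g (a0, f0) = 1" "\<eta> > 0" for \<eta> and g :: "complex \<times> complex \<Rightarrow> complex"
  proof -
    have "\<exists>\<delta>>0. \<forall>p\<in>ball (a0, f0) \<eta>. dist p (a0, f0) < \<delta> \<longrightarrow> dist (g p) 1 < 1"
    proof -
      have "(a0, f0) \<in> ball (a0, f0) \<eta>" using that(3) by simp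
      then have "\<exists>\<delta>>0. \<forall>p\<in>ball (a0, f0) \<eta>. dist p (a0, f0) < \<delta> \<longrightarrow> dist (g p) (g (a0, f0)) < 1"
        using that(1) unfolding continuous_on_iff by (meson zero_less_one)
      then show ?thesis using \<open>g (a0, f0) = 1\<close> by simp
    qed
    then obtain \<delta> where "\<delta> > 0" "\<forall>p\<in>ball (a0, f0) \<eta>. dist p (a0, f0) < \<delta> \<longrightarrow> dist (g p) 1 < 1" by blast
    then show ?thesis using that(3)
      by (intro exI[of _ "min \<delta> \<eta>"]) (auto simp: dist_commute)
  qed
  have B: "Re u > 0" "u \<noteq> 0" "u \<notin> \<real>\<^sub>\<le>\<^sub>0" if "u \<in> ball 1 1" for u :: complex
  proof -
    have "\<bar>Re (1 - u)\<bar> \<le> cmod (1 - u)" by (rule abs_Re_le_cmod)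
    then show "Re u > 0" using that by (simp add: dist_norm)
    then show "u \<noteq> 0" "u \<notin> \<real>\<^sub>\<le>\<^sub>0" by (auto simp: complex_nonpos_Reals_iff)
  qed
  have \<phi>1: "\<phi> (a0, f0) = 1" using z0(2) unfolding \<phi>_def fst_conv snd_conv z0(1)[symmetric] by simp
  then obtain \<eta> where \<eta>: "\<eta> > 0" "\<phi> ` ball (a0, f0) \<eta> \<subseteq> ball 1 1" using ball_ex[OF c\<phi>] zero_less_one by blast
  define z where "z p = z0 * csqrt (\<phi> p)" for p
  have cz: "continuous_on (ball (a0, f0) \<eta>) z" unfolding z_def
  proof (intro continuous_intros)
    show "continuous_on (ball (a0, f0) \<eta>) (\<lambda>p. csqrt (\<phi> p))"
    proof (rule continuous_on_compose2[OF continuous_on_csqrt c\<phi>])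
      show "\<phi> ` ball (a0, f0) \<eta> \<subseteq> - \<real>\<^sub>\<le>\<^sub>0" using \<eta>(2) B(3) by blast
    qed
  qed
  have zz: "(z p)\<^sup>2 = (fst p)\<^sup>2 - snd p ^ n" for p
    using z0(2) by (simp add: z_def power_mult_distrib \<phi>_def)
  define u where "u p = (fst p + z p) / fst w0 ^ n" for p
  have cu: "continuous_on (ball (a0, f0) \<eta>) u" unfolding u_def
    using nz by (intro continuous_intros cz) auto
  have "u (a0, f0) = 1" using az0 nz by (simp add: u_def z_def \<phi>1)
  then obtain \<epsilon> where \<epsilon>: "\<epsilon> > 0" "\<epsilon> \<le> \<eta>" "u ` ball (a0, f0) \<epsilon> \<subseteq> ball 1 1"
    using ball_ex[OF cu _ \<eta>(1)] by blast
  define \<omega> where "\<omega> p = fst w0 * exp (Ln (u p) / of_nat n)" for p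
  have c\<omega>: "continuous_on (ball (a0, f0) \<epsilon>) \<omega>" unfolding \<omega>_def
  proof -
    have "continuous_on (ball (a0, f0) \<epsilon>) u"
      by (rule continuous_on_subset[OF cu]) (use \<epsilon>(2) in auto)
    moreover have "u p \<notin> \<real>\<^sub>\<le>\<^sub>0" if "p \<in> ball (a0, f0) \<epsilon>" for p using that \<epsilon>(3) B(3) by blast
    ultimately show "continuous_on (ball (a0, f0) \<epsilon>) (\<lambda>p. fst w0 * exp (Ln (u p) / of_nat n))"
      using n by (intro continuous_intros) auto
  qed
  have \<omega>nz: "\<omega> p \<noteq> 0" for p using nz by (simp add: \<omega>_def)
  have \<omega>n: "\<omega> p ^ n = fst p + z p" if "p \<in> ball (a0, f0) \<epsilon>" for p
  proof -
    have "u p \<noteq> 0" using that \<epsilon>(3) B(2) by blast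
    have "exp (Ln (u p) / of_nat n) ^ n = exp (of_nat n * (Ln (u p) / of_nat n))"
      by (rule exp_of_nat_mult[symmetric])
    also have "\<dots> = u p" using n \<open>u p \<noteq> 0\<close> by simp
    finally show ?thesis using nz by (simp add: \<omega>_def power_mult_distrib u_def)
  qed
  define \<sigma> where "\<sigma> p = (\<omega> p, snd p / \<omega> p)" for p
  have "continuous_on (ball (a0, f0) \<epsilon>) \<sigma>" unfolding \<sigma>_def
    using \<omega>nz by (intro continuous_intros c\<omega>) auto
  moreover have "\<sigma> p \<in> fib n (fst p) (snd p)" if p: "p \<in> ball (a0, f0) \<epsilon>" for p
  proof -
    have "snd p ^ n = (fst p + z p) * (fst p - z p)" using zz[of p] by (simp add: power2_eq_square algebra_simps)
    moreover have "fst p + z p \<noteq> 0" unfolding \<omega>n[OF p, symmetric] using \<omega>nz[of p] by simp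
    ultimately have "(snd p / \<omega> p) ^ n = fst p - z p"
      unfolding power_divide \<omega>n[OF p] by simp
    then show ?thesis using \<omega>n[OF p] \<omega>nz[of p] by (simp add: \<sigma>_def fib_def)
  qed
  ultimately show ?thesis using \<epsilon>(1) by blast
qed

lemma local_branch:
  assumes n: "n \<ge> 1" and d: "a0\<^sup>2 \<noteq> f0 ^ n"
  shows "\<exists>\<epsilon>>0. \<exists>\<sigma>. continuous_on (ball (a0, f0) \<epsilon>) \<sigma> \<and>
    (\<forall>p\<in>ball (a0, f0) \<epsilon>. \<sigma> p \<in> fib n (fst p) (snd p))"
proof -
  obtain w0 where w0: "w0 \<in> fib n a0 f0" using fib_nonempty[OF n] by blast
  show ?thesis
  proof (cases "fst w0 = 0")
    case False
    then show ?thesis using local_branch_fst[OF n w0 d] by blast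
  next
    case True
    have "(snd w0, fst w0) \<in> fib n a0 f0" using w0 by (auto simp: fib_def mult.commute add.commute)
    moreover have "snd w0 \<noteq> 0" using fib_powers_neq[OF w0 d] True by auto
    ultimately show ?thesis using local_branch_fst[OF n _ d, of "(snd w0, fst w0)"] by simp
  qed
qed

text \<open>Functions \<open>A\<close> and \<open>F\<close> on \<open>T\<close> describe, up to the multipliers \<open>m i\<close>, sections of the \<open>n\<close>-th and second powers of a
line bundle. The multipliers themselves need not be continuous. Only their quotients and the normalised
functions \<open>A / (m i)\<^sup>n\<close> and \<open>F / (m i)\<^sup>2\<close> on \<open>U i\<close> are; they are the transition functions and the
local representatives of the sections. In this way points of the total space of the bundle are written as
complex numbers.\<close>

section \<open>Monodromy of the dihedral cover\<close>

locale dihedral_cover =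
  fixes T :: "'a topology" and n :: nat and I :: "'i set" and U :: "'i \<Rightarrow> 'a set"
    and m :: "'i \<Rightarrow> 'a \<Rightarrow> complex" and A F :: "'a \<Rightarrow> complex"
  assumes n: "n \<ge> 1"
    and U_open: "\<And>i. i \<in> I \<Longrightarrow> openin T (U i)"
    and U_cover: "\<And>x. x \<in> topspace T \<Longrightarrow> \<exists>i\<in>I. x \<in> U i"
    and m_nonzero: "\<And>i x. i \<in> I \<Longrightarrow> x \<in> U i \<Longrightarrow> m i x \<noteq> 0"
    and m_quotient: "\<And>i j. i \<in> I \<Longrightarrow> j \<in> I \<Longrightarrow>
      continuous_map (subtopology T (U i \<inter> U j)) euclidean (\<lambda>x. m i x / m j x)"
    and A_cont: "\<And>i. i \<in> I \<Longrightarrow> continuous_map (subtopology T (U i)) euclidean (\<lambda>x. A x / m i x ^ n)"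
    and F_cont: "\<And>i. i \<in> I \<Longrightarrow> continuous_map (subtopology T (U i)) euclidean (\<lambda>x. F x / (m i x)\<^sup>2)"
    and discriminant: "\<And>x. x \<in> topspace T \<Longrightarrow> (A x)\<^sup>2 \<noteq> F x ^ n"
begin

abbreviation E :: "'a \<Rightarrow> (complex \<times> complex) set" where
  "E x \<equiv> fib n (A x) (F x)"

abbreviation D :: "(int \<times> bool) set" where
  "D \<equiv> carrier (dihedral_group n)"

text \<open>A lift of \<open>\<gamma>\<close> over \<open>S\<close>. Continuity is required in every local trivialisation, that is, after division by the
multiplier.\<close>

definition lift :: "('b::topological_space \<Rightarrow> 'a) \<Rightarrow> 'b set \<Rightarrow> ('b \<Rightarrow> complex \<times> complex) \<Rightarrow> bool" where
  "lift \<gamma> S e \<longleftrightarrow> (\<forall>t\<in>S. e t \<in> E (\<gamma> t)) \<and>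
     (\<forall>i\<in>I. continuous_on {t\<in>S. \<gamma> t \<in> U i} (\<lambda>t. dilate (1 / m i (\<gamma> t)) (e t)))"

lemma E_powers_neq: "x \<in> topspace T \<Longrightarrow> w \<in> E x \<Longrightarrow> fst w ^ n \<noteq> snd w ^ n"
  using fib_powers_neq discriminant by blast

lemma continuous_on_dilate:
  assumes "continuous_on S g" "continuous_on S e"
  shows "continuous_on S (\<lambda>t. dilate (g t) (e t))"
  unfolding dilate_def by (intro continuous_intros assms)

lemma continuous_on_act: "continuous_on S e \<Longrightarrow> continuous_on S (\<lambda>t. act n g (e t))"
  unfolding act_def by (cases "snd g") (auto intro!: continuous_intros)

lemma lift_subset:
  assumes "lift \<gamma> S e" "S' \<subseteq> S"
  shows "lift \<gamma> S' e"
  unfolding lift_def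
proof (intro conjI ballI)
  show "e t \<in> E (\<gamma> t)" if "t \<in> S'" for t using assms that unfolding lift_def by blast
  fix i assume "i \<in> I"
  then have "continuous_on {t\<in>S. \<gamma> t \<in> U i} (\<lambda>t. dilate (1 / m i (\<gamma> t)) (e t))"
    using assms(1) unfolding lift_def by blast
  then show "continuous_on {t\<in>S'. \<gamma> t \<in> U i} (\<lambda>t. dilate (1 / m i (\<gamma> t)) (e t))"
    by (rule continuous_on_subset) (use assms(2) in blast)
qed

lemma lift_cong:
  assumes "lift \<gamma> S e" "\<And>t. t \<in> S \<Longrightarrow> \<gamma> t = \<gamma>' t" "\<And>t. t \<in> S \<Longrightarrow> e t = e' t"
  shows "lift \<gamma>' S e'"
proof -
  have "{t\<in>S. \<gamma>' t \<in> U i} = {t\<in>S. \<gamma> t \<in> U i}" for i using assms(2) by auto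
  moreover have "continuous_on {t\<in>S. \<gamma> t \<in> U i} (\<lambda>t. dilate (1 / m i (\<gamma>' t)) (e' t))" if "i \<in> I" for i
    using assms(1) that unfolding lift_def
    by (auto simp: assms(2,3) cong: continuous_on_cong_simp)
  ultimately show ?thesis using assms unfolding lift_def by auto
qed

lemma lift_act: "lift \<gamma> S e \<Longrightarrow> lift \<gamma> S (\<lambda>t. act n g (e t))"
  unfolding lift_def by (auto simp: dilate_act intro: act_fib[OF n] continuous_on_act)

lemma lift_compose:
  assumes "lift \<gamma> S e" "continuous_on S' \<phi>" "\<phi> ` S' \<subseteq> S"
  shows "lift (\<lambda>t. \<gamma> (\<phi> t)) S' (\<lambda>t. e (\<phi> t))"
  unfolding lift_def
proof (intro conjI ballI)
  fix i assume "i \<in> I"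
  then have "continuous_on {t\<in>S. \<gamma> t \<in> U i} (\<lambda>t. dilate (1 / m i (\<gamma> t)) (e t))"
    using assms(1) by (simp add: lift_def)
  then show "continuous_on {t\<in>S'. \<gamma> (\<phi> t) \<in> U i} (\<lambda>t. dilate (1 / m i (\<gamma> (\<phi> t))) (e (\<phi> t)))"
    by (rule continuous_on_compose2[OF _ continuous_on_subset[OF assms(2)]]) (use assms(3) in auto)
qed (use assms in \<open>auto simp: lift_def\<close>)

lemma lift_const: "w \<in> E x \<Longrightarrow> lift (\<lambda>t. x) S (\<lambda>t. w)"
  unfolding lift_def by auto

lemma lift_glue:
  fixes \<gamma> :: "real \<Rightarrow> 'a"
  assumes "lift \<gamma> {a..b} e1" "lift \<gamma> {b..c} e2" "e1 b = e2 b" "a \<le> b" "b \<le> c"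
  shows "lift \<gamma> {a..c} (\<lambda>t. if t \<le> b then e1 t else e2 t)"
  unfolding lift_def
proof (intro conjI ballI)
  fix t assume "t \<in> {a..c}"
  then show "(if t \<le> b then e1 t else e2 t) \<in> E (\<gamma> t)" using assms unfolding lift_def by auto
next
  fix i assume i: "i \<in> I"
  let ?f = "\<lambda>e t. dilate (1 / m i (\<gamma> t)) (e t)"
  have "continuous_on {t\<in>{a..c}. \<gamma> t \<in> U i} (\<lambda>t. if t \<le> b then ?f e1 t else ?f e2 t)"
  proof (rule continuous_on_cases_le)
    show "continuous_on {t \<in> {t \<in> {a..c}. \<gamma> t \<in> U i}. t \<le> b} (?f e1)"
      using assms(1) i unfolding lift_def by (auto elim!: ballE[of _ _ i] elim: continuous_on_subset)
    show "continuous_on {t \<in> {t \<in> {a..c}. \<gamma> t \<in> U i}. b \<le> t} (?f e2)"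
      using assms(2) i unfolding lift_def by (auto elim!: ballE[of _ _ i] elim: continuous_on_subset)
  qed (use assms(3) in auto)
  then show "continuous_on {t\<in>{a..c}. \<gamma> t \<in> U i} (\<lambda>t. dilate (1 / m i (\<gamma> t)) (if t \<le> b then e1 t else e2 t))"
    by (simp add: if_distrib[of "dilate _"])
qed

lemma preimage_neighbourhood:
  assumes "continuous_map (top_of_set S) T \<gamma>" "t0 \<in> S" "openin T V" "\<gamma> t0 \<in> V"
  shows "\<exists>O'. open O' \<and> t0 \<in> O' \<and> (\<forall>t\<in>S \<inter> O'. \<gamma> t \<in> V)"
proof -
  have "openin (top_of_set S) {t \<in> topspace (top_of_set S). \<gamma> t \<in> V}"
    using assms(1,3) by (rule openin_continuous_map_preimage)
  then obtain O' where "open O'" "{t \<in> S. \<gamma> t \<in> V} = S \<inter> O'"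
    by (auto simp: openin_open)
  then show ?thesis using assms(2,4) by (intro exI[of _ O']) auto
qed

text \<open>The group is finite and acts freely, so the finitely many conditions \<open>e' = h e\<close> with \<open>h \<noteq> g\<close> fail near \<open>t0\<close>;
by transitivity \<open>e' = g e\<close> is the only possibility left.\<close>

lemma lifts_differ_locally_by_constant:
  assumes \<gamma>: "continuous_map (top_of_set S) T \<gamma>" and e: "lift \<gamma> S e" and e': "lift \<gamma> S e'"
    and t0: "t0 \<in> S" and g: "e' t0 = act n g (e t0)" "g \<in> D"
  shows "\<forall>\<^sub>F t in at t0 within S. e' t = act n g (e t)"
proof -
  have "\<gamma> t0 \<in> topspace T" using \<gamma> t0 by (auto simp: continuous_map_def)
  then obtain i where i: "i \<in> I" "\<gamma> t0 \<in> U i" using U_cover by blast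
  obtain O' where O': "open O'" "t0 \<in> O'" "\<And>t. t \<in> S \<inter> O' \<Longrightarrow> \<gamma> t \<in> U i"
    using preimage_neighbourhood[OF \<gamma> t0 U_open[OF i(1)] i(2)] by blast
  define Si where "Si = {t\<in>S. \<gamma> t \<in> U i}"
  define f where "f e t = dilate (1 / m i (\<gamma> t)) (e t)" for e :: "'b \<Rightarrow> complex \<times> complex" and t
  have c: "continuous_on Si (f e)" "continuous_on Si (f e')"
    using e e' i(1) unfolding lift_def Si_def f_def by auto
  have t0i: "t0 \<in> Si" using t0 i by (simp add: Si_def)
  have dilate_inj: "dilate (1 / m i (\<gamma> t)) v = dilate (1 / m i (\<gamma> t)) w \<longleftrightarrow> v = w" if "t \<in> Si" for t v w
    using m_nonzero[OF i(1), of "\<gamma> t"] that by (auto simp: Si_def dilate_def prod_eq_iff)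
  have "\<forall>\<^sub>F t in at t0 within Si. \<forall>h\<in>D - {g}. e' t \<noteq> act n h (e t)"
  proof (intro eventually_ball_finite ballI)
    show "finite (D - {g})" using finite_carrier_dihedral by blast
    fix h assume h: "h \<in> D - {g}"
    have "e t0 \<in> E (\<gamma> t0)" using e t0 by (simp add: lift_def)
    then have "fst (e t0) ^ n \<noteq> snd (e t0) ^ n" using E_powers_neq \<open>\<gamma> t0 \<in> topspace T\<close> by blast
    then have "act n g (e t0) \<noteq> act n h (e t0)" using act_free[OF n] g(2) h by blast
    then have "f e' t0 - act n h (f e t0) \<noteq> 0"
      unfolding f_def dilate_act[symmetric] using g(1) dilate_inj[OF t0i] by simp
    moreover have "continuous_on Si (\<lambda>t. f e' t - act n h (f e t))"
      by (intro continuous_intros c continuous_on_act)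
    then have "((\<lambda>t. f e' t - act n h (f e t)) \<longlongrightarrow> f e' t0 - act n h (f e t0)) (at t0 within Si)"
      using t0i by (simp add: continuous_on_def)
    ultimately have "\<forall>\<^sub>F t in at t0 within Si. f e' t - act n h (f e t) \<noteq> 0"
      by (metis tendsto_imp_eventually_ne)
    then show "\<forall>\<^sub>F t in at t0 within Si. e' t \<noteq> act n h (e t)"
      by eventually_elim (auto simp: f_def dilate_act)
  qed
  moreover have "at t0 within Si = at t0 within S"
    by (rule at_within_nhd[OF O'(2,1)]) (use O'(3) in \<open>auto simp: Si_def\<close>)
  ultimately have "\<forall>\<^sub>F t in at t0 within S. \<forall>h\<in>D - {g}. e' t \<noteq> act n h (e t)" by simp
  moreover have "\<forall>\<^sub>F t in at t0 within S. t \<in> S" by (simp add: eventually_at_filter)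
  ultimately show ?thesis
  proof eventually_elim
    case (elim t)
    then obtain h where "h \<in> D" "e' t = act n h (e t)"
      using act_transitive[OF n, of "e t" "A (\<gamma> t)" "F (\<gamma> t)" "e' t"] e e' by (auto simp: lift_def)
    then show ?case using elim(1) by blast
  qed
qed

lemma lifts_differ_by_constant:
  assumes S: "connected S" and \<gamma>: "continuous_map (top_of_set S) T \<gamma>"
    and e: "lift \<gamma> S e" and e': "lift \<gamma> S e'" and t0: "t0 \<in> S"
    and g: "e' t0 = act n g (e t0)" "g \<in> D" and t: "t \<in> S"
  shows "e' t = act n g (e t)"
proof -
  define G where "G t = (THE h. h \<in> D \<and> e' t = act n h (e t))" for t
  have ex1: "\<exists>!h. h \<in> D \<and> e' t = act n h (e t)" if "t \<in> S" for t
  proof -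
    have "e t \<in> E (\<gamma> t)" "e' t \<in> E (\<gamma> t)" "\<gamma> t \<in> topspace T"
      using e e' \<gamma> that by (auto simp: lift_def continuous_map_def)
    then show ?thesis using act_transitive[OF n] act_free[OF n E_powers_neq] by metis
  qed
  have G: "G t \<in> D" "e' t = act n (G t) (e t)" if "t \<in> S" for t
    using theI'[OF ex1[OF that]] unfolding G_def by auto
  have G_eq: "G t = h" if "t \<in> S" "h \<in> D" "e' t = act n h (e t)" for t h
    using ex1[OF that(1)] G[OF that(1)] that(2,3) by blast
  have "G t0 = G t"
  proof (rule connected_local_const[OF S t0 t], intro ballI)
    fix a assume a: "a \<in> S"
    have "\<forall>\<^sub>F b in at a within S. b \<in> S" by (simp add: eventually_at_filter)
    with lifts_differ_locally_by_constant[OF \<gamma> e e' a G(2,1)[OF a]]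
    show "\<forall>\<^sub>F b in at a within S. G a = G b"
    proof eventually_elim
      case (elim b)
      then show ?case using G_eq[OF elim(2) G(1)[OF a] elim(1)] by simp
    qed
  qed
  then show ?thesis using G(2)[OF t] G_eq[OF t0 g(2,1)] by simp
qed

text \<open>Lifting \<open>\<gamma>\<close> from \<open>a\<close> to \<open>b\<close> transports \<open>u\<close> to \<open>v\<close>.\<close>

definition carries :: "(real \<Rightarrow> 'a) \<Rightarrow> real \<Rightarrow> real \<Rightarrow> complex \<times> complex \<Rightarrow> complex \<times> complex \<Rightarrow> bool" where
  "carries \<gamma> a b u v \<longleftrightarrow> (\<exists>e. lift \<gamma> {a..b} e \<and> e a = u \<and> e b = v)"

lemma carries_trans:
  assumes "carries \<gamma> a b u v" "carries \<gamma> b c v w" "a \<le> b" "b \<le> c"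
  shows "carries \<gamma> a c u w"
proof -
  obtain e1 e2 where e: "lift \<gamma> {a..b} e1" "e1 a = u" "e1 b = v" "lift \<gamma> {b..c} e2" "e2 b = v" "e2 c = w"
    using assms unfolding carries_def by blast
  have "lift \<gamma> {a..c} (\<lambda>t. if t \<le> b then e1 t else e2 t)"
    using e assms by (intro lift_glue) auto
  moreover have "(if c \<le> b then e1 c else e2 c) = w" using e assms by auto
  ultimately show ?thesis unfolding carries_def using e assms
    by (intro exI[of _ "\<lambda>t. if t \<le> b then e1 t else e2 t"]) auto
qed

lemma carries_act: "carries \<gamma> a b u v \<Longrightarrow> carries \<gamma> a b (act n g u) (act n g v)"
  unfolding carries_def using lift_act by blast

lemma carries_unique:
  assumes \<gamma>: "continuous_map (top_of_set {a..b}) T \<gamma>" and "a \<le> b"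
    and "carries \<gamma> a b u v" "carries \<gamma> a b u v'"
  shows "v = v'"
proof -
  obtain e e' where e: "lift \<gamma> {a..b} e" "e a = u" "e b = v" "lift \<gamma> {a..b} e'" "e' a = u" "e' b = v'"
    using assms unfolding carries_def by blast
  have "e' b = act n (0, False) (e b)"
  proof (rule lifts_differ_by_constant[OF connected_Icc \<gamma> e(1,4)])
    show "e' a = act n (0, False) (e a)" using e by (simp add: act_one)
    show "(0, False) \<in> D" using n by (simp add: carrier_dihedral)
  qed (use assms(2) in auto)
  then show ?thesis using e by (simp add: act_one)
qed

lemma lift_of_branch:
  assumes i: "i \<in> I" and \<gamma>: "continuous_map (top_of_set S) T \<gamma>" and U: "\<And>t. t \<in> S \<Longrightarrow> \<gamma> t \<in> U i"
    and s: "continuous_on S s" "\<And>t. t \<in> S \<Longrightarrow> s t \<in> fib n (A (\<gamma> t) / m i (\<gamma> t) ^ n) (F (\<gamma> t) / (m i (\<gamma> t))\<^sup>2)"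
  shows "lift \<gamma> S (\<lambda>t. dilate (m i (\<gamma> t)) (s t))"
  unfolding lift_def
proof (intro conjI ballI)
  fix t assume t: "t \<in> S"
  then show "dilate (m i (\<gamma> t)) (s t) \<in> E (\<gamma> t)"
    using dilate_fib[OF s(2)[OF t], of "m i (\<gamma> t)"] m_nonzero[OF i U[OF t]] by simp
next
  fix j assume j: "j \<in> I"
  let ?S = "{t \<in> S. \<gamma> t \<in> U j}"
  have "continuous_map (top_of_set ?S) (subtopology T (U i \<inter> U j)) \<gamma>"
    using \<gamma> U by (auto simp: continuous_map_in_subtopology intro: continuous_map_from_subtopology_mono)
  from continuous_map_compose[OF this m_quotient[OF i j]]
  have "continuous_on ?S (\<lambda>t. m i (\<gamma> t) / m j (\<gamma> t))" by (simp add: o_def)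
  moreover have "continuous_on ?S s" by (rule continuous_on_subset[OF s(1)]) auto
  ultimately have "continuous_on ?S (\<lambda>t. dilate (m i (\<gamma> t) / m j (\<gamma> t)) (s t))" by (rule continuous_on_dilate)
  then show "continuous_on ?S (\<lambda>t. dilate (1 / m j (\<gamma> t)) (dilate (m i (\<gamma> t)) (s t)))"
    by (simp add: dilate_dilate)
qed

text \<open>Normalised by the multiplier, the functions are continuous, and a continuous solution of the equations of the fibre
near their values is provided by \<open>local_branch\<close>. The domain of \<open>\<gamma>\<close> is arbitrary, as squares will be lifted
as well as intervals.\<close>

lemma local_trivialisation:
  fixes \<gamma> :: "'b::topological_space \<Rightarrow> 'a"
  assumes \<gamma>: "continuous_map (top_of_set S) T \<gamma>" and t0: "t0 \<in> S"
  shows "\<exists>O'. open O' \<and> t0 \<in> O' \<and> (\<exists>e. lift \<gamma> (S \<inter> O') e)"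
proof -
  have t0T: "\<gamma> t0 \<in> topspace T" using \<gamma> t0 by (auto simp: continuous_map_def)
  then obtain i where i: "i \<in> I" "\<gamma> t0 \<in> U i" using U_cover by blast
  define a f where "a x = A x / m i x ^ n" and "f x = F x / (m i x)\<^sup>2" for x
  have mi: "m i (\<gamma> t0) \<noteq> 0" using m_nonzero i by blast
  have "(a (\<gamma> t0))\<^sup>2 \<noteq> f (\<gamma> t0) ^ n"
  proof
    assume eq: "(a (\<gamma> t0))\<^sup>2 = f (\<gamma> t0) ^ n"
    have "(A (\<gamma> t0))\<^sup>2 = (a (\<gamma> t0))\<^sup>2 * (m i (\<gamma> t0) ^ n)\<^sup>2"
      using mi by (simp add: a_def power_divide)
    also have "\<dots> = f (\<gamma> t0) ^ n * ((m i (\<gamma> t0))\<^sup>2) ^ n" unfolding eq by (simp add: power_mult[symmetric] mult.commute)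
    also have "\<dots> = F (\<gamma> t0) ^ n" using mi by (simp add: f_def power_mult_distrib[symmetric])
    finally show False using discriminant[OF t0T] by simp
  qed
  then obtain \<epsilon> \<sigma> where \<epsilon>: "\<epsilon> > 0" and \<sigma>: "continuous_on (ball (a (\<gamma> t0), f (\<gamma> t0)) \<epsilon>) \<sigma>"
    "\<And>p. p \<in> ball (a (\<gamma> t0), f (\<gamma> t0)) \<epsilon> \<Longrightarrow> \<sigma> p \<in> fib n (fst p) (snd p)"
    using local_branch[OF n] by blast
  have "continuous_map (subtopology T (U i)) (prod_topology euclidean euclidean) (\<lambda>x. (a x, f x))"
    using A_cont[OF i(1)] F_cont[OF i(1)] unfolding continuous_map_pairwise
    by (simp add: o_def a_def f_def)
  then have caf: "continuous_map (subtopology T (U i)) euclidean (\<lambda>x. (a x, f x))" by simp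
  have "openin (subtopology T (U i)) {x \<in> topspace (subtopology T (U i)). (a x, f x) \<in> ball (a (\<gamma> t0), f (\<gamma> t0)) \<epsilon>}"
    by (rule openin_continuous_map_preimage[OF caf]) simp
  then have "openin T {x \<in> topspace (subtopology T (U i)). (a x, f x) \<in> ball (a (\<gamma> t0), f (\<gamma> t0)) \<epsilon>}"
    using openin_trans_full U_open[OF i(1)] by blast
  from preimage_neighbourhood[OF \<gamma> t0 this]
  obtain O' where O': "open O'" "t0 \<in> O'"
    "\<And>t. t \<in> S \<inter> O' \<Longrightarrow> \<gamma> t \<in> U i \<and> (a (\<gamma> t), f (\<gamma> t)) \<in> ball (a (\<gamma> t0), f (\<gamma> t0)) \<epsilon>"
    using i(2) t0T \<epsilon> by auto
  have \<gamma>': "continuous_map (top_of_set (S \<inter> O')) T \<gamma>"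
    using \<gamma> by (rule continuous_map_from_subtopology_mono) auto
  have "lift \<gamma> (S \<inter> O') (\<lambda>t. dilate (m i (\<gamma> t)) (\<sigma> (a (\<gamma> t), f (\<gamma> t))))"
  proof (rule lift_of_branch[OF i(1) \<gamma>'])
    show "\<gamma> t \<in> U i" if "t \<in> S \<inter> O'" for t using O'(3)[OF that] by blast
    have "continuous_map (top_of_set (S \<inter> O')) (subtopology T (U i)) \<gamma>"
      using \<gamma>' O'(3) by (auto simp: continuous_map_in_subtopology)
    from continuous_map_compose[OF this caf]
    have "continuous_on (S \<inter> O') (\<lambda>t. (a (\<gamma> t), f (\<gamma> t)))" by (simp add: o_def)
    then show "continuous_on (S \<inter> O') (\<lambda>t. \<sigma> (a (\<gamma> t), f (\<gamma> t)))"
      by (rule continuous_on_compose2[OF \<sigma>(1)]) (use O'(3) in auto)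
    show "\<sigma> (a (\<gamma> t), f (\<gamma> t)) \<in> fib n (A (\<gamma> t) / m i (\<gamma> t) ^ n) (F (\<gamma> t) / (m i (\<gamma> t))\<^sup>2)"
      if "t \<in> S \<inter> O'" for t
      using \<sigma>(2)[of "(a (\<gamma> t), f (\<gamma> t))"] O'(3)[OF that] by (simp add: a_def f_def)
  qed
  then show ?thesis using O'(1,2) by blast
qed

definition band :: "real \<Rightarrow> real \<Rightarrow> real set" where
  "band s0 \<eta> = {0..1} \<inter> ball s0 \<eta>"

text \<open>Existence of lifts along the lines \<open>s = const\<close> of a homotopy, with end points depending continuously on \<open>s\<close> near
\<open>s0\<close>. Bolzano's bisection principle replaces a Lebesgue number: the claim holds for short intervals
in \<open>t\<close> by local trivialisation and can be composed, at the price of a smaller strip.\<close>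

lemma homotopy_strip:
  fixes H :: "real \<times> real \<Rightarrow> 'a"
  assumes H: "continuous_map (top_of_set ({0..1} \<times> {0..1})) T H" and s0: "s0 \<in> {0..1}"
    and \<eta>: "\<eta> > 0" and u: "lift (\<lambda>s. H (s, 0)) (band s0 \<eta>) u"
  shows "\<exists>\<eta>'>0. \<eta>' \<le> \<eta> \<and> (\<exists>v. lift (\<lambda>s. H (s, 1)) (band s0 \<eta>') v \<and>
    (\<forall>s\<in>band s0 \<eta>'. carries (\<lambda>t. H (s, t)) 0 1 (u s) (v s)))"
proof -
  \<comment> \<open>The claim for the interval \<open>[a, b]\<close>: any lift on \<open>t = a\<close> is transported to a lift on \<open>t = b\<close>.\<close>
  define P where "P a b \<longleftrightarrow> (0 \<le> a \<and> b \<le> 1 \<longrightarrow> (\<forall>\<eta>>0. \<forall>u. lift (\<lambda>s. H (s, a)) (band s0 \<eta>) u \<longrightarrow>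
    (\<exists>\<eta>'>0. \<eta>' \<le> \<eta> \<and> (\<exists>v. lift (\<lambda>s. H (s, b)) (band s0 \<eta>') v \<and>
    (\<forall>s\<in>band s0 \<eta>'. carries (\<lambda>t. H (s, t)) a b (u s) (v s))))))" for a b
  have "P 0 1"
  proof (rule Bolzano[of 0 1 P])
    show "(0::real) \<le> 1" by simp
  next
    fix a b c assume P: "P a b" "P b c" "a \<le> b" "b \<le> c"
    show "P a c" unfolding P_def
    proof (intro impI allI)
      fix \<eta> :: real and u assume ac: "0 \<le> a \<and> c \<le> 1" and \<eta>: "\<eta> > 0" and u: "lift (\<lambda>s. H (s, a)) (band s0 \<eta>) u"
      have "0 \<le> a \<and> b \<le> 1" "0 \<le> b \<and> c \<le> 1" using ac P(3,4) by auto
      then obtain \<eta>1 v where 1: "\<eta>1 > 0" "\<eta>1 \<le> \<eta>" "lift (\<lambda>s. H (s, b)) (band s0 \<eta>1) v"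
        "\<forall>s\<in>band s0 \<eta>1. carries (\<lambda>t. H (s, t)) a b (u s) (v s)"
        using P(1) \<eta> u unfolding P_def by blast
      then obtain \<eta>2 w where 2: "\<eta>2 > 0" "\<eta>2 \<le> \<eta>1" "lift (\<lambda>s. H (s, c)) (band s0 \<eta>2) w"
        "\<forall>s\<in>band s0 \<eta>2. carries (\<lambda>t. H (s, t)) b c (v s) (w s)"
        using P(2) \<open>0 \<le> b \<and> c \<le> 1\<close> unfolding P_def by blast
      have "band s0 \<eta>2 \<subseteq> band s0 \<eta>1" using 2(2) by (auto simp: band_def)
      then have "\<forall>s\<in>band s0 \<eta>2. carries (\<lambda>t. H (s, t)) a c (u s) (w s)"
        using 1(4) 2(4) P(3,4) carries_trans by blast
      then show "\<exists>\<eta>'>0. \<eta>' \<le> \<eta> \<and> (\<exists>v. lift (\<lambda>s. H (s, c)) (band s0 \<eta>') v \<and>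
        (\<forall>s\<in>band s0 \<eta>'. carries (\<lambda>t. H (s, t)) a c (u s) (v s)))"
        using 1(2) 2(1-3) by (intro exI[of _ \<eta>2]) auto
    qed
  next
    fix t0 :: real assume t0: "0 \<le> t0" "t0 \<le> 1"
    then obtain O' e where O': "open O'" "(s0, t0) \<in> O'" and e: "lift H (({0..1} \<times> {0..1}) \<inter> O') e"
      using local_trivialisation[OF H, of "(s0, t0)"] s0 by auto
    obtain X Y where XY: "open X" "open Y" "s0 \<in> X" "t0 \<in> Y" "X \<times> Y \<subseteq> O'"
      using open_prod_elim[OF O'] by (metis mem_Sigma_iff)
    obtain \<delta>1 \<delta>2 where d: "\<delta>1 > 0" "ball s0 \<delta>1 \<subseteq> X" "\<delta>2 > 0" "ball t0 \<delta>2 \<subseteq> Y"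
      using XY by (meson open_contains_ball)
    have "P a b" if ab: "a \<le> t0" "t0 \<le> b" "b - a < \<delta>2" for a b
      unfolding P_def
    proof (intro impI allI)
      fix \<eta> :: real and u assume ab': "0 \<le> a \<and> b \<le> 1" and \<eta>: "\<eta> > 0" and u: "lift (\<lambda>s. H (s, a)) (band s0 \<eta>) u"
      define \<eta>' where "\<eta>' = min \<eta> \<delta>1"
      have \<eta>': "\<eta>' > 0" "\<eta>' \<le> \<eta>" using \<eta> d by (auto simp: \<eta>'_def)
      have sub: "band s0 \<eta>' \<times> {a..b} \<subseteq> ({0..1} \<times> {0..1}) \<inter> O'"
      proof
        fix p assume "p \<in> band s0 \<eta>' \<times> {a..b}"
        then obtain s t where p: "p = (s, t)" "s \<in> {0..1}" "s \<in> ball s0 \<delta>1" "t \<in> {a..b}"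
          by (auto simp: band_def \<eta>'_def)
        moreover have "t \<in> ball t0 \<delta>2" using p(4) ab by (auto simp: dist_real_def)
        ultimately have "s \<in> X" "t \<in> Y" using d(2,4) by blast+
        then have "p \<in> O'" using XY(5) p(1) by blast
        then show "p \<in> ({0..1} \<times> {0..1}) \<inter> O'" using p ab' by auto
      qed
      have mem: "(s, t) \<in> ({0..1} \<times> {0..1}) \<inter> O'" if "s \<in> band s0 \<eta>'" "t \<in> {a..b}" for s t
        using sub that by blast
      have aI: "a \<in> {a..b}" "b \<in> {a..b}" using ab by auto
      have slice: "lift (\<lambda>s. H (s, t)) (band s0 \<eta>') (\<lambda>s. e (s, t))" if "t \<in> {a..b}" for t
      proof (rule lift_compose[OF e])
        show "(\<lambda>s. (s, t)) ` band s0 \<eta>' \<subseteq> ({0..1} \<times> {0..1}) \<inter> O'" using mem that by blast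
      qed (intro continuous_intros)
      have H\<gamma>: "continuous_map (top_of_set (band s0 \<eta>')) T (\<lambda>s. H (s, a))"
      proof -
        have "continuous_map (top_of_set (band s0 \<eta>')) (top_of_set ({0..1} \<times> {0..1})) (\<lambda>s. (s, a))"
          using mem[OF _ aI(1)] by (auto intro!: continuous_intros)
        from continuous_map_compose[OF this H] show ?thesis by (simp add: o_def)
      qed
      have s0b: "s0 \<in> band s0 \<eta>'" using s0 \<eta>' by (simp add: band_def)
      have con: "connected (band s0 \<eta>')" unfolding band_def
        by (intro convex_connected convex_Int) auto
      have u': "lift (\<lambda>s. H (s, a)) (band s0 \<eta>') u"
        by (rule lift_subset[OF u]) (use \<eta>' in \<open>auto simp: band_def\<close>)
      \<comment> \<open>The given lift on \<open>t = a\<close> is a translate of the local one, so the latter can be moved to match it.\<close>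
      have "u s0 \<in> E (H (s0, a))" "e (s0, a) \<in> E (H (s0, a))"
        using u' slice[OF aI(1)] s0b by (auto simp: lift_def)
      then obtain g where g: "g \<in> D" "u s0 = act n g (e (s0, a))" using act_transitive[OF n] by blast
      have ug: "u s = act n g (e (s, a))" if "s \<in> band s0 \<eta>'" for s
        by (rule lifts_differ_by_constant[OF con H\<gamma> slice[OF aI(1)] u' s0b g(2,1) that])
      have "lift (\<lambda>s. H (s, b)) (band s0 \<eta>') (\<lambda>s. act n g (e (s, b)))"
        using lift_act[OF slice[OF aI(2)]] .
      moreover have "carries (\<lambda>t. H (s, t)) a b (u s) (act n g (e (s, b)))" if s: "s \<in> band s0 \<eta>'" for s
      proof -
        have "lift (\<lambda>t. H (s, t)) {a..b} (\<lambda>t. e (s, t))"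
        proof (rule lift_compose[OF e])
          show "(\<lambda>t. (s, t)) ` {a..b} \<subseteq> ({0..1} \<times> {0..1}) \<inter> O'" using mem s by blast
        qed (intro continuous_intros)
        from lift_act[OF this] show ?thesis
          unfolding carries_def ug[OF s] by (intro exI[of _ "\<lambda>t. act n g (e (s, t))"]) simp
      qed
      ultimately show "\<exists>\<eta>'>0. \<eta>' \<le> \<eta> \<and> (\<exists>v. lift (\<lambda>s. H (s, b)) (band s0 \<eta>') v \<and>
        (\<forall>s\<in>band s0 \<eta>'. carries (\<lambda>t. H (s, t)) a b (u s) (v s)))"
        using \<eta>' by blast
    qed
    then show "\<exists>d>0. \<forall>a b. a \<le> t0 \<and> t0 \<le> b \<and> b - a < d \<longrightarrow> P a b" using d(3) by blast
  qed
  then show ?thesis using \<eta> u unfolding P_def by simp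
qed

text \<open>The end points of the lifts lie in the discrete fibre over \<open>y1\<close> and vary continuously with \<open>s\<close>, so they are
constant.\<close>

lemma homotopy_carries:
  fixes H :: "real \<times> real \<Rightarrow> 'a"
  assumes H: "continuous_map (top_of_set ({0..1} \<times> {0..1})) T H"
    and ends: "\<And>s. s \<in> {0..1} \<Longrightarrow> H (s, 0) = y0" "\<And>s. s \<in> {0..1} \<Longrightarrow> H (s, 1) = y1" and w: "w \<in> E y0"
  shows "\<exists>v. \<forall>s\<in>{0..1}. carries (\<lambda>t. H (s, t)) 0 1 w v"
proof -
  have slice: "continuous_map (top_of_set {0..1}) T (\<lambda>t. H (s, t))" if "s \<in> {0..1}" for s
  proof -
    have "continuous_map (top_of_set {0..1}) (top_of_set ({0..1} \<times> {0..1})) (\<lambda>t. (s, t))"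
      using that by (auto intro!: continuous_intros)
    from continuous_map_compose[OF this H] show ?thesis by (simp add: o_def)
  qed
  have y1T: "y1 \<in> topspace T"
    using slice[of 0] ends(2)[of 0] by (force simp: continuous_map_def)
  have local: "\<exists>\<eta>>0. \<exists>v. \<forall>s\<in>band s0 \<eta>. carries (\<lambda>t. H (s, t)) 0 1 w v" if s0: "s0 \<in> {0..1}" for s0
  proof -
    have "lift (\<lambda>s. H (s, 0)) (band s0 1) (\<lambda>s. w)"
      by (rule lift_cong[OF lift_const[OF w]]) (use ends(1) in \<open>auto simp: band_def\<close>)
    from homotopy_strip[OF H s0 zero_less_one this]
    obtain \<eta> v where \<eta>: "\<eta> > 0" and v: "lift (\<lambda>s. H (s, 1)) (band s0 \<eta>) v"
      "\<forall>s\<in>band s0 \<eta>. carries (\<lambda>t. H (s, t)) 0 1 w (v s)" by blast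
    have v': "lift (\<lambda>s. y1) (band s0 \<eta>) v"
      by (rule lift_cong[OF v(1)]) (use ends(2) in \<open>auto simp: band_def\<close>)
    have s0b: "s0 \<in> band s0 \<eta>" using s0 \<eta> by (simp add: band_def)
    have "v s0 \<in> E y1" using v' s0b by (simp add: lift_def)
    have con: "connected (band s0 \<eta>)" unfolding band_def
      by (intro convex_connected convex_Int) auto
    have "v s = act n (0, False) (v s0)" if "s \<in> band s0 \<eta>" for s
      by (rule lifts_differ_by_constant[OF con _ lift_const[OF \<open>v s0 \<in> E y1\<close>] v' s0b _ _ that])
         (use y1T n in \<open>auto simp: act_one carrier_dihedral\<close>)
    then have "\<forall>s\<in>band s0 \<eta>. carries (\<lambda>t. H (s, t)) 0 1 w (v s0)" using v(2) by (simp add: act_one)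
    then show ?thesis using \<eta> by blast
  qed
  define f where "f s = (THE v. carries (\<lambda>t. H (s, t)) 0 1 w v)" for s
  have f: "f s = v" if "s \<in> {0..1}" "carries (\<lambda>t. H (s, t)) 0 1 w v" for s v
    unfolding f_def using that carries_unique[OF slice[OF that(1)]] by (intro the_equality) auto
  have "f 0 = f s" if s: "s \<in> {0..1}" for s
  proof (rule connected_local_const[of "{0..1}"])
    show "\<forall>a\<in>{0..1}. \<forall>\<^sub>F b in at a within {0..1}. f a = f b"
    proof
      fix a :: real assume a: "a \<in> {0..1}"
      obtain \<eta> v where \<eta>: "\<eta> > 0" "\<forall>s\<in>band a \<eta>. carries (\<lambda>t. H (s, t)) 0 1 w v" using local[OF a] by blast
      have "f b = v" if "b \<in> {0..1}" "dist b a < \<eta>" for b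
        using f[OF that(1)] \<eta>(2) that by (auto simp: band_def dist_commute)
      then show "\<forall>\<^sub>F b in at a within {0..1}. f a = f b"
        using a \<eta>(1) unfolding eventually_at by (intro exI[of _ \<eta>]) auto
    qed
  qed (use s in auto)
  moreover have "carries (\<lambda>t. H (s, t)) 0 1 w (f s)" if s: "s \<in> {0..1}" for s
  proof -
    obtain \<eta> v where \<eta>: "\<eta> > 0" "\<forall>s\<in>band s \<eta>. carries (\<lambda>t. H (s, t)) 0 1 w v" using local[OF s] by blast
    then have "carries (\<lambda>t. H (s, t)) 0 1 w v" using s by (auto simp: band_def)
    then show ?thesis using f[OF s] by simp
  qed
  ultimately have "\<forall>s\<in>{0..1}. carries (\<lambda>t. H (s, t)) 0 1 w (f 0)" by metis
  then show ?thesis by blast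
qed

text \<open>A path is a homotopy that does not depend on its parameter.\<close>

lemma path_carries:
  assumes "pathin T p" "w \<in> E (p 0)"
  shows "\<exists>v. carries p 0 1 w v"
proof -
  have "continuous_map (top_of_set ({0..1} \<times> {0..1})) (top_of_set {0..1::real}) (\<lambda>x. snd x :: real)"
    by (auto intro!: continuous_intros)
  from continuous_map_compose[OF this assms(1)[unfolded pathin_def]]
  have "continuous_map (top_of_set ({0..1} \<times> {0..1})) T (\<lambda>x. p (snd x :: real))" by (simp add: o_def)
  from homotopy_carries[OF this, of "p 0" "p 1" w] assms(2) show ?thesis by fastforce
qed

lemma carries_end: "carries p a b w v \<Longrightarrow> a \<le> b \<Longrightarrow> v \<in> E (p b)"
  unfolding carries_def lift_def by fastforce

lemma carries_reverse: "carries p 0 1 u v \<Longrightarrow> carries (\<lambda>t. p (1 - t)) 0 1 v u"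
proof -
  assume "carries p 0 1 u v"
  then obtain e where e: "lift p {0..1} e" "e 0 = u" "e 1 = v" unfolding carries_def by blast
  have "lift (\<lambda>t. p (1 - t)) {0..1} (\<lambda>t. e (1 - t))"
    by (rule lift_compose[OF e(1)]) (auto intro!: continuous_intros)
  then show ?thesis unfolding carries_def using e by (intro exI[of _ "\<lambda>t. e (1 - t)"]) auto
qed

lemma carries_join:
  assumes "carries p 0 1 u v" "carries q 0 1 v w" "p 1 = q 0"
  shows "carries (loop_join p q) 0 1 u w"
proof -
  obtain e1 e2 where e: "lift p {0..1} e1" "e1 0 = u" "e1 1 = v" "lift q {0..1} e2" "e2 0 = v" "e2 1 = w"
    using assms unfolding carries_def by blast
  have "lift (\<lambda>t. p (2 * t)) {0..1/2} (\<lambda>t. e1 (2 * t))"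
    by (rule lift_compose[OF e(1)]) (auto intro!: continuous_intros)
  then have 1: "lift (loop_join p q) {0..1/2} (\<lambda>t. e1 (2 * t))"
    by (rule lift_cong) (auto simp: loop_join_def)
  have "lift (\<lambda>t. q (2 * t - 1)) {1/2..1} (\<lambda>t. e2 (2 * t - 1))"
    by (rule lift_compose[OF e(4)]) (auto intro!: continuous_intros)
  then have 2: "lift (loop_join p q) {1/2..1} (\<lambda>t. e2 (2 * t - 1))"
  proof (rule lift_cong)
    fix t :: real assume "t \<in> {1/2..1}"
    then consider "t = 1/2" | "t > 1/2" by fastforce
    then show "q (2 * t - 1) = loop_join p q t"
    proof cases
      case 1
      show ?thesis unfolding 1 using assms(3) by (simp add: loop_join_def)
    qed (simp add: loop_join_def)
  qed simp
  have "carries (loop_join p q) 0 (1/2) u v"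
    unfolding carries_def using 1 e by (intro exI[of _ "\<lambda>t. e1 (2 * t)"]) auto
  moreover have "carries (loop_join p q) (1/2) 1 v w"
    unfolding carries_def using 2 e by (intro exI[of _ "\<lambda>t. e2 (2 * t - 1)"]) auto
  ultimately show ?thesis by (rule carries_trans) auto
qed

lemma pathin_loop_join:
  assumes "pathin T p" "pathin T q" "p 1 = q 0"
  shows "pathin T (loop_join p q)"
proof -
  have "continuous_map (top_of_set {0..1}) T (\<lambda>t. if t \<le> 1/2 then p (2 * t) else q (2 * t - 1))"
  proof (rule continuous_map_cases_le)
    show "continuous_map (subtopology (top_of_set {0..1}) {x \<in> topspace (top_of_set {0..1}). x \<le> 1/2}) T (\<lambda>t. p (2 * t))"
    proof -
      have "continuous_map (subtopology (top_of_set {0..1}) {x \<in> topspace (top_of_set {0..1}). x \<le> 1/2}) (top_of_set {0..1::real}) (\<lambda>t. 2 * t)"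
        by (auto simp: subtopology_subtopology continuous_map_in_subtopology intro!: continuous_intros)
      from continuous_map_compose[OF this assms(1)[unfolded pathin_def]] show ?thesis by (simp add: o_def)
    qed
    show "continuous_map (subtopology (top_of_set {0..1}) {x \<in> topspace (top_of_set {0..1}). 1/2 \<le> x}) T (\<lambda>t. q (2 * t - 1))"
    proof -
      have "continuous_map (subtopology (top_of_set {0..1}) {x \<in> topspace (top_of_set {0..1}). 1/2 \<le> x}) (top_of_set {0..1::real}) (\<lambda>t. 2 * t - 1)"
        by (auto simp: subtopology_subtopology continuous_map_in_subtopology intro!: continuous_intros)
      from continuous_map_compose[OF this assms(2)[unfolded pathin_def]] show ?thesis by (simp add: o_def)
    qed
    show "p (2 * t) = q (2 * t - 1)" if "t \<in> topspace (top_of_set {0..1})" "t = 1/2" for t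
      unfolding that(2) using assms(3) by simp
  qed auto
  then show ?thesis unfolding pathin_def loop_join_def .
qed

lemma pathin_reverse: "pathin T p \<Longrightarrow> pathin T (\<lambda>t. p (1 - t))"
proof -
  assume p: "pathin T p"
  have "continuous_map (top_of_set {0..1}) (top_of_set {0..1::real}) (\<lambda>t. 1 - t)"
    by (auto intro!: continuous_intros)
  from continuous_map_compose[OF this p[unfolded pathin_def]] show ?thesis by (simp add: pathin_def o_def)
qed

text \<open>The monodromy of a loop is the \<open>g\<close> with end point \<open>g e0\<close>. It is multiplicative because the lift of \<open>q\<close> starting at
\<open>(mon p) e0\<close> is the translate by \<open>mon p\<close> of the lift starting at \<open>e0\<close>.\<close>

theorem monodromy_epimorphism:
  assumes y0: "y0 \<in> topspace T" and e0: "e0 \<in> E y0"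
    and surj: "\<And>g. g \<in> D \<Longrightarrow> \<exists>p\<in>loops T y0. carries p 0 1 e0 (act n g e0)"
  shows "\<exists>h. h \<in> epi (fundamental_group T y0) (dihedral_group n)"
proof -
  define mon where "mon p = (THE g. g \<in> D \<and> carries p 0 1 e0 (act n g e0))" for p
  have loopD: "pathin T p" "p 0 = y0" "p 1 = y0" if "p \<in> loops T y0" for p using that by (auto simp: loops_def)
  have mon_eq: "mon p = g" if p: "p \<in> loops T y0" and g: "g \<in> D" "carries p 0 1 e0 (act n g e0)" for p g
    unfolding mon_def
  proof (rule the_equality)
    fix h assume h: "h \<in> D \<and> carries p 0 1 e0 (act n h e0)"
    have "act n h e0 = act n g e0"
      using carries_unique[OF loopD(1)[OF p, unfolded pathin_def] _ _ g(2)] h by simp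
    then show "h = g" using act_free[OF n E_powers_neq[OF y0 e0]] h g(1) by blast
  qed (use g in auto)
  have mon: "mon p \<in> D" "carries p 0 1 e0 (act n (mon p) e0)" if p: "p \<in> loops T y0" for p
  proof -
    obtain v where v: "carries p 0 1 e0 v" using path_carries[OF loopD(1)[OF p]] e0 loopD(2)[OF p] by blast
    then have "v \<in> E y0" using carries_end[OF v] loopD(3)[OF p] by simp
    then obtain g where "g \<in> D" "v = act n g e0" using act_transitive[OF n e0] by blast
    then show "mon p \<in> D" "carries p 0 1 e0 (act n (mon p) e0)" using mon_eq[OF p] v by auto
  qed
  have join: "loop_join p q \<in> loops T y0" if "p \<in> loops T y0" "q \<in> loops T y0" for p q
    using pathin_loop_join[OF loopD(1)[OF that(1)] loopD(1)[OF that(2)]] loopD[OF that(1)] loopD[OF that(2)]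
    by (auto simp: loops_def loop_join_def)
  have mon_join: "mon (loop_join p q) = mon p \<otimes>\<^bsub>dihedral_group n\<^esub> mon q"
    if p: "p \<in> loops T y0" and q: "q \<in> loops T y0" for p q
  proof (rule mon_eq[OF join[OF p q] dihedral_mult_closed[OF n]])
    have "carries q 0 1 (act n (mon p) e0) (act n (mon p) (act n (mon q) e0))"
      using carries_act[OF mon(2)[OF q]] .
    then show "carries (loop_join p q) 0 1 e0 (act n (mon p \<otimes>\<^bsub>dihedral_group n\<^esub> mon q) e0)"
      unfolding act_mult[OF n]
      by (rule carries_join[OF mon(2)[OF p]]) (simp add: loopD[OF p] loopD[OF q])
  qed
  have mon_class: "mon q = mon p" if q: "q \<in> loop_class T y0 p" for p q
  proof -
    obtain H :: "real \<times> real \<Rightarrow> 'a" where H: "continuous_map (prod_topology (top_of_set {0..1}) (top_of_set {0..1})) T H"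
      "\<forall>t. H (0, t) = p t" "\<forall>t. H (1, t) = q t" "\<forall>s\<in>{0..1}. H (s, 0) = y0 \<and> H (s, 1) = y0"
      using q unfolding loop_class_def homotopic_with_def by blast
    have qL: "q \<in> loops T y0" using q by (simp add: loop_class_def)
    have H': "continuous_map (top_of_set ({0..1} \<times> {0..1})) T H" using H(1) by simp
    obtain v where v: "\<And>s. s \<in> {0..1} \<Longrightarrow> carries (\<lambda>t. H (s, t)) 0 1 e0 v"
      using homotopy_carries[OF H', of y0 y0 e0] H(4) e0 by blast
    have "carries p 0 1 e0 v" "carries q 0 1 e0 v" using v[of 0] v[of 1] by (simp_all add: H(2,3))
    moreover have "v = act n (mon q) e0"
      using carries_unique[OF loopD(1)[OF qL, unfolded pathin_def] _ calculation(2) mon(2)[OF qL]] by simp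
    moreover have "p \<in> loops T y0"
    proof -
      have "continuous_map (top_of_set {0..1}) (top_of_set ({0..1} \<times> {0..1})) (\<lambda>t. (0::real, t::real))"
        by (auto intro!: continuous_intros)
      from continuous_map_compose[OF this H']
      have "continuous_map (top_of_set {0..1}) T p" by (simp add: o_def H(2))
      moreover have "p 0 = y0" "p 1 = y0" using H(2) bspec[OF H(4), of 0] by auto
      ultimately show ?thesis by (auto simp: loops_def pathin_def)
    qed
    ultimately show ?thesis using mon_eq mon(1)[OF qL] by metis
  qed
  have self: "p \<in> loop_class T y0 p" if "p \<in> loops T y0" for p
    using that by (auto simp: loop_class_def loops_def pathin_def)
  define h where "h C = mon (SOME p. p \<in> C)" for C
  have h: "h C = g" if "C \<noteq> {}" "\<And>p. p \<in> C \<Longrightarrow> mon p = g" for C g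
    unfolding h_def using that some_in_eq by blast
  have h_class: "h (loop_class T y0 p) = mon p" if "p \<in> loops T y0" for p
  proof (rule h)
    show "loop_class T y0 p \<noteq> {}" using self[OF that] by blast
  qed (rule mon_class)
  let ?G = "fundamental_group T y0"
  have car: "carrier ?G = loop_class T y0 ` loops T y0" by (simp add: fundamental_group_def)
  have "h \<in> hom ?G (dihedral_group n)"
  proof (rule homI)
    fix C assume "C \<in> carrier ?G"
    then show "h C \<in> carrier (dihedral_group n)" using car h_class mon(1) by auto
  next
    fix A B assume "A \<in> carrier ?G" "B \<in> carrier ?G"
    then obtain p q where pq: "p \<in> loops T y0" "q \<in> loops T y0" "A = loop_class T y0 p" "B = loop_class T y0 q"
      using car by auto
    have AB: "A \<otimes>\<^bsub>?G\<^esub> B = (\<Union>p'\<in>A. \<Union>q'\<in>B. loop_class T y0 (loop_join p' q'))"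
      by (simp add: fundamental_group_def)
    have "h (A \<otimes>\<^bsub>?G\<^esub> B) = mon p \<otimes>\<^bsub>dihedral_group n\<^esub> mon q"
    proof (rule h)
      show "A \<otimes>\<^bsub>?G\<^esub> B \<noteq> {}"
        unfolding AB using self[OF pq(1)] self[OF pq(2)] self[OF join[OF pq(1,2)]] pq(3,4) by blast
      fix r assume "r \<in> A \<otimes>\<^bsub>?G\<^esub> B"
      then obtain p' q' where r: "p' \<in> A" "q' \<in> B" "r \<in> loop_class T y0 (loop_join p' q')" unfolding AB by blast
      then have "p' \<in> loops T y0" "q' \<in> loops T y0" "mon p' = mon p" "mon q' = mon q"
        using mon_class pq(3,4) by (auto simp: loop_class_def)
      then show "mon r = mon p \<otimes>\<^bsub>dihedral_group n\<^esub> mon q"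
        using mon_class[OF r(3)] mon_join by simp
    qed
    then show "h (A \<otimes>\<^bsub>?G\<^esub> B) = h A \<otimes>\<^bsub>dihedral_group n\<^esub> h B"
      using h_class pq by simp
  qed
  moreover have "h ` carrier ?G = carrier (dihedral_group n)"
  proof
    show "h ` carrier ?G \<subseteq> D" using car h_class mon(1) by auto
    show "D \<subseteq> h ` carrier ?G"
    proof
      fix g assume g: "g \<in> D"
      then obtain p where p: "p \<in> loops T y0" "carries p 0 1 e0 (act n g e0)" using surj by blast
      then have "h (loop_class T y0 p) = g" using h_class mon_eq g by simp
      then show "g \<in> h ` carrier ?G" using p(1) car by auto
    qed
  qed
  ultimately show ?thesis unfolding epi_def by blast
qed

lemma loops_conjugate:
  assumes \<delta>: "pathin T \<delta>" "\<delta> 0 = y0" "\<delta> 1 = y1" and e1: "e1 \<in> E y1"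
    and loops: "\<And>g. g \<in> D \<Longrightarrow> \<exists>p\<in>loops T y1. carries p 0 1 e1 (act n g e1)"
  shows "\<exists>e0\<in>E y0. \<forall>g\<in>D. \<exists>p\<in>loops T y0. carries p 0 1 e0 (act n g e0)"
proof -
  have r: "pathin T (\<lambda>t. \<delta> (1 - t))" using pathin_reverse[OF \<delta>(1)] .
  obtain e0 where backward: "carries (\<lambda>t. \<delta> (1 - t)) 0 1 e1 e0"
    using path_carries[OF r, of e1] e1 \<delta> by auto
  have e0: "e0 \<in> E y0" using carries_end[OF backward] \<delta> by simp
  have forth: "carries \<delta> 0 1 e0 e1" using carries_reverse[OF backward] by simp
  have "\<exists>p\<in>loops T y0. carries p 0 1 e0 (act n g e0)" if g: "g \<in> D" for g
  proof -
    obtain p where p: "pathin T p" "p 0 = y1" "p 1 = y1" "carries p 0 1 e1 (act n g e1)"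
      using loops[OF g] by (auto simp: loops_def)
    let ?q = "loop_join (loop_join \<delta> p) (\<lambda>t. \<delta> (1 - t))"
    have 1: "pathin T (loop_join \<delta> p)" "carries (loop_join \<delta> p) 0 1 e0 (act n g e1)"
      using pathin_loop_join[OF \<delta>(1) p(1)] carries_join[OF forth p(4)] \<delta> p by auto
    have j1: "loop_join \<delta> p 1 = \<delta> (1 - 0)" using \<delta> p by (simp add: loop_join_def)
    have "pathin T ?q" by (rule pathin_loop_join[OF 1(1) r j1])
    moreover have "carries ?q 0 1 e0 (act n g e0)" by (rule carries_join[OF 1(2) carries_act[OF backward] j1])
    moreover have "?q 0 = y0" "?q 1 = y0" using \<delta> by (auto simp: loop_join_def)
    ultimately show ?thesis by (auto simp: loops_def)
  qed
  then show ?thesis using e0 by blast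
qed

text \<open>The local picture at a transversal intersection of \<open>A = 0\<close> and \<open>F = 0\<close>, where \<open>A\<close> and \<open>F\<close> are coordinates on a
bidisc. The solutions \<open>(w, w')\<close> themselves are then coordinates on the cover. The set \<open>Nb\<close> of those with
\<open>w\<^sup>n \<noteq> w'\<^sup>n\<close> is path connected and contains with a point its whole orbit.\<close>

lemma carries_local_model:
  assumes i: "i \<in> I" and r: "r > 0"
    and \<Sigma>: "continuous_map (top_of_set {p. cmod (fst p) < r \<and> cmod (snd p) < r \<and> (fst p)\<^sup>2 \<noteq> snd p ^ n}) T \<Sigma>"
    and U: "\<And>p. cmod (fst p) < r \<Longrightarrow> cmod (snd p) < r \<Longrightarrow> (fst p)\<^sup>2 \<noteq> snd p ^ n \<Longrightarrow> \<Sigma> p \<in> U i"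
    and AF: "\<And>p. cmod (fst p) < r \<Longrightarrow> cmod (snd p) < r \<Longrightarrow> (fst p)\<^sup>2 \<noteq> snd p ^ n \<Longrightarrow>
      A (\<Sigma> p) = m i (\<Sigma> p) ^ n * fst p \<and> F (\<Sigma> p) = (m i (\<Sigma> p))\<^sup>2 * snd p"
  shows "\<exists>y1\<in>topspace T. \<exists>e1\<in>E y1. \<forall>g\<in>D. \<exists>p\<in>loops T y1. carries p 0 1 e1 (act n g e1)"
proof -
  define \<rho> where "\<rho> = min 1 r"
  have \<rho>: "\<rho> > 0" "\<rho> \<le> 1" "\<rho> \<le> r" using r by (auto simp: \<rho>_def)
  define Nb where "Nb = {w :: complex \<times> complex. cmod (fst w) < \<rho> \<and> cmod (snd w) < \<rho> \<and> fst w ^ n \<noteq> snd w ^ n}"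
  define q where "q w = ((fst w ^ n + snd w ^ n) / 2, fst w * snd w)" for w :: "complex \<times> complex"
  define B where "B = {p. cmod (fst p) < r \<and> cmod (snd p) < r \<and> (fst p)\<^sup>2 \<noteq> snd p ^ n}"
  have qfib: "w \<in> fib n (fst (q w)) (snd (q w))" for w by (simp add: q_def fib_def)
  have qB: "q w \<in> B" if w: "w \<in> Nb" for w
  proof -
    have small: "cmod z ^ n < \<rho>" if "cmod z < \<rho>" for z :: complex
    proof -
      have "cmod z ^ n \<le> cmod z ^ 1" using that \<rho> n by (intro power_decreasing) auto
      then show ?thesis using that by simp
    qed
    have w': "cmod (fst w) < \<rho>" "cmod (snd w) < \<rho>" "fst w ^ n \<noteq> snd w ^ n" using w by (auto simp: Nb_def)
    have "cmod ((fst w ^ n + snd w ^ n) / 2) \<le> (cmod (fst w) ^ n + cmod (snd w) ^ n) / 2"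
      using norm_triangle_ineq[of "fst w ^ n" "snd w ^ n"] by (simp add: norm_divide norm_power)
    also have "\<dots> < \<rho>" using small[OF w'(1)] small[OF w'(2)] by simp
    finally have 1: "cmod ((fst w ^ n + snd w ^ n) / 2) < r" using \<rho>(3) by linarith
    have "cmod (fst w) * cmod (snd w) \<le> 1 * cmod (snd w)" using w' \<rho> by (intro mult_right_mono) auto
    then have 2: "cmod (fst w * snd w) < r" using w'(2) \<rho>(3) by (simp add: norm_mult)
    have "(fst (q w))\<^sup>2 \<noteq> snd (q w) ^ n" using fib_discriminant[OF qfib[of w]] w'(3) by auto
    then show ?thesis using 1 2 by (simp add: B_def q_def)
  qed
  have q_act: "q (act n g w) = q w" for g w
  proof -
    have "act n g w \<in> fib n (fst (q w)) (snd (q w))" using act_fib[OF n qfib] .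
    then show ?thesis by (auto simp: q_def fib_def prod_eq_iff)
  qed
  have NbB: "act n g w \<in> Nb" if w: "w \<in> Nb" for g w
  proof -
    have "fst (act n g w) ^ n \<noteq> snd (act n g w) ^ n"
    proof -
      have "act n g w \<in> fib n (fst (q w)) (snd (q w))" using act_fib[OF n qfib] .
      moreover have "(fst (q w))\<^sup>2 \<noteq> snd (q w) ^ n" using qB[OF w] by (simp add: B_def)
      ultimately show ?thesis by (rule fib_powers_neq)
    qed
    then show ?thesis using w by (auto simp: Nb_def act_def norm_mult rot_def)
  qed
  \<comment> \<open>Any point of \<open>Nb\<close> would do as base point.\<close>
  define w1 where "w1 = (complex_of_real (\<rho> / 2), 0 :: complex)"
  have w1: "w1 \<in> Nb" using \<rho> n by (auto simp: Nb_def w1_def power_0_left)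
  define y1 where "y1 = \<Sigma> (q w1)"
  define e1 where "e1 = dilate (m i y1) w1"
  have B_UAF: "\<Sigma> p \<in> U i" "A (\<Sigma> p) = m i (\<Sigma> p) ^ n * fst p" "F (\<Sigma> p) = (m i (\<Sigma> p))\<^sup>2 * snd p" if "p \<in> B" for p
    using U AF that by (auto simp: B_def)
  have path: "\<exists>\<omega>. continuous_on {0..1::real} \<omega> \<and> \<omega> ` {0..1} \<subseteq> Nb \<and> \<omega> 0 = w1 \<and> \<omega> 1 = v" if v: "v \<in> Nb" for v
  proof -
    \<comment> \<open>Join \<open>w1\<close> to \<open>v\<close> inside the complex line through them: it meets \<open>Nb\<close> in a convex open set minus finitely
      many points, which is path connected.\<close>
    define l where "l t = (fst w1 + t * (fst v - fst w1), snd w1 + t * (snd v - snd w1))" for t :: complex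
    define S where "S = {t. cmod (fst (l t)) < \<rho> \<and> cmod (snd (l t)) < \<rho>}"
    define Z where "Z = {t. fst (l t) ^ n = snd (l t) ^ n}"
    define P where "P = [:fst w1, fst v - fst w1:] ^ n - [:snd w1, snd v - snd w1:] ^ n"
    have P: "poly P t = fst (l t) ^ n - snd (l t) ^ n" for t by (simp add: P_def l_def)
    have l01: "l 0 = w1" "l 1 = v" by (simp_all add: l_def)
    have "poly P 0 \<noteq> 0" using w1 unfolding P l01 by (simp add: Nb_def)
    then have "P \<noteq> 0" by auto
    then have "finite Z" using poly_roots_finite[of P] by (simp add: P Z_def)
    have cl: "continuous_on X l" for X unfolding l_def by (intro continuous_intros)
    have "open S" unfolding S_def l_def
      by (intro open_Collect_conj open_Collect_less continuous_intros)
    have half: "convex {t. cmod (a + t * (b - a)) < \<rho>}" for a b :: complex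
    proof (rule convexI)
      fix s t :: complex and u v :: real
      assume st: "s \<in> {t. cmod (a + t * (b - a)) < \<rho>}" "t \<in> {t. cmod (a + t * (b - a)) < \<rho>}" and uv: "0 \<le> u" "0 \<le> v" "u + v = 1"
      have "a + s * (b - a) \<in> ball 0 \<rho>" "a + t * (b - a) \<in> ball 0 \<rho>" using st by auto
      then have "u *\<^sub>R (a + s * (b - a)) + v *\<^sub>R (a + t * (b - a)) \<in> ball 0 \<rho>"
        using convexD[OF convex_ball] uv by blast
      moreover have "u *\<^sub>R (a + s * (b - a)) + v *\<^sub>R (a + t * (b - a)) = (u + v) *\<^sub>R a + (u *\<^sub>R s + v *\<^sub>R t) * (b - a)"
        by (simp add: algebra_simps scaleR_conv_of_real)
      ultimately show "u *\<^sub>R s + v *\<^sub>R t \<in> {t. cmod (a + t * (b - a)) < \<rho>}" using uv by simp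
    qed
    have "S = {t. cmod (fst w1 + t * (fst v - fst w1)) < \<rho>} \<inter> {t. cmod (snd w1 + t * (snd v - snd w1)) < \<rho>}"
      by (auto simp: S_def l_def)
    then have "connected S" using convex_Int[OF half half] convex_connected by metis
    then have "path_connected (S - Z)"
      using \<open>open S\<close> \<open>finite Z\<close> by (intro path_connected_open_diff_countable) (auto intro: countable_finite)
    moreover have "0 \<in> S - Z" "1 \<in> S - Z" using w1 v by (auto simp: S_def Z_def l01 Nb_def)
    ultimately obtain g where g: "path g" "path_image g \<subseteq> S - Z" "pathstart g = 0" "pathfinish g = 1"
      unfolding path_connected_def by blast
    have "continuous_on {0..1} (\<lambda>t. l (g t))"
      using g(1) unfolding path_def by (intro continuous_on_compose2[OF cl[of UNIV]]) auto
    moreover have "(\<lambda>t. l (g t)) ` {0..1} \<subseteq> Nb"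
      using g(2) by (fastforce simp: path_image_def Nb_def S_def Z_def)
    ultimately show ?thesis using g(3,4) l01
      by (intro exI[of _ "\<lambda>t. l (g t)"]) (simp add: pathstart_def pathfinish_def)
  qed
  have "\<exists>p\<in>loops T y1. carries p 0 1 e1 (act n g e1)" if "g \<in> D" for g
  proof -
    obtain \<omega> where \<omega>: "continuous_on {0..1::real} \<omega>" "\<omega> ` {0..1} \<subseteq> Nb" "\<omega> 0 = w1" "\<omega> 1 = act n g w1"
      using path[OF NbB[OF w1]] by blast
    define p where "p t = \<Sigma> (q (\<omega> t))" for t
    have qB': "q (\<omega> t) \<in> B" if "t \<in> {0..1}" for t using \<omega>(2) qB that by blast
    have "continuous_on {0..1} (\<lambda>t. q (\<omega> t))" unfolding q_def by (intro continuous_intros \<omega>(1)) auto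
    then have "continuous_map (top_of_set {0..1}) (top_of_set B) (\<lambda>t. q (\<omega> t))" using qB' by auto
    from continuous_map_compose[OF this \<Sigma>[folded B_def]]
    have pc: "continuous_map (top_of_set {0..1}) T p" by (simp add: o_def p_def[abs_def])
    have ends: "p 0 = y1" "p 1 = y1" by (simp_all add: p_def \<omega> y1_def q_act)
    have "lift p {0..1} (\<lambda>t. dilate (m i (p t)) (\<omega> t))"
    proof (rule lift_of_branch[OF i pc _ \<omega>(1)])
      fix t :: real assume t: "t \<in> {0..1}"
      show "p t \<in> U i" using B_UAF(1)[OF qB'[OF t]] by (simp add: p_def)
      then have "m i (p t) \<noteq> 0" using m_nonzero[OF i] by blast
      then have "A (p t) / m i (p t) ^ n = fst (q (\<omega> t))" "F (p t) / (m i (p t))\<^sup>2 = snd (q (\<omega> t))"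
        using B_UAF(2,3)[OF qB'[OF t]] by (simp_all add: p_def)
      then show "\<omega> t \<in> fib n (A (p t) / m i (p t) ^ n) (F (p t) / (m i (p t))\<^sup>2)" using qfib by simp
    qed
    then have "carries p 0 1 e1 (act n g e1)"
      unfolding carries_def by (intro exI[of _ "\<lambda>t. dilate (m i (p t)) (\<omega> t)"]) (simp add: ends \<omega> e1_def dilate_act)
    then show ?thesis using pc ends by (auto simp: loops_def pathin_def)
  qed
  moreover have "y1 \<in> topspace T"
    using \<Sigma>[folded B_def] qB[OF w1] by (auto simp: continuous_map_def y1_def)
  moreover have "e1 \<in> E y1"
    using dilate_fib[OF qfib[of w1], of "m i y1"] B_UAF(2,3)[OF qB[OF w1]] by (simp add: e1_def y1_def)
  ultimately show ?thesis by blast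
qed

end

text \<open>Preimages of a rotation and a reflection do not commute, as \<open>1\<close> and \<open>- 1\<close> differ modulo \<open>n \<ge> 3\<close>.\<close>

lemma epi_dihedral_imp_noncommuting:
  assumes h: "h \<in> epi G (dihedral_group n)" and n: "n \<ge> 3"
  shows "\<exists>x\<in>carrier G. \<exists>y\<in>carrier G. x \<otimes>\<^bsub>G\<^esub> y \<noteq> y \<otimes>\<^bsub>G\<^esub> x"
proof -
  have "(1, False) \<in> carrier (dihedral_group n)" "(0, True) \<in> carrier (dihedral_group n)"
    using n by (auto simp: carrier_dihedral)
  then have "(1, False) \<in> h ` carrier G" "(0, True) \<in> h ` carrier G" using h by (simp_all add: epi_def)
  then obtain x y where xy: "x \<in> carrier G" "h x = (1, False)" "y \<in> carrier G" "h y = (0, True)"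
    by (elim imageE) metis
  have hm: "h (a \<otimes>\<^bsub>G\<^esub> b) = h a \<otimes>\<^bsub>dihedral_group n\<^esub> h b" if "a \<in> carrier G" "b \<in> carrier G" for a b
    using h that unfolding epi_def hom_def by blast
  have "h (x \<otimes>\<^bsub>G\<^esub> y) = (1 mod int n, True)" "h (y \<otimes>\<^bsub>G\<^esub> x) = ((- 1) mod int n, True)"
    unfolding hm[OF xy(1,3)] hm[OF xy(3,1)] xy by (simp_all add: dihedral_group_def)
  moreover have "1 mod int n = 1" "(- 1) mod int n = int n - 1" using n by (simp_all add: zmod_minus1)
  ultimately have "h (x \<otimes>\<^bsub>G\<^esub> y) \<noteq> h (y \<otimes>\<^bsub>G\<^esub> x)" using n by simp
  then show ?thesis using xy by metis
qed

section \<open>Charts and regular functions on a smooth variety\<close>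

lemma ztop_affine: "ztop (affine_fspace n S) = topology_generated_by {{x \<in> zeros n S. p x \<noteq> 0} | p. p \<in> poly_funs n}"
  by (simp add: affine_fspace_def Let_def)

lemma points_affine: "points (affine_fspace n S) = zeros n S"
proof -
  have "zeros n S = {x \<in> zeros n S. (\<lambda>_. 1::complex) x \<noteq> 0}" by simp
  then have "zeros n S \<in> {{x \<in> zeros n S. p x \<noteq> 0} | p. p \<in> poly_funs n}"
    using poly_funs.const by (intro CollectI exI conjI)
  then show ?thesis unfolding ztop_affine topology_generated_by_topspace by blast
qed

lemma principal_open_affine:
  "p \<in> poly_funs n \<Longrightarrow> openin (ztop (affine_fspace n S)) {x \<in> zeros n S. p x \<noteq> 0}"
  unfolding ztop_affine by (rule topology_generated_by_Basis) blast

text \<open>Principal open sets are closed under finite intersections, since polynomials can be multiplied.\<close>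

lemma principal_basis_affine:
  assumes "openin (ztop (affine_fspace n S)) W" "z \<in> W"
  shows "\<exists>p\<in>poly_funs n. p z \<noteq> 0 \<and> {y \<in> zeros n S. p y \<noteq> 0} \<subseteq> W"
proof -
  have "generate_topology_on {{x \<in> zeros n S. p x \<noteq> 0} | p. p \<in> poly_funs n} W"
    using assms(1) unfolding ztop_affine openin_topology_generated_by_iff .
  then show ?thesis using assms(2)
  proof (induct arbitrary: z)
    case Empty
    then show ?case by simp
  next
    case (Int A B)
    have "z \<in> A" "z \<in> B" using Int(5) by auto
    from Int(2)[OF this(1)] Int(4)[OF this(2)]
    obtain p q where p: "p \<in> poly_funs n" "p z \<noteq> 0" "{y \<in> zeros n S. p y \<noteq> 0} \<subseteq> A"
      "q \<in> poly_funs n" "q z \<noteq> 0" "{y \<in> zeros n S. q y \<noteq> 0} \<subseteq> B" by blast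
    have "(\<lambda>y. p y * q y) \<in> poly_funs n" using p by (auto intro: poly_funs.mult)
    then show ?case using p by (intro bexI[of _ "\<lambda>y. p y * q y"]) auto
  next
    case (UN K)
    then obtain k where "k \<in> K" "z \<in> k" by blast
    then show ?case using UN(2) by blast
  next
    case (Basis s)
    then show ?case by blast
  qed
qed

lemma reg_affine: "reg (affine_fspace n S) W = {f. \<forall>x\<in>W. \<exists>V. openin (ztop (affine_fspace n S)) V \<and> x \<in> V \<and> V \<subseteq> W \<and>
    (\<exists>p\<in>poly_funs n. \<exists>q\<in>poly_funs n. \<forall>y\<in>V. q y \<noteq> 0 \<and> f y = p y / q y)}"
  by (simp add: affine_fspace_def Let_def)

text \<open>What is used of an isomorphism of an open subset with a smooth affine variety: open sets and regular functions are
described by polynomials in the coordinates \<open>\<phi>\<close>.\<close>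

locale smooth_chart =
  fixes Y :: "'a fspace" and U :: "'a set" and N c :: nat and f :: "nat \<Rightarrow> (nat \<Rightarrow> complex) \<Rightarrow> complex"
    and \<phi> :: "'a \<Rightarrow> nat \<Rightarrow> complex" and \<psi> :: "(nat \<Rightarrow> complex) \<Rightarrow> 'a" and V
  defines "V \<equiv> zeros N (f ` {..<c})"
  assumes U_open: "openin (ztop Y) U"
    and submersive: "submersive N c f"
    and \<phi>_in: "x \<in> U \<Longrightarrow> \<phi> x \<in> V" and \<psi>_in: "z \<in> V \<Longrightarrow> \<psi> z \<in> U"
    and \<psi>_\<phi>: "x \<in> U \<Longrightarrow> \<psi> (\<phi> x) = x" and \<phi>_\<psi>: "z \<in> V \<Longrightarrow> \<phi> (\<psi> z) = z"
    and principal_open: "p \<in> poly_funs N \<Longrightarrow> openin (ztop Y) {x \<in> U. p (\<phi> x) \<noteq> 0}"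
    and principal_basis: "openin (ztop Y) W \<Longrightarrow> x \<in> W \<Longrightarrow> x \<in> U \<Longrightarrow>
      \<exists>r\<in>poly_funs N. r (\<phi> x) \<noteq> 0 \<and> {y \<in> U. r (\<phi> y) \<noteq> 0} \<subseteq> W"
    and regular_local: "openin (ztop Y) W \<Longrightarrow> g \<in> reg Y W \<Longrightarrow> x \<in> W \<Longrightarrow> x \<in> U \<Longrightarrow>
      \<exists>p\<in>poly_funs N. \<exists>q\<in>poly_funs N. \<exists>r\<in>poly_funs N. r (\<phi> x) \<noteq> 0 \<and>
        (\<forall>y\<in>U. r (\<phi> y) \<noteq> 0 \<longrightarrow> y \<in> W \<and> q (\<phi> y) \<noteq> 0 \<and> g y = p (\<phi> y) / q (\<phi> y))"
    and regular_quotient: "openin (ztop Y) W \<Longrightarrow> W \<subseteq> U \<Longrightarrow> p \<in> poly_funs N \<Longrightarrow> q \<in> poly_funs N \<Longrightarrow>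
      \<forall>x\<in>W. q (\<phi> x) \<noteq> 0 \<Longrightarrow> (\<lambda>x. p (\<phi> x) / q (\<phi> x)) \<in> reg Y W"

locale smooth_var =
  fixes Y :: "'a fspace"
  assumes Y: "smooth_variety Y"
begin

lemma sheaf: "function_sheaf Y"
  using Y by (simp add: smooth_variety_def variety_def)

lemma reg_cong:
  assumes "openin (ztop Y) W" "f \<in> reg Y W" "\<And>x. x \<in> W \<Longrightarrow> f x = g x"
  shows "g \<in> reg Y W"
  using conjunct1[OF sheaf[unfolded function_sheaf_def], rule_format, of W f g] assms by simp

lemma reg_mono:
  assumes "openin (ztop Y) W" "openin (ztop Y) W'" "W' \<subseteq> W" "f \<in> reg Y W"
  shows "f \<in> reg Y W'"
  using conjunct1[OF conjunct2[OF sheaf[unfolded function_sheaf_def]], rule_format, of W W'] assms by blast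

lemma reg_local:
  assumes "openin (ztop Y) W"
    "\<And>x. x \<in> W \<Longrightarrow> \<exists>V. openin (ztop Y) V \<and> x \<in> V \<and> V \<subseteq> W \<and> f \<in> reg Y V"
  shows "f \<in> reg Y W"
  using conjunct2[OF conjunct2[OF sheaf[unfolded function_sheaf_def]], rule_format, of W f] assms by simp

lemma opens_meet:
  assumes "openin (ztop Y) W" "openin (ztop Y) W'" "W \<noteq> {}" "W' \<noteq> {}"
  shows "W \<inter> W' \<noteq> {}"
proof -
  have "irreducible_topology (ztop Y)" using Y by (simp add: smooth_variety_def variety_def)
  then show ?thesis using assms unfolding irreducible_topology_def by blast
qed

lemma chart_exists:
  assumes x: "x \<in> points Y"
  shows "\<exists>U N c f \<phi> \<psi>. smooth_chart Y U N c f \<phi> \<psi> \<and> x \<in> U"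
proof -
  obtain U where U: "openin (ztop Y) U" "x \<in> U" "smooth_affine_space (open_subspace Y U)"
    using Y x unfolding smooth_variety_def by blast
  obtain N c f where f: "\<forall>j<c. f j \<in> poly_funs N"
    "\<forall>x \<in> zeros N (f ` {..<c}). \<forall>b :: nat \<Rightarrow> complex.
       (\<forall>i<N. (\<Sum>j<c. b j * partial_deriv i (f j) x) = 0) \<longrightarrow> (\<forall>j<c. b j = 0)"
    and iso: "fspace_isomorphic (open_subspace Y U) (affine_fspace N (f ` {..<c}))"
    using U(3) unfolding smooth_affine_space_def by blast
  let ?A = "affine_fspace N (f ` {..<c})" and ?V = "zeros N (f ` {..<c})"
  obtain \<phi> where \<phi>: "homeomorphic_map (ztop (open_subspace Y U)) (ztop ?A) \<phi>"
    and \<phi>reg: "\<And>W g. openin (ztop ?A) W \<Longrightarrow>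
        g \<in> reg ?A W \<longleftrightarrow> g \<circ> \<phi> \<in> reg (open_subspace Y U) {x \<in> points (open_subspace Y U). \<phi> x \<in> W}"
    using iso unfolding fspace_isomorphic_def fspace_iso_def by blast
  have pts: "points (open_subspace Y U) = U"
    using openin_subset[OF U(1)] by (auto simp: open_subspace_def)
  have ztop: "ztop (open_subspace Y U) = subtopology (ztop Y) U" and reg: "reg (open_subspace Y U) = reg Y"
    by (simp_all add: open_subspace_def)
  obtain \<psi> where \<psi>: "homeomorphic_maps (ztop (open_subspace Y U)) (ztop ?A) \<phi> \<psi>"
    using \<phi> homeomorphic_map_maps by blast
  have c\<phi>: "continuous_map (subtopology (ztop Y) U) (ztop ?A) \<phi>" and c\<psi>: "continuous_map (ztop ?A) (subtopology (ztop Y) U) \<psi>"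
    and inv1: "\<And>x. x \<in> U \<Longrightarrow> \<psi> (\<phi> x) = x" and inv2: "\<And>z. z \<in> ?V \<Longrightarrow> \<phi> (\<psi> z) = z"
    using \<psi> pts points_affine[of N "f ` {..<c}"] unfolding homeomorphic_maps_def ztop by auto
  have top: "topspace (subtopology (ztop Y) U) = U" using pts ztop by simp
  have in1: "\<phi> x \<in> ?V" if "x \<in> U" for x using c\<phi> that top points_affine by (auto simp: continuous_map_def)
  have in2: "\<psi> z \<in> U" if "z \<in> ?V" for z
    using c\<psi> that top points_affine unfolding continuous_map_def by (metis PiE funcset_mem)
  have pre: "openin (ztop Y) {x \<in> U. \<phi> x \<in> W}" if "openin (ztop ?A) W" for W
  proof -
    have "openin (subtopology (ztop Y) U) {x \<in> topspace (subtopology (ztop Y) U). \<phi> x \<in> W}"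
      by (rule openin_continuous_map_preimage[OF c\<phi> that])
    then show ?thesis unfolding top using openin_trans_full U(1) by blast
  qed
  have img: "openin (ztop ?A) {z \<in> ?V. \<psi> z \<in> W}" if "openin (ztop Y) W" for W
  proof -
    have "openin (subtopology (ztop Y) U) (W \<inter> U)" using that by (rule openin_subtopology_Int)
    from openin_continuous_map_preimage[OF c\<psi> this]
    have "openin (ztop ?A) {z \<in> ?V. \<psi> z \<in> W \<inter> U}" unfolding points_affine .
    moreover have "{z \<in> ?V. \<psi> z \<in> W \<inter> U} = {z \<in> ?V. \<psi> z \<in> W}" using in2 by auto
    ultimately show ?thesis by simp
  qed
  have "smooth_chart Y U N c f \<phi> \<psi>"
  proof (unfold_locales)
    show "openin (ztop Y) U" by (rule U(1))
    show "submersive N c f" using f unfolding submersive_def indep_rows_def by blast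
    show "\<phi> x \<in> ?V" if "x \<in> U" for x using in1[OF that] .
    show "\<psi> z \<in> U" if "z \<in> ?V" for z using in2[OF that] .
    show "\<psi> (\<phi> x) = x" if "x \<in> U" for x using inv1[OF that] .
    show "\<phi> (\<psi> z) = z" if "z \<in> ?V" for z using inv2[OF that] .
    show "openin (ztop Y) {x \<in> U. p (\<phi> x) \<noteq> 0}" if "p \<in> poly_funs N" for p
    proof -
      have "{x \<in> U. \<phi> x \<in> {z \<in> ?V. p z \<noteq> 0}} = {x \<in> U. p (\<phi> x) \<noteq> 0}" using in1 by auto
      then show ?thesis using pre[OF principal_open_affine[OF that]] by metis
    qed
    have basis: "\<exists>r\<in>poly_funs N. r (\<phi> x) \<noteq> 0 \<and> {y \<in> U. r (\<phi> y) \<noteq> 0} \<subseteq> {y \<in> U. \<phi> y \<in> W}"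
      if W: "openin (ztop ?A) W" and x: "\<phi> x \<in> W" for W x
    proof -
      obtain r where "r \<in> poly_funs N" "r (\<phi> x) \<noteq> 0" "{y \<in> ?V. r y \<noteq> 0} \<subseteq> W"
        using principal_basis_affine[OF W x] by blast
      then show ?thesis using in1 by blast
    qed
    show "\<exists>r\<in>poly_funs N. r (\<phi> x) \<noteq> 0 \<and> {y \<in> U. r (\<phi> y) \<noteq> 0} \<subseteq> W"
      if W: "openin (ztop Y) W" and x: "x \<in> W" "x \<in> U" for W x
    proof -
      have "\<phi> x \<in> {z \<in> ?V. \<psi> z \<in> W}" using x in1 inv1 by auto
      from basis[OF img[OF W] this] obtain r where r: "r \<in> poly_funs N" "r (\<phi> x) \<noteq> 0"
        "{y \<in> U. r (\<phi> y) \<noteq> 0} \<subseteq> {y \<in> U. \<phi> y \<in> {z \<in> ?V. \<psi> z \<in> W}}" by blast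
      have "{y \<in> U. r (\<phi> y) \<noteq> 0} \<subseteq> W"
      proof
        fix y assume "y \<in> {y \<in> U. r (\<phi> y) \<noteq> 0}"
        then show "y \<in> W" using r(3) inv1[of y] by auto
      qed
      then show ?thesis using r(1,2) by blast
    qed
    show "\<exists>p\<in>poly_funs N. \<exists>q\<in>poly_funs N. \<exists>r\<in>poly_funs N. r (\<phi> x) \<noteq> 0 \<and>
        (\<forall>y\<in>U. r (\<phi> y) \<noteq> 0 \<longrightarrow> y \<in> W \<and> q (\<phi> y) \<noteq> 0 \<and> g y = p (\<phi> y) / q (\<phi> y))"
      if W: "openin (ztop Y) W" and g: "g \<in> reg Y W" and x: "x \<in> W" "x \<in> U" for W g x
    proof -
      let ?W = "{z \<in> ?V. \<psi> z \<in> W}"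
      have eq: "{x \<in> points (open_subspace Y U). \<phi> x \<in> ?W} = W \<inter> U" unfolding pts using in1 inv1 by auto
      have WU: "openin (ztop Y) (W \<inter> U)" using W U(1) by blast
      have "g \<in> reg Y (W \<inter> U)" by (rule reg_mono[OF W WU _ g]) auto
      then have "(g \<circ> \<psi>) \<circ> \<phi> \<in> reg Y (W \<inter> U)" by (rule reg_cong[OF WU]) (simp add: inv1)
      then have "g \<circ> \<psi> \<in> reg ?A ?W" using \<phi>reg[OF img[OF W], of "g \<circ> \<psi>"] unfolding eq reg by blast
      moreover have "\<phi> x \<in> ?W" using x in1 inv1 by auto
      ultimately obtain V' p q where V': "openin (ztop ?A) V'" "\<phi> x \<in> V'" "V' \<subseteq> ?W"
        "p \<in> poly_funs N" "q \<in> poly_funs N" "\<forall>y\<in>V'. q y \<noteq> 0 \<and> (g \<circ> \<psi>) y = p y / q y"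
        unfolding reg_affine by blast
      obtain r where r: "r \<in> poly_funs N" "r (\<phi> x) \<noteq> 0" "{y \<in> U. r (\<phi> y) \<noteq> 0} \<subseteq> {y \<in> U. \<phi> y \<in> V'}"
        using basis[OF V'(1,2)] by blast
      have "y \<in> W \<and> q (\<phi> y) \<noteq> 0 \<and> g y = p (\<phi> y) / q (\<phi> y)" if "y \<in> U" "r (\<phi> y) \<noteq> 0" for y
      proof -
        have "\<phi> y \<in> V'" using r(3) that by blast
        then show ?thesis using V'(3,6) inv1[OF that(1)] by fastforce
      qed
      then show ?thesis using V'(4,5) r(1,2) by blast
    qed
    show "(\<lambda>x. p (\<phi> x) / q (\<phi> x)) \<in> reg Y W"
      if W: "openin (ztop Y) W" "W \<subseteq> U" and pq: "p \<in> poly_funs N" "q \<in> poly_funs N" "\<forall>x\<in>W. q (\<phi> x) \<noteq> 0" for W p q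
    proof -
      let ?W = "{z \<in> ?V. \<psi> z \<in> W}"
      have eq: "{x \<in> points (open_subspace Y U). \<phi> x \<in> ?W} = W" unfolding pts using in1 inv1 W(2) by auto
      have "(\<lambda>z. p z / q z) \<in> reg ?A ?W" unfolding reg_affine
      proof (intro CollectI ballI exI[of _ ?W] conjI)
        fix y assume "y \<in> ?W"
        then have "q y \<noteq> 0" if "y \<in> ?W" for y using pq(3) that inv2 by fastforce
        then show "\<exists>p'\<in>poly_funs N. \<exists>q'\<in>poly_funs N. \<forall>y\<in>?W. q' y \<noteq> 0 \<and> p y / q y = p' y / q' y"
          using pq(1,2) by blast
      qed (use img[OF W(1)] in auto)
      then show ?thesis using \<phi>reg[OF img[OF W(1)], of "\<lambda>z. p z / q z"] unfolding eq reg by (simp add: o_def)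
    qed
  qed
  then show ?thesis using U(2) by blast
qed

text \<open>Regularity can be tested in charts. Closure of regular functions under ring operations is not part of the
definition of a space with functions and is derived from this.\<close>

lemma reg_from_quotients:
  assumes W: "openin (ztop Y) W"
    and loc: "\<And>x U N c f \<phi> \<psi>. x \<in> W \<Longrightarrow> smooth_chart Y U N c f \<phi> \<psi> \<Longrightarrow> x \<in> U \<Longrightarrow>
      \<exists>p\<in>poly_funs N. \<exists>q\<in>poly_funs N. \<exists>r\<in>poly_funs N. r (\<phi> x) \<noteq> 0 \<and>
        (\<forall>y\<in>U. r (\<phi> y) \<noteq> 0 \<longrightarrow> y \<in> W \<and> q (\<phi> y) \<noteq> 0 \<and> h y = p (\<phi> y) / q (\<phi> y))"
  shows "h \<in> reg Y W"
proof (rule reg_local[OF W])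
  fix x assume x: "x \<in> W"
  then have "x \<in> points Y" using openin_subset[OF W] by blast
  then obtain U N c f \<phi> \<psi> where ch: "smooth_chart Y U N c f \<phi> \<psi>" and xU: "x \<in> U" using chart_exists by blast
  obtain p q r where pqr: "p \<in> poly_funs N" "q \<in> poly_funs N" "r \<in> poly_funs N" "r (\<phi> x) \<noteq> 0"
    "\<forall>y\<in>U. r (\<phi> y) \<noteq> 0 \<longrightarrow> y \<in> W \<and> q (\<phi> y) \<noteq> 0 \<and> h y = p (\<phi> y) / q (\<phi> y)"
    using loc[OF x ch xU] by blast
  let ?V = "{y \<in> U. r (\<phi> y) \<noteq> 0}"
  have V: "openin (ztop Y) ?V" using smooth_chart.principal_open[OF ch pqr(3)] .
  have "(\<lambda>x. p (\<phi> x) / q (\<phi> x)) \<in> reg Y ?V"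
    by (rule smooth_chart.regular_quotient[OF ch V _ pqr(1,2)]) (use pqr(5) in auto)
  then have "h \<in> reg Y ?V" by (rule reg_cong[OF V]) (use pqr(5) in auto)
  then show "\<exists>V. openin (ztop Y) V \<and> x \<in> V \<and> V \<subseteq> W \<and> h \<in> reg Y V"
    using V xU pqr(4,5) by (intro exI[of _ ?V]) auto
qed

lemma reg_const: "openin (ztop Y) W \<Longrightarrow> (\<lambda>x. k) \<in> reg Y W"
proof (rule reg_from_quotients)
  fix x U N c f \<phi> and \<psi> :: "(nat \<Rightarrow> complex) \<Rightarrow> 'a"
  assume W: "openin (ztop Y) W" "x \<in> W" and ch: "smooth_chart Y U N c f \<phi> \<psi>" and xU: "x \<in> U"
  obtain r where "r \<in> poly_funs N" "r (\<phi> x) \<noteq> 0" "{y \<in> U. r (\<phi> y) \<noteq> 0} \<subseteq> W"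
    using smooth_chart.principal_basis[OF ch W xU] by blast
  then show "\<exists>p\<in>poly_funs N. \<exists>q\<in>poly_funs N. \<exists>r\<in>poly_funs N. r (\<phi> x) \<noteq> 0 \<and>
    (\<forall>y\<in>U. r (\<phi> y) \<noteq> 0 \<longrightarrow> y \<in> W \<and> q (\<phi> y) \<noteq> 0 \<and> k = p (\<phi> y) / q (\<phi> y))"
    by (intro bexI[of _ "\<lambda>_. k"] bexI[of _ "\<lambda>_. 1"] bexI[of _ r]) (auto intro: poly_funs.const)
qed

lemma reg_add_mult:
  assumes W: "openin (ztop Y) W" and g: "g \<in> reg Y W" and h: "h \<in> reg Y W"
  shows "(\<lambda>x. g x + h x) \<in> reg Y W" "(\<lambda>x. g x * h x) \<in> reg Y W"
proof -
  have common: "\<exists>p q p' q' r. p \<in> poly_funs N \<and> q \<in> poly_funs N \<and> p' \<in> poly_funs N \<and> q' \<in> poly_funs N \<and>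
      r \<in> poly_funs N \<and> r (\<phi> x) \<noteq> 0 \<and> (\<forall>y\<in>U. r (\<phi> y) \<noteq> 0 \<longrightarrow> y \<in> W \<and> q (\<phi> y) \<noteq> 0 \<and>
      g y = p (\<phi> y) / q (\<phi> y) \<and> q' (\<phi> y) \<noteq> 0 \<and> h y = p' (\<phi> y) / q' (\<phi> y))"
    if x: "x \<in> W" "x \<in> U" and ch: "smooth_chart Y U N c f \<phi> \<psi>" for x U N c f \<phi> and \<psi> :: "(nat \<Rightarrow> complex) \<Rightarrow> 'a"
  proof -
    obtain p q r where 1: "p \<in> poly_funs N" "q \<in> poly_funs N" "r \<in> poly_funs N" "r (\<phi> x) \<noteq> 0"
      "\<forall>y\<in>U. r (\<phi> y) \<noteq> 0 \<longrightarrow> y \<in> W \<and> q (\<phi> y) \<noteq> 0 \<and> g y = p (\<phi> y) / q (\<phi> y)"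
      using smooth_chart.regular_local[OF ch W g x] by blast
    obtain p' q' r' where 2: "p' \<in> poly_funs N" "q' \<in> poly_funs N" "r' \<in> poly_funs N" "r' (\<phi> x) \<noteq> 0"
      "\<forall>y\<in>U. r' (\<phi> y) \<noteq> 0 \<longrightarrow> y \<in> W \<and> q' (\<phi> y) \<noteq> 0 \<and> h y = p' (\<phi> y) / q' (\<phi> y)"
      using smooth_chart.regular_local[OF ch W h x] by blast
    show ?thesis
    proof (rule exI[of _ p], rule exI[of _ q], rule exI[of _ p'], rule exI[of _ q'],
        rule exI[of _ "\<lambda>z. r z * r' z"], intro conjI ballI impI)
      show "(\<lambda>z. r z * r' z) \<in> poly_funs N" using 1(3) 2(3) by (rule poly_funs.mult)
      show "r (\<phi> x) * r' (\<phi> x) \<noteq> 0" using 1(4) 2(4) by simp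
      fix y assume y: "y \<in> U" "r (\<phi> y) * r' (\<phi> y) \<noteq> 0"
      then have ne: "r (\<phi> y) \<noteq> 0" "r' (\<phi> y) \<noteq> 0" by auto
      note y1 = 1(5)[rule_format, OF y(1) ne(1)] and y2 = 2(5)[rule_format, OF y(1) ne(2)]
      show "y \<in> W" "q (\<phi> y) \<noteq> 0" "g y = p (\<phi> y) / q (\<phi> y)" "q' (\<phi> y) \<noteq> 0" "h y = p' (\<phi> y) / q' (\<phi> y)"
        using y1 y2 by blast+
    qed (use 1 2 in blast)+
  qed
  show "(\<lambda>x. g x + h x) \<in> reg Y W"
  proof (rule reg_from_quotients[OF W])
    fix x U N c f \<phi> and \<psi> :: "(nat \<Rightarrow> complex) \<Rightarrow> 'a"
    assume x: "x \<in> W" and ch: "smooth_chart Y U N c f \<phi> \<psi>" and xU: "x \<in> U"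
    obtain p q p' q' r where P: "p \<in> poly_funs N" "q \<in> poly_funs N" "p' \<in> poly_funs N" "q' \<in> poly_funs N"
      "r \<in> poly_funs N" "r (\<phi> x) \<noteq> 0" "\<forall>y\<in>U. r (\<phi> y) \<noteq> 0 \<longrightarrow> y \<in> W \<and> q (\<phi> y) \<noteq> 0 \<and>
      g y = p (\<phi> y) / q (\<phi> y) \<and> q' (\<phi> y) \<noteq> 0 \<and> h y = p' (\<phi> y) / q' (\<phi> y)"
      using common[OF x xU ch] by blast
    have "(\<lambda>z. p z * q' z + p' z * q z) \<in> poly_funs N" "(\<lambda>z. q z * q' z) \<in> poly_funs N"
      using P by (auto intro!: poly_funs.intros)
    then show "\<exists>p\<in>poly_funs N. \<exists>q\<in>poly_funs N. \<exists>r\<in>poly_funs N. r (\<phi> x) \<noteq> 0 \<and>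
      (\<forall>y\<in>U. r (\<phi> y) \<noteq> 0 \<longrightarrow> y \<in> W \<and> q (\<phi> y) \<noteq> 0 \<and> g y + h y = p (\<phi> y) / q (\<phi> y))"
      using P(5-7) by (intro bexI[of _ "\<lambda>z. p z * q' z + p' z * q z"] bexI[of _ "\<lambda>z. q z * q' z"] bexI[of _ r])
        (auto simp: add_frac_eq)
  qed
  show "(\<lambda>x. g x * h x) \<in> reg Y W"
  proof (rule reg_from_quotients[OF W])
    fix x U N c f \<phi> and \<psi> :: "(nat \<Rightarrow> complex) \<Rightarrow> 'a"
    assume x: "x \<in> W" and ch: "smooth_chart Y U N c f \<phi> \<psi>" and xU: "x \<in> U"
    obtain p q p' q' r where P: "p \<in> poly_funs N" "q \<in> poly_funs N" "p' \<in> poly_funs N" "q' \<in> poly_funs N"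
      "r \<in> poly_funs N" "r (\<phi> x) \<noteq> 0" "\<forall>y\<in>U. r (\<phi> y) \<noteq> 0 \<longrightarrow> y \<in> W \<and> q (\<phi> y) \<noteq> 0 \<and>
      g y = p (\<phi> y) / q (\<phi> y) \<and> q' (\<phi> y) \<noteq> 0 \<and> h y = p' (\<phi> y) / q' (\<phi> y)"
      using common[OF x xU ch] by blast
    have "(\<lambda>z. p z * p' z) \<in> poly_funs N" "(\<lambda>z. q z * q' z) \<in> poly_funs N"
      using P by (auto intro!: poly_funs.intros)
    then show "\<exists>p\<in>poly_funs N. \<exists>q\<in>poly_funs N. \<exists>r\<in>poly_funs N. r (\<phi> x) \<noteq> 0 \<and>
      (\<forall>y\<in>U. r (\<phi> y) \<noteq> 0 \<longrightarrow> y \<in> W \<and> q (\<phi> y) \<noteq> 0 \<and> g y * h y = p (\<phi> y) / q (\<phi> y))"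
      using P(5-7) by (intro bexI[of _ "\<lambda>z. p z * p' z"] bexI[of _ "\<lambda>z. q z * q' z"] bexI[of _ r]) auto
  qed
qed

lemma reg_diff:
  assumes W: "openin (ztop Y) W" and g: "g \<in> reg Y W" and h: "h \<in> reg Y W"
  shows "(\<lambda>x. g x - h x) \<in> reg Y W"
  using reg_add_mult(1)[OF W g reg_add_mult(2)[OF W reg_const[OF W, of "-1"] h]] by simp

lemma reg_power: "openin (ztop Y) W \<Longrightarrow> g \<in> reg Y W \<Longrightarrow> (\<lambda>x. g x ^ k) \<in> reg Y W"
  by (induct k) (auto intro: reg_const reg_add_mult(2))

lemma reg_nonzero_open:
  assumes W: "openin (ztop Y) W" and g: "g \<in> reg Y W"
  shows "openin (ztop Y) {x \<in> W. g x \<noteq> 0}"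
proof (subst openin_subopen, intro ballI)
  fix x assume x: "x \<in> {x \<in> W. g x \<noteq> 0}"
  then have "x \<in> points Y" using openin_subset[OF W] by blast
  then obtain U N c f \<phi> \<psi> where ch: "smooth_chart Y U N c f \<phi> \<psi>" and xU: "x \<in> U" using chart_exists by blast
  have xW: "x \<in> W" using x by blast
  obtain p q r where pqr: "p \<in> poly_funs N" "q \<in> poly_funs N" "r \<in> poly_funs N" "r (\<phi> x) \<noteq> 0"
    "\<forall>y\<in>U. r (\<phi> y) \<noteq> 0 \<longrightarrow> y \<in> W \<and> q (\<phi> y) \<noteq> 0 \<and> g y = p (\<phi> y) / q (\<phi> y)"
    using smooth_chart.regular_local[OF ch W g xW xU] by blast
  have "openin (ztop Y) {y \<in> U. p (\<phi> y) * r (\<phi> y) \<noteq> 0}"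
    by (rule smooth_chart.principal_open[OF ch poly_funs.mult[OF pqr(1,3)]])
  moreover have "x \<in> {y \<in> U. p (\<phi> y) * r (\<phi> y) \<noteq> 0}" using x xU pqr(4,5) by auto
  moreover have "{y \<in> U. p (\<phi> y) * r (\<phi> y) \<noteq> 0} \<subseteq> {x \<in> W. g x \<noteq> 0}" using pqr(5) by auto
  ultimately show "\<exists>T. openin (ztop Y) T \<and> x \<in> T \<and> T \<subseteq> {x \<in> W. g x \<noteq> 0}" by blast
qed

text \<open>The identity theorem for regular functions on an irreducible variety.\<close>

lemma reg_identity:
  assumes W: "openin (ztop Y) W" and g: "g \<in> reg Y W" "h \<in> reg Y W"
    and W': "openin (ztop Y) W'" "W' \<noteq> {}" "\<And>x. x \<in> W \<Longrightarrow> x \<in> W' \<Longrightarrow> g x = h x" and x: "x \<in> W"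
  shows "g x = h x"
proof (rule ccontr)
  assume "g x \<noteq> h x"
  then have ne: "{x \<in> W. g x - h x \<noteq> 0} \<noteq> {}" using x by auto
  have "openin (ztop Y) {x \<in> W. g x - h x \<noteq> 0}" using reg_nonzero_open[OF W reg_diff[OF W g]] .
  from opens_meet[OF this W'(1) ne W'(2)] show False using W'(3) by auto
qed

lemma points_open: "openin (ztop Y) (points Y)"
  by simp

lemma classical_open: "openin (ztop Y) W \<Longrightarrow> g \<in> reg Y W \<Longrightarrow> open A \<Longrightarrow>
    openin (classical_topology Y) {x \<in> W. g x \<in> A}"
  unfolding classical_topology_def by (rule topology_generated_by_Basis) blast

lemma zariski_open_classical: "openin (ztop Y) W \<Longrightarrow> openin (classical_topology Y) W"
  using classical_open[OF _ reg_const[of W 0] open_UNIV] by simp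

lemma topspace_classical: "topspace (classical_topology Y) = points Y"
proof
  show "points Y \<subseteq> topspace (classical_topology Y)"
    using zariski_open_classical[OF points_open] by (rule openin_subset)
  show "topspace (classical_topology Y) \<subseteq> points Y"
    unfolding classical_topology_def topology_generated_by_topspace using openin_subset by fastforce
qed

lemma reg_continuous:
  assumes W: "openin (ztop Y) W" and g: "g \<in> reg Y W"
  shows "continuous_map (subtopology (classical_topology Y) W) euclidean g"
  unfolding continuous_map_def
proof (intro conjI allI impI)
  fix A :: "complex set" assume "openin euclidean A"
  then have "openin (classical_topology Y) {x \<in> W. g x \<in> A}" using classical_open[OF W g] by simp
  moreover have "{x \<in> topspace (subtopology (classical_topology Y) W). g x \<in> A} = {x \<in> W. g x \<in> A} \<inter> W"
    using openin_subset[OF W] by (auto simp: topspace_classical)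
  ultimately show "openin (subtopology (classical_topology Y) W) {x \<in> topspace (subtopology (classical_topology Y) W). g x \<in> A}"
    by (simp only: openin_subtopology_Int)
qed simp

end

text \<open>Hadamard's lemma for polynomials, in a form where the quotients are polynomials of \<open>z\<close> alone.\<close>

section \<open>Polynomials vanishing to second order\<close>

lemma hadamard:
  "p \<in> poly_funs N \<Longrightarrow> \<exists>Q. (\<forall>i. Q i \<in> poly_funs N) \<and> (\<forall>z. p z - p z0 = (\<Sum>i<N. (z i - z0 i) * Q i z))"
proof (induct rule: poly_funs.induct)
  case (const k)
  show ?case by (intro exI[of _ "\<lambda>i z. 0"]) (auto intro: poly_funs.const)
next
  case (coord k)
  have "(\<lambda>z. if i = k then 1 else 0) \<in> poly_funs N" for i by (rule poly_funs.const)
  moreover have "z k - z0 k = (\<Sum>i<N. (z i - z0 i) * (if i = k then 1 else 0))" for z :: "nat \<Rightarrow> complex"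
    using coord by (simp add: if_distrib[of "\<lambda>x. _ * x"] cong: if_cong)
  ultimately show ?case by (intro exI[of _ "\<lambda>i z. if i = k then 1 else 0"]) auto
next
  case (add p q)
  then obtain P Q where PQ: "\<forall>i. P i \<in> poly_funs N" "\<forall>z. p z - p z0 = (\<Sum>i<N. (z i - z0 i) * P i z)"
    "\<forall>i. Q i \<in> poly_funs N" "\<forall>z. q z - q z0 = (\<Sum>i<N. (z i - z0 i) * Q i z)" by blast
  have "p z + q z - (p z0 + q z0) = (\<Sum>i<N. (z i - z0 i) * (P i z + Q i z))" for z
  proof -
    have "p z + q z - (p z0 + q z0) = (p z - p z0) + (q z - q z0)" by simp
    also have "\<dots> = (\<Sum>i<N. (z i - z0 i) * P i z) + (\<Sum>i<N. (z i - z0 i) * Q i z)" using PQ(2,4) by simp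
    finally show ?thesis by (simp add: distrib_left sum.distrib)
  qed
  then show ?case using PQ(1,3) by (intro exI[of _ "\<lambda>i z. P i z + Q i z"]) (auto intro: poly_funs.add)
next
  case (mult p q)
  then obtain P Q where PQ: "\<forall>i. P i \<in> poly_funs N" "\<forall>z. p z - p z0 = (\<Sum>i<N. (z i - z0 i) * P i z)"
    "\<forall>i. Q i \<in> poly_funs N" "\<forall>z. q z - q z0 = (\<Sum>i<N. (z i - z0 i) * Q i z)" by blast
  have "p z * q z - p z0 * q z0 = (\<Sum>i<N. (z i - z0 i) * (P i z * q z + p z0 * Q i z))" for z
  proof -
    have "p z * q z - p z0 * q z0 = (p z - p z0) * q z + p z0 * (q z - q z0)" by (simp add: algebra_simps)
    also have "\<dots> = (\<Sum>i<N. (z i - z0 i) * P i z) * q z + p z0 * (\<Sum>i<N. (z i - z0 i) * Q i z)"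
      using PQ(2,4) by simp
    also have "\<dots> = (\<Sum>i<N. (z i - z0 i) * (P i z * q z + p z0 * Q i z))"
      by (simp add: sum_distrib_right sum_distrib_left sum.distrib[symmetric] distrib_left mult_ac)
    finally show ?thesis .
  qed
  moreover have "(\<lambda>z. P i z * q z + p z0 * Q i z) \<in> poly_funs N" for i
    using PQ(1,3) mult(3) by (intro poly_funs_intros) auto
  ultimately show ?case by (intro exI[of _ "\<lambda>i z. P i z * q z + p z0 * Q i z"]) auto
qed

lemma second_order_zero:
  assumes p: "p \<in> poly_funs N" "p z0 = 0" "\<And>i. i < N \<Longrightarrow> partial_deriv i p z0 = 0"
  shows "\<exists>Q. (\<forall>i. Q i \<in> poly_funs N) \<and> (\<forall>i<N. Q i z0 = 0) \<and> (\<forall>z. p z = (\<Sum>i<N. (z i - z0 i) * Q i z))"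
proof -
  obtain Q where Q: "\<And>i. Q i \<in> poly_funs N" "\<And>z. p z - p z0 = (\<Sum>i<N. (z i - z0 i) * Q i z)"
    using hadamard[OF p(1)] by blast
  have "Q i z0 = 0" if i: "i < N" for i
  proof -
    have "p (z0(i := t)) = (t - z0 i) * Q i (z0(i := t))" for t
    proof -
      have "p (z0(i := t)) = (\<Sum>k<N. ((z0(i := t)) k - z0 k) * Q k (z0(i := t)))"
        using Q(2)[of "z0(i := t)"] p(2) by simp
      also have "\<dots> = (\<Sum>k<N. if k = i then (t - z0 i) * Q i (z0(i := t)) else 0)"
        by (intro sum.cong) auto
      finally show ?thesis using i by simp
    qed
    moreover have "((\<lambda>t. p (z0(i := t))) has_field_derivative 0) (at (z0 i))"
      unfolding p(3)[OF i, symmetric]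
      by (rule strict_diff_partial_derivative[OF poly_funs_strict_diff_partial_deriv[OF p(1)] i])
    ultimately have 1: "((\<lambda>t. (t - z0 i) * Q i (z0(i := t))) has_field_derivative 0) (at (z0 i))" by simp
    have 2: "((\<lambda>t. (t - z0 i) * Q i (z0(i := t))) has_field_derivative
        1 * Q i (z0(i := z0 i)) + partial_deriv i (Q i) z0 * (z0 i - z0 i)) (at (z0 i))"
      by (intro DERIV_mult strict_diff_partial_derivative[OF poly_funs_strict_diff_partial_deriv[OF Q(1)] i])
         (auto intro!: derivative_eq_intros)
    then show ?thesis using DERIV_unique[OF 1 2] by simp
  qed
  then show ?thesis using Q p(2) by (intro exI[of _ Q]) auto
qed

section \<open>Classical topology and transversality\<close>

context smooth_var
begin

text \<open>A regular function is a quotient of polynomials in the chart, and these are continuous.\<close>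

lemma chart_continuous:
  assumes ch: "smooth_chart Y U N c f \<phi> \<psi>"
  shows "continuous_map (top_of_set (zeros N (f ` {..<c}))) (classical_topology Y) \<psi>"
proof -
  interpret ch: smooth_chart Y U N c f \<phi> \<psi> "zeros N (f ` {..<c})" by (rule ch) simp
  let ?V = "zeros N (f ` {..<c})"
  let ?S = "{{x \<in> U. f x \<in> W} | U f W. openin (ztop Y) U \<and> f \<in> reg Y U \<and> open W}"
  show ?thesis unfolding classical_topology_def continuous_on_generated_topo_iff
  proof (intro conjI allI impI)
    fix B assume "B \<in> ?S"
    then obtain W g A where B: "B = {x \<in> W. g x \<in> A}" and W: "openin (ztop Y) W" "g \<in> reg Y W" and A: "open A" by blast
    show "openin (top_of_set ?V) (\<psi> -` B \<inter> topspace (top_of_set ?V))"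
    proof (subst openin_subopen, intro ballI)
      fix z assume "z \<in> \<psi> -` B \<inter> topspace (top_of_set ?V)"
      then have z: "z \<in> ?V" "\<psi> z \<in> W" "g (\<psi> z) \<in> A" by (auto simp: B)
      obtain p q r where pqr: "p \<in> poly_funs N" "q \<in> poly_funs N" "r \<in> poly_funs N" "r (\<phi> (\<psi> z)) \<noteq> 0"
        "\<forall>y\<in>U. r (\<phi> y) \<noteq> 0 \<longrightarrow> y \<in> W \<and> q (\<phi> y) \<noteq> 0 \<and> g y = p (\<phi> y) / q (\<phi> y)"
        using ch.regular_local[OF W z(2) ch.\<psi>_in[OF z(1)]] by blast
      define G where "G = {z. r z * q z \<noteq> 0}"
      have "open G" unfolding G_def
        by (intro open_Collect_neq continuous_on_mult continuous_on_const continuous_on_poly_funs[OF pqr(3)] continuous_on_poly_funs[OF pqr(2)])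
      moreover have "continuous_on G (\<lambda>z. p z / q z)"
        by (intro continuous_on_divide continuous_on_subset[OF continuous_on_poly_funs[OF pqr(1)]]
          continuous_on_subset[OF continuous_on_poly_funs[OF pqr(2)]]) (auto simp: G_def)
      ultimately have "open (G \<inter> (\<lambda>z. p z / q z) -` A)" using A by (intro continuous_open_preimage)
      then have "openin (top_of_set ?V) (?V \<inter> (G \<inter> (\<lambda>z. p z / q z) -` A))" by (rule openin_open_Int)
      moreover have "z \<in> ?V \<inter> (G \<inter> (\<lambda>z. p z / q z) -` A)"
        using z pqr(4) pqr(5)[rule_format, OF ch.\<psi>_in[OF z(1)] pqr(4)] ch.\<phi>_\<psi>[OF z(1)] by (auto simp: G_def)
      moreover have "?V \<inter> (G \<inter> (\<lambda>z. p z / q z) -` A) \<subseteq> \<psi> -` B \<inter> topspace (top_of_set ?V)"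
      proof
        fix w assume w: "w \<in> ?V \<inter> (G \<inter> (\<lambda>z. p z / q z) -` A)"
        then have "w \<in> ?V" "r (\<phi> (\<psi> w)) \<noteq> 0" using ch.\<phi>_\<psi>[of w] by (auto simp: G_def)
        then show "w \<in> \<psi> -` B \<inter> topspace (top_of_set ?V)"
          using pqr(5)[rule_format, OF ch.\<psi>_in[of w]] w ch.\<phi>_\<psi>[of w] by (auto simp: B)
      qed
      ultimately show "\<exists>T. openin (top_of_set ?V) T \<and> z \<in> T \<and> T \<subseteq> \<psi> -` B \<inter> topspace (top_of_set ?V)" by blast
    qed
  next
    have "points Y \<subseteq> \<Union>?S" using topspace_classical unfolding classical_topology_def topology_generated_by_topspace by simp
    then show "\<psi> ` topspace (top_of_set ?V) \<subseteq> \<Union>?S"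
      using ch.\<psi>_in openin_subset[OF ch.U_open] unfolding topspace_euclidean_subtopology by blast
  qed
qed

lemma chart_irreducible:
  assumes ch: "smooth_chart Y U N c f \<phi> \<psi>"
  shows "smooth_irreducible_zeros N c f"
proof -
  interpret ch: smooth_chart Y U N c f \<phi> \<psi> "zeros N (f ` {..<c})" by (rule ch) simp
  show ?thesis
  proof
    show "submersive N c f" by (rule ch.submersive)
    fix p q assume pq: "p \<in> poly_funs N" "q \<in> poly_funs N" "\<forall>z\<in>zeros N (f ` {..<c}). p z * q z = 0"
    show "(\<forall>z\<in>zeros N (f ` {..<c}). p z = 0) \<or> (\<forall>z\<in>zeros N (f ` {..<c}). q z = 0)"
    proof (rule ccontr)
      assume "\<not> ?thesis"
      then obtain z w where z: "z \<in> zeros N (f ` {..<c})" "p z \<noteq> 0" and w: "w \<in> zeros N (f ` {..<c})" "q w \<noteq> 0" by blast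
      have "\<psi> z \<in> {x \<in> U. p (\<phi> x) \<noteq> 0}" "\<psi> w \<in> {x \<in> U. q (\<phi> x) \<noteq> 0}"
        using z w ch.\<psi>_in ch.\<phi>_\<psi> by auto
      then obtain x where "x \<in> U" "p (\<phi> x) \<noteq> 0" "q (\<phi> x) \<noteq> 0"
        using opens_meet[OF ch.principal_open[OF pq(1)] ch.principal_open[OF pq(2)]] by blast
      then show False using pq(3) ch.\<phi>_in by fastforce
    qed
  qed
qed

lemma chart_path:
  assumes ch: "smooth_chart Y U N c f \<phi> \<psi>" and q: "q \<in> poly_funs N"
    and x: "x1 \<in> U" "q (\<phi> x1) \<noteq> 0" "x2 \<in> U" "q (\<phi> x2) \<noteq> 0"
  shows "path_component_of (subtopology (classical_topology Y) {x \<in> U. q (\<phi> x) \<noteq> 0}) x1 x2"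
proof -
  interpret ch: smooth_chart Y U N c f \<phi> \<psi> "zeros N (f ` {..<c})" by (rule ch) simp
  interpret V: smooth_irreducible_zeros N c f "zeros N (f ` {..<c})" by (rule chart_irreducible[OF ch]) simp
  obtain g where g: "path g" "path_image g \<subseteq> {z \<in> zeros N (f ` {..<c}). q z \<noteq> 0}" "pathstart g = \<phi> x1" "pathfinish g = \<phi> x2"
    using V.principal_open_path_connected[OF q ch.\<phi>_in[OF x(1)] x(2) ch.\<phi>_in[OF x(3)] x(4)] unfolding path_component_def by blast
  have gV: "g t \<in> zeros N (f ` {..<c})" "q (g t) \<noteq> 0" if "t \<in> {0..1}" for t
    using subsetD[OF g(2), of "g t"] that by (auto simp: path_image_def simp del: image_subset_iff)
  have "continuous_map (top_of_set {0..1}) (top_of_set (zeros N (f ` {..<c}))) g"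
    using g(1) gV by (auto simp: path_def)
  from continuous_map_compose[OF this chart_continuous[OF ch]]
  have "pathin (classical_topology Y) (\<psi> \<circ> g)" by (simp add: pathin_def)
  then have "pathin (subtopology (classical_topology Y) {x \<in> U. q (\<phi> x) \<noteq> 0}) (\<psi> \<circ> g)"
    using gV ch.\<psi>_in ch.\<phi>_\<psi> by (auto simp: pathin_subtopology)
  moreover have "(\<psi> \<circ> g) 0 = x1" "(\<psi> \<circ> g) 1 = x2"
    using g(3,4) ch.\<psi>_\<phi> x by (auto simp: pathstart_def pathfinish_def)
  ultimately show ?thesis unfolding path_component_of_def by blast
qed

text \<open>Every point has a Zariski neighbourhood to whose points it can be joined, and two such neighbourhoods meet.\<close>

theorem zariski_open_path_connected:
  assumes W: "openin (ztop Y) W" and x: "x1 \<in> W" "x2 \<in> W"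
  shows "path_component_of (subtopology (classical_topology Y) W) x1 x2"
proof -
  have nbhd: "\<exists>P. openin (ztop Y) P \<and> x \<in> P \<and> (\<forall>y\<in>P. path_component_of (subtopology (classical_topology Y) W) x y)"
    if xW: "x \<in> W" for x
  proof -
    have "x \<in> points Y" using xW openin_subset[OF W] by blast
    then obtain U N c f \<phi> \<psi> where ch: "smooth_chart Y U N c f \<phi> \<psi>" and xU: "x \<in> U" using chart_exists by blast
    obtain r where r: "r \<in> poly_funs N" "r (\<phi> x) \<noteq> 0" "{y \<in> U. r (\<phi> y) \<noteq> 0} \<subseteq> W"
      using smooth_chart.principal_basis[OF ch W xW xU] by blast
    have "path_component_of (subtopology (classical_topology Y) W) x y" if "y \<in> {y \<in> U. r (\<phi> y) \<noteq> 0}" for y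
    proof -
      have "path_component_of (subtopology (classical_topology Y) {y \<in> U. r (\<phi> y) \<noteq> 0}) x y"
        using chart_path[OF ch r(1) xU r(2)] that by blast
      then show ?thesis using r(3) path_component_of_mono by metis
    qed
    then show ?thesis using smooth_chart.principal_open[OF ch r(1)] xU r(2) by blast
  qed
  obtain P1 P2 where P: "openin (ztop Y) P1" "x1 \<in> P1" "\<forall>y\<in>P1. path_component_of (subtopology (classical_topology Y) W) x1 y"
    "openin (ztop Y) P2" "x2 \<in> P2" "\<forall>y\<in>P2. path_component_of (subtopology (classical_topology Y) W) x2 y"
    using nbhd[OF x(1)] nbhd[OF x(2)] by blast
  then obtain y where "y \<in> P1" "y \<in> P2" using opens_meet[OF P(1,4)] by blast
  then show ?thesis using P(3,6) path_component_of_trans path_component_of_sym by metis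
qed

text \<open>A linear relation between the rows says that a combination \<open>Q\<close> of the equations and of the numerators
vanishes to second order at the point. On \<open>Y\<close> the equations vanish, so \<open>Q\<close> lies in the square of the maximal ideal, and
so does the corresponding combination of \<open>g\<close> and \<open>h\<close>. Independence of the differentials makes its coefficients
zero, and smoothness those of the equations.\<close>

lemma transversal_rows:
  assumes ch: "smooth_chart Y U N c f \<phi> \<psi>" and x0: "x0 \<in> U"
    and W: "openin (ztop Y) W" and gh: "g \<in> reg Y W" "h \<in> reg Y W" and zero: "g x0 = 0" "h x0 = 0"
    and P: "p1 \<in> poly_funs N" "q1 \<in> poly_funs N" "p2 \<in> poly_funs N" "q2 \<in> poly_funs N" "r \<in> poly_funs N" "r (\<phi> x0) \<noteq> 0"
      "\<And>y. y \<in> U \<Longrightarrow> r (\<phi> y) \<noteq> 0 \<Longrightarrow> y \<in> W \<and> q1 (\<phi> y) \<noteq> 0 \<and> g y = p1 (\<phi> y) / q1 (\<phi> y) \<and>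
         q2 (\<phi> y) \<noteq> 0 \<and> h y = p2 (\<phi> y) / q2 (\<phi> y)"
    and ind: "independent_differentials Y x0 [g, h]"
  shows "indep_rows (Suc (Suc c)) N (\<lambda>j i. if j < c then partial_deriv i (f j) (\<phi> x0)
    else if j = c then inverse (q1 (\<phi> x0)) * partial_deriv i p1 (\<phi> x0)
    else inverse (q2 (\<phi> x0)) * partial_deriv i p2 (\<phi> x0))" (is "indep_rows _ N ?A")
  unfolding indep_rows_def
proof (intro allI impI)
  interpret ch: smooth_chart Y U N c f \<phi> \<psi> "zeros N (f ` {..<c})" by (rule ch) simp
  fix b j assume b: "\<forall>i<N. (\<Sum>j<Suc (Suc c). b j * ?A j i) = 0" and j: "j < Suc (Suc c)"
  define z0 where "z0 = \<phi> x0"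
  have z0: "z0 \<in> zeros N (f ` {..<c})" unfolding z0_def by (rule ch.\<phi>_in[OF x0])
  have f0: "f k (\<phi> y) = 0" if "k < c" "y \<in> U" for k y using ch.\<phi>_in[OF that(2)] that(1) by (auto simp: zeros_iff)
  have fP: "f k \<in> poly_funs N" if "k < c" for k using ch.submersive that by (simp add: submersive_def)
  note r0 = P(7)[OF x0 P(6)]
  have p0: "p1 z0 = 0" "p2 z0 = 0" "q1 z0 \<noteq> 0" "q2 z0 \<noteq> 0" using r0 zero by (auto simp: z0_def)
  define \<beta>1 \<beta>2 where "\<beta>1 = b c * inverse (q1 z0)" and "\<beta>2 = b (Suc c) * inverse (q2 z0)"
  define Q where "Q z = (\<Sum>k<c. b k * f k z) + (\<beta>1 * p1 z + \<beta>2 * p2 z)" for z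
  have Q: "Q \<in> poly_funs N" unfolding Q_def using P fP by (intro poly_funs_intros) auto
  have Q0: "Q z0 = 0" using p0 f0[OF _ x0] by (simp add: Q_def z0_def)
  have "strict_diff N Q z0 (\<lambda>i. (\<Sum>k<c. b k * partial_deriv i (f k) z0) + (\<beta>1 * partial_deriv i p1 z0 + \<beta>2 * partial_deriv i p2 z0))"
    unfolding Q_def using P fP
    by (intro strict_diff_add strict_diff_sum strict_diff_cmult poly_funs_strict_diff_partial_deriv tendsto_poly_funs) auto
  note dQ = strict_diff_partial_deriv[OF this]
  have "partial_deriv i Q z0 = 0" if i: "i < N" for i
  proof -
    have "(\<Sum>k<c. b k * ?A k i) = (\<Sum>k<c. b k * partial_deriv i (f k) z0)" by (simp add: z0_def)
    then show ?thesis using dQ[OF i] b[rule_format, OF i] by (simp add: \<beta>1_def \<beta>2_def z0_def mult.assoc add.assoc)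
  qed
  then obtain R where R: "\<And>i. R i \<in> poly_funs N" "\<And>i. i < N \<Longrightarrow> R i z0 = 0" "\<And>z. Q z = (\<Sum>i<N. (z i - z0 i) * R i z)"
    using second_order_zero[OF Q Q0] by blast
  define G where "G = {y \<in> U. r (\<phi> y) \<noteq> 0}"
  have G: "openin (ztop Y) G" "G \<subseteq> U" "x0 \<in> G" "G \<subseteq> W"
    using ch.principal_open[OF P(5)] x0 P(6,7) by (auto simp: G_def)
  have polyreg: "(\<lambda>y. p (\<phi> y)) \<in> reg Y G" if "p \<in> poly_funs N" for p
    using ch.regular_quotient[OF G(1,2) that poly_funs.const[of 1]] by simp
  \<comment> \<open>The first \<open>N\<close> products express \<open>Q\<close>. The last two compensate for \<open>q1\<close> and \<open>q2\<close>, which are only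
    constant to first order: they add \<open>(b c - \<beta>1 q1) g\<close> and \<open>(b (c + 1) - \<beta>2 q2) h\<close>.\<close>
  define u where "u i = (if i < N then (\<lambda>y. \<phi> y i - z0 i) else if i = N then (\<lambda>y. b c - \<beta>1 * q1 (\<phi> y))
    else (\<lambda>y. b (Suc c) - \<beta>2 * q2 (\<phi> y)))" for i
  define v where "v i = (if i < N then (\<lambda>y. R i (\<phi> y)) else if i = N then g else h)" for i
  have gG: "g \<in> reg Y G" "h \<in> reg Y G" using reg_mono[OF W G(1,4)] gh by auto
  have ureg: "u i \<in> reg Y G" for i
  proof -
    have "(\<lambda>z. z i - z0 i) \<in> poly_funs N" if "i < N" using that by (intro poly_funs_intros)
    moreover have "(\<lambda>z. b c - \<beta>1 * q1 z) \<in> poly_funs N" "(\<lambda>z. b (Suc c) - \<beta>2 * q2 z) \<in> poly_funs N"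
      using P by (auto intro!: poly_funs_intros)
    ultimately show ?thesis unfolding u_def using polyreg[of "\<lambda>z. z i - z0 i"]
        polyreg[of "\<lambda>z. b c - \<beta>1 * q1 z"] polyreg[of "\<lambda>z. b (Suc c) - \<beta>2 * q2 z"] by auto
  qed
  have vreg: "v i \<in> reg Y G" for i unfolding v_def using polyreg[OF R(1)] gG by auto
  have u0: "u i x0 = 0" for i using p0 by (auto simp: u_def z0_def \<beta>1_def \<beta>2_def)
  have v0: "v i x0 = 0" for i using R(2) zero by (auto simp: v_def z0_def)
  have split: "(\<Sum>i<Suc (Suc N). u i y * v i y) = b c * g y + b (Suc c) * h y" if y: "y \<in> G" for y
  proof -
    have yU: "y \<in> U" "r (\<phi> y) \<noteq> 0" using y by (auto simp: G_def)
    note ry = P(7)[OF yU]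
    have "(\<Sum>i<N. u i y * v i y) = Q (\<phi> y)" unfolding R(3) by (intro sum.cong) (auto simp: u_def v_def)
    also have "\<dots> = \<beta>1 * p1 (\<phi> y) + \<beta>2 * p2 (\<phi> y)" using f0[OF _ yU(1)] by (simp add: Q_def)
    also have "\<dots> = \<beta>1 * q1 (\<phi> y) * g y + \<beta>2 * q2 (\<phi> y) * h y" using ry by simp
    finally show ?thesis by (simp add: u_def v_def algebra_simps)
  qed
  have "(\<lambda>y. \<Sum>i<length [g, h]. b (c + i) * (([g, h] ! i) y - ([g, h] ! i) x0)) \<in> max_ideal_square Y x0"
    unfolding max_ideal_square_def
  proof (intro CollectI exI conjI allI impI ballI)
    show "openin (ztop Y) G" "x0 \<in> G" using G by auto
    show "(\<Sum>i<length [g, h]. b (c + i) * (([g, h] ! i) y - ([g, h] ! i) x0)) = (\<Sum>i<Suc (Suc N). u i y * v i y)"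
      if "y \<in> G" for y
      unfolding split[OF that] using zero by (simp add: lessThan_Suc numeral_2_eq_2)
  qed (use ureg vreg u0 v0 in auto)
  note b01 = ind[unfolded independent_differentials_def, rule_format, OF this]
  have b0: "b c = 0" "b (Suc c) = 0" using b01[of 0] b01[of 1] by simp_all
  have "\<forall>i<N. (\<Sum>j<c. b j * partial_deriv i (f j) z0) = 0" using b b0 by (simp add: z0_def)
  then have "\<forall>j<c. b j = 0"
    using ch.submersive z0 unfolding submersive_def indep_rows_def by blast
  then show "b j = 0" using b0 j by (auto simp: less_Suc_eq)
qed

text \<open>The submersion theorem for the equations of a chart together with \<open>g\<close> and \<open>h\<close>; requiring the
equations to vanish keeps the section on \<open>Y\<close>.\<close>

lemma transversal_local_section:
  assumes W: "openin (ztop Y) W" and gh: "g \<in> reg Y W" "h \<in> reg Y W" and x0: "x0 \<in> W"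
    and zero: "g x0 = 0" "h x0 = 0" and ind: "independent_differentials Y x0 [g, h]"
  obtains r \<Sigma> where "r > 0"
    "continuous_map (top_of_set {p. cmod (fst p) < r \<and> cmod (snd p) < r}) (classical_topology Y) \<Sigma>"
    "\<And>p. cmod (fst p) < r \<Longrightarrow> cmod (snd p) < r \<Longrightarrow> \<Sigma> p \<in> W \<and> g (\<Sigma> p) = fst p \<and> h (\<Sigma> p) = snd p"
proof -
  have "x0 \<in> points Y" using x0 openin_subset[OF W] by blast
  then obtain U N c f \<phi> \<psi> where ch: "smooth_chart Y U N c f \<phi> \<psi>" and xU: "x0 \<in> U" using chart_exists by blast
  interpret ch: smooth_chart Y U N c f \<phi> \<psi> "zeros N (f ` {..<c})" by (rule ch) simp
  obtain p1 q1 r1 where 1: "p1 \<in> poly_funs N" "q1 \<in> poly_funs N" "r1 \<in> poly_funs N" "r1 (\<phi> x0) \<noteq> 0"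
    "\<forall>y\<in>U. r1 (\<phi> y) \<noteq> 0 \<longrightarrow> y \<in> W \<and> q1 (\<phi> y) \<noteq> 0 \<and> g y = p1 (\<phi> y) / q1 (\<phi> y)"
    using ch.regular_local[OF W gh(1) x0 xU] by blast
  obtain p2 q2 r2 where 2: "p2 \<in> poly_funs N" "q2 \<in> poly_funs N" "r2 \<in> poly_funs N" "r2 (\<phi> x0) \<noteq> 0"
    "\<forall>y\<in>U. r2 (\<phi> y) \<noteq> 0 \<longrightarrow> y \<in> W \<and> q2 (\<phi> y) \<noteq> 0 \<and> h y = p2 (\<phi> y) / q2 (\<phi> y)"
    using ch.regular_local[OF W gh(2) x0 xU] by blast
  define R where "R z = r1 z * r2 z" for z
  have R: "R \<in> poly_funs N" unfolding R_def[abs_def] using 1(3) 2(3) by (rule poly_funs.mult)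
  have R0: "R (\<phi> x0) \<noteq> 0" using 1(4) 2(4) by (simp add: R_def)
  have quot: "y \<in> W \<and> q1 (\<phi> y) \<noteq> 0 \<and> g y = p1 (\<phi> y) / q1 (\<phi> y) \<and> q2 (\<phi> y) \<noteq> 0 \<and> h y = p2 (\<phi> y) / q2 (\<phi> y)"
    if "y \<in> U" "R (\<phi> y) \<noteq> 0" for y
    using 1(5)[rule_format, of y] 2(5)[rule_format, of y] that by (simp add: R_def)
  note rows = transversal_rows[OF ch xU W gh zero 1(1,2) 2(1,2) R R0 quot ind]
  define z0 where "z0 = \<phi> x0"
  have z0: "z0 \<in> zeros N (f ` {..<c})" unfolding z0_def by (rule ch.\<phi>_in[OF xU])
  have q0: "q1 z0 \<noteq> 0" "q2 z0 \<noteq> 0" "p1 z0 = 0" "p2 z0 = 0" using quot[OF xU R0] zero by (auto simp: z0_def)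
  define G where "G j z = (if j < c then f j z else if j = c then inverse (q1 z) * p1 z else inverse (q2 z) * p2 z)"
    for j :: nat and z
  have sd_quot: "strict_diff N (\<lambda>z. inverse (q z) * p z) z0 (\<lambda>i. inverse (q z0) * partial_deriv i p z0)"
    if "p \<in> poly_funs N" "q \<in> poly_funs N" "q z0 \<noteq> 0" "p z0 = 0" for p q
  proof -
    have "((\<lambda>z. inverse (q z)) \<longlongrightarrow> inverse (q z0)) (nhds z0)"
      using tendsto_inverse[OF tendsto_poly_funs[OF that(2)] that(3)] .
    then have "strict_diff N (\<lambda>z. inverse (q z) * p z) z0
        (\<lambda>i. inverse (q z0) * partial_deriv i p z0 + p z0 * (- partial_deriv i q z0 / (q z0 * q z0)))"
      using that by (intro strict_diff_mult strict_diff_inverse poly_funs_strict_diff_partial_deriv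
          tendsto_poly_funs[of p] tendsto_poly_funs[of q])
    then show ?thesis using that(4) by simp
  qed
  have fP: "f j \<in> poly_funs N" if "j < c" for j using ch.submersive that by (simp add: submersive_def)
  have Gc: "G j = f j" if "j < c" for j using that by (simp add: G_def fun_eq_iff)
  have Gc2: "G j = (\<lambda>z. inverse (q2 z) * p2 z)" if "j > c" for j
    using that by (simp add: G_def fun_eq_iff)
  define A where "A j i = (if j < c then partial_deriv i (f j) z0
    else if j = c then inverse (q1 z0) * partial_deriv i p1 z0
    else inverse (q2 z0) * partial_deriv i p2 z0)" for j i :: nat
  have sd: "strict_diff N (G j) z0 (A j)" for j
  proof -
    consider "j < c" | "j = c" | "j > c" by linarith
    then show ?thesis
    proof cases
      case 1
      then show ?thesis using poly_funs_strict_diff_partial_deriv[OF fP[OF 1]] by (simp add: Gc A_def[abs_def])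
    next
      case 2
      have "A j = (\<lambda>i. inverse (q1 z0) * partial_deriv i p1 z0)" using 2 by (simp add: A_def fun_eq_iff)
      moreover have "G j = (\<lambda>z. inverse (q1 z) * p1 z)" using 2 by (simp add: G_def fun_eq_iff)
      ultimately show ?thesis using sd_quot[OF \<open>p1 \<in> poly_funs N\<close> \<open>q1 \<in> poly_funs N\<close> q0(1,3)] by simp
    next
      case 3
      have "A j = (\<lambda>i. inverse (q2 z0) * partial_deriv i p2 z0)" using 3 by (simp add: A_def fun_eq_iff)
      then show ?thesis using sd_quot[OF \<open>p2 \<in> poly_funs N\<close> \<open>q2 \<in> poly_funs N\<close> q0(2,4)] Gc2[OF 3] by simp
    qed
  qed
  have "indep_rows (Suc (Suc c)) N A" using rows unfolding z0_def[symmetric] A_def[abs_def] .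
  moreover have "z0 \<in> affine_space N" using z0 by (simp add: zeros_iff)
  ultimately obtain \<delta> s where s: "right_inverse_near N (Suc (Suc c)) G z0 \<delta> s"
    using local_section[of z0 N "Suc (Suc c)" G A] sd by blast
  have \<delta>: "\<delta> > 0" by (rule right_inverse_nearD(1)[OF s])
  have G0: "G j z0 = 0" for j using q0 z0 by (auto simp: G_def zeros_iff)
  define \<gamma> where "\<gamma> p j = (if j < c then 0 else if j = c then fst p else snd p)" for p :: "complex \<times> complex" and j :: nat
  define w where "w p = s (\<gamma> p)" for p
  define S where "S = {p :: complex \<times> complex. cmod (fst p) < \<delta> \<and> cmod (snd p) < \<delta>}"
  have nearS: "near (Suc (Suc c)) \<delta> (\<lambda>j. G j z0) (\<gamma> p)" if "p \<in> S" for p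
    using that \<delta> by (auto simp: near_def G0 \<gamma>_def S_def)
  have S: "open S" unfolding S_def
    by (intro open_Collect_conj open_Collect_less continuous_intros)
  have cw: "continuous_on S w" unfolding w_def
  proof (rule right_inverse_near_continuous[OF s _ nearS])
    show "continuous_on S (\<lambda>p. \<gamma> p j)" for j unfolding \<gamma>_def
      by (cases "j < c"; cases "j = c") (auto intro!: continuous_intros)
  qed
  have wG: "G j (w p) = \<gamma> p j" if "p \<in> S" "j < Suc (Suc c)" for p j
    unfolding w_def by (rule right_inverse_nearD(4)[OF s nearS[OF that(1)] that(2)])
  have wV: "w p \<in> zeros N (f ` {..<c})" if p: "p \<in> S" for p
  proof -
    have "w p \<in> affine_space N" unfolding w_def by (rule right_inverse_nearD(3)[OF s nearS[OF p]])
    moreover have "f j (w p) = 0" if "j < c" for j using wG[OF p, of j] that by (simp add: Gc \<gamma>_def)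
    ultimately show ?thesis by (simp add: zeros_iff)
  qed
  have w0: "w (0, 0) = z0" unfolding w_def by (rule right_inverse_nearD(2)[OF s]) (simp add: \<gamma>_def G0)
  have "continuous_on S (\<lambda>p. R (w p))"
    using continuous_on_compose2[OF continuous_on_poly_funs[OF R] cw] by blast
  then have "open (S \<inter> (\<lambda>p. R (w p)) -` (- {0}))" using S by (intro continuous_open_preimage) auto
  moreover have "(0, 0) \<in> S \<inter> (\<lambda>p. R (w p)) -` (- {0})" using \<delta> R0 w0 by (simp add: S_def z0_def)
  ultimately obtain \<epsilon> where \<epsilon>: "\<epsilon> > 0" "ball (0, 0) \<epsilon> \<subseteq> S \<inter> (\<lambda>p. R (w p)) -` (- {0})"
    unfolding open_contains_ball by blast
  have box: "p \<in> S \<and> R (w p) \<noteq> 0" if "cmod (fst p) < \<epsilon> / 2" "cmod (snd p) < \<epsilon> / 2" for p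
  proof -
    have "norm p \<le> cmod (fst p) + cmod (snd p)" using norm_Pair_le[of "fst p" "snd p"] by simp
    then have "p \<in> ball (0, 0) \<epsilon>" using that by (simp add: zero_prod_def[symmetric])
    then show ?thesis using \<epsilon>(2) by blast
  qed
  show thesis
  proof (rule that)
    show "\<epsilon> / 2 > 0" using \<epsilon>(1) by simp
    let ?B = "{p :: complex \<times> complex. cmod (fst p) < \<epsilon> / 2 \<and> cmod (snd p) < \<epsilon> / 2}"
    have BS: "?B \<subseteq> S" using box by blast
    have "continuous_on ?B w" by (rule continuous_on_subset[OF cw BS])
    moreover have "w \<in> ?B \<rightarrow> zeros N (f ` {..<c})" using wV BS by blast
    ultimately have "continuous_map (top_of_set ?B) (top_of_set (zeros N (f ` {..<c}))) w"
      unfolding continuous_map_in_subtopology by simp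
    from continuous_map_compose[OF this chart_continuous[OF ch]]
    show "continuous_map (top_of_set ?B) (classical_topology Y) (\<psi> \<circ> w)" .
  next
    fix p :: "complex \<times> complex" assume p: "cmod (fst p) < \<epsilon> / 2" "cmod (snd p) < \<epsilon> / 2"
    then have pS: "p \<in> S" and Rp: "R (w p) \<noteq> 0" using box by blast+
    have \<phi>w: "\<phi> (\<psi> (w p)) = w p" by (rule ch.\<phi>_\<psi>[OF wV[OF pS]])
    have "g (\<psi> (w p)) = G c (w p)" "h (\<psi> (w p)) = G (Suc c) (w p)" "\<psi> (w p) \<in> W"
      using quot[OF ch.\<psi>_in[OF wV[OF pS]]] Rp unfolding \<phi>w by (simp_all add: G_def divide_inverse mult.commute)
    then show "(\<psi> \<circ> w) p \<in> W \<and> g ((\<psi> \<circ> w) p) = fst p \<and> h ((\<psi> \<circ> w) p) = snd p"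
      using wG[OF pS] by (simp add: \<gamma>_def)
  qed
qed

end

section \<open>Divisors and dihedral quotients of the fundamental group\<close>

locale smooth_var_divisor = smooth_var Y for Y :: "'a fspace" +
  fixes L :: "('a set \<times> 'a ratfun) set"
  assumes L: "divisor Y L"
begin

text \<open>The function \<open>h\<close> is the local expression of the section \<open>s\<close> in the trivialisation given by the member \<open>i\<close> of the divisor.\<close>

definition represents :: "'a set \<times> 'a ratfun \<Rightarrow> nat \<Rightarrow> 'a ratfun \<Rightarrow> ('a \<Rightarrow> complex) \<Rightarrow> bool" where
  "represents i k s h \<longleftrightarrow> h \<in> reg Y (fst i) \<and>
     (\<forall>x\<in>fst i \<inter> (fst s \<inter> fst (snd i)). h x = snd s x * snd (snd i) x ^ k)"

definition open_domain :: "'a ratfun \<Rightarrow> bool" where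
  "open_domain s \<longleftrightarrow> openin (ztop Y) (fst s) \<and> fst s \<noteq> {}"

definition unit_domain :: "'a set \<times> 'a ratfun \<Rightarrow> 'a set" where
  "unit_domain i = {x \<in> fst (snd i). snd (snd i) x \<noteq> 0}"

text \<open>The transition function of the line bundle between two trivialisations.\<close>

definition transition :: "'a set \<times> 'a ratfun \<Rightarrow> 'a set \<times> 'a ratfun \<Rightarrow> 'a \<Rightarrow> complex" where
  "transition i j = (SOME u. u \<in> reg Y (fst i \<inter> fst j) \<and> (\<forall>x\<in>fst i \<inter> fst j. u x \<noteq> 0) \<and>
     rat_eq (snd i) (rat_mult (fst i \<inter> fst j, u) (snd j)))"

lemma local_equation_iff: "local_equation Y L k s x h \<longleftrightarrow> (\<exists>i\<in>L. x \<in> fst i \<and> represents i k s h)"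
  by (simp add: local_equation_def represents_def rat_eq_def rat_mult_def rat_power_def case_prod_beta)

lemma section_represented: "s \<in> sections_mult Y L k \<Longrightarrow> i \<in> L \<Longrightarrow> \<exists>h. represents i k s h"
  by (auto simp: sections_mult_def represents_def rat_eq_def rat_mult_def rat_power_def case_prod_beta)

lemma section_open_domain: "s \<in> sections_mult Y L k \<Longrightarrow> open_domain s"
  unfolding sections_mult_def ratfuns_def open_domain_def by (cases s) auto

lemma L_open: "i \<in> L \<Longrightarrow> openin (ztop Y) (fst i)"
  and L_ratfun: "i \<in> L \<Longrightarrow> snd i \<in> ratfuns Y" and L_nonzero: "i \<in> L \<Longrightarrow> rat_nonzero (snd i)"
  using L unfolding divisor_def case_prod_beta by simp_all

lemma L_cover: "x \<in> points Y \<Longrightarrow> \<exists>i\<in>L. x \<in> fst i"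
  using L unfolding divisor_def by blast

lemma L_quotient: "i \<in> L \<Longrightarrow> j \<in> L \<Longrightarrow> \<exists>u\<in>reg Y (fst i \<inter> fst j).
    (\<forall>x\<in>fst i \<inter> fst j. u x \<noteq> 0) \<and> rat_eq (snd i) (rat_mult (fst i \<inter> fst j, u) (snd j))"
  using L unfolding divisor_def case_prod_beta by simp

lemma unit_domain:
  assumes i: "i \<in> L"
  shows "openin (ztop Y) (unit_domain i) \<and> unit_domain i \<noteq> {}"
proof -
  have "openin (ztop Y) (fst (snd i))" "snd (snd i) \<in> reg Y (fst (snd i))"
    using L_ratfun[OF i] by (auto simp: ratfuns_def case_prod_beta)
  then have "openin (ztop Y) (unit_domain i)" unfolding unit_domain_def by (rule reg_nonzero_open)
  then show ?thesis using L_nonzero[OF i] by (auto simp: unit_domain_def rat_nonzero_def)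
qed

lemma transition:
  assumes "i \<in> L" "j \<in> L"
  shows "transition i j \<in> reg Y (fst i \<inter> fst j)" "\<And>x. x \<in> fst i \<Longrightarrow> x \<in> fst j \<Longrightarrow> transition i j x \<noteq> 0"
    "\<And>x. x \<in> fst i \<Longrightarrow> x \<in> fst j \<Longrightarrow> x \<in> unit_domain i \<Longrightarrow> x \<in> unit_domain j \<Longrightarrow>
      snd (snd i) x = transition i j x * snd (snd j) x"
proof -
  have ex: "\<exists>u. u \<in> reg Y (fst i \<inter> fst j) \<and> (\<forall>x\<in>fst i \<inter> fst j. u x \<noteq> 0) \<and>
     rat_eq (snd i) (rat_mult (fst i \<inter> fst j, u) (snd j))" using L_quotient[OF assms] by blast
  note t = someI_ex[OF ex, folded transition_def]
  show "transition i j \<in> reg Y (fst i \<inter> fst j)" using t by blast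
  show "transition i j x \<noteq> 0" if "x \<in> fst i" "x \<in> fst j" for x using t that by blast
  show "snd (snd i) x = transition i j x * snd (snd j) x"
    if "x \<in> fst i" "x \<in> fst j" "x \<in> unit_domain i" "x \<in> unit_domain j" for x
    using t that unfolding rat_eq_def rat_mult_def unit_domain_def by auto
qed

lemma overlap_open: "i \<in> L \<Longrightarrow> j \<in> L \<Longrightarrow> openin (ztop Y) (fst i \<inter> fst j)"
  using L_open by blast

lemma three_opens_meet:
  assumes "openin (ztop Y) A \<and> A \<noteq> {}" "openin (ztop Y) B \<and> B \<noteq> {}" "openin (ztop Y) C \<and> C \<noteq> {}"
  shows "openin (ztop Y) (A \<inter> B \<inter> C) \<and> A \<inter> B \<inter> C \<noteq> {}"
proof -
  have "openin (ztop Y) (A \<inter> B)" "A \<inter> B \<noteq> {}" using assms opens_meet by blast+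
  then show ?thesis using assms(3) opens_meet by blast
qed

text \<open>Both sides are regular and agree where the rational functions are defined and the local equations are
nonzero, which is a nonempty open set.\<close>

lemma represents_change:
  assumes ij: "i \<in> L" "j \<in> L" and s: "open_domain s" and h: "represents i k s h" "represents j k s h'"
    and x: "x \<in> fst i" "x \<in> fst j"
  shows "h x = transition i j x ^ k * h' x"
proof (rule reg_identity[OF overlap_open[OF ij]])
  note W = overlap_open[OF ij]
  show "h \<in> reg Y (fst i \<inter> fst j)" using h(1) reg_mono[OF L_open[OF ij(1)] W] by (auto simp: represents_def)
  have "h' \<in> reg Y (fst i \<inter> fst j)" using h(2) reg_mono[OF L_open[OF ij(2)] W] by (auto simp: represents_def)
  then show "(\<lambda>x. transition i j x ^ k * h' x) \<in> reg Y (fst i \<inter> fst j)"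
    by (intro reg_add_mult(2) reg_power W transition(1) ij)
  show "openin (ztop Y) (fst s \<inter> unit_domain i \<inter> unit_domain j)" "fst s \<inter> unit_domain i \<inter> unit_domain j \<noteq> {}"
    using three_opens_meet[OF s[unfolded open_domain_def] unit_domain[OF ij(1)] unit_domain[OF ij(2)]] by blast+
  fix y assume y: "y \<in> fst i \<inter> fst j" "y \<in> fst s \<inter> unit_domain i \<inter> unit_domain j"
  then have "y \<in> fst (snd i)" "y \<in> fst (snd j)" by (auto simp: unit_domain_def)
  then have "h y = snd s y * snd (snd i) y ^ k" "h' y = snd s y * snd (snd j) y ^ k"
    using h y unfolding represents_def by blast+
  then show "h y = transition i j y ^ k * h' y" using transition(3)[OF ij, of y] y by (simp add: power_mult_distrib)
qed (use x in blast)

lemma transition_cocycle: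
  assumes ijk: "i \<in> L" "j \<in> L" "k \<in> L" and x: "x \<in> fst i" "x \<in> fst j" "x \<in> fst k"
  shows "transition i j x * transition j k x = transition i k x"
proof (rule reg_identity[of "fst i \<inter> fst j \<inter> fst k"])
  show W: "openin (ztop Y) (fst i \<inter> fst j \<inter> fst k)" using L_open ijk by blast
  have "transition i j \<in> reg Y (fst i \<inter> fst j \<inter> fst k)" "transition j k \<in> reg Y (fst i \<inter> fst j \<inter> fst k)"
    "transition i k \<in> reg Y (fst i \<inter> fst j \<inter> fst k)"
    by (rule reg_mono[OF overlap_open W _ transition(1)]; (use ijk in blast))+
  then show "(\<lambda>x. transition i j x * transition j k x) \<in> reg Y (fst i \<inter> fst j \<inter> fst k)" "transition i k \<in> reg Y (fst i \<inter> fst j \<inter> fst k)"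
    using reg_add_mult(2)[OF W] by blast+
  show "openin (ztop Y) (unit_domain i \<inter> unit_domain j \<inter> unit_domain k)" "unit_domain i \<inter> unit_domain j \<inter> unit_domain k \<noteq> {}"
    using three_opens_meet[OF unit_domain[OF ijk(1)] unit_domain[OF ijk(2)] unit_domain[OF ijk(3)]] by blast+
  fix y assume y: "y \<in> fst i \<inter> fst j \<inter> fst k" "y \<in> unit_domain i \<inter> unit_domain j \<inter> unit_domain k"
  have l: "snd (snd i) y = transition i j y * snd (snd j) y" "snd (snd j) y = transition j k y * snd (snd k) y"
    "snd (snd i) y = transition i k y * snd (snd k) y"
    by (rule transition(3); (use ijk y in blast))+
  have "snd (snd k) y \<noteq> 0" using y by (simp add: unit_domain_def)
  moreover have "(transition i j y * transition j k y) * snd (snd k) y = transition i k y * snd (snd k) y"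
    using l by (metis mult.assoc)
  ultimately show "transition i j y * transition j k y = transition i k y" using mult_right_cancel by blast
qed (use x in blast)

text \<open>Vanishing does not depend on the trivialisation, since transition functions have no zeros.\<close>

lemma zero_locus_iff:
  assumes s: "open_domain s" and i: "i \<in> L" and h: "represents i k s h" and x: "x \<in> fst i"
  shows "x \<in> zero_locus Y L k s \<longleftrightarrow> h x = 0"
proof
  assume "x \<in> zero_locus Y L k s"
  then obtain j h' where j: "j \<in> L" "x \<in> fst j" "represents j k s h'" "h' x = 0"
    unfolding zero_locus_def local_equation_iff by blast
  then show "h x = 0" using represents_change[OF i j(1) s h j(3) x j(2)] by simp
next
  assume "h x = 0"
  then show "x \<in> zero_locus Y L k s"
    unfolding zero_locus_def local_equation_iff using i h x openin_subset[OF L_open[OF i]] by blast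
qed

definition disc_section :: "nat \<Rightarrow> 'a ratfun \<Rightarrow> 'a ratfun \<Rightarrow> 'a ratfun" where
  "disc_section n a F = rat_diff (rat_power a 2) (rat_power F n)"

lemma disc_section_open_domain:
  assumes "open_domain a" "open_domain F"
  shows "open_domain (disc_section n a F)"
  using assms opens_meet[of "fst a" "fst F"]
  unfolding open_domain_def disc_section_def rat_diff_def rat_power_def by auto

lemma disc_section_represented:
  assumes i: "i \<in> L" and g: "represents i n a g" and h: "represents i 2 F h"
  shows "represents i (2 * n) (disc_section n a F) (\<lambda>x. (g x)\<^sup>2 - h x ^ n)"
  unfolding represents_def
proof (intro conjI ballI)
  show "(\<lambda>x. (g x)\<^sup>2 - h x ^ n) \<in> reg Y (fst i)"
    using g h L_open[OF i] by (intro reg_diff reg_power) (auto simp: represents_def)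
  fix x assume x: "x \<in> fst i \<inter> (fst (disc_section n a F) \<inter> fst (snd i))"
  then have "g x = snd a x * snd (snd i) x ^ n" "h x = snd F x * (snd (snd i) x)\<^sup>2"
    using g h by (auto simp: represents_def disc_section_def rat_diff_def rat_power_def)
  then show "(g x)\<^sup>2 - h x ^ n = snd (disc_section n a F) x * snd (snd i) x ^ (2 * n)"
    by (simp add: disc_section_def rat_diff_def rat_power_def power_mult_distrib power_mult[symmetric]
        mult.commute[of n 2] left_diff_distrib)
qed

text \<open>The multiplier at a point \<open>x\<close> is the transition function from a trivialisation chosen at \<open>x\<close>. With this
choice \<open>A\<close> and \<open>f\<close> are the values of the sections in the chosen trivialisations, and the quotients of multipliers
are transition functions by the cocycle relation.\<close>

theorem dihedral_quotient:
  assumes n: "n \<ge> 1" and a: "a \<in> sections_mult Y L n" and F: "F \<in> sections_mult Y L 2"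
    and B: "B = zero_locus Y L (2 * n) (disc_section n a F)"
    and transverse: "zero_divisors_transverse Y L n a 2 F"
    and p: "p \<in> zero_locus Y L n a" "p \<in> zero_locus Y L 2 F"
    and y0: "y0 \<in> points Y - B"
  shows "\<exists>h. h \<in> epi (fundamental_group (subtopology (classical_topology Y) (points Y - B)) y0) (dihedral_group n)"
proof -
  define Z where "Z = points Y - B"
  define T where "T = subtopology (classical_topology Y) Z"
  define la lF where "la i = (SOME h. represents i n a h)" and "lF i = (SOME h. represents i 2 F h)" for i
  have la: "represents i n a (la i)" and lF: "represents i 2 F (lF i)" if "i \<in> L" for i
    unfolding la_def lF_def using someI_ex[OF section_represented[OF a that]] someI_ex[OF section_represented[OF F that]] .
  note a' = section_open_domain[OF a] and F' = section_open_domain[OF F]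
  have inB: "x \<in> B \<longleftrightarrow> (la i x)\<^sup>2 = lF i x ^ n" if "i \<in> L" "x \<in> fst i" for i x
    unfolding B using zero_locus_iff[OF disc_section_open_domain[OF a' F'] that(1) disc_section_represented[OF that(1) la[OF that(1)] lF[OF that(1)]] that(2)]
    by simp
  \<comment> \<open>A trivialisation is chosen at every point, without any continuity.\<close>
  define idx where "idx x = (SOME i. i \<in> L \<and> x \<in> fst i)" for x
  have idx: "idx x \<in> L" "x \<in> fst (idx x)" if "x \<in> points Y" for x
    unfolding idx_def using someI_ex[of "\<lambda>i. i \<in> L \<and> x \<in> fst i"] L_cover[OF that] by blast+
  define m where "m j x = transition (idx x) j x" for j x
  define A where "A x = la (idx x) x" for x
  define f where "f x = lF (idx x) x" for x
  have Aeq: "A x = m i x ^ n * la i x" and Feq: "f x = (m i x)\<^sup>2 * lF i x" if "i \<in> L" "x \<in> fst i" for i x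
  proof -
    have x: "x \<in> points Y" using that openin_subset[OF L_open[OF that(1)]] by blast
    show "A x = m i x ^ n * la i x" unfolding A_def m_def
      by (rule represents_change[OF idx(1)[OF x] that(1) a' la[OF idx(1)[OF x]] la[OF that(1)] idx(2)[OF x] that(2)])
    show "f x = (m i x)\<^sup>2 * lF i x" unfolding f_def m_def
      by (rule represents_change[OF idx(1)[OF x] that(1) F' lF[OF idx(1)[OF x]] lF[OF that(1)] idx(2)[OF x] that(2)])
  qed
  have m0: "m i x \<noteq> 0" if "i \<in> L" "x \<in> fst i" for i x
  proof -
    have x: "x \<in> points Y" using that openin_subset[OF L_open[OF that(1)]] by blast
    show ?thesis unfolding m_def using transition(2)[OF idx(1)[OF x] that(1) idx(2)[OF x] that(2)] .
  qed
  have mquot: "m i x / m j x = transition j i x" if "i \<in> L" "j \<in> L" "x \<in> fst i" "x \<in> fst j" for i j x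
  proof -
    have x: "x \<in> points Y" using that openin_subset[OF L_open[OF that(1)]] by blast
    have "m j x * transition j i x = m i x" unfolding m_def
      by (rule transition_cocycle[OF idx(1)[OF x] that(2,1) idx(2)[OF x] that(4,3)])
    then show ?thesis using m0[OF that(2,4)] by (simp add: field_simps)
  qed
  have disc: "(A x)\<^sup>2 \<noteq> f x ^ n" if "x \<in> Z" for x
    using inB[OF idx, of x] that unfolding A_def f_def Z_def by blast
  have Z: "openin (ztop Y) Z"
  proof (subst openin_subopen, intro ballI)
    fix x assume x: "x \<in> Z"
    then have xY: "x \<in> points Y" by (simp add: Z_def)
    let ?i = "idx x"
    let ?V = "{y \<in> fst ?i. (la ?i y)\<^sup>2 - lF ?i y ^ n \<noteq> 0}"
    have "(\<lambda>y. (la ?i y)\<^sup>2 - lF ?i y ^ n) \<in> reg Y (fst ?i)"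
      using disc_section_represented[OF idx(1)[OF xY] la[OF idx(1)[OF xY]] lF[OF idx(1)[OF xY]]] by (simp add: represents_def)
    then have "openin (ztop Y) ?V" by (rule reg_nonzero_open[OF L_open[OF idx(1)[OF xY]]])
    moreover have "x \<in> ?V" using disc[OF x] idx(2)[OF xY] by (simp add: A_def f_def)
    moreover have "?V \<subseteq> Z"
      using inB[OF idx(1)[OF xY]] openin_subset[OF L_open[OF idx(1)[OF xY]]] unfolding Z_def by auto
    ultimately show "\<exists>V. openin (ztop Y) V \<and> x \<in> V \<and> V \<subseteq> Z" by blast
  qed
  have topT: "topspace T = Z" unfolding T_def using openin_subset[OF Z] by (auto simp: topspace_classical)
  have regT: "continuous_map (subtopology T V) euclidean g" if "g \<in> reg Y W" "openin (ztop Y) W" "V \<subseteq> W" for g V W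
  proof -
    have "continuous_map (subtopology (classical_topology Y) (Z \<inter> V)) euclidean g"
      by (rule continuous_map_from_subtopology_mono[OF reg_continuous[OF that(2,1)]]) (use that(3) in blast)
    then show ?thesis by (simp add: T_def subtopology_subtopology)
  qed
  interpret dihedral_cover T n L "\<lambda>i. fst i \<inter> Z" m A f
  proof
    show "n \<ge> 1" by (rule n)
    show "openin T (fst i \<inter> Z)" if "i \<in> L" for i
      unfolding T_def by (rule openin_subtopology_Int[OF zariski_open_classical[OF L_open[OF that]]])
    show "\<exists>i\<in>L. x \<in> fst i \<inter> Z" if "x \<in> topspace T" for x
      using L_cover[of x] that unfolding topT Z_def by blast
    show "m i x \<noteq> 0" if "i \<in> L" "x \<in> fst i \<inter> Z" for i x using m0 that by blast
    show "continuous_map (subtopology T (fst i \<inter> Z \<inter> (fst j \<inter> Z))) euclidean (\<lambda>x. m i x / m j x)" if "i \<in> L" "j \<in> L" for i j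
      by (rule continuous_map_eq[OF regT[OF transition(1)[OF that(2,1)] overlap_open[OF that(2,1)]]]) (use mquot[OF that] in auto)
    show "continuous_map (subtopology T (fst i \<inter> Z)) euclidean (\<lambda>x. A x / m i x ^ n)" if i: "i \<in> L" for i
    proof (rule continuous_map_eq[OF regT])
      show "la i \<in> reg Y (fst i)" using la[OF i] by (simp add: represents_def)
    qed (use Aeq[OF i] m0[OF i] L_open[OF i] in auto)
    show "continuous_map (subtopology T (fst i \<inter> Z)) euclidean (\<lambda>x. f x / (m i x)\<^sup>2)" if i: "i \<in> L" for i
    proof (rule continuous_map_eq[OF regT])
      show "lF i \<in> reg Y (fst i)" using lF[OF i] by (simp add: represents_def)
    qed (use Feq[OF i] m0[OF i] L_open[OF i] in auto)
    show "(A x)\<^sup>2 \<noteq> f x ^ n" if "x \<in> topspace T" for x using disc that unfolding topT .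
  qed
  have pY: "p \<in> points Y" using p by (simp add: zero_locus_def)
  define i where "i = idx p"
  have i: "i \<in> L" "p \<in> fst i" unfolding i_def using idx[OF pY] by blast+
  have zero: "la i p = 0" "lF i p = 0"
    using zero_locus_iff[OF a' i(1) la[OF i(1)] i(2)] zero_locus_iff[OF F' i(1) lF[OF i(1)] i(2)] p by blast+
  have "independent_differentials Y p [la i, lF i]"
    using transverse p i la[OF i(1)] lF[OF i(1)] unfolding zero_divisors_transverse_def local_equation_iff by blast
  note ind = this
  have "la i \<in> reg Y (fst i)" "lF i \<in> reg Y (fst i)"
    using la[OF i(1)] lF[OF i(1)] by (simp_all add: represents_def)
  from transversal_local_section[OF L_open[OF i(1)] this i(2) zero ind]
  obtain r \<Sigma> where r: "r > 0"
    and \<Sigma>: "continuous_map (top_of_set {p. cmod (fst p) < r \<and> cmod (snd p) < r}) (classical_topology Y) \<Sigma>"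
    and sec: "\<And>p. cmod (fst p) < r \<Longrightarrow> cmod (snd p) < r \<Longrightarrow> \<Sigma> p \<in> fst i \<and> la i (\<Sigma> p) = fst p \<and> lF i (\<Sigma> p) = snd p"
    by blast
  have \<Sigma>Z: "\<Sigma> q \<in> fst i \<inter> Z" if "cmod (fst q) < r" "cmod (snd q) < r" "(fst q)\<^sup>2 \<noteq> snd q ^ n" for q
    using sec[OF that(1,2)] inB[OF i(1), of "\<Sigma> q"] that(3) openin_subset[OF L_open[OF i(1)]] by (auto simp: Z_def)
  have "continuous_map (top_of_set {p. cmod (fst p) < r \<and> cmod (snd p) < r \<and> (fst p)\<^sup>2 \<noteq> snd p ^ n}) T \<Sigma>"
    unfolding T_def continuous_map_in_subtopology
  proof
    show "continuous_map (top_of_set {p. cmod (fst p) < r \<and> cmod (snd p) < r \<and> (fst p)\<^sup>2 \<noteq> snd p ^ n}) (classical_topology Y) \<Sigma>"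
      by (rule continuous_map_from_subtopology_mono[OF \<Sigma>]) blast
  qed (use \<Sigma>Z in auto)
  moreover have "A (\<Sigma> q) = m i (\<Sigma> q) ^ n * fst q \<and> f (\<Sigma> q) = (m i (\<Sigma> q))\<^sup>2 * snd q"
    if "cmod (fst q) < r" "cmod (snd q) < r" for q
    using Aeq[OF i(1), of "\<Sigma> q"] Feq[OF i(1), of "\<Sigma> q"] sec[OF that] by simp
  ultimately have "\<exists>y1\<in>topspace T. \<exists>e1\<in>E y1. \<forall>g\<in>D. \<exists>p\<in>loops T y1. carries p 0 1 e1 (act n g e1)"
    using \<Sigma>Z by (intro carries_local_model[OF i(1) r])
  then obtain y1 e1 where y1: "y1 \<in> topspace T" "e1 \<in> E y1" "\<forall>g\<in>D. \<exists>p\<in>loops T y1. carries p 0 1 e1 (act n g e1)"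
    by blast
  have "path_component_of T y0 y1"
    unfolding T_def by (rule zariski_open_path_connected[OF Z]) (use y0 y1(1) topT Z_def in auto)
  then obtain \<delta> where \<delta>: "pathin T \<delta>" "\<delta> 0 = y0" "\<delta> 1 = y1" unfolding path_component_of_def by blast
  obtain e0 where e0: "e0 \<in> E y0" "\<forall>g\<in>D. \<exists>p\<in>loops T y0. carries p 0 1 e0 (act n g e0)"
    using loops_conjugate[OF \<delta> y1(2)] y1(3) by blast
  have "y0 \<in> topspace T" unfolding topT Z_def by (rule y0)
  from monodromy_epimorphism[OF this e0(1)] e0(2) show ?thesis unfolding T_def Z_def by blast
qed

end

theorem proposition8p2:
  fixes Y :: "'a fspace"
    and L :: "('a set \<times> 'a ratfun) set"
    and a F :: "'a ratfun"
    and n :: nat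
    and y0 :: 'a
  defines "\<B> \<equiv> zero_locus Y L (2 * n) (rat_diff (rat_power a 2) (rat_power F n))"
  defines "\<pi>\<^sub>1 \<equiv> fundamental_group (subtopology (classical_topology Y) (points Y - \<B>)) y0"
  assumes Y: "smooth_variety Y"
    and L: "divisor Y L"
    and n: "n \<ge> 1"
    and a: "a \<in> sections_mult Y L n"
    and F: "F \<in> sections_mult Y L 2"
    and i: "zero_divisor_smooth_in Y L (2 * n) (rat_diff (rat_power a 2) (rat_power F n))
              (points Y - zero_locus Y L 2 F)"
    and ii: "zero_divisors_transverse Y L n a 2 F"
    and nonempty: "zero_locus Y L n a \<inter> zero_locus Y L 2 F \<noteq> {}"
    and y0: "y0 \<in> points Y - \<B>"
  shows "(\<exists>h. h \<in> epi \<pi>\<^sub>1 (dihedral_group n)) \<and>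
         (n \<ge> 3 \<longrightarrow> (\<exists>x \<in> carrier \<pi>\<^sub>1. \<exists>y \<in> carrier \<pi>\<^sub>1. x \<otimes>\<^bsub>\<pi>\<^sub>1\<^esub> y \<noteq> y \<otimes>\<^bsub>\<pi>\<^sub>1\<^esub> x))"
proof -
  interpret smooth_var_divisor Y L by standard (rule Y, rule L)
  obtain p where p: "p \<in> zero_locus Y L n a" "p \<in> zero_locus Y L 2 F" using nonempty by blast
  have "\<exists>h. h \<in> epi \<pi>\<^sub>1 (dihedral_group n)"
    unfolding \<pi>\<^sub>1_def by (rule dihedral_quotient[OF n a F _ ii p y0]) (simp add: \<B>_def disc_section_def)
  then show ?thesis using epi_dihedral_imp_noncommuting by blast
qed

end
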